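(* For every class $\mathcal{G}$ of graphs of bounded expansion, there is a function $f$ such that for every $n$-vertex unweighted graph $G\in\mathcal{G}$ and every positive integer $k$, one can decide whether the diameter of $G$ is at most $k$ in $O(f(k)\cdot n^{1+o(1)})$ time.
   Context: Graphs are finite, strongly connected (possibly directed; structural notions refer to the underlying undirected graph), unweighted, so $dist(u,v)$ is the minimum number of arcs on a path from $u$ to $v$, and the diameter is $\max_{u,v}dist(u,v)$. A graph $H$ is an $r$-shallow minor of $G$ if it can be obtained from a subgraph of $G$ by contracting pairwise disjoint connected subgraphs each of radius at most $r$. A graph class $\mathcal{G}$ has bounded expansion if for every $r$ there is a constant $d_r(\mathcal{G})$ such that every $r$-shallow minor of every graph in $\mathcal{G}$ has edge density (edges divided by vertices) at most $d_r(\mathcal{G})$. *)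

theory Defs
  imports "Graph_Theory.Graph_Theory" "HOL-Library.Log_Nat"
begin

section \<open>Distances, diameter and radius\<close>

text \<open>
  Distances are those of the library for unit weights. They take values in \<^typ>\<open>ereal\<close>, with value
  \<open>\<infinity>\<close> between vertices that are not joined by a walk.
\<close>

definition hop_dist :: "'a pair_pre_digraph \<Rightarrow> 'a \<Rightarrow> 'a \<Rightarrow> ereal" where
  "hop_dist G u v = wf_digraph.\<mu> (with_proj G) (\<lambda>_. 1) u v"

definition diameter :: "'a pair_pre_digraph \<Rightarrow> ereal" where
  "diameter G = (SUP u\<in>pverts G. SUP v\<in>pverts G. hop_dist G u v)"

definition radius :: "'a pair_pre_digraph \<Rightarrow> ereal" where
  "radius G = (INF c\<in>pverts G. SUP v\<in>pverts G. hop_dist G c v)"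


section \<open>Shallow minors and bounded expansion\<close>

text \<open>
  As in the library, finite simple undirected graphs are the symmetric digraphs satisfying
  \<^const>\<open>pair_graph\<close>: every edge is represented by two opposite arcs.
\<close>

text \<open>
  Every set in \<open>P\<close> becomes a single vertex, the vertices outside \<open>\<Union>P\<close> are kept
  (as singletons); loops and parallel edges that arise are dropped.
\<close>

definition contract :: "'a pair_pre_digraph \<Rightarrow> 'a set set \<Rightarrow> 'a set pair_pre_digraph" where
  "contract S P =
    (let V = P \<union> {{v} | v. v \<in> pverts S - \<Union>P}
     in \<lparr> pverts = V,
          parcs = {(A, B). A \<in> V \<and> B \<in> V \<and> A \<noteq> B \<and> (\<exists>a\<in>A. \<exists>b\<in>B. (a, b) \<in> parcs S)} \<rparr>)"

text \<open>
  The graph \<open>G\<close> is meant to be undirected. Minors are not closed under isomorphism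
  here: their vertices are always sets of vertices of \<open>G\<close>. This does not affect their densities.
\<close>

definition shallow_minor ::
  "nat \<Rightarrow> 'a set pair_pre_digraph \<Rightarrow> 'a pair_pre_digraph \<Rightarrow> bool" where
  "shallow_minor r H G \<longleftrightarrow>
    (\<exists>S \<B>. pair_graph S \<and> subgraph (with_proj S) (with_proj G) \<and>
      (\<forall>B\<in>\<B>. pair_graph B \<and> subgraph (with_proj B) (with_proj S) \<and>
         Digraph_Component.connected (with_proj B) \<and> radius B \<le> ereal (real r)) \<and>
      (\<forall>B\<in>\<B>. \<forall>B'\<in>\<B>. B \<noteq> B' \<longrightarrow> pverts B \<inter> pverts B' = {}) \<and>
      H = contract S (pverts ` \<B>))"

definition edge_density :: "'a pair_pre_digraph \<Rightarrow> real" where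
  "edge_density H = (real (card (parcs H)) / 2) / real (card (pverts H))"

definition bounded_expansion :: "'a pair_pre_digraph set \<Rightarrow> bool" where
  "bounded_expansion \<G> \<longleftrightarrow>
    (\<forall>r. \<exists>d::real. \<forall>G\<in>\<G>. \<forall>H.
      shallow_minor r H (mk_symmetric (with_proj G)) \<longrightarrow> edge_density H \<le> d)"


section \<open>Random access machines with logarithmic cost\<close>

text \<open>
  A program uses the registers it names (a fixed finite number, so naming one is free) and an
  unbounded, indirectly addressed memory. Jumps are replaced by structured control flow.
  Words are arbitrary natural numbers, and every instruction is charged the total bit length of
  the values and addresses it handles, so that no time is saved by packing data into large
  words. Compared with unit cost on words of \<open>O(log N)\<close> bits, this changes running times by a
  factor \<open>O(log N)\<close> at most.
\<close>

record ram_state =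
  reg :: "nat \<Rightarrow> nat"
  mem :: "nat \<Rightarrow> nat"

datatype arith = Plus | Minus | Times | Div

fun arith_sem :: "arith \<Rightarrow> nat \<Rightarrow> nat \<Rightarrow> nat" where
  "arith_sem Plus a b = a + b"
| "arith_sem Minus a b = a - b"
| "arith_sem Times a b = a * b"
| "arith_sem Div a b = a div b"

datatype ram_com =
    Skip
  | SetConst nat nat
  | Copy nat nat
  | Arith arith nat nat nat
  | Load nat nat
  | Store nat nat
  | Seq ram_com ram_com
  | IfLess nat nat ram_com ram_com
  | WhileLess nat nat ram_com

definition bit_len :: "nat \<Rightarrow> nat" where
  "bit_len a = max 1 (floorlog 2 a)"

text \<open>\<open>ram_exec p s t s'\<close>: program \<open>p\<close> started in state \<open>s\<close> halts in state \<open>s'\<close> after time \<open>t\<close>.\<close>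

inductive ram_exec :: "ram_com \<Rightarrow> ram_state \<Rightarrow> nat \<Rightarrow> ram_state \<Rightarrow> bool" where
  Skip: "ram_exec Skip s 1 s"
| SetConst: "ram_exec (SetConst x c) s (bit_len c) (s\<lparr>reg := (reg s)(x := c)\<rparr>)"
| Copy: "ram_exec (Copy x y) s (bit_len (reg s y)) (s\<lparr>reg := (reg s)(x := reg s y)\<rparr>)"
| Arith: "ram_exec (Arith f x y z) s (bit_len (reg s y) + bit_len (reg s z))
    (s\<lparr>reg := (reg s)(x := arith_sem f (reg s y) (reg s z))\<rparr>)"
| Load: "ram_exec (Load x y) s (bit_len (reg s y) + bit_len (mem s (reg s y)))
    (s\<lparr>reg := (reg s)(x := mem s (reg s y))\<rparr>)"
| Store: "ram_exec (Store x y) s (bit_len (reg s x) + bit_len (reg s y))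
    (s\<lparr>mem := (mem s)(reg s x := reg s y)\<rparr>)"
| Seq: "ram_exec p s t s' \<Longrightarrow> ram_exec q s' t' s'' \<Longrightarrow> ram_exec (Seq p q) s (t + t') s''"
| IfTrue: "reg s x < reg s y \<Longrightarrow> ram_exec p s t s' \<Longrightarrow>
    ram_exec (IfLess x y p q) s (bit_len (reg s x) + bit_len (reg s y) + t) s'"
| IfFalse: "\<not> reg s x < reg s y \<Longrightarrow> ram_exec q s t s' \<Longrightarrow>
    ram_exec (IfLess x y p q) s (bit_len (reg s x) + bit_len (reg s y) + t) s'"
| WhileTrue: "reg s x < reg s y \<Longrightarrow> ram_exec p s t s' \<Longrightarrow>
    ram_exec (WhileLess x y p) s' t' s'' \<Longrightarrow>
    ram_exec (WhileLess x y p) s (bit_len (reg s x) + bit_len (reg s y) + t + t') s''"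
| WhileFalse: "\<not> reg s x < reg s y \<Longrightarrow>
    ram_exec (WhileLess x y p) s (bit_len (reg s x) + bit_len (reg s y)) s"


section \<open>Input and decision\<close>

text \<open>
  The input is a graph, with vertices numbered \<open>0, \<dots>, n - 1\<close> in any way and given by a list of
  its \<open>m\<close> arcs in any order, and the number \<open>k\<close>. Registers 0, 1, 2 hold \<open>n\<close>, \<open>m\<close>, \<open>k\<close>, and memory
  cells \<open>2 i\<close> and \<open>2 i + 1\<close> the tail and head of the arc at position \<open>i\<close>; everything else is 0.
\<close>

definition ram_input :: "nat \<Rightarrow> (nat \<times> nat) list \<Rightarrow> nat \<Rightarrow> ram_state" where
  "ram_input n es k =
    \<lparr> reg = (\<lambda>_. 0)(0 := n, 1 := length es, 2 := k),
      mem = (\<lambda>a. if a < 2 * length es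
                 then (if even a then fst (es ! (a div 2)) else snd (es ! (a div 2)))
                 else 0) \<rparr>"

definition encodes_input :: "ram_state \<Rightarrow> 'a pair_pre_digraph \<Rightarrow> nat \<Rightarrow> bool" where
  "encodes_input s G k \<longleftrightarrow>
    (\<exists>num es. bij_betw num (pverts G) {..<card (pverts G)} \<and>
       distinct es \<and> set es = (\<lambda>(u, v). (num u, num v)) ` parcs G \<and>
       s = ram_input (card (pverts G)) es k)"

text \<open>The answer is left in register 0: 1 for yes, 0 for no.\<close>

definition decides_in_time :: "ram_com \<Rightarrow> ram_state \<Rightarrow> bool \<Rightarrow> real \<Rightarrow> bool" where
  "decides_in_time p s answer T \<longleftrightarrow>
    (\<exists>t s'. ram_exec p s t s' \<and> reg s' 0 = of_bool answer \<and> real t \<le> T)"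

end

theory Submission
  imports Defs "HOL-Library.Nat_Bijection" "HOL-Real_Asymp.Real_Asymp"
begin

text \<open>
  Every pair of vertices joined by a short walk gets a common hub, and the pairs without a suitable
  common hub are counted by inclusion and exclusion.

  Hubs. Orient the underlying graph so that every vertex has few out-neighbours, its hubs, and then
  repeat \<open>k\<close> times: join any two hubs \<open>x\<close>, \<open>y\<close> of a common vertex \<open>c\<close> by a new edge standing for the
  walk through \<open>c\<close>, and orient the new edges in the same way. A shortest walk that contains such a
  pattern \<open>x, c, y\<close> is shortened by the new edge, so after \<open>k\<close> rounds any two vertices at distance at
  most \<open>k\<close> are joined by a walk that first ascends from vertices to their hubs and then descends;
  its top is the common hub. New edges are traces of short walks, each vertex being inside boundedly
  many of them. Choosing a maximal family of walks with disjoint interiors, and then a random set of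
  end vertices, turns a dense set of such edges into a dense shallow minor. Hence the augmented
  graphs stay sparse, and repeatedly removing the vertices of degree at most twice the average
  orients them.

  Counting. Let \<open>S(u)\<close> be the bounded set of vertices reachable from \<open>u\<close> by ascending \<open>k\<close> times. The sum of
  \<open>(-1)^|T|\<close> over the sets \<open>T\<close> of suitable common hubs of \<open>u\<close> and \<open>v\<close> is 1 if there is no such hub and 0
  otherwise. Exchanging the sums, it suffices to know, for each of the boundedly many subsets \<open>T\<close> of
  \<open>S(u)\<close> with the distances from \<open>u\<close>, the number of \<open>v\<close> for which all of \<open>T\<close> is suitable. These numbers are
  tabulated by inserting, for every \<open>v\<close>, all subsets of \<open>S(v)\<close> with all admissible distances into a trie.
\<close>

section \<open>Shallow minors and fraternal augmentations\<close>

text \<open>Comparing the label sets of all pairs would already take quadratic time, which is why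
  pairs are counted instead of inspected. A common hub is suitable if the known distances through it
  add up to at most k. Sparsity belongs to the underlying undirected graph, so hubs and new edges
  live there, whereas distances are directed and kept separately for both orders of a pair; hence
  \<open>R\<close> and its symmetric closure occur side by side. New edges of round i stand for
  walks of at most 2^i steps, so that round uses the density of minors of radius 2^i. The program
  knows none of these bounds: it compares degrees with the average of what is left, so one machine
  serves every class, and the class enters only the analysis. The number of steps is linear in n;
  the bit length of the numbers adds a logarithmic factor, which the term o(1) in the exponent
  absorbs. \<open>minor_bound\<close> restates density for relations on numbered vertices, with a
  centre chosen in each branch set; it counts ordered pairs, which doubles the density.\<close>

definition minor_bound :: "nat \<Rightarrow> 'a set \<Rightarrow> 'a rel \<Rightarrow> nat \<Rightarrow> bool" where
  "minor_bound r V R d \<longleftrightarrow>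
    (\<forall>X B M. X \<subseteq> V \<and>
      (\<forall>z\<in>X. z \<in> B z \<and> B z \<subseteq> V \<and> (\<forall>v\<in>B z. \<exists>i\<le>r. (z, v) \<in> (R \<inter> B z \<times> B z) ^^ i)) \<and>
      (\<forall>z\<in>X. \<forall>z'\<in>X. z \<noteq> z' \<longrightarrow> B z \<inter> B z' = {}) \<and>
      M \<subseteq> X \<times> X \<and> (\<forall>(x, y)\<in>M. x \<noteq> y \<and> (\<exists>a\<in>B x. \<exists>b\<in>B y. (a, b) \<in> R)) \<longrightarrow>
      card M \<le> d * card X)"

section \<open>Dense sets of linked pairs yield dense shallow minors\<close>

definition linked :: "nat \<Rightarrow> 'a rel \<Rightarrow> 'a \<Rightarrow> 'a \<Rightarrow> 'a set \<Rightarrow> bool" where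
  "linked l R x y I \<longleftrightarrow> (\<exists>i\<le>l. (x, y) \<in> (R \<inter> (insert x (insert y I)) \<times> (insert x (insert y I))) ^^ i)"

lemma relpow_mono_rel:
  fixes R S :: "'a rel"
  shows "(a, b) \<in> R ^^ i \<Longrightarrow> R \<subseteq> S \<Longrightarrow> (a, b) \<in> S ^^ i"
  by (induction i arbitrary: b) auto

text \<open>A shortest walk meets each of its ends only once. Its interior \<open>J\<close> together
  with x has radius at most l around x and is adjacent to y, so contracting
  \<open>insert x J\<close> turns the pair into an edge of a minor.\<close>

lemma linked_shortest:
  assumes "linked l R x y I" "x \<noteq> y"
  obtains J where "J \<subseteq> I" "x \<notin> J" "y \<notin> J" "finite J" "card J \<le> l"
    "\<And>v. v \<in> insert x J \<Longrightarrow> \<exists>i\<le>l. (x, v) \<in> (R \<inter> insert x J \<times> insert x J) ^^ i"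
    "\<exists>b\<in>insert x J. (b, y) \<in> R"
proof -
  let ?W = "insert x (insert y I)"
  let ?R = "R \<inter> ?W \<times> ?W"
  define i where "i = (LEAST i. (x, y) \<in> ?R ^^ i)"
  obtain i0 where i0: "i0 \<le> l" "(x, y) \<in> ?R ^^ i0" using assms(1) unfolding linked_def by blast
  have i: "(x, y) \<in> ?R ^^ i" unfolding i_def using i0(2) by (rule LeastI)
  have il: "i \<le> l" unfolding i_def using Least_le[of "\<lambda>i. (x, y) \<in> ?R ^^ i", OF i0(2)] i0(1) by simp
  have min: "(x, y) \<notin> ?R ^^ j" if "j < i" for j
    using that not_less_Least unfolding i_def by blast
  obtain f where f: "f 0 = x" "f i = y" "\<And>j. j < i \<Longrightarrow> (f j, f (Suc j)) \<in> ?R"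
    using i unfolding relpow_fun_conv by blast
  have i0': "0 < i" using f assms(2) by (cases i) auto
  \<comment> \<open>A visit to y before the end could be cut off behind, a return to x could be cut
    off in front; either contradicts the minimality of \<open>i\<close>.\<close>
  have pre: "(x, f j) \<in> ?R ^^ j" if "j \<le> i" for j
    unfolding relpow_fun_conv using f that by (intro exI[of _ f]) auto
  have post: "(f j, y) \<in> ?R ^^ (i - j)" if "j \<le> i" for j
    unfolding relpow_fun_conv using f that by (intro exI[of _ "\<lambda>a. f (j + a)"]) auto
  have ny: "f j \<noteq> y" if "j < i" for j using min[OF that] pre[of j] that by auto
  have nx: "f j \<noteq> x" if "0 < j" "j \<le> i" for j
    using min[of "i - j"] post[of j] that by auto
  define J where "J = f ` {0<..<i}"
  have fJ: "f j \<in> insert x J" if "j < i" for j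
    using that f(1) unfolding J_def by (cases "j = 0") auto
  have "f j \<in> I" if "j \<in> {0<..<i}" for j
    using f(3)[of j] ny[of j] nx[of j] that by auto
  then have 1: "J \<subseteq> I" unfolding J_def by blast
  have 2: "x \<notin> J" "y \<notin> J"
  proof -
    have "f j \<noteq> x \<and> f j \<noteq> y" if "j \<in> {0<..<i}" for j
      using nx[of j] ny[of j] that by simp
    then show "x \<notin> J" "y \<notin> J" unfolding J_def image_iff by metis+
  qed
  have "card J \<le> card {0<..<i}" unfolding J_def by (rule card_image_le) simp
  then have 3: "card J \<le> l" using il by simp
  have w: "(x, f j) \<in> (R \<inter> insert x J \<times> insert x J) ^^ j" if "j < i" for j
    unfolding relpow_fun_conv
  proof (intro exI[of _ f] conjI allI impI)
    fix a assume "a < j"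
    then show "(f a, f (Suc a)) \<in> R \<inter> insert x J \<times> insert x J"
      using f(3)[of a] fJ[of a] fJ[of "Suc a"] that by auto
  qed (use f in auto)
  show thesis
  proof (rule that[of J])
    show "\<exists>i\<le>l. (x, v) \<in> (R \<inter> insert x J \<times> insert x J) ^^ i" if v: "v \<in> insert x J" for v
    proof -
      obtain j where "j < i" "v = f j"
        using v i0' f(1) unfolding J_def by auto
      then show ?thesis using w[of j] il by (intro exI[of _ j]) auto
    qed
    have "(f (i - 1), y) \<in> R" using f(3)[of "i - 1"] f(2) i0' by auto
    then show "\<exists>b\<in>insert x J. (b, y) \<in> R" using fJ[of "i - 1"] i0' by auto
  qed (use 1 2 3 in \<open>auto simp: J_def\<close>)
qed

lemma linked_trans:
  assumes "linked l R x c I" "linked l' R c y I'"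
  shows "linked (l + l') R x y (insert c (I \<union> I'))"
proof -
  let ?W = "insert x (insert y (insert c (I \<union> I')))"
  from assms obtain i j where i: "i \<le> l" "(x, c) \<in> (R \<inter> insert x (insert c I) \<times> insert x (insert c I)) ^^ i"
    and j: "j \<le> l'" "(c, y) \<in> (R \<inter> insert c (insert y I') \<times> insert c (insert y I')) ^^ j"
    unfolding linked_def by blast
  have "(x, c) \<in> (R \<inter> ?W \<times> ?W) ^^ i" by (rule relpow_mono_rel[OF i(2)]) auto
  moreover have "(c, y) \<in> (R \<inter> ?W \<times> ?W) ^^ j" by (rule relpow_mono_rel[OF j(2)]) auto
  ultimately have "(x, y) \<in> (R \<inter> ?W \<times> ?W) ^^ (i + j)" by (auto simp: relpow_add)
  then show ?thesis unfolding linked_def using i(1) j(1) by (intro exI[of _ "i + j"]) auto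
qed

text \<open>Greedy choice. What is left out meets something chosen and can be charged to it.\<close>

lemma exists_maximal_disjoint:
  assumes "finite F"
  obtains M where "M \<subseteq> F" "\<And>e e'. e \<in> M \<Longrightarrow> e' \<in> M \<Longrightarrow> e \<noteq> e' \<Longrightarrow> J e \<inter> J e' = {}"
    "\<And>e. e \<in> F - M \<Longrightarrow> \<exists>e'\<in>M. J e \<inter> J e' \<noteq> {}"
proof -
  have "\<exists>M. M \<subseteq> F \<and> (\<forall>e\<in>M. \<forall>e'\<in>M. e \<noteq> e' \<longrightarrow> J e \<inter> J e' = {}) \<and>
    (\<forall>e\<in>F - M. \<exists>e'\<in>M. J e \<inter> J e' \<noteq> {})"
    using assms
  proof induction
    case (insert e F)
    then obtain M where M: "M \<subseteq> F" "\<forall>e\<in>M. \<forall>e'\<in>M. e \<noteq> e' \<longrightarrow> J e \<inter> J e' = {}"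
      "\<forall>e\<in>F - M. \<exists>e'\<in>M. J e \<inter> J e' \<noteq> {}" by blast
    show ?case
    proof (cases "\<exists>e'\<in>M. J e \<inter> J e' \<noteq> {}")
      case True
      then show ?thesis using M by (intro exI[of _ M]) auto
    next
      case False
      then have "J e \<inter> J e' = {}" "J e' \<inter> J e = {}" if "e' \<in> M" for e' using that by blast+
      then show ?thesis using M by (intro exI[of _ "insert e M"]) auto
    qed
  qed simp
  then show thesis by (elim exE conjE) (rule that, auto)
qed

text \<open>Averaging over all subsets \<open>Y\<close> of \<open>X\<close>, that is, over a
  uniformly random one: e survives if \<open>P e\<close> lies inside \<open>Y\<close> and
  \<open>Q e\<close> outside, which has probability at least 2^(-c).\<close>

lemma averaging_subset:
  assumes X: "finite X" and M: "finite M"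
    and P: "\<And>e. e \<in> M \<Longrightarrow> finite (P e) \<and> finite (Q e) \<and> P e \<subseteq> X \<and> P e \<inter> Q e = {} \<and> card (P e \<union> Q e) \<le> c"
  obtains Y where "Y \<subseteq> X" "card M \<le> 2 ^ c * card {e\<in>M. P e \<subseteq> Y \<and> Q e \<inter> Y = {}}"
proof -
  let ?K = "\<lambda>Y. {e\<in>M. P e \<subseteq> Y \<and> Q e \<inter> Y = {}}"
  have ge: "2 ^ card X \<le> 2 ^ c * card {Y\<in>Pow X. P e \<subseteq> Y \<and> Q e \<inter> Y = {}}" if e: "e \<in> M" for e
  proof -
    \<comment> \<open>Membership is prescribed for at most c vertices; the others are free.\<close>
    let ?Z = "X - (P e \<union> Q e)"
    have "inj_on (\<lambda>Y. Y \<union> P e) (Pow ?Z)" by (rule inj_onI) blast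
    then have "card (Pow ?Z) = card ((\<lambda>Y. Y \<union> P e) ` Pow ?Z)" by (simp add: card_image)
    also have "\<dots> \<le> card {Y\<in>Pow X. P e \<subseteq> Y \<and> Q e \<inter> Y = {}}"
      by (rule card_mono) (use X P[OF e] in auto)
    finally have 1: "2 ^ card ?Z \<le> card {Y\<in>Pow X. P e \<subseteq> Y \<and> Q e \<inter> Y = {}}"
      using X by (simp add: card_Pow)
    have "card X \<le> c + card ?Z"
    proof -
      have "card X - card (P e \<union> Q e) \<le> card ?Z" "card (P e \<union> Q e) \<le> c"
        using diff_card_le_card_Diff[of "P e \<union> Q e" X] P[OF e] by auto
      then show ?thesis by linarith
    qed
    then have "(2::nat) ^ card X \<le> 2 ^ c * 2 ^ card ?Z"
      unfolding power_add[symmetric] by (intro power_increasing) auto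
    also have "\<dots> \<le> 2 ^ c * card {Y\<in>Pow X. P e \<subseteq> Y \<and> Q e \<inter> Y = {}}" using 1 by simp
    finally show ?thesis .
  qed
  have "(\<Sum>Y\<in>Pow X. card (?K Y)) = (\<Sum>Y\<in>Pow X. \<Sum>e\<in>M. of_bool (P e \<subseteq> Y \<and> Q e \<inter> Y = {}))"
    by (intro sum.cong refl) (use M in \<open>simp add: sum.If_cases of_bool_def Int_def\<close>)
  also have "\<dots> = (\<Sum>e\<in>M. \<Sum>Y\<in>Pow X. of_bool (P e \<subseteq> Y \<and> Q e \<inter> Y = {}))" by (rule sum.swap)
  also have "\<dots> = (\<Sum>e\<in>M. card {Y\<in>Pow X. P e \<subseteq> Y \<and> Q e \<inter> Y = {}})"
    by (intro sum.cong refl) (use X in \<open>simp add: sum.If_cases of_bool_def Int_def\<close>)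
  finally have sums: "(\<Sum>Y\<in>Pow X. card (?K Y)) = (\<Sum>e\<in>M. card {Y\<in>Pow X. P e \<subseteq> Y \<and> Q e \<inter> Y = {}})" .
  have "\<exists>Y\<in>Pow X. card M \<le> 2 ^ c * card (?K Y)"
  proof (rule ccontr)
    assume "\<not> ?thesis"
    then have "2 ^ c * card (?K Y) < card M" if "Y \<in> Pow X" for Y using that not_le by blast
    then have "(\<Sum>Y\<in>Pow X. 2 ^ c * card (?K Y)) < (\<Sum>Y\<in>Pow X. card M)"
      by (intro sum_strict_mono) (use X in auto)
    also have "\<dots> = card M * 2 ^ card X" using X by (simp add: card_Pow)
    also have "\<dots> = (\<Sum>e\<in>M. 2 ^ card X)" by simp
    also have "\<dots> \<le> (\<Sum>e\<in>M. 2 ^ c * card {Y\<in>Pow X. P e \<subseteq> Y \<and> Q e \<inter> Y = {}})"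
      by (intro sum_mono ge)
    also have "\<dots> = (\<Sum>Y\<in>Pow X. 2 ^ c * card (?K Y))"
      using sums by (simp add: sum_distrib_left[symmetric])
    finally show False by simp
  qed
  then show thesis using that by blast
qed

text \<open>One factor for each loss in \<open>linked_pairs_sparse\<close>: \<open>1 + l * C\<close>
  for passing to disjoint interiors, \<open>2 ^ (l + 2)\<close> for the random choice, which
  constrains two ends and at most l interior vertices, and d for the minor that results.\<close>

definition link_density :: "nat \<Rightarrow> nat \<Rightarrow> nat \<Rightarrow> nat" where
  "link_density l C d = (1 + l * C) * (2 ^ (l + 2) * d)"

text \<open>Disjoint interiors alone do not make a minor, since an interior vertex may be an end of
  another pair. The random set \<open>Y\<close> repairs this: only pairs with both ends in
  \<open>Y\<close> and interior outside \<open>Y\<close> are kept, and each interior is contracted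
  into the first end of its pair.\<close>

lemma linked_pairs_sparse:
  assumes mb: "minor_bound l V R d" and fin: "finite V"
    and X: "X \<subseteq> V" and F: "F \<subseteq> X \<times> X"
    and I: "\<And>x y. (x, y) \<in> F \<Longrightarrow> x \<noteq> y \<and> I (x, y) \<subseteq> V \<and> linked l R x y (I (x, y))"
    and C: "\<And>v. card {e\<in>F. v \<in> I e} \<le> C"
  shows "card F \<le> link_density l C d * card X"
proof -
  have finX: "finite X" using X fin finite_subset by auto
  have finF: "finite F" using F finX finite_subset by blast
  let ?P = "\<lambda>e J. J \<subseteq> I e \<and> fst e \<notin> J \<and> snd e \<notin> J \<and> finite J \<and> card J \<le> l \<and>
    (\<forall>v\<in>insert (fst e) J. \<exists>i\<le>l. (fst e, v) \<in> (R \<inter> insert (fst e) J \<times> insert (fst e) J) ^^ i) \<and>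
    (\<exists>b\<in>insert (fst e) J. (b, snd e) \<in> R)"
  have "\<forall>e\<in>F. \<exists>J. ?P e J"
  proof
    fix e assume "e \<in> F"
    then obtain x y where e: "e = (x, y)" "(x, y) \<in> F" by (cases e) auto
    obtain J where "J \<subseteq> I (x, y)" "x \<notin> J" "y \<notin> J" "finite J" "card J \<le> l"
      "\<And>v. v \<in> insert x J \<Longrightarrow> \<exists>i\<le>l. (x, v) \<in> (R \<inter> insert x J \<times> insert x J) ^^ i"
      "\<exists>b\<in>insert x J. (b, y) \<in> R"
      using linked_shortest[of l R x y "I (x, y)"] I[OF e(2)] by metis
    then show "\<exists>J. ?P e J" unfolding e by (intro exI[of _ J]) auto
  qed
  then obtain J where J: "\<And>e. e \<in> F \<Longrightarrow> ?P e (J e)" by metis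
  obtain M where M: "M \<subseteq> F" "\<And>e e'. e \<in> M \<Longrightarrow> e' \<in> M \<Longrightarrow> e \<noteq> e' \<Longrightarrow> J e \<inter> J e' = {}"
    "\<And>e. e \<in> F - M \<Longrightarrow> \<exists>e'\<in>M. J e \<inter> J e' \<noteq> {}"
    using exists_maximal_disjoint[OF finF, of J] by metis
  have finM: "finite M" using M(1) finF finite_subset by auto
  \<comment> \<open>An omitted pair shares a vertex with a chosen interior. Such an interior has at
    most l vertices, and each of them lies in at most C of the sets \<open>I e\<close>.\<close>
  have "F - M \<subseteq> (\<Union>e'\<in>M. \<Union>v\<in>J e'. {e\<in>F. v \<in> I e})"
  proof
    fix e assume e: "e \<in> F - M"
    then obtain e' v where "e' \<in> M" "v \<in> J e" "v \<in> J e'" using M(3)[OF e] by blast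
    then show "e \<in> (\<Union>e'\<in>M. \<Union>v\<in>J e'. {e\<in>F. v \<in> I e})" using J[of e] e by blast
  qed
  then have "card (F - M) \<le> card (\<Union>e'\<in>M. \<Union>v\<in>J e'. {e\<in>F. v \<in> I e})"
    by (rule card_mono[rotated]) (use finF finM M(1) J in \<open>auto intro!: finite_UN_I\<close>)
  also have "\<dots> \<le> (\<Sum>e'\<in>M. card (\<Union>v\<in>J e'. {e\<in>F. v \<in> I e}))" by (rule card_UN_le[OF finM])
  also have "\<dots> \<le> (\<Sum>e'\<in>M. l * C)"
  proof (rule sum_mono)
    fix e' assume e': "e' \<in> M"
    then have "e' \<in> F" using M(1) by blast
    then have "finite (J e')" "card (J e') \<le> l" using J[of e'] by blast+
    have "card (\<Union>v\<in>J e'. {e\<in>F. v \<in> I e}) \<le> (\<Sum>v\<in>J e'. card {e\<in>F. v \<in> I e})"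
      by (rule card_UN_le) fact
    also have "\<dots> \<le> (\<Sum>v\<in>J e'. C)" by (intro sum_mono C)
    also have "\<dots> \<le> l * C" using \<open>card (J e') \<le> l\<close> by simp
    finally show "card (\<Union>v\<in>J e'. {e\<in>F. v \<in> I e}) \<le> l * C" .
  qed
  finally have "card (F - M) \<le> card M * (l * C)" by simp
  moreover have "card F = card M + card (F - M)"
    using M(1) finF finM by (simp add: card_Diff_subset card_mono)
  ultimately have FM: "card F \<le> (1 + l * C) * card M" by (simp add: algebra_simps)
  have "\<And>e. e \<in> M \<Longrightarrow> finite {fst e, snd e} \<and> finite (J e) \<and> {fst e, snd e} \<subseteq> X \<and>
     {fst e, snd e} \<inter> J e = {} \<and> card ({fst e, snd e} \<union> J e) \<le> l + 2"
  proof -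
    fix e assume e: "e \<in> M"
    then have eF: "e \<in> F" using M(1) by blast
    have "card ({fst e, snd e} \<union> J e) \<le> card {fst e, snd e} + card (J e)" by (rule card_Un_le)
    also have "card {fst e, snd e} \<le> 2" by (simp add: card_insert_if)
    finally have "card ({fst e, snd e} \<union> J e) \<le> l + 2" using J[OF eF] by simp
    then show "finite {fst e, snd e} \<and> finite (J e) \<and> {fst e, snd e} \<subseteq> X \<and>
     {fst e, snd e} \<inter> J e = {} \<and> card ({fst e, snd e} \<union> J e) \<le> l + 2"
      using J[OF eF] F eF by (cases e) auto
  qed
  then obtain Y where Y: "Y \<subseteq> X"
    "card M \<le> 2 ^ (l + 2) * card {e\<in>M. {fst e, snd e} \<subseteq> Y \<and> J e \<inter> Y = {}}"
    by (rule averaging_subset[OF finX finM, of "\<lambda>e. {fst e, snd e}" J "l + 2"])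
  let ?M = "{e\<in>M. {fst e, snd e} \<subseteq> Y \<and> J e \<inter> Y = {}}"
  \<comment> \<open>The interiors of all surviving pairs with first end z form a star around z. Each
    is reached from z within itself, so the radius stays at most l however many there are.\<close>
  define B where "B z = insert z (\<Union>e\<in>{e\<in>?M. fst e = z}. J e)" for z
  have "card ?M \<le> d * card Y"
  proof (rule mb[unfolded minor_bound_def, rule_format, where B = B], intro conjI ballI impI)
    show "Y \<subseteq> V" using Y X by blast
    fix z assume z: "z \<in> Y"
    show "z \<in> B z" by (simp add: B_def)
    show "B z \<subseteq> V"
    proof -
      have "J e \<subseteq> V" if "e \<in> ?M" for e
        using that J[of e] I[of "fst e" "snd e"] M(1) by auto
      then show ?thesis using z Y X by (auto simp: B_def)
    qed
    show "\<exists>i\<le>l. (z, v) \<in> (R \<inter> B z \<times> B z) ^^ i" if v: "v \<in> B z" for v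
    proof (cases "v = z")
      case True
      then show ?thesis by (intro exI[of _ 0]) auto
    next
      case False
      then obtain e where e: "e \<in> ?M" "fst e = z" "v \<in> J e" using v by (auto simp: B_def)
      then obtain i where i: "i \<le> l" "(z, v) \<in> (R \<inter> insert z (J e) \<times> insert z (J e)) ^^ i"
        using J[of e] M(1) by blast
      have "insert z (J e) \<subseteq> B z" using e by (auto simp: B_def)
      then have "(z, v) \<in> (R \<inter> B z \<times> B z) ^^ i" by (intro relpow_mono_rel[OF i(2)]) auto
      then show ?thesis using i by blast
    qed
    fix z' assume z': "z' \<in> Y" "z \<noteq> z'"
    have 1: "J e \<inter> J e' = {}" if "e \<in> ?M" "e' \<in> ?M" "fst e = z" "fst e' = z'" for e e'
      using M(2)[of e e'] that z' by auto
    have 2: "J e \<inter> Y = {}" if "e \<in> ?M" for e using that by auto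
    have 3: "J e \<inter> B z' = {}" if "e \<in> ?M" "fst e = z" for e
      unfolding B_def using 1[OF that(1) _ that(2)] 2[OF that(1)] z' by blast
    have 4: "z \<notin> B z'" unfolding B_def using 2 z z' by blast
    show "B z \<inter> B z' = {}" using 3 4 unfolding B_def[of z] by blast
  next
    show "?M \<subseteq> Y \<times> Y" by auto
    show "case e of (x, y) \<Rightarrow> x \<noteq> y \<and> (\<exists>a\<in>B x. \<exists>b\<in>B y. (a, b) \<in> R)" if e: "e \<in> ?M" for e
    proof -
      obtain x y where xy: "e = (x, y)" by (cases e)
      have eF: "e \<in> F" using e M(1) by auto
      obtain b where b: "b \<in> insert x (J e)" "(b, y) \<in> R" using J[OF eF] xy by auto
      have "b \<in> B x" using b(1) e xy unfolding B_def by force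
      moreover have "y \<in> B y" by (simp add: B_def)
      ultimately show ?thesis using b(2) I eF xy by auto
    qed
  qed
  also have "\<dots> \<le> d * card X" using Y(1) finX by (simp add: card_mono)
  finally have "card M \<le> 2 ^ (l + 2) * (d * card X)" using Y(2)
    by (meson le_trans mult_le_mono2)
  then have "card F \<le> (1 + l * C) * (2 ^ (l + 2) * (d * card X))" using FM
    by (meson le_trans mult_le_mono2)
  then show ?thesis unfolding link_density_def by (simp only: mult.assoc)
qed

section \<open>Augmentations: traces of bounded length and congestion\<close>

definition augmentation :: "'a set \<Rightarrow> 'a rel \<Rightarrow> nat \<Rightarrow> nat \<Rightarrow> 'a rel \<Rightarrow> bool" where
  "augmentation V R l C A \<longleftrightarrow> A \<subseteq> V \<times> V \<and> sym A \<and> irrefl A \<and>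
    (\<exists>I. (\<forall>(x, y)\<in>A. I (x, y) \<subseteq> V \<and> linked l R x y (I (x, y))) \<and> (\<forall>v. card {e\<in>A. v \<in> I e} \<le> C))"

definition fraternal :: "('a \<Rightarrow> 'a set) \<Rightarrow> 'a rel" where
  "fraternal H = {(x, y). x \<noteq> y \<and> (\<exists>c. x \<in> H c \<and> y \<in> H c)}"

lemma linked_mono: "linked l R x y I \<Longrightarrow> l \<le> l' \<Longrightarrow> linked l' R x y I"
  unfolding linked_def by (meson le_trans)

text \<open>An original edge is its own trace and has no interior.\<close>

lemma augmentation_self:
  assumes "R \<subseteq> V \<times> V" "sym R" "irrefl R"
  shows "augmentation V R 1 0 R"
  unfolding augmentation_def
proof (intro conjI exI[of _ "\<lambda>_. {}"] ballI allI)
  fix e assume "e \<in> R"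
  then show "case e of (x, y) \<Rightarrow> {} \<subseteq> V \<and> linked 1 R x y {}"
    unfolding linked_def by (auto intro!: exI[of _ 1])
qed (use assms in auto)

text \<open>The pair x, y of hubs of c is traced along the old traces from x to c and from c to y,
  which doubles the length. A vertex lies on a new trace either as c itself, for at most
  \<open>\<Delta> * \<Delta>\<close> pairs of its hubs, or inside one of the two old parts: that
  part is one of at most C, and then the other hub has at most \<open>\<Delta>\<close>
  choices.\<close>

lemma augmentation_fraternal:
  assumes A: "augmentation V R l C A" and fin: "finite V"
    and H: "\<And>v h. h \<in> H v \<Longrightarrow> (v, h) \<in> A" and card_H: "\<And>v. card (H v) \<le> \<Delta>"
  shows "augmentation V R (2 * l) (C + \<Delta> * \<Delta> + 2 * C * \<Delta>) (A \<union> fraternal H)"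
proof -
  from A obtain I where AV: "A \<subseteq> V \<times> V" and symA: "sym A" and irr: "irrefl A"
    and I: "\<And>x y. (x, y) \<in> A \<Longrightarrow> I (x, y) \<subseteq> V \<and> linked l R x y (I (x, y))"
    and C: "\<And>v. card {e\<in>A. v \<in> I e} \<le> C"
    unfolding augmentation_def by blast
  have HV: "H v \<subseteq> V" for v using H AV by blast
  have finH: "finite (H v)" for v using HV fin finite_subset by blast
  have finA: "finite A" using AV fin finite_subset by blast
  \<comment> \<open>A pair may have many common owners; one is fixed, so that it has a single
    trace.\<close>
  define c where "c e = (SOME c. fst e \<in> H c \<and> snd e \<in> H c)" for e
  have c: "fst e \<in> H (c e) \<and> snd e \<in> H (c e)" if "e \<in> fraternal H" for e
    unfolding c_def by (rule someI_ex) (use that in \<open>auto simp: fraternal_def\<close>)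
  define I' where "I' e = (if e \<in> A then I e
    else insert (c e) (I (fst e, c e) \<union> I (c e, snd e)))" for e
  show ?thesis unfolding augmentation_def
  proof (intro conjI exI[of _ I'] ballI allI)
    show "A \<union> fraternal H \<subseteq> V \<times> V" using AV HV unfolding fraternal_def by blast
    show "sym (A \<union> fraternal H)" using symA unfolding fraternal_def sym_def by blast
    show "irrefl (A \<union> fraternal H)" using irr unfolding fraternal_def irrefl_def by blast
  next
    fix e assume e: "e \<in> A \<union> fraternal H"
    obtain x y where xy: "e = (x, y)" by (cases e)
    have "I' e \<subseteq> V \<and> linked (2 * l) R x y (I' e)"
    proof (cases "e \<in> A")
      case True
      then show ?thesis using I[of x y] linked_mono[of l R x y "I e" "2 * l"] xy by (auto simp: I'_def)
    next
      case False
      then have "e \<in> fraternal H" using e by blast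
      then have "x \<in> H (c e)" "y \<in> H (c e)" using c xy by force+
      then have "(x, c e) \<in> A" "(c e, y) \<in> A" using H symA by (auto dest: symD)
      then have "I (x, c e) \<subseteq> V" "I (c e, y) \<subseteq> V" "linked l R x (c e) (I (x, c e))"
        "linked l R (c e) y (I (c e, y))" "c e \<in> V"
        using I AV by blast+
      moreover have "I' e = insert (c e) (I (x, c e) \<union> I (c e, y))"
        using False xy by (simp add: I'_def)
      ultimately show ?thesis
        using linked_trans[of l R x "c e" "I (x, c e)" l y "I (c e, y)"] by (simp add: mult_2)
    qed
    then show "case e of (x, y) \<Rightarrow> I' (x, y) \<subseteq> V \<and> linked (2 * l) R x y (I' (x, y))"
      using xy by simp
  next
    fix v
    let ?Av = "{e\<in>A. v \<in> I e}"
    have finAv: "finite ?Av" using finA by simp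
    have sub: "{e\<in>A \<union> fraternal H. v \<in> I' e} \<subseteq> ?Av \<union> H v \<times> H v \<union>
      (\<Union>f\<in>?Av. {fst f} \<times> H (snd f)) \<union> (\<Union>f\<in>?Av. H (fst f) \<times> {snd f})" (is "_ \<subseteq> ?U")
    proof
      fix e assume e: "e \<in> {e\<in>A \<union> fraternal H. v \<in> I' e}"
      show "e \<in> ?U"
      proof (cases "e \<in> A")
        case True
        then show ?thesis using e by (simp add: I'_def)
      next
        case False
        obtain x y where xy: "e = (x, y)" by (cases e)
        from False e have xyH: "x \<in> H (c e)" "y \<in> H (c e)" using c xy by force+
        then have A': "(x, c e) \<in> A" "(c e, y) \<in> A" using H symA by (auto dest: symD)
        from False e xy consider "v = c e" | "v \<in> I (x, c e)" | "v \<in> I (c e, y)"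
          by (auto simp: I'_def)
        then show ?thesis
        proof cases
          case 1
          then show ?thesis using xyH xy by simp
        next
          case 2
          then have "(x, c e) \<in> ?Av" using A' by simp
          then have "e \<in> (\<Union>f\<in>?Av. {fst f} \<times> H (snd f))" using xyH xy by force
          then show ?thesis by blast
        next
          case 3
          then have "(c e, y) \<in> ?Av" using A' by simp
          then have "e \<in> (\<Union>f\<in>?Av. H (fst f) \<times> {snd f})" using xyH xy by force
          then show ?thesis by blast
        qed
      qed
    qed
    have b1: "card (\<Union>f\<in>?Av. {fst f} \<times> H (snd f)) \<le> C * \<Delta>"
    proof -
      have "card (\<Union>f\<in>?Av. {fst f} \<times> H (snd f)) \<le> (\<Sum>f\<in>?Av. card ({fst f} \<times> H (snd f)))"
        by (rule card_UN_le[OF finAv])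
      also have "\<dots> \<le> (\<Sum>f\<in>?Av. \<Delta>)" by (rule sum_mono) (simp add: card_H card_cartesian_product)
      also have "\<dots> \<le> C * \<Delta>" using C[of v] by simp
      finally show ?thesis .
    qed
    have b2: "card (\<Union>f\<in>?Av. H (fst f) \<times> {snd f}) \<le> C * \<Delta>"
    proof -
      have "card (\<Union>f\<in>?Av. H (fst f) \<times> {snd f}) \<le> (\<Sum>f\<in>?Av. card (H (fst f) \<times> {snd f}))"
        by (rule card_UN_le[OF finAv])
      also have "\<dots> \<le> (\<Sum>f\<in>?Av. \<Delta>)" by (rule sum_mono) (simp add: card_H card_cartesian_product)
      also have "\<dots> \<le> C * \<Delta>" using C[of v] by simp
      finally show ?thesis .
    qed
    have b3: "card (H v \<times> H v) \<le> \<Delta> * \<Delta>" by (simp add: card_cartesian_product mult_le_mono card_H)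
    have "card {e\<in>A \<union> fraternal H. v \<in> I' e} \<le> card ?U"
      by (rule card_mono[OF _ sub]) (use finAv finH in auto)
    also have "\<dots> \<le> card ?Av + card (H v \<times> H v) + card (\<Union>f\<in>?Av. {fst f} \<times> H (snd f)) +
        card (\<Union>f\<in>?Av. H (fst f) \<times> {snd f})"
      by (intro order_trans[OF card_Un_le] add_mono order_refl)
    also have "\<dots> \<le> C + \<Delta> * \<Delta> + C * \<Delta> + C * \<Delta>"
      by (intro add_mono C b1 b2 b3)
    finally show "card {e\<in>A \<union> fraternal H. v \<in> I' e} \<le> C + \<Delta> * \<Delta> + 2 * C * \<Delta>" by simp
  qed
qed

text \<open>Stated for every part \<open>F\<close> of the augmentation, because peeling needs it for
  each of the subgraphs that remain.\<close>

lemma augmentation_sparse: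
  assumes A: "augmentation V R l C A" and mb: "minor_bound l V R d" and fin: "finite V"
    and X: "X \<subseteq> V" and F: "F \<subseteq> A" "F \<subseteq> X \<times> X"
  shows "card F \<le> link_density l C d * card X"
proof -
  from A obtain I where AV: "A \<subseteq> V \<times> V" and irr: "irrefl A"
    and I: "\<And>x y. (x, y) \<in> A \<Longrightarrow> I (x, y) \<subseteq> V \<and> linked l R x y (I (x, y))"
    and C: "\<And>v. card {e\<in>A. v \<in> I e} \<le> C"
    unfolding augmentation_def by blast
  have finA: "finite A" using AV fin finite_subset by blast
  show ?thesis
  proof (rule linked_pairs_sparse[OF mb fin X F(2)])
    show "x \<noteq> y \<and> I (x, y) \<subseteq> V \<and> linked l R x y (I (x, y))" if "(x, y) \<in> F" for x y
      using that F(1) I irr by (auto simp: irrefl_def)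
    show "card {e\<in>F. v \<in> I e} \<le> C" for v
    proof -
      have "card {e\<in>F. v \<in> I e} \<le> card {e\<in>A. v \<in> I e}"
        by (rule card_mono) (use finA F(1) in auto)
      then show ?thesis using C[of v] by simp
    qed
  qed
qed

section \<open>Shortening walks until they ascend and then descend\<close>

fun walk_weight :: "('a \<Rightarrow> 'a \<Rightarrow> nat) \<Rightarrow> 'a list \<Rightarrow> nat" where
  "walk_weight w (x # y # p) = w x y + walk_weight w (y # p)"
| "walk_weight w p = 0"

definition updown :: "('a \<Rightarrow> 'a set) \<Rightarrow> 'a list \<Rightarrow> bool" where
  "updown H p \<longleftrightarrow> (\<exists>us c ds. p = us @ c # ds \<and> successively (\<lambda>x y. y \<in> H x) (us @ [c]) \<and>
     successively (\<lambda>x y. x \<in> H y) (c # ds))"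

text \<open>The only obstruction to ascending and then descending is a step down followed at once by
  a step up, and there both neighbours are hubs of the middle vertex.\<close>

lemma updown_or_fraternal:
  assumes "successively (\<lambda>x y. (x, y) \<in> A) p" "p \<noteq> []"
    and H: "\<And>x y. (x, y) \<in> A \<Longrightarrow> y \<in> H x \<or> x \<in> H y"
  shows "updown H p \<or> (\<exists>xs x c y ys. p = xs @ x # c # y # ys \<and> x \<in> H c \<and> y \<in> H c)"
  using assms(1,2)
proof (induction p)
  case (Cons a p)
  show ?case
  proof (cases p)
    case Nil
    then show ?thesis unfolding updown_def by (intro disjI1 exI[of _ "[]"] exI[of _ a]) auto
  next
    case p: (Cons b r)
    have ab: "(a, b) \<in> A" using Cons.prems p by simp
    have "successively (\<lambda>x y. (x, y) \<in> A) p" using Cons.prems p by simp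
    then consider "updown H p" | "\<exists>xs x c y ys. p = xs @ x # c # y # ys \<and> x \<in> H c \<and> y \<in> H c"
      using Cons.IH p by blast
    then show ?thesis
    proof cases
      case 2
      then obtain xs x c y ys where "a # p = (a # xs) @ x # c # y # ys" "x \<in> H c" "y \<in> H c" by auto
      then show ?thesis by blast
    next
      case 1
      then obtain us c ds where u: "p = us @ c # ds" "successively (\<lambda>x y. y \<in> H x) (us @ [c])"
        "successively (\<lambda>x y. x \<in> H y) (c # ds)" unfolding updown_def by blast
      show ?thesis
      proof (cases "b \<in> H a")
        case True
        have "updown H (a # p)" unfolding updown_def
          by (rule exI[of _ "a # us"], rule exI[of _ c], rule exI[of _ ds])
            (use u True p in \<open>cases us; auto\<close>)
        then show ?thesis by blast
      next
        case False
        then have aH: "a \<in> H b" using H[OF ab] by blast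
        show ?thesis
        proof (cases us)
          case Nil
          have "updown H (a # p)" unfolding updown_def
            by (rule exI[of _ "[]"], rule exI[of _ a], rule exI[of _ p])
              (use u Nil aH p in auto)
          then show ?thesis by blast
        next
          case us: (Cons b' us')
          show ?thesis
          proof (cases us')
            case Nil
            then have "a # p = [] @ a # b # c # ds \<and> a \<in> H b \<and> c \<in> H b"
              using u us p aH by auto
            then show ?thesis by blast
          next
            case (Cons y us'')
            then have "a # p = [] @ a # b # y # us'' @ c # ds \<and> a \<in> H b \<and> y \<in> H b"
              using u us p aH by auto
            then show ?thesis by blast
          qed
        qed
      qed
    qed
  qed
qed simp

lemma walk_weight_append:
  "walk_weight w (xs @ x # ys) = walk_weight w (xs @ [x]) + walk_weight w (x # ys)"
proof (induction xs)
  case (Cons a xs)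
  then show ?case by (cases xs) auto
qed simp

lemma walk_weight_mono:
  "(\<And>x y. w' x y \<le> w x y) \<Longrightarrow> walk_weight w' p \<le> walk_weight w p"
  by (induction w p rule: walk_weight.induct) (auto intro: add_mono)

text \<open>Weights stand for directed distances and need not be symmetric, so reversal transposes
  them.\<close>

lemma walk_weight_rev: "walk_weight w (rev p) = walk_weight (\<lambda>x y. w y x) p"
proof (induction w p rule: walk_weight.induct)
  case (1 w x y p)
  have "walk_weight w (rev (x # y # p)) = walk_weight w ((rev p @ [y]) @ [x])" by simp
  also have "\<dots> = walk_weight w (rev p @ [y]) + w y x"
    using walk_weight_append[of w "rev p" y "[x]"] by simp
  finally show ?case using 1 by simp
qed auto

text \<open>The number \<open>j\<close> is the potential of the rounds: a walk that is not yet
  \<open>updown\<close> has at most \<open>j\<close> edges, and a round removes at least one. The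
  bound \<open>Suc k\<close> on the number of vertices is carried along because it later bounds the
  height of the climb; the weight alone would not, as steps of weight 0 are not excluded.\<close>

definition short_walk ::
  "nat \<Rightarrow> nat \<Rightarrow> 'a rel \<Rightarrow> ('a \<Rightarrow> 'a set) \<Rightarrow> ('a \<Rightarrow> 'a \<Rightarrow> nat) \<Rightarrow> 'a \<Rightarrow> 'a \<Rightarrow> bool" where
  "short_walk k j A H w u v \<longleftrightarrow> (\<exists>p. p \<noteq> [] \<and> hd p = u \<and> last p = v \<and>
     successively (\<lambda>x y. (x, y) \<in> A) p \<and> walk_weight w p \<le> k \<and> length p \<le> Suc k \<and>
     (updown H p \<or> length p \<le> Suc j))"

lemma updown_mono: "updown H p \<Longrightarrow> (\<And>x. H x \<subseteq> H' x) \<Longrightarrow> updown H' p"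
proof -
  assume "updown H p" and H: "\<And>x. H x \<subseteq> H' x"
  then obtain us c ds where "p = us @ c # ds" "successively (\<lambda>x y. y \<in> H x) (us @ [c])"
     "successively (\<lambda>x y. x \<in> H y) (c # ds)" unfolding updown_def by blast
  moreover have "successively (\<lambda>x y. y \<in> H' x) (us @ [c])"
    by (rule successively_mono[OF calculation(2)]) (use H in auto)
  moreover have "successively (\<lambda>x y. x \<in> H' y) (c # ds)"
    by (rule successively_mono[OF calculation(3)]) (use H in auto)
  ultimately show "updown H' p" unfolding updown_def by blast
qed

lemma short_walk_fraternal:
  assumes sw: "short_walk k (Suc j) A H w u v"
    and H: "\<And>x y. (x, y) \<in> A \<Longrightarrow> y \<in> H x \<or> x \<in> H y"
    and A': "A \<union> fraternal H \<subseteq> A'" and H': "\<And>x. H x \<subseteq> H' x"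
    and w': "\<And>x y. w' x y \<le> w x y"
    and tri: "\<And>x y c. x \<in> H c \<Longrightarrow> y \<in> H c \<Longrightarrow> w' x y \<le> w x c + w c y"
  shows "short_walk k j A' H' w' u v"
proof -
  from sw obtain p where p: "p \<noteq> []" "hd p = u" "last p = v" "successively (\<lambda>x y. (x, y) \<in> A) p"
    "walk_weight w p \<le> k" "length p \<le> Suc k" "updown H p \<or> length p \<le> Suc (Suc j)"
    unfolding short_walk_def by blast
  have succ': "successively (\<lambda>x y. (x, y) \<in> A') q" if "successively (\<lambda>x y. (x, y) \<in> A) q" for q
    by (rule successively_mono[OF that]) (use A' in auto)
  show ?thesis
  proof (cases "updown H p")
    case True
    then show ?thesis unfolding short_walk_def
      using p succ'[OF p(4)] updown_mono[OF True H'] order_trans[OF walk_weight_mono[of w' w p, OF w'] p(5)]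
      by (intro exI[of _ p]) simp
  next
    case False
    then obtain xs x c y ys where s: "p = xs @ x # c # y # ys" "x \<in> H c" "y \<in> H c"
      using updown_or_fraternal[OF p(4,1) H] by blast
    have len: "length p \<le> Suc (Suc j)" using p(7) False by blast
    show ?thesis
    proof (cases "x = y")
      case True
      \<comment> \<open>No edge is added for equal hubs; the detour x, c, x is simply cut
        out.\<close>
      let ?q = "xs @ y # ys"
      have "successively (\<lambda>x y. (x, y) \<in> A) ?q"
        using p(4) unfolding s True by (auto simp: successively_append_iff)
      moreover have "walk_weight w' ?q \<le> walk_weight w p"
        using walk_weight_mono[of w' w ?q, OF w'] walk_weight_append[of w xs x "c # y # ys"]
          walk_weight_append[of w xs y ys] unfolding s True by simp
      ultimately show ?thesis unfolding short_walk_def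
        by (intro exI[of _ ?q] conjI disjI2 succ') (use p len s True in \<open>auto simp: hd_append\<close>)
    next
      case False
      let ?q = "xs @ x # y # ys"
      have xy: "(x, y) \<in> A'" using s False A' unfolding fraternal_def by blast
      have "successively (\<lambda>x y. (x, y) \<in> A) (xs @ [x])" "successively (\<lambda>x y. (x, y) \<in> A) (y # ys)"
        using p(4) unfolding s by (auto simp: successively_append_iff)
      then have "successively (\<lambda>x y. (x, y) \<in> A') (xs @ [x])" "successively (\<lambda>x y. (x, y) \<in> A') (y # ys)"
        using succ' by blast+
      then have "successively (\<lambda>x y. (x, y) \<in> A') ?q"
        using xy by (auto simp: successively_append_iff)
      moreover have "walk_weight w' ?q \<le> walk_weight w p"
        using walk_weight_mono[of w' w "xs @ [x]", OF w'] walk_weight_mono[of w' w "y # ys", OF w'] tri[OF s(2,3)]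
          walk_weight_append[of w xs x "c # y # ys"] walk_weight_append[of w' xs x "y # ys"]
        unfolding s by simp
      ultimately show ?thesis unfolding short_walk_def
        by (intro exI[of _ ?q] conjI disjI2) (use p len s in \<open>auto simp: hd_append\<close>)
    qed
  qed
qed

text \<open>With potential 0 the walk is \<open>updown\<close> or a single vertex, which is
  \<open>updown\<close> too. The descending half is read backwards, so that both halves climb to the
  apex; its weights are transposed accordingly.\<close>

lemma short_walk_apex:
  assumes sw: "short_walk k 0 A H w u v"
  obtains p q where "p \<noteq> []" "q \<noteq> []" "hd p = u" "hd q = v" "last p = last q" "length p \<le> Suc k" "length q \<le> Suc k"
    "successively (\<lambda>x y. y \<in> H x) p" "successively (\<lambda>x y. y \<in> H x) q"
    "walk_weight w p + walk_weight (\<lambda>x y. w y x) q \<le> k"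
proof -
  from sw obtain p where p: "p \<noteq> []" "hd p = u" "last p = v"
    "walk_weight w p \<le> k" "length p \<le> Suc k" "updown H p \<or> length p \<le> 1"
    unfolding short_walk_def by auto
  have "updown H p"
  proof (cases "updown H p")
    case False
    then obtain a where "p = [a]" using p by (cases p) auto
    then show ?thesis unfolding updown_def by (intro exI[of _ "[]"] exI[of _ a]) auto
  qed
  then obtain us c ds where s: "p = us @ c # ds" "successively (\<lambda>x y. y \<in> H x) (us @ [c])"
      "successively (\<lambda>x y. x \<in> H y) (c # ds)" unfolding updown_def by blast
  show thesis
  proof (rule that[of "us @ [c]" "rev (c # ds)"])
    show "successively (\<lambda>x y. y \<in> H x) (rev (c # ds))"
      using s(3) by (subst successively_rev) auto
    show "walk_weight w (us @ [c]) + walk_weight (\<lambda>x y. w y x) (rev (c # ds)) \<le> k"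
      using p(4) walk_weight_append[of w us c ds] unfolding s walk_weight_rev by simp
    show "hd (rev (c # ds)) = v" using p s by (simp add: hd_rev del: rev.simps)
    show "hd (us @ [c]) = u" using p s by (cases us) auto
  qed (use p s in auto)
qed

section \<open>Distances as powers of the arc relation, and minors of the input graph\<close>

lemma awalk_iff_relpow:
  assumes "pair_wf_digraph G"
  shows "(\<exists>p. pre_digraph.awalk (with_proj G) u p v \<and> length p = i) \<longleftrightarrow> u \<in> pverts G \<and> (u, v) \<in> parcs G ^^ i"
proof -
  interpret pair_wf_digraph G by fact
  show ?thesis
  proof (induction i arbitrary: u)
    case 0
    then show ?case by (auto simp: awalk_Nil_iff)
  next
    case (Suc i)
    have "(\<exists>p. awalk u p v \<and> length p = Suc i) \<longleftrightarrow>
        (\<exists>w. (u, w) \<in> parcs G \<and> (\<exists>p. awalk w p v \<and> length p = i))" (is "?L \<longleftrightarrow> ?R")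
    proof
      assume ?L
      then obtain a b p where "awalk u ((a, b) # p) v" "length p = i" by (auto simp: length_Suc_conv)
      then show ?R by (auto simp: awalk_Cons_iff)
    next
      assume ?R
      then obtain w p where w: "(u, w) \<in> parcs G" "awalk w p v" "length p = i" by blast
      then have "awalk u ((u, w) # p) v" by (simp add: awalk_Cons_iff)
      then show ?L using w(3) by (intro exI[of _ "(u, w) # p"]) simp
    qed
    also have "\<dots> \<longleftrightarrow> u \<in> pverts G \<and> (u, v) \<in> parcs G ^^ Suc i"
      unfolding Suc relpow_commute[symmetric] relpow.simps using in_arcsD1 in_arcsD2 by (auto intro: relcompI)
    finally show ?case .
  qed
qed

lemma hop_dist_le_iff:
  assumes G: "pair_wf_digraph G" and u: "u \<in> pverts G"
  shows "hop_dist G u v \<le> ereal (real k) \<longleftrightarrow> (\<exists>i\<le>k. (u, v) \<in> parcs G ^^ i)"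
proof -
  interpret pair_wf_digraph G by fact
  have wf: "wf_digraph (with_proj G)" by unfold_locales
  have cost: "awalk_cost (\<lambda>_. 1) p = real (length p)" for p :: "('a \<times> 'a) list"
    unfolding awalk_cost_def by (induction p) auto
  have mu: "hop_dist G u v = (INF p\<in>{p. awalk u p v}. ereal (real (length p)))"
    unfolding hop_dist_def \<mu>_def cost ..
  show ?thesis
  proof
    assume "hop_dist G u v \<le> ereal (real k)"
    \<comment> \<open>The strict bound k + 1 yields an actual walk below it, whose integral length
      is then at most k.\<close>
    then have "(INF p\<in>{p. awalk u p v}. ereal (real (length p))) < ereal (real (Suc k))"
      unfolding mu by (rule le_less_trans) simp
    then obtain p where "awalk u p v" "length p < Suc k" unfolding INF_less_iff by auto
    then show "\<exists>i\<le>k. (u, v) \<in> parcs G ^^ i"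
      using awalk_iff_relpow[OF G, of u v "length p"] by (intro exI[of _ "length p"]) auto
  next
    assume "\<exists>i\<le>k. (u, v) \<in> parcs G ^^ i"
    then obtain i p where "i \<le> k" "awalk u p v" "length p = i"
      using awalk_iff_relpow[OF G, of u v] u by blast
    then show "hop_dist G u v \<le> ereal (real k)"
      unfolding mu by (intro INF_lower2[of p]) auto
  qed
qed

lemma diameter_le_iff:
  assumes G: "pair_wf_digraph G"
  shows "diameter G \<le> ereal (real k) \<longleftrightarrow>
    (\<forall>u\<in>pverts G. \<forall>v\<in>pverts G. \<exists>i\<le>k. (u, v) \<in> parcs G ^^ i)"
  unfolding diameter_def SUP_le_iff using hop_dist_le_iff[OF G] by blast

text \<open>The subgraph is induced on the union of the branch sets, so contraction leaves no
  singletons over, and the vertices of the minor are exactly the branch sets. Being disjoint and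
  nonempty, they differ for different centres.\<close>

lemma shallow_minor_contract:
  assumes G: "pair_graph G" and XV: "X \<subseteq> pverts G"
    and B: "\<And>z. z \<in> X \<Longrightarrow> z \<in> B z \<and> B z \<subseteq> pverts G \<and>
      (\<forall>v\<in>B z. \<exists>i\<le>r. (z, v) \<in> (parcs G \<inter> B z \<times> B z) ^^ i)"
    and disj: "\<And>z z'. z \<in> X \<Longrightarrow> z' \<in> X \<Longrightarrow> z \<noteq> z' \<Longrightarrow> B z \<inter> B z' = {}"
  obtains H where "shallow_minor r H G" "pverts H = B ` X"
    "parcs H = {(B x, B y) | x y. x \<in> X \<and> y \<in> X \<and> x \<noteq> y \<and> (\<exists>a\<in>B x. \<exists>b\<in>B y. (a, b) \<in> parcs G)}"
proof -
  interpret G: pair_graph G by fact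
  define ind where "ind W = \<lparr>pverts = W, parcs = parcs G \<inter> W \<times> W\<rparr>" for W
  define W where "W = (\<Union>z\<in>X. B z)"
  have ind_simps: "pverts (ind W) = W" "parcs (ind W) = parcs G \<inter> W \<times> W" for W
    by (simp_all add: ind_def)
  have ind_graph: "pair_graph (ind W)" if "W \<subseteq> pverts G" for W
  proof
    show "finite (pverts (ind W))" "finite (parcs (ind W))"
      using finite_subset[OF that G.pair_finite_verts] G.pair_finite_arcs by (auto simp: ind_simps)
    show "symmetric (with_proj (ind W))" unfolding symmetric_def
      by (rule symI) (auto simp: ind_simps intro: G.arcs_symmetric)
  qed (auto simp: ind_simps dest: G.pair_no_loops)
  have wf: "wf_digraph (with_proj (ind W))" if "W \<subseteq> pverts G" for W
  proof -
    interpret pair_graph "ind W" by (rule ind_graph[OF that])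
    show ?thesis by unfold_locales
  qed
  have wfG: "wf_digraph (with_proj G)" by unfold_locales
  have WV: "W \<subseteq> pverts G" using B by (auto simp: W_def)
  have inj: "inj_on B X"
    by (rule inj_onI) (metis B disj disjoint_iff)
  define H where "H = contract (ind W) (pverts ` (ind ` B ` X))"
  have PX: "pverts ` (ind ` B ` X) = B ` X" by (auto simp: ind_simps image_iff)
  have V: "B ` X \<union> {{v} | v. v \<in> pverts (ind W) - \<Union> (B ` X)} = B ` X"
    by (auto simp: ind_simps W_def)
  have "shallow_minor r H G" unfolding shallow_minor_def
  proof (intro exI[of _ "ind W"] exI[of _ "ind ` B ` X"] conjI ballI impI)
    show "pair_graph (ind W)" by (rule ind_graph[OF WV])
    show "subgraph (with_proj (ind W)) (with_proj G)"
      unfolding subgraph_def using wf[OF WV] wfG WV by (auto simp: ind_simps)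
    show "H = contract (ind W) (pverts ` (ind ` B ` X))" by (simp add: H_def)
  next
    fix P assume "P \<in> ind ` B ` X"
    then obtain z where z: "z \<in> X" "P = ind (B z)" by blast
    have BV: "B z \<subseteq> pverts G" using B z by blast
    have pg: "pair_graph P" unfolding z by (rule ind_graph[OF BV])
    interpret P: pair_graph P by (rule pg)
    show "pair_graph P" by (rule pg)
    show "subgraph (with_proj P) (with_proj (ind W))"
      unfolding subgraph_def z using wf[OF WV] wf[OF BV] z(1) by (auto simp: ind_simps W_def)
    have reach: "\<exists>i\<le>r. (z, v) \<in> parcs P ^^ i" if "v \<in> pverts P" for v
      using B[OF z(1)] that unfolding z(2) ind_simps by blast
    have zP: "z \<in> pverts P" using B[OF z(1)] unfolding z(2) ind_simps by blast
    have "(SUP v\<in>pverts P. hop_dist P z v) \<le> ereal (real r)"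
    proof (rule SUP_least)
      fix v assume "v \<in> pverts P"
      then show "hop_dist P z v \<le> ereal (real r)"
        using hop_dist_le_iff[OF _ zP] reach P.pair_wf_digraph by blast
    qed
    then show "radius P \<le> ereal (real r)" unfolding radius_def using zP by (rule INF_lower2[rotated])
    \<comment> \<open>Connectedness is defined through the symmetric closure, which does not change
      \<open>P\<close>.\<close>
    have symP: "mk_symmetric (with_proj P) = P"
    proof -
      have "(\<Union>e\<in>parcs P. {(fst e, snd e), (snd e, fst e)}) = parcs P"
        using P.arcs_symmetric by auto
      then show ?thesis unfolding mk_symmetric_def by simp
    qed
    have zr: "z \<rightarrow>\<^sup>*\<^bsub>with_proj P\<^esub> v" if v: "v \<in> pverts P" for v
    proof -
      obtain i where i: "(z, v) \<in> parcs P ^^ i" using reach[OF v] by blast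
      then obtain p where "P.awalk z p v" using awalk_iff_relpow[OF P.pair_wf_digraph, of z v i] zP by blast
      then show ?thesis using P.reachable_awalk by blast
    qed
    show "Digraph_Component.connected (with_proj P)"
      unfolding Digraph_Component.connected_def symP
    proof (rule strongly_connectedI)
      show "verts (with_proj P) \<noteq> {}" using zP by auto
      fix u v assume "u \<in> verts (with_proj P)" "v \<in> verts (with_proj P)"
      then have "z \<rightarrow>\<^sup>*\<^bsub>with_proj P\<^esub> u" "z \<rightarrow>\<^sup>*\<^bsub>with_proj P\<^esub> v" using zr by auto
      then show "u \<rightarrow>\<^sup>*\<^bsub>with_proj P\<^esub> v"
        using symmetric_reachable[OF P.sym_arcs] P.reachable_trans by blast
    qed
  next
    fix P P' assume "P \<in> ind ` B ` X" "P' \<in> ind ` B ` X" "P \<noteq> P'"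
    then show "pverts P \<inter> pverts P' = {}" using disj by (fastforce simp: ind_simps)
  qed
  moreover have "pverts H = B ` X" unfolding H_def contract_def PX V Let_def by simp
  moreover have "parcs H = {(B x, B y) | x y. x \<in> X \<and> y \<in> X \<and> x \<noteq> y \<and> (\<exists>a\<in>B x. \<exists>b\<in>B y. (a, b) \<in> parcs G)}"
    unfolding H_def contract_def PX V Let_def
    using inj by (auto simp: ind_simps W_def inj_on_eq_iff)
  ultimately show thesis by (rule that)
qed

text \<open>An edge may contribute both of its orders to \<open>M\<close> but counts once in
  \<open>edge_density\<close>, hence 2 * d. The branch sets of numbers are pulled back along the
  inverse \<open>g\<close> of the numbering.\<close>

lemma minor_bound_of_shallow_minors:
  assumes G: "pair_graph G" and num: "inj_on num (pverts G)"
    and d: "\<And>H. shallow_minor r H G \<Longrightarrow> edge_density H \<le> d"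
  shows "minor_bound r (num ` pverts G) ((\<lambda>(u, v). (num u, num v)) ` parcs G) (nat \<lceil>2 * d\<rceil>)"
  unfolding minor_bound_def
proof (intro allI impI, elim conjE)
  fix X and B :: "'b \<Rightarrow> 'b set" and M
  interpret G: pair_graph G by fact
  let ?R = "(\<lambda>(u, v). (num u, num v)) ` parcs G"
  assume X: "X \<subseteq> num ` pverts G"
    and B: "\<forall>z\<in>X. z \<in> B z \<and> B z \<subseteq> num ` pverts G \<and> (\<forall>v\<in>B z. \<exists>i\<le>r. (z, v) \<in> (?R \<inter> B z \<times> B z) ^^ i)"
    and disj: "\<forall>z\<in>X. \<forall>z'\<in>X. z \<noteq> z' \<longrightarrow> B z \<inter> B z' = {}"
    and M: "M \<subseteq> X \<times> X" "\<forall>(x, y)\<in>M. x \<noteq> y \<and> (\<exists>a\<in>B x. \<exists>b\<in>B y. (a, b) \<in> ?R)"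
  define g where "g = the_inv_into (pverts G) num"
  have g: "g (num v) = v" if "v \<in> pverts G" for v
    unfolding g_def using num that by (rule the_inv_into_f_f)
  have ginj: "inj_on g (num ` pverts G)" by (rule inj_onI) (auto simp: g)
  have gR: "(g a, g b) \<in> parcs G" if "(a, b) \<in> ?R" for a b
    using that g G.in_arcsD1 G.in_arcsD2 by auto
  define C where "C x = g ` B (num x)" for x
  let ?Y = "g ` X"
  have numg: "num (g a) = a" if "a \<in> num ` pverts G" for a using that g by auto
  have gV: "g a \<in> pverts G" if "a \<in> num ` pverts G" for a using that g by auto
  have finX: "finite X" using X G.pair_finite_verts finite_subset by blast
  have C: "C (g z) = g ` B z" if "z \<in> X" for z using that X numg unfolding C_def by auto
  obtain H where H: "shallow_minor r H G" "pverts H = C ` ?Y"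
    "parcs H = {(C x, C y) | x y. x \<in> ?Y \<and> y \<in> ?Y \<and> x \<noteq> y \<and> (\<exists>a\<in>C x. \<exists>b\<in>C y. (a, b) \<in> parcs G)}"
  proof (rule shallow_minor_contract[OF G, of ?Y C r])
    show "?Y \<subseteq> pverts G" using X gV by auto
    fix x assume "x \<in> ?Y"
    then obtain z where z: "z \<in> X" "x = g z" by blast
    have Bz: "z \<in> B z" "B z \<subseteq> num ` pverts G" "\<And>v. v \<in> B z \<Longrightarrow> \<exists>i\<le>r. (z, v) \<in> (?R \<inter> B z \<times> B z) ^^ i"
      using B z(1) by blast+
    have map: "(g z, g v) \<in> (parcs G \<inter> C x \<times> C x) ^^ i" if "(z, v) \<in> (?R \<inter> B z \<times> B z) ^^ i" for v i
      using that
    proof (induction i arbitrary: v)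
      case (Suc i)
      then obtain u where u: "(z, u) \<in> (?R \<inter> B z \<times> B z) ^^ i" "(u, v) \<in> ?R" "u \<in> B z" "v \<in> B z"
        by (elim relpow_Suc_E) blast
      then have "(g u, g v) \<in> parcs G \<inter> C x \<times> C x" using gR[OF u(2)] C[OF z(1)] z(2) by auto
      then show ?case using Suc.IH[OF u(1)] by (meson relpow_Suc_I)
    qed simp
    show "x \<in> C x \<and> C x \<subseteq> pverts G \<and> (\<forall>v\<in>C x. \<exists>i\<le>r. (x, v) \<in> (parcs G \<inter> C x \<times> C x) ^^ i)"
    proof (intro conjI ballI)
      show "x \<in> C x" using C z Bz(1) by auto
      show "C x \<subseteq> pverts G" using C z Bz(2) gV by auto
      fix v assume "v \<in> C x"
      then obtain w where w: "w \<in> B z" "v = g w" using C z by auto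
      then show "\<exists>i\<le>r. (x, v) \<in> (parcs G \<inter> C x \<times> C x) ^^ i" using Bz(3)[OF w(1)] map z(2) by blast
    qed
    fix x' assume "x' \<in> ?Y" "x \<noteq> x'"
    then obtain z' where z': "z' \<in> X" "x' = g z'" "z \<noteq> z'" using z by blast
    have "B z' \<subseteq> num ` pverts G" "B z \<inter> B z' = {}" using B disj z z' by blast+
    then have "g ` B z \<inter> g ` B z' = {}" using Bz(2) inj_on_image_Int[OF ginj, of "B z" "B z'"] by auto
    then show "C x \<inter> C x' = {}" using C z z' by auto
  qed
  have Cinj: "C (g x) \<noteq> C (g y)" if "x \<in> X" "y \<in> X" "x \<noteq> y" for x y
  proof -
    have "B x \<inter> B y = {}" "x \<in> B x" "B x \<subseteq> num ` pverts G" "B y \<subseteq> num ` pverts G" using B disj that by blast+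
    then have "g ` B x \<inter> g ` B y = {}" "g x \<in> g ` B x" using inj_on_image_Int[OF ginj, of "B x" "B y"] by auto
    then show ?thesis using C that by auto
  qed
  let ?f = "\<lambda>(x, y). (C (g x), C (g y))"
  have "inj_on ?f M" by (rule inj_onI) (use M(1) Cinj in \<open>auto, blast+\<close>)
  moreover have "?f ` M \<subseteq> parcs H"
  proof
    fix e assume "e \<in> ?f ` M"
    then obtain x y where xy: "(x, y) \<in> M" "e = (C (g x), C (g y))" by auto
    then have "x \<in> X" "y \<in> X" "x \<noteq> y" using M by auto
    obtain a b where ab: "a \<in> B x" "b \<in> B y" "(a, b) \<in> ?R" using M(2) xy by blast
    have "g x \<noteq> g y" using \<open>x \<in> X\<close> \<open>y \<in> X\<close> \<open>x \<noteq> y\<close> X ginj by (metis inj_onD subsetD)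
    moreover have "g a \<in> C (g x)" "g b \<in> C (g y)" using ab C \<open>x \<in> X\<close> \<open>y \<in> X\<close> by auto
    ultimately show "e \<in> parcs H" using gR[OF ab(3)] \<open>x \<in> X\<close> \<open>y \<in> X\<close> unfolding H(3) xy(2) by blast
  qed
  moreover have "finite (parcs H)"
  proof (rule finite_subset)
    show "parcs H \<subseteq> C ` ?Y \<times> C ` ?Y" unfolding H(3) by auto
  qed (use finX in auto)
  ultimately have cM: "card M \<le> card (parcs H)" by (metis card_image card_mono)
  have cV: "card (pverts H) \<le> card X" unfolding H(2) image_image by (rule card_image_le[OF finX])
  show "card M \<le> nat \<lceil>2 * d\<rceil> * card X"
  \<comment> \<open>Without vertices the density is a division by zero and bounds nothing; but then
    \<open>X\<close> is empty.\<close>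
  proof (cases "card (pverts H) = 0")
    case True
    then have "X = {}" unfolding H(2) using finX by auto
    then show ?thesis using M(1) by auto
  next
    case False
    then have "real (card (parcs H)) \<le> 2 * d * real (card (pverts H))"
      using d[OF H(1)] unfolding edge_density_def by (simp add: field_simps)
    also have "\<dots> \<le> real (nat \<lceil>2 * d\<rceil>) * real (card (pverts H))"
      by (intro mult_right_mono) (auto simp: real_nat_ceiling_ge)
    also have "\<dots> \<le> real (nat \<lceil>2 * d\<rceil>) * real (card X)" using cV by (intro mult_left_mono) auto
    finally have "card (parcs H) \<le> nat \<lceil>2 * d\<rceil> * card X"
      unfolding of_nat_mult[symmetric] of_nat_le_iff .
    then show ?thesis using cM by linarith
  qed
qed

lemma pair_graph_mk_symmetric:
  assumes "pair_digraph G" shows "pair_graph (mk_symmetric (with_proj G))"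
proof -
  interpret pair_digraph G by fact
  show ?thesis
  proof
    show "symmetric (with_proj (mk_symmetric (with_proj G)))"
      unfolding symmetric_def by (rule symI) (auto simp: mk_symmetric_def intro: rev_bexI)
    show "fst e \<noteq> snd e" if "e \<in> parcs (mk_symmetric (with_proj G))" for e
      using that by (cases e) (auto simp: mk_symmetric_def dest: no_loops')
  qed (use pair_finite_verts pair_finite_arcs in
      \<open>auto simp: mk_symmetric_def dest: in_arcsD1 in_arcsD2\<close>)
qed

section \<open>A loop language with arrays\<close>

record loop_state =
  vars :: "nat \<Rightarrow> nat"
  arr :: "nat \<Rightarrow> nat \<Rightarrow> nat \<Rightarrow> nat \<Rightarrow> nat"
  ticks :: nat

text \<open>The only loops are counted ones, so every program terminates, its meaning is a function,
  and its cost can be read off the final state. The bound of a \<open>For\<close> is read once at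
  entry and the counter is set anew in each iteration, so the body may overwrite both variables. The
  table number \<open>t\<close> of an array access is a constant of the program; the three indices
  are variables.\<close>

datatype loop_com =
    Nop
  | Const nat nat
  | Move nat nat
  | Inc nat nat
  | Sub nat nat nat
  | Quot nat nat nat
  | AddMin nat nat nat
  | Inp nat nat
  | Get nat nat nat nat nat
  | Put nat nat nat nat nat
  | Then loop_com loop_com (infixr ";;" 60)
  | Cond nat nat loop_com loop_com
  | For nat nat loop_com

abbreviation tick :: "loop_state \<Rightarrow> loop_state" where
  "tick s \<equiv> s\<lparr>ticks := Suc (ticks s)\<rparr>"

abbreviation set_var :: "nat \<Rightarrow> nat \<Rightarrow> loop_state \<Rightarrow> loop_state" where
  "set_var x a s \<equiv> s\<lparr>vars := (vars s)(x := a)\<rparr>"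

definition set_arr :: "nat \<Rightarrow> nat \<Rightarrow> nat \<Rightarrow> nat \<Rightarrow> nat \<Rightarrow> loop_state \<Rightarrow> loop_state" where
  "set_arr t i j l a s = s\<lparr>arr := (arr s)(t := (arr s t)(i := (arr s t i)(j := (arr s t i j)(l := a))))\<rparr>"

lemma set_arr_simps [simp]:
  "vars (set_arr t i j l a s) = vars s" "ticks (set_arr t i j l a s) = ticks s"
  "arr (set_arr t i j l a s) t' i' j' l' = (if t' = t \<and> i' = i \<and> j' = j \<and> l' = l then a else arr s t' i' j' l')"
  by (simp_all add: set_arr_def)

primrec sem :: "nat \<Rightarrow> (nat \<Rightarrow> nat) \<Rightarrow> loop_com \<Rightarrow> loop_state \<Rightarrow> loop_state" where
  "sem n inp Nop s = tick s"
| "sem n inp (Const x c) s = tick (set_var x c s)"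
| "sem n inp (Move x y) s = tick (set_var x (vars s y) s)"
| "sem n inp (Inc x y) s = tick (set_var x (Suc (vars s y)) s)"
| "sem n inp (Sub x y z) s = tick (set_var x (vars s y - vars s z) s)"
| "sem n inp (Quot x y z) s = tick (set_var x (vars s y div vars s z) s)"
| "sem n inp (AddMin x y z) s = tick (set_var x (vars s y + min (vars s z) n) s)"
| "sem n inp (Inp x y) s = tick (set_var x (inp (vars s y)) s)"
| "sem n inp (Get x t i j l) s = tick (set_var x (arr s t (vars s i) (vars s j) (vars s l)) s)"
| "sem n inp (Put t i j l x) s = tick (set_arr t (vars s i) (vars s j) (vars s l) (vars s x) s)"
| "sem n inp (c ;; d) s = sem n inp d (sem n inp c s)"
| "sem n inp (Cond x y c d) s =
    (if vars s x < vars s y then sem n inp c (tick s) else sem n inp d (tick s))"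
| "sem n inp (For x y c) s = fold (\<lambda>i s. sem n inp c (tick (set_var x i s))) [0..<vars s y] (tick s)"

text \<open>These are the numbers a program brings in by itself. Table numbers count too, since the
  compiled program loads them to compute addresses.\<close>

primrec consts_le :: "loop_com \<Rightarrow> nat \<Rightarrow> bool" where
  "consts_le Nop W = True"
| "consts_le (Const x c) W = (c \<le> W)"
| "consts_le (Move x y) W = True"
| "consts_le (Inc x y) W = True"
| "consts_le (Sub x y z) W = True"
| "consts_le (Quot x y z) W = True"
| "consts_le (AddMin x y z) W = True"
| "consts_le (Inp x y) W = True"
| "consts_le (Get x t i j l) W = (t \<le> W)"
| "consts_le (Put t i j l x) W = (t \<le> W)"
| "consts_le (c ;; d) W = (consts_le c W \<and> consts_le d W)"
| "consts_le (Cond x y c d) W = (consts_le c W \<and> consts_le d W)"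
| "consts_le (For x y c) W = consts_le c W"

definition vals_le :: "nat \<Rightarrow> loop_state \<Rightarrow> bool" where
  "vals_le b s \<longleftrightarrow> (\<forall>x. vars s x \<le> b) \<and> (\<forall>t i j l. arr s t i j l \<le> b)"

text \<open>
  An instruction increases the largest value by at most \<open>n + 1\<close> (this is why \<^const>\<open>AddMin\<close> truncates its
  second argument), so a bound on the ticks also bounds all bit lengths.
\<close>

definition grown :: "nat \<Rightarrow> nat \<Rightarrow> loop_state \<Rightarrow> bool" where
  "grown n W s \<longleftrightarrow> vals_le (W + Suc n * ticks s) s"

lemma fold_inv:
  assumes "I 0 s" "\<And>i s. i < b \<Longrightarrow> I i s \<Longrightarrow> I (Suc i) (f i s)"
  shows "I b (fold f [0..<b] s)"
proof -
  have "I a (fold f [0..<a] s)" if "a \<le> b" for a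
    using that by (induction a) (auto intro: assms)
  then show ?thesis by blast
qed

lemma ticks_mono: "ticks s \<le> ticks (sem n inp c s)"
proof (induction c arbitrary: s)
  case (For x y c)
  have "ticks s \<le> ticks (fold (\<lambda>i s. sem n inp c (tick (set_var x i s))) [0..<vars s y] (tick s))"
    by (rule fold_inv[of "\<lambda>_ s'. ticks s \<le> ticks s'"])
      (auto intro: order_trans[OF _ For.IH])
  then show ?case by simp
next
  case (Then c d)
  then show ?case by (auto intro: order_trans)
next
  case (Cond x y c d)
  show ?case using Cond.IH[of "tick s"] by auto
qed (auto simp: set_arr_def)

lemma vals_le_mono: "vals_le b s \<Longrightarrow> b \<le> b' \<Longrightarrow> vals_le b' s"
  unfolding vals_le_def by (meson le_trans)

lemma grown_tick: "grown n W s \<Longrightarrow> grown n W (tick s)"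
proof -
  assume "grown n W s"
  then have "vals_le (W + Suc n * Suc (ticks s)) s"
    unfolding grown_def by (rule vals_le_mono) simp
  then show ?thesis unfolding grown_def vals_le_def by simp
qed

lemma grown_sem:
  assumes inp: "\<And>a. inp a \<le> W"
  shows "grown n W s \<Longrightarrow> consts_le c W \<Longrightarrow> grown n W (sem n inp c s)"
proof (induction c arbitrary: s)
  case (For x y c)
  have g0: "grown n W s" by fact
  \<comment> \<open>Counter values lie below the loop bound, which respects the limit already at
    entry.\<close>
  have y: "vars s y \<le> W + Suc n * ticks s" using g0 unfolding grown_def vals_le_def by blast
  have "grown n W (fold (\<lambda>i s. sem n inp c (tick (set_var x i s))) [0..<vars s y] (tick s)) \<and>
      ticks s \<le> ticks (fold (\<lambda>i s. sem n inp c (tick (set_var x i s))) [0..<vars s y] (tick s))"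
  proof (rule fold_inv[of "\<lambda>_ s'. grown n W s' \<and> ticks s \<le> ticks s'"], intro conjI)
    show "grown n W (tick s)" using g0 by (rule grown_tick)
    show "ticks s \<le> ticks (tick s)" by simp
    fix i s' assume i: "i < vars s y" and s': "grown n W s' \<and> ticks s \<le> ticks s'"
    have "vars s y \<le> W + Suc n * ticks s'"
      by (rule order_trans[OF y]) (use s' in \<open>intro add_left_mono mult_le_mono2, simp\<close>)
    then have i': "i \<le> W + Suc n * Suc (ticks s')" using i by simp
    have "vals_le (W + Suc n * Suc (ticks s')) s'"
      using s' unfolding grown_def by (elim conjE) (erule vals_le_mono, simp)
    then have "grown n W (tick (set_var x i s'))"
      using i' unfolding grown_def vals_le_def by simp
    then show "grown n W (sem n inp c (tick (set_var x i s'))) \<and>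
        ticks s \<le> ticks (sem n inp c (tick (set_var x i s')))"
      using For s' ticks_mono[of "tick (set_var x i s')" n inp c] by auto
  qed
  then show ?case by simp
next
  case (Cond x y c d)
  have "grown n W (tick s)" using Cond.prems(1) by (rule grown_tick)
  then show ?case using Cond by auto
next
  case (AddMin x y z)
  have "vars s y \<le> W + Suc n * ticks s" using AddMin unfolding grown_def vals_le_def by blast
  then have "vars s y + min (vars s z) n \<le> W + Suc n * Suc (ticks s)" by (simp add: min_def)
  moreover have "vals_le (W + Suc n * Suc (ticks s)) s"
    using AddMin(1) unfolding grown_def by (rule vals_le_mono) simp
  ultimately show ?case unfolding grown_def vals_le_def by simp
next
  case (Put t i j l x)
  have "vals_le (W + Suc n * Suc (ticks s)) s"
    using Put(1) unfolding grown_def by (rule vals_le_mono) simp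
  then show ?case unfolding grown_def vals_le_def by simp
next
  case (Sub x y z)
  have "vals_le (W + Suc n * Suc (ticks s)) s"
    using Sub(1) unfolding grown_def by (rule vals_le_mono) simp
  then show ?case unfolding grown_def vals_le_def by (auto intro: order_trans[OF diff_le_self])
next
  case (Quot x y z)
  have "vals_le (W + Suc n * Suc (ticks s)) s"
    using Quot(1) unfolding grown_def by (rule vals_le_mono) simp
  then show ?case unfolding grown_def vals_le_def by (auto intro: order_trans[OF div_le_dividend])
next
  case (Inc x y)
  have "vars s y \<le> W + Suc n * ticks s" using Inc unfolding grown_def vals_le_def by blast
  moreover have "vals_le (W + Suc n * Suc (ticks s)) s"
    using Inc(1) unfolding grown_def by (rule vals_le_mono) simp
  ultimately show ?case unfolding grown_def vals_le_def by simp
next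
  case (Inp x y)
  have "vals_le (W + Suc n * Suc (ticks s)) s"
    using Inp(1) unfolding grown_def by (rule vals_le_mono) simp
  moreover have "inp (vars s y) \<le> W + Suc n * Suc (ticks s)" using inp[of "vars s y"] by simp
  ultimately show ?case unfolding grown_def vals_le_def by simp
next
  case (Const x c)
  have "vals_le (W + Suc n * Suc (ticks s)) s"
    using Const(1) unfolding grown_def by (rule vals_le_mono) simp
  then show ?case using Const unfolding grown_def vals_le_def by simp
next
  case (Move x y)
  have "vals_le (W + Suc n * Suc (ticks s)) s"
    using Move(1) unfolding grown_def by (rule vals_le_mono) simp
  then show ?case unfolding grown_def vals_le_def by simp
next
  case (Get x t i j l)
  have "vals_le (W + Suc n * Suc (ticks s)) s"
    using Get(1) unfolding grown_def by (rule vals_le_mono) simp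
  then show ?case unfolding grown_def vals_le_def by simp
next
  case Nop
  then show ?case using grown_tick by simp
qed simp

section \<open>Compilation to the random access machine\<close>

text \<open>Splits logarithmic cost into the number \<open>q\<close> of values handled and the bit
  length of a common bound \<open>V\<close>, so that costs of single instructions become small
  constants.\<close>

definition runs :: "nat \<Rightarrow> ram_com \<Rightarrow> ram_state \<Rightarrow> ram_state \<Rightarrow> nat \<Rightarrow> bool" where
  "runs V p r r' q \<longleftrightarrow> (\<exists>t \<le> q * bit_len V. ram_exec p r t r')"

lemma bit_len_mono: "a \<le> b \<Longrightarrow> bit_len a \<le> bit_len b"
  unfolding bit_len_def by (intro max.mono floorlog_mono) auto

lemma bit_len_pos: "0 < bit_len a" by (simp add: bit_len_def)

lemma runs_mono: "runs V p r r' q \<Longrightarrow> q \<le> q' \<Longrightarrow> runs V p r r' q'"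
  unfolding runs_def by (meson le_trans mult_le_mono1)

lemma runs_Seq: "runs V p r r' a \<Longrightarrow> runs V q r' r'' b \<Longrightarrow> runs V (Seq p q) r r'' (a + b)"
  unfolding runs_def add_mult_distrib by (meson ram_exec.Seq add_mono)

lemma runs_Skip: "runs V Skip r r 1"
  unfolding runs_def using bit_len_pos[of V] ram_exec.Skip by (intro exI[of _ 1]) auto

lemma runs_SetConst: "c \<le> V \<Longrightarrow> runs V (SetConst x c) r (r\<lparr>reg := (reg r)(x := c)\<rparr>) 1"
  unfolding runs_def using bit_len_mono[of c V] ram_exec.SetConst by auto

lemma runs_Copy: "reg r y \<le> V \<Longrightarrow> runs V (Copy x y) r (r\<lparr>reg := (reg r)(x := reg r y)\<rparr>) 1"
  unfolding runs_def using bit_len_mono[of "reg r y" V] ram_exec.Copy by auto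

lemma runs_Arith: "reg r y \<le> V \<Longrightarrow> reg r z \<le> V \<Longrightarrow>
    runs V (Arith f x y z) r (r\<lparr>reg := (reg r)(x := arith_sem f (reg r y) (reg r z))\<rparr>) 2"
  unfolding runs_def using bit_len_mono[of "reg r y" V] bit_len_mono[of "reg r z" V]
  by (intro exI conjI, rule_tac[2] ram_exec.Arith) linarith

lemma runs_Load: "reg r y \<le> V \<Longrightarrow> mem r (reg r y) \<le> V \<Longrightarrow>
    runs V (Load x y) r (r\<lparr>reg := (reg r)(x := mem r (reg r y))\<rparr>) 2"
  unfolding runs_def using bit_len_mono[of "reg r y" V] bit_len_mono[of "mem r (reg r y)" V]
  by (intro exI conjI, rule_tac[2] ram_exec.Load) linarith

lemma runs_Store: "reg r x \<le> V \<Longrightarrow> reg r y \<le> V \<Longrightarrow>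
    runs V (Store x y) r (r\<lparr>mem := (mem r)(reg r x := reg r y)\<rparr>) 2"
  unfolding runs_def using bit_len_mono[of "reg r y" V] bit_len_mono[of "reg r x" V]
  by (intro exI conjI, rule_tac[2] ram_exec.Store) linarith

lemma runs_IfLess:
  assumes "reg r x \<le> V" "reg r y \<le> V"
    "reg r x < reg r y \<Longrightarrow> runs V p r r' a" "\<not> reg r x < reg r y \<Longrightarrow> runs V q r r' a"
  shows "runs V (IfLess x y p q) r r' (a + 2)"
proof -
  have b: "bit_len (reg r x) + bit_len (reg r y) \<le> 2 * bit_len V"
    using bit_len_mono[OF assms(1)] bit_len_mono[OF assms(2)] by simp
  show ?thesis
  proof (cases "reg r x < reg r y")
    case True
    then obtain t where "t \<le> a * bit_len V" "ram_exec p r t r'" using assms(3) runs_def by blast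
    then show ?thesis unfolding runs_def add_mult_distrib using b True
      by (intro exI conjI, rule_tac[2] ram_exec.IfTrue) auto
  next
    case False
    then obtain t where "t \<le> a * bit_len V" "ram_exec q r t r'" using assms(4) runs_def by blast
    then show ?thesis unfolding runs_def add_mult_distrib using b False
      by (intro exI conjI, rule_tac[2] ram_exec.IfFalse) auto
  qed
qed

lemma runs_WhileFalse:
  assumes "reg r x \<le> V" "reg r y \<le> V" "\<not> reg r x < reg r y"
  shows "runs V (WhileLess x y p) r r 2"
  unfolding runs_def using bit_len_mono[OF assms(1)] bit_len_mono[OF assms(2)] assms(3)
  by (intro exI conjI, rule_tac[2] ram_exec.WhileFalse) auto

lemma runs_WhileTrue:
  assumes "reg r x \<le> V" "reg r y \<le> V" "reg r x < reg r y"
    "runs V p r r' a" "runs V (WhileLess x y p) r' r'' b"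
  shows "runs V (WhileLess x y p) r r'' (a + b + 2)"
proof -
  obtain t t' where t: "t \<le> a * bit_len V" "ram_exec p r t r'" "t' \<le> b * bit_len V"
     "ram_exec (WhileLess x y p) r' t' r''" using assms(4,5) unfolding runs_def by blast
  show ?thesis unfolding runs_def add_mult_distrib
    using bit_len_mono[OF assms(1)] bit_len_mono[OF assms(2)] t
    by (intro exI conjI, rule_tac[2] ram_exec.WhileTrue[OF assms(3) t(2,4)]) linarith
qed

text \<open>
  Registers 0, 1, 3, 4 of the compiled program hold \<open>n\<close>, the end of the input, and the constants 1
  and 2, registers 5 to 8 are scratch. Variables live in the even registers from 20 on, loop counters
  and loop bounds of nesting depth \<open>d\<close> in the odd registers \<open>4 d + 21\<close> and \<open>4 d + 23\<close>.
\<close>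

abbreviation vreg :: "nat \<Rightarrow> nat" where "vreg x \<equiv> 2 * x + 20"

text \<open>Cantor pairing of registers 6 and 5, left in register 5.\<close>

definition pair_code :: ram_com where
  "pair_code = Seq (Arith Plus 7 6 5) (Seq (Arith Plus 8 7 3) (Seq (Arith Times 7 7 8)
    (Seq (Arith Div 7 7 4) (Arith Plus 5 7 6))))"

definition addr_code :: "nat \<Rightarrow> nat \<Rightarrow> nat \<Rightarrow> nat \<Rightarrow> ram_com" where
  "addr_code t i j l = Seq (Copy 5 (vreg l)) (Seq (Copy 6 (vreg j)) (Seq pair_code
    (Seq (Copy 6 (vreg i)) (Seq pair_code (Seq (SetConst 6 t) (Seq pair_code (Arith Plus 5 5 1)))))))"

text \<open>Injective, so that unboundedly many arrays share one memory without collisions, and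
  polynomial in the indices, so that addresses keep logarithmic length.\<close>

definition cell :: "nat \<Rightarrow> nat \<Rightarrow> nat \<Rightarrow> nat \<Rightarrow> nat" where
  "cell t i j l = prod_encode (t, prod_encode (i, prod_encode (j, l)))"

primrec compile :: "nat \<Rightarrow> loop_com \<Rightarrow> ram_com" where
  "compile d Nop = Skip"
| "compile d (Const x c) = SetConst (vreg x) c"
| "compile d (Move x y) = Copy (vreg x) (vreg y)"
| "compile d (Inc x y) = Arith Plus (vreg x) (vreg y) 3"
| "compile d (Sub x y z) = Arith Minus (vreg x) (vreg y) (vreg z)"
| "compile d (Quot x y z) = Arith Div (vreg x) (vreg y) (vreg z)"
| "compile d (AddMin x y z) = IfLess (vreg z) 0 (Arith Plus (vreg x) (vreg y) (vreg z))
     (Arith Plus (vreg x) (vreg y) 0)"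
| "compile d (Inp x y) = IfLess (vreg y) 1 (Load (vreg x) (vreg y)) (SetConst (vreg x) 0)"
| "compile d (Get x t i j l) = Seq (addr_code t i j l) (Load (vreg x) 5)"
| "compile d (Put t i j l x) = Seq (addr_code t i j l) (Store 5 (vreg x))"
| "compile d (c1 ;; c2) = Seq (compile d c1) (compile d c2)"
| "compile d (Cond x y c1 c2) = IfLess (vreg x) (vreg y) (compile d c1) (compile d c2)"
| "compile d (For x y c) = Seq (SetConst (4 * d + 21) 0) (Seq (Copy (4 * d + 23) (vreg y))
    (WhileLess (4 * d + 21) (4 * d + 23)
      (Seq (Copy (vreg x) (4 * d + 21))
        (Seq (compile (Suc d) c) (Arith Plus (4 * d + 21) (4 * d + 21) 3)))))"

definition implements :: "nat \<Rightarrow> nat \<Rightarrow> (nat \<Rightarrow> nat) \<Rightarrow> loop_state \<Rightarrow> ram_state \<Rightarrow> bool" where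
  "implements n base inp s r \<longleftrightarrow> reg r 0 = n \<and> reg r 1 = base \<and> reg r 3 = 1 \<and> reg r 4 = 2 \<and>
    (\<forall>x. reg r (vreg x) = vars s x) \<and> (\<forall>a<base. mem r a = inp a) \<and>
    (\<forall>t i j l. mem r (base + cell t i j l) = arr s t i j l)"

text \<open>The registers in question are the counters and bounds of the loops that enclose depth
  \<open>d\<close>; a compiled body must leave them intact.\<close>

definition same_hidden :: "nat \<Rightarrow> ram_state \<Rightarrow> ram_state \<Rightarrow> bool" where
  "same_hidden d r r' \<longleftrightarrow> (\<forall>x. odd x \<and> 21 \<le> x \<and> x < 4 * d + 21 \<longrightarrow> reg r' x = reg r x)"

text \<open>The second bound covers the product that the machine forms before halving it.\<close>

lemma prod_encode_le:
  assumes "a \<le> b" "c \<le> b" "1 \<le> b" shows "prod_encode (a, c) \<le> 9 * b ^ 2"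
    and "(a + c) * Suc (a + c) \<le> 9 * b ^ 2"
proof -
  have "(a + c) * Suc (a + c) \<le> (2 * b) * (3 * b)" using assms by (intro mult_mono) auto
  then have m: "(a + c) * Suc (a + c) \<le> 6 * b ^ 2" by (simp add: power2_eq_square)
  then show "(a + c) * Suc (a + c) \<le> 9 * b ^ 2" by simp
  have "b \<le> b ^ 2" using assms by (simp add: power2_eq_square)
  then show "prod_encode (a, c) \<le> 9 * b ^ 2"
    using m assms unfolding prod_encode_def triangle_def by simp
qed

lemma pair_code_runs:
  assumes r: "reg r 3 = 1" "reg r 4 = 2" and b: "reg r 6 \<le> b" "reg r 5 \<le> b" "1 \<le> b"
    and V: "9 * b ^ 2 \<le> V"
  obtains r' where "runs V pair_code r r' 10" "reg r' 5 = prod_encode (reg r 6, reg r 5)"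
    "mem r' = mem r" "\<And>x. x \<notin> {5, 7, 8} \<Longrightarrow> reg r' x = reg r x"
proof -
  let ?a = "reg r 6" and ?c = "reg r 5"
  have bb: "b \<le> b ^ 2" using b by (simp add: power2_eq_square)
  have le: "(?a + ?c) * Suc (?a + ?c) \<le> V" "prod_encode (?a, ?c) \<le> V"
    using prod_encode_le[OF b] V by linarith+
  have le2: "?a \<le> V" "?c \<le> V" "?a + ?c \<le> V" "Suc (?a + ?c) \<le> V" "1 \<le> V" "2 \<le> V"
    "(?a + ?c) * Suc (?a + ?c) div 2 \<le> V"
    using b bb V le(1) by (auto intro: order_trans[OF div_le_dividend])
  let ?r1 = "r\<lparr>reg := (reg r)(7 := ?a + ?c)\<rparr>"
  let ?r2 = "?r1\<lparr>reg := (reg ?r1)(8 := Suc (?a + ?c))\<rparr>"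
  let ?r3 = "?r2\<lparr>reg := (reg ?r2)(7 := (?a + ?c) * Suc (?a + ?c))\<rparr>"
  let ?r4 = "?r3\<lparr>reg := (reg ?r3)(7 := (?a + ?c) * Suc (?a + ?c) div 2)\<rparr>"
  let ?r5 = "?r4\<lparr>reg := (reg ?r4)(5 := (?a + ?c) * Suc (?a + ?c) div 2 + ?a)\<rparr>"
  have 1: "runs V (Arith Plus 7 6 5) r ?r1 2" using runs_Arith[of r 6 V 5 Plus 7] le2 by simp
  have 2: "runs V (Arith Plus 8 7 3) ?r1 ?r2 2" using runs_Arith[of ?r1 7 V 3 Plus 8] le2 r by simp
  have 3: "runs V (Arith Times 7 7 8) ?r2 ?r3 2" using runs_Arith[of ?r2 7 V 8 Times 7] le2 r by simp
  have 4: "runs V (Arith Div 7 7 4) ?r3 ?r4 2" using runs_Arith[of ?r3 7 V 4 Div 7] le le2 r by simp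
  have 5: "runs V (Arith Plus 5 7 6) ?r4 ?r5 2" using runs_Arith[of ?r4 7 V 6 Plus 5] le2 r by simp
  have "runs V pair_code r ?r5 (2 + (2 + (2 + (2 + 2))))" unfolding pair_code_def
    by (intro runs_Seq) (rule 1 2 3 4 5)+
  then show thesis
    by (intro that[of ?r5]) (auto simp: prod_encode_def triangle_def)
qed

lemma addr_code_runs:
  assumes im: "implements n base inp s r" and v: "vals_le b s" and b: "1 \<le> b" "t \<le> b" "base \<le> b"
    and V: "(9 * b) ^ 8 \<le> V"
  obtains r' where "runs V (addr_code t i j l) r r' 36"
    "reg r' 5 = base + cell t (vars s i) (vars s j) (vars s l)" "reg r' 5 \<le> V"
    "mem r' = mem r" "\<And>x. x \<notin> {5, 6, 7, 8} \<Longrightarrow> reg r' x = reg r x"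
proof -
  have vb: "vars s x \<le> b" for x using v by (simp add: vals_le_def)
  have reg: "reg r (vreg x) = vars s x" "reg r 3 = 1" "reg r 4 = 2" "reg r 1 = base" for x
    using im by (auto simp: implements_def)
  have b1: "b \<le> 9 * b ^ 2" using b by (simp add: power2_eq_square)
  have b2: "9 * b ^ 2 \<le> 9 * (9 * b ^ 2) ^ 2" using b1 b by (simp add: power2_eq_square)
  have b3: "9 * (9 * b ^ 2) ^ 2 \<le> 9 * (9 * (9 * b ^ 2) ^ 2) ^ 2"
    using b1 b2 b by (simp add: power2_eq_square)
  \<comment> \<open>Three nested pairings take b to at most \<open>9 ^ 7 * b ^ 8\<close>, whence the
    exponent 8; the remaining factor 9 leaves room for the addition of \<open>base\<close>.\<close>
  have "9 * (9 * (9 * b ^ 2) ^ 2) ^ 2 = 9 ^ 7 * b ^ 8" by (simp add: power_mult_distrib flip: power_mult)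
  moreover have "(9 * b) ^ 8 = 9 * (9 ^ 7 * b ^ 8)" by (simp add: power_mult_distrib)
  ultimately have b4: "9 * (9 * (9 * (9 * b ^ 2) ^ 2) ^ 2) \<le> V" using V by simp
  let ?r1 = "r\<lparr>reg := (reg r)(5 := vars s l)\<rparr>"
  let ?r2 = "?r1\<lparr>reg := (reg ?r1)(6 := vars s j)\<rparr>"
  have n: "vreg x \<noteq> 5" "vreg x \<noteq> 6" "vreg x \<noteq> 7" "vreg x \<noteq> 8" for x by presburger+
  have 1: "runs V (Copy 5 (vreg l)) r ?r1 1"
    using runs_Copy[of r "vreg l" V 5] vb[of l] reg b1 b2 b3 b4 by simp
  have 2: "runs V (Copy 6 (vreg j)) ?r1 ?r2 1"
    using runs_Copy[of ?r1 "vreg j" V 6] vb[of j] reg b1 b2 b3 b4 n by simp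
  obtain r3 where 3: "runs V pair_code ?r2 r3 10" "reg r3 5 = prod_encode (vars s j, vars s l)"
    "mem r3 = mem r" "\<And>x. x \<notin> {5, 7, 8} \<Longrightarrow> reg r3 x = reg ?r2 x"
    using pair_code_runs[of ?r2 b V] reg vb[of j] vb[of l] b b1 b2 b3 b4 by auto
  let ?r4 = "r3\<lparr>reg := (reg r3)(6 := vars s i)\<rparr>"
  have "reg r3 (vreg i) = vars s i" using 3(4)[of "vreg i"] n reg by simp
  then have 4: "runs V (Copy 6 (vreg i)) r3 ?r4 1"
    using runs_Copy[of r3 "vreg i" V 6] vb[of i] b1 b2 b3 b4 by simp
  have c3: "reg r3 5 \<le> 9 * b ^ 2" unfolding 3(2) by (rule prod_encode_le) (use vb b in auto)
  obtain r5 where 5: "runs V pair_code ?r4 r5 10"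
    "reg r5 5 = prod_encode (vars s i, prod_encode (vars s j, vars s l))"
    "mem r5 = mem r" "\<And>x. x \<notin> {5, 7, 8} \<Longrightarrow> reg r5 x = reg ?r4 x"
    using pair_code_runs[of ?r4 "9 * b ^ 2" V] reg vb[of i] b b1 b2 b3 b4 c3 3 n
      order_trans[OF vb[of i] b1] by auto
  let ?r6 = "r5\<lparr>reg := (reg r5)(6 := t)\<rparr>"
  have 6: "runs V (SetConst 6 t) r5 ?r6 1"
    using runs_SetConst[of t V 6] b b1 b2 b3 b4 by simp
  have c5: "reg r5 5 \<le> 9 * (9 * b ^ 2) ^ 2" unfolding 5(2)
    by (rule prod_encode_le) (use c3[unfolded 3(2)] vb[of i] b1 b in auto)
  obtain r7 where 7: "runs V pair_code ?r6 r7 10"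
    "reg r7 5 = cell t (vars s i) (vars s j) (vars s l)"
    "mem r7 = mem r" "\<And>x. x \<notin> {5, 7, 8} \<Longrightarrow> reg r7 x = reg ?r6 x"
    using pair_code_runs[of ?r6 "9 * (9 * b ^ 2) ^ 2" V] reg b b1 b2 b3 b4 c5 3 5 n
      order_trans[OF order_trans[OF b(2) b1] b2] unfolding cell_def by auto
  have c7: "reg r7 5 \<le> 9 * (9 * (9 * b ^ 2) ^ 2) ^ 2" unfolding 7(2) cell_def
    by (rule prod_encode_le) (use c5[unfolded 5(2)] b(2) b1 b2 b in auto)
  let ?r8 = "r7\<lparr>reg := (reg r7)(5 := reg r7 5 + base)\<rparr>"
  have "reg r7 1 = base" using 3(4)[of 1] 5(4)[of 1] 7(4)[of 1] reg by simp
  moreover have "base \<le> V" using b b1 b2 b3 b4 by linarith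
  moreover have "reg r7 5 \<le> V" using c7 b4 by linarith
  ultimately have 8: "runs V (Arith Plus 5 5 1) r7 ?r8 2"
    using runs_Arith[of r7 5 V 1 Plus 5] by simp
  have "runs V (addr_code t i j l) r ?r8 (1 + (1 + (10 + (1 + (10 + (1 + (10 + 2)))))))"
    unfolding addr_code_def
    by (intro runs_Seq) (rule 1 2 3(1) 4 5(1) 6 7(1) 8)+
  then have run: "runs V (addr_code t i j l) r ?r8 36"
    by (rule runs_mono) simp
  show thesis
  proof (rule that[OF run])
    show "reg ?r8 5 \<le> V" using c7 b1 b2 b3 b4 b by simp
    show "reg ?r8 x = reg r x" if "x \<notin> {5, 6, 7, 8}" for x
      using 3(4)[of x] 5(4)[of x] 7(4)[of x] that by simp
  qed (use 7 in auto)
qed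


lemma implements_set_var:
  assumes "implements n base inp s r"
  shows "implements n base inp (tick (set_var x a s)) (r\<lparr>reg := (reg r)(vreg x := a)\<rparr>)"
  using assms unfolding implements_def by auto

lemma implements_scratch:
  assumes "implements n base inp s r" "mem r' = mem r" "\<And>x. x \<notin> {5, 6, 7, 8} \<Longrightarrow> odd x \<or> x < 20 \<or> reg r' x = reg r x"
    "\<And>x. x \<in> {0, 1, 3, 4} \<or> (even x \<and> 20 \<le> x) \<Longrightarrow> reg r' x = reg r x"
  shows "implements n base inp s r'"
  using assms unfolding implements_def by auto

lemma implements_set_hidden:
  assumes "implements n base inp s r" "odd h" "20 \<le> h"
  shows "implements n base inp s (r\<lparr>reg := (reg r)(h := a)\<rparr>)"
proof -
  have "vreg z \<noteq> h" for z using assms(2) by auto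
  then show ?thesis using assms unfolding implements_def by simp
qed

lemma cell_eq_iff: "cell t i j l = cell t' i' j' l' \<longleftrightarrow> t = t' \<and> i = i' \<and> j = j' \<and> l = l'"
  unfolding cell_def by auto

lemma implements_set_arr:
  assumes "implements n base inp s r"
  shows "implements n base inp (tick (set_arr t i j l a s)) (r\<lparr>mem := (mem r)(base + cell t i j l := a)\<rparr>)"
  using assms unfolding implements_def set_arr_def by (auto simp: cell_eq_iff)

lemma same_hidden_refl: "same_hidden d r r" by (simp add: same_hidden_def)

lemma same_hidden_trans: "same_hidden d r r' \<Longrightarrow> same_hidden d r' r'' \<Longrightarrow> same_hidden d r r''"
  by (simp add: same_hidden_def)

lemma same_hidden_set_var: "same_hidden d r (r\<lparr>reg := (reg r)(vreg x := a)\<rparr>)"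
  unfolding same_hidden_def by auto

text \<open>Ticks never decrease, so a bound \<open>T\<close> on the final ticks bounds all values
  met on the way, and one \<open>V\<close> serves all addresses. The dearest instruction is an array
  access, with 36 for the address and 2 for the access itself; the factor 50 leaves room for the
  bookkeeping of loops. Reading beyond the input must give 0 without touching memory, because the
  arrays begin at \<open>base\<close>.\<close>

lemma compile_correct:
  assumes inp: "\<And>a. inp a \<le> W" "\<And>a. base \<le> a \<Longrightarrow> inp a = 0" and n: "n \<le> W" "base \<le> W" "1 \<le> W"
    and V: "(9 * (W + Suc n * T)) ^ 8 \<le> V"
  shows "implements n base inp s r \<Longrightarrow> grown n W s \<Longrightarrow> consts_le c W \<Longrightarrow> ticks (sem n inp c s) \<le> T \<Longrightarrow>
    \<exists>r'. runs V (compile d c) r r' (50 * (ticks (sem n inp c s) - ticks s)) \<and>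
      implements n base inp (sem n inp c s) r' \<and> same_hidden d r r'"
proof (induction c arbitrary: d s r)
  have le_V: "a \<le> V" if "a \<le> W + Suc n * T" for a
  proof -
    have "a \<le> 9 * (W + Suc n * T)" using that by simp
    also have "\<dots> \<le> (9 * (W + Suc n * T)) ^ 8" using n by (intro self_le_power) auto
    finally show ?thesis using V by simp
  qed
  have bound: "vals_le (W + Suc n * T) s" if "grown n W s" "ticks s \<le> T" for s
    using that(1) unfolding grown_def by (rule vals_le_mono) (use that(2) in \<open>intro add_left_mono mult_le_mono2\<close>)
  have var: "reg r (vreg x) \<le> V" "reg r (vreg x) = vars s x" "vars s x \<le> V" "reg r 0 \<le> V" "reg r 1 \<le> V" "reg r 3 \<le> V"
    "reg r 0 = n" "reg r 1 = base" "reg r 3 = 1"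
    if "implements n base inp s r" "grown n W s" "ticks s \<le> T" for s r x
    using bound[OF that(2,3)] that(1) le_V n unfolding implements_def vals_le_def by auto
  have step: "\<exists>r'. runs V p r r' (50 * (ticks (tick (set_var x a s)) - ticks s)) \<and>
      implements n base inp (tick (set_var x a s)) r' \<and> same_hidden d r r'"
    if "implements n base inp s r" "runs V p r (r\<lparr>reg := (reg r)(vreg x := a)\<rparr>) q" "q \<le> 50" for p r x a s q d
    using that implements_set_var same_hidden_set_var runs_mono[OF that(2), of 50]
    by (intro exI[of _ "r\<lparr>reg := (reg r)(vreg x := a)\<rparr>"]) auto
  {
    case Nop
    then have "implements n base inp (tick s) r" unfolding implements_def by simp
    then show ?case using runs_mono[OF runs_Skip, of 50 V r] same_hidden_refl by auto
  next
    case (Const x c)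
    have "c \<le> V" using Const.prems(3) le_V[of c] by simp
    then show ?case unfolding sem.simps compile.simps
      by (intro step[OF Const.prems(1) runs_SetConst]) auto
  next
    case (Move x y)
    have t: "ticks s \<le> T" using Move.prems(4) by simp
    note v = var[OF Move.prems(1,2) t]
    have "runs V (compile d (Move x y)) r (r\<lparr>reg := (reg r)(vreg x := vars s y)\<rparr>) 1"
      using runs_Copy[OF v(1), of "vreg x" y] v(2) by simp
    then show ?case unfolding sem.simps by (intro step[OF Move.prems(1)]) auto
  next
    case (Inc x y)
    have t: "ticks s \<le> T" using Inc.prems(4) by simp
    note v = var[OF Inc.prems(1,2) t]
    have "runs V (compile d (Inc x y)) r (r\<lparr>reg := (reg r)(vreg x := Suc (vars s y))\<rparr>) 2"
      using runs_Arith[OF v(1) v(6), of Plus "vreg x" y] v(2,9) by simp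
    then show ?case unfolding sem.simps by (intro step[OF Inc.prems(1)]) auto
  next
    case (Sub x y z)
    have t: "ticks s \<le> T" using Sub.prems(4) by simp
    note v = var[OF Sub.prems(1,2) t]
    have "runs V (compile d (Sub x y z)) r (r\<lparr>reg := (reg r)(vreg x := vars s y - vars s z)\<rparr>) 2"
      using runs_Arith[OF v(1) v(1), of Minus "vreg x" y z] v(2) by simp
    then show ?case unfolding sem.simps by (intro step[OF Sub.prems(1)]) auto
  next
    case (Quot x y z)
    have t: "ticks s \<le> T" using Quot.prems(4) by simp
    note v = var[OF Quot.prems(1,2) t]
    have "runs V (compile d (Quot x y z)) r (r\<lparr>reg := (reg r)(vreg x := vars s y div vars s z)\<rparr>) 2"
      using runs_Arith[OF v(1) v(1), of Div "vreg x" y z] v(2) by simp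
    then show ?case unfolding sem.simps by (intro step[OF Quot.prems(1)]) auto
  next
    case (AddMin x y z)
    have t: "ticks s \<le> T" using AddMin.prems(4) by simp
    note v = var[OF AddMin.prems(1,2) t]
    have "runs V (compile d (AddMin x y z)) r (r\<lparr>reg := (reg r)(vreg x := vars s y + min (vars s z) n)\<rparr>) (2 + 2)"
      unfolding compile.simps
    proof (rule runs_IfLess[OF v(1) v(4)])
      assume "reg r (vreg z) < reg r 0"
      then show "runs V (Arith Plus (vreg x) (vreg y) (vreg z)) r
          (r\<lparr>reg := (reg r)(vreg x := vars s y + min (vars s z) n)\<rparr>) 2"
        using runs_Arith[OF v(1) v(1), of Plus "vreg x" y z] v(2,7) by simp
    next
      assume "\<not> reg r (vreg z) < reg r 0"
      then show "runs V (Arith Plus (vreg x) (vreg y) 0) r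
          (r\<lparr>reg := (reg r)(vreg x := vars s y + min (vars s z) n)\<rparr>) 2"
        using runs_Arith[OF v(1) v(4), of Plus "vreg x" y] v(2,7) by simp
    qed
    then show ?case unfolding sem.simps by (intro step[OF AddMin.prems(1)]) auto
  next
    case (Inp x y)
    have t: "ticks s \<le> T" using Inp.prems(4) by simp
    note v = var[OF Inp.prems(1,2) t]
    have "runs V (compile d (Inp x y)) r (r\<lparr>reg := (reg r)(vreg x := inp (vars s y))\<rparr>) (2 + 2)"
      unfolding compile.simps
    proof (rule runs_IfLess[OF v(1) v(5)])
      assume "reg r (vreg y) < reg r 1"
      then have m: "mem r (reg r (vreg y)) = inp (vars s y)" using Inp.prems(1) v(2,8) unfolding implements_def by simp
      have "inp (vars s y) \<le> V" using inp(1)[of "vars s y"] le_V by simp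
      then show "runs V (Load (vreg x) (vreg y)) r (r\<lparr>reg := (reg r)(vreg x := inp (vars s y))\<rparr>) 2"
        using runs_Load[OF v(1), of y "vreg x"] m by simp
    next
      assume "\<not> reg r (vreg y) < reg r 1"
      then have "inp (vars s y) = 0" using inp(2) v(2,8) by simp
      then show "runs V (SetConst (vreg x) 0) r (r\<lparr>reg := (reg r)(vreg x := inp (vars s y))\<rparr>) 2"
        using runs_mono[OF runs_SetConst[of 0 V "vreg x" r], of 2] by simp
    qed
    then show ?case unfolding sem.simps by (intro step[OF Inp.prems(1)]) auto
  next
    case (Get x t i j l)
    have tt: "ticks s \<le> T" using Get.prems(4) by simp
    note v = var[OF Get.prems(1,2) tt]
    obtain r1 where r1: "runs V (addr_code t i j l) r r1 36"
      "reg r1 5 = base + cell t (vars s i) (vars s j) (vars s l)" "reg r1 5 \<le> V"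
      "mem r1 = mem r" "\<And>x. x \<notin> {5, 6, 7, 8} \<Longrightarrow> reg r1 x = reg r x"
      using addr_code_runs[OF Get.prems(1) bound[OF Get.prems(2) tt] _ _ _ V, of t i j l] n Get.prems(3) by auto
    have im: "implements n base inp s r1"
      by (rule implements_scratch[OF Get.prems(1) r1(4)]) (use r1(5) in auto)
    have m: "mem r1 (reg r1 5) = arr s t (vars s i) (vars s j) (vars s l)"
      using Get.prems(1) r1(2,4) unfolding implements_def by simp
    moreover have "arr s t (vars s i) (vars s j) (vars s l) \<le> V"
      using bound[OF Get.prems(2) tt] le_V unfolding vals_le_def by blast
    ultimately have "runs V (Load (vreg x) 5) r1
       (r1\<lparr>reg := (reg r1)(vreg x := arr s t (vars s i) (vars s j) (vars s l))\<rparr>) 2"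
      using runs_Load[OF r1(3), of "vreg x"] by simp
    from runs_Seq[OF r1(1) this] have "runs V (compile d (Get x t i j l)) r
       (r1\<lparr>reg := (reg r1)(vreg x := arr s t (vars s i) (vars s j) (vars s l))\<rparr>) (50 * (ticks (sem n inp (Get x t i j l) s) - ticks s))"
      by (auto elim: runs_mono)
    moreover have "same_hidden d r (r1\<lparr>reg := (reg r1)(vreg x := arr s t (vars s i) (vars s j) (vars s l))\<rparr>)"
      unfolding same_hidden_def using r1(5) by auto
    ultimately show ?case unfolding sem.simps using implements_set_var[OF im] by blast
  next
    case (Put t i j l x)
    have tt: "ticks s \<le> T" using Put.prems(4) by (simp add: set_arr_def)
    note v = var[OF Put.prems(1,2) tt]
    obtain r1 where r1: "runs V (addr_code t i j l) r r1 36"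
      "reg r1 5 = base + cell t (vars s i) (vars s j) (vars s l)" "reg r1 5 \<le> V"
      "mem r1 = mem r" "\<And>x. x \<notin> {5, 6, 7, 8} \<Longrightarrow> reg r1 x = reg r x"
      using addr_code_runs[OF Put.prems(1) bound[OF Put.prems(2) tt] _ _ _ V, of t i j l] n Put.prems(3) by auto
    have im: "implements n base inp s r1"
      by (rule implements_scratch[OF Put.prems(1) r1(4)]) (use r1(5) in auto)
    note v1 = var[OF im Put.prems(2) tt]
    have "runs V (Store 5 (vreg x)) r1
       (r1\<lparr>mem := (mem r1)(base + cell t (vars s i) (vars s j) (vars s l) := vars s x)\<rparr>) 2"
      using runs_Store[OF r1(3) v1(1)] r1(2) v1(2) by simp
    from runs_Seq[OF r1(1) this] have "runs V (compile d (Put t i j l x)) r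
       (r1\<lparr>mem := (mem r1)(base + cell t (vars s i) (vars s j) (vars s l) := vars s x)\<rparr>) (50 * (ticks (sem n inp (Put t i j l x) s) - ticks s))"
      by (auto elim: runs_mono simp: set_arr_def)
    moreover have "same_hidden d r (r1\<lparr>mem := (mem r1)(base + cell t (vars s i) (vars s j) (vars s l) := vars s x)\<rparr>)"
      unfolding same_hidden_def using r1(5) by auto
    ultimately show ?case unfolding sem.simps using implements_set_arr[OF im] by blast
  next
    case (Then c1 c2)
    let ?s1 = "sem n inp c1 s"
    have t1: "ticks ?s1 \<le> T" using Then.prems(4) ticks_mono[of ?s1 n inp c2] by simp
    obtain r1 where r1: "runs V (compile d c1) r r1 (50 * (ticks ?s1 - ticks s))"
      "implements n base inp ?s1 r1" "same_hidden d r r1"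
      using Then.IH(1)[OF Then.prems(1,2) _ t1, of d] Then.prems(3) by auto
    have "grown n W ?s1" using grown_sem[OF inp(1) Then.prems(2), of c1] Then.prems(3) by simp
    then obtain r2 where r2: "runs V (compile d c2) r1 r2 (50 * (ticks (sem n inp c2 ?s1) - ticks ?s1))"
      "implements n base inp (sem n inp c2 ?s1) r2" "same_hidden d r1 r2"
      using Then.IH(2)[OF r1(2), of d] Then.prems(3,4) by auto
    have "50 * (ticks ?s1 - ticks s) + 50 * (ticks (sem n inp c2 ?s1) - ticks ?s1) =
        50 * (ticks (sem n inp c2 ?s1) - ticks s)"
      using ticks_mono[of s n inp c1] ticks_mono[of ?s1 n inp c2] by simp
    then have "runs V (compile d (c1 ;; c2)) r r2 (50 * (ticks (sem n inp c2 ?s1) - ticks s))"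
      using runs_Seq[OF r1(1) r2(1)] by simp
    then show ?case using r2(2) same_hidden_trans[OF r1(3) r2(3)] by auto
  next
    case (Cond x y c1 c2)
    let ?c = "if vars s x < vars s y then c1 else c2"
    let ?s1 = "sem n inp ?c (tick s)"
    have eq: "sem n inp (Cond x y c1 c2) s = ?s1" by simp
    have t1: "ticks ?s1 \<le> T" using Cond.prems(4) unfolding eq .
    have t: "ticks (tick s) \<le> ticks ?s1" by (rule ticks_mono)
    have ts: "ticks s \<le> T" using t t1 by simp
    note v = var[OF Cond.prems(1,2) ts]
    have im: "implements n base inp (tick s) r" using Cond.prems(1) unfolding implements_def by simp
    have "\<exists>r'. runs V (compile d ?c) r r' (50 * (ticks ?s1 - ticks (tick s))) \<and>
      implements n base inp ?s1 r' \<and> same_hidden d r r'"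
      using Cond.IH[OF im grown_tick[OF Cond.prems(2)], of d] Cond.prems(3) t1 by auto
    then obtain r1 where r1: "runs V (compile d ?c) r r1 (50 * (ticks ?s1 - ticks (tick s)))"
      "implements n base inp ?s1 r1" "same_hidden d r r1" by blast
    have "runs V (compile d (Cond x y c1 c2)) r r1 (50 * (ticks ?s1 - ticks (tick s)) + 2)"
      unfolding compile.simps by (rule runs_IfLess[OF v(1) v(1)]) (use r1(1) v(2) in auto)
    then have "runs V (compile d (Cond x y c1 c2)) r r1 (50 * (ticks ?s1 - ticks s))"
      by (rule runs_mono) (use t in simp)
    then show ?case using r1 unfolding eq by blast
  next
    case (For x y c)
    let ?f = "\<lambda>i s. sem n inp c (tick (set_var x i s))"
    let ?cnt = "4 * d + 21" and ?bnd = "4 * d + 23" and ?b = "vars s y"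
    let ?body = "Seq (Copy (vreg x) ?cnt) (Seq (compile (Suc d) c) (Arith Plus ?cnt ?cnt 3))"
    let ?s1 = "fold ?f [0..<?b] (tick s)"
    have eq: "sem n inp (For x y c) s = ?s1" by simp
    have fmono: "ticks s' \<le> ticks (fold ?f [i..<b] s')" for i b s'
    proof (induction "b - i" arbitrary: i s')
      case (Suc a)
      then have "[i..<b] = i # [Suc i..<b]" by (simp add: upt_conv_Cons)
      moreover have "ticks s' \<le> ticks (?f i s')"
        using ticks_mono[of "tick (set_var x i s')" n inp c] by simp
      moreover have "a = b - Suc i" using Suc(2) by simp
      ultimately show ?case using Suc(1)[of "Suc i" "?f i s'"] by simp
    qed simp
    have t1: "ticks ?s1 \<le> T" using For.prems(4) by simp
    have t: "ticks (tick s) \<le> ticks ?s1" by (rule fmono)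
    have ts: "ticks s \<le> T" using t t1 by simp
    note v = var[OF For.prems(1,2) ts]
    have bV: "?b \<le> V" using v(3) .
    have yb: "?b \<le> W + Suc n * ticks s" using For.prems(2) unfolding grown_def vals_le_def by blast
    have loop: "\<exists>r'. runs V (WhileLess ?cnt ?bnd ?body) r r' (50 * (ticks (fold ?f [i..<?b] s') - ticks s') + 2) \<and>
        implements n base inp (fold ?f [i..<?b] s') r' \<and> same_hidden d r r'"
      if "implements n base inp s' r" "grown n W s'" "ticks s \<le> ticks s'" "ticks (fold ?f [i..<?b] s') \<le> T"
        "reg r ?cnt = i" "reg r ?bnd = ?b" "i \<le> ?b" for i s' r
      using that
    proof (induction "?b - i" arbitrary: i s' r)
      case 0
      have ib: "i = ?b" using 0 by simp
      have e: "fold ?f [i..<?b] s' = s'" unfolding ib by simp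
      have "runs V (WhileLess ?cnt ?bnd ?body) r r 2"
        by (rule runs_WhileFalse) (use bV "0.prems"(5,6) ib in auto)
      then have r: "runs V (WhileLess ?cnt ?bnd ?body) r r (50 * (ticks s' - ticks s') + 2)"
        by (rule runs_mono) simp
      show ?case unfolding e by (intro exI[of _ r] conjI r "0.prems"(1) same_hidden_refl)
    next
      case (Suc a)
      then have ib: "i < ?b" by simp
      then have upt: "[i..<?b] = i # [Suc i..<?b]" by (simp add: upt_conv_Cons)
      let ?s2 = "tick (set_var x i s')"
      let ?s3 = "sem n inp c ?s2"
      have T3: "ticks (fold ?f [Suc i..<?b] ?s3) \<le> T" using Suc.prems(4) upt by simp
      have t3: "ticks ?s3 \<le> T" using fmono[of ?s3 "Suc i" ?b] T3 by simp
      have t2: "Suc (ticks s') \<le> ticks ?s3" using ticks_mono[of ?s2 n inp c] by simp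
      have iV: "i \<le> V" "Suc i \<le> V" "1 \<le> V" using ib bV by simp_all
      let ?r1 = "r\<lparr>reg := (reg r)(vreg x := i)\<rparr>"
      have odd: "?cnt \<noteq> vreg z" "?bnd \<noteq> vreg z" for z by presburger+
      have run1: "runs V (Copy (vreg x) ?cnt) r ?r1 1"
        using runs_Copy[of r ?cnt V "vreg x"] Suc.prems(5) iV by simp
      have im1: "implements n base inp ?s2 ?r1" by (rule implements_set_var[OF Suc.prems(1)])
      have "i \<le> W + Suc n * Suc (ticks s')"
      proof -
        have "Suc n * ticks s \<le> Suc n * Suc (ticks s')" using Suc.prems(3) by (intro mult_le_mono2) simp
        then show ?thesis using ib yb by linarith
      qed
      moreover have "vals_le (W + Suc n * Suc (ticks s')) s'"
        using Suc.prems(2) unfolding grown_def by (rule vals_le_mono) simp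
      ultimately have g2: "grown n W ?s2" unfolding grown_def vals_le_def by simp
      obtain r2 where r2: "runs V (compile (Suc d) c) ?r1 r2 (50 * (ticks ?s3 - ticks ?s2))"
        "implements n base inp ?s3 r2" "same_hidden (Suc d) ?r1 r2"
        using For.IH[OF im1 g2 _ t3, of "Suc d"] For.prems(3) by auto
      have h2: "reg r2 ?cnt = i" "reg r2 ?bnd = ?b"
        using r2(3) Suc.prems(5,6) odd[of x] unfolding same_hidden_def by auto
      let ?r3 = "r2\<lparr>reg := (reg r2)(?cnt := Suc i)\<rparr>"
      have run3: "runs V (Arith Plus ?cnt ?cnt 3) r2 ?r3 2"
        using runs_Arith[of r2 ?cnt V 3 Plus ?cnt] h2 iV r2(2) unfolding implements_def by simp
      have im3: "implements n base inp ?s3 ?r3"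
        by (rule implements_set_hidden[OF r2(2)]) auto
      have g3: "grown n W ?s3" using grown_sem[OF inp(1) g2, of c] For.prems(3) by simp
      have "\<exists>r'. runs V (WhileLess ?cnt ?bnd ?body) ?r3 r' (50 * (ticks (fold ?f [Suc i..<?b] ?s3) - ticks ?s3) + 2) \<and>
        implements n base inp (fold ?f [Suc i..<?b] ?s3) r' \<and> same_hidden d ?r3 r'"
      proof (rule Suc.hyps(1)[OF _ im3 g3])
        show "ticks s \<le> ticks ?s3" using t2 Suc.prems(3) by simp
        show "a = ?b - Suc i" using Suc.hyps(2) by simp
        show "reg ?r3 ?cnt = Suc i" "reg ?r3 ?bnd = ?b" using h2 by auto
      qed (use T3 ib in auto)
      then obtain r4 where r4: "runs V (WhileLess ?cnt ?bnd ?body) ?r3 r4 (50 * (ticks (fold ?f [Suc i..<?b] ?s3) - ticks ?s3) + 2)"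
        "implements n base inp (fold ?f [Suc i..<?b] ?s3) r4" "same_hidden d ?r3 r4" by blast
      have body: "runs V ?body r ?r3 (1 + (50 * (ticks ?s3 - ticks ?s2) + 2))"
        by (intro runs_Seq) (rule run1 r2(1) run3)+
      have "runs V (WhileLess ?cnt ?bnd ?body) r r4 ((1 + (50 * (ticks ?s3 - ticks ?s2) + 2)) +
          (50 * (ticks (fold ?f [Suc i..<?b] ?s3) - ticks ?s3) + 2) + 2)"
        by (rule runs_WhileTrue[OF _ _ _ body r4(1)]) (use Suc.prems(5,6) ib iV bV in auto)
      then have "runs V (WhileLess ?cnt ?bnd ?body) r r4 (50 * (ticks (fold ?f [i..<?b] s') - ticks s') + 2)"
      \<comment> \<open>The tick for setting the loop variable pays for the copy, the increment and
        the comparison of each iteration.\<close>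
      proof (rule runs_mono)
        have "ticks ?s3 \<le> ticks (fold ?f [Suc i..<?b] ?s3)" by (rule fmono)
        then show "(1 + (50 * (ticks ?s3 - ticks ?s2) + 2)) +
          (50 * (ticks (fold ?f [Suc i..<?b] ?s3) - ticks ?s3) + 2) + 2 \<le>
          50 * (ticks (fold ?f [i..<?b] s') - ticks s') + 2"
          unfolding upt using t2 by simp
      qed
      moreover have "same_hidden d r r4"
      proof -
        have "same_hidden d r ?r3"
          using r2(3) unfolding same_hidden_def by auto
        then show ?thesis using r4(3) by (rule same_hidden_trans)
      qed
      ultimately show ?case using r4(2) unfolding upt by auto
    qed
    have odd: "?cnt \<noteq> vreg z" "?bnd \<noteq> vreg z" for z by presburger+
    let ?r1 = "r\<lparr>reg := (reg r)(?cnt := 0)\<rparr>"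
    let ?r2 = "?r1\<lparr>reg := (reg ?r1)(?bnd := ?b)\<rparr>"
    have run1: "runs V (SetConst ?cnt 0) r ?r1 1" by (rule runs_SetConst) simp
    have run2: "runs V (Copy ?bnd (vreg y)) ?r1 ?r2 1"
      using runs_Copy[of ?r1 "vreg y" V ?bnd] v(1,2)[of y] odd[of y] by simp
    have im2: "implements n base inp (tick s) ?r2"
    proof -
      have "implements n base inp (tick s) r" using For.prems(1) unfolding implements_def by simp
      then show ?thesis by (intro implements_set_hidden) auto
    qed
    obtain r3 where r3: "runs V (WhileLess ?cnt ?bnd ?body) ?r2 r3 (50 * (ticks ?s1 - ticks (tick s)) + 2)"
      "implements n base inp ?s1 r3" "same_hidden d ?r2 r3"
      using loop[OF im2 grown_tick[OF For.prems(2)], of 0] t1 by auto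
    have "runs V (compile d (For x y c)) r r3 (1 + (1 + (50 * (ticks ?s1 - ticks (tick s)) + 2)))"
      unfolding compile.simps by (intro runs_Seq) (rule run1 run2 r3(1))+
    then have "runs V (compile d (For x y c)) r r3 (50 * (ticks ?s1 - ticks s))"
      by (rule runs_mono) (use t in simp)
    moreover have "same_hidden d r r3"
    proof -
      have "same_hidden d r ?r2" unfolding same_hidden_def by auto
      then show ?thesis using r3(3) by (rule same_hidden_trans)
    qed
    ultimately show ?case using r3(2) unfolding eq by blast
  }
qed

section \<open>Invariants of loops\<close>

primrec mod_vars :: "loop_com \<Rightarrow> nat set" where
  "mod_vars Nop = {}"
| "mod_vars (Const x c) = {x}"
| "mod_vars (Move x y) = {x}"
| "mod_vars (Inc x y) = {x}"
| "mod_vars (Sub x y z) = {x}"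
| "mod_vars (Quot x y z) = {x}"
| "mod_vars (AddMin x y z) = {x}"
| "mod_vars (Inp x y) = {x}"
| "mod_vars (Get x t i j l) = {x}"
| "mod_vars (Put t i j l x) = {}"
| "mod_vars (c ;; d) = mod_vars c \<union> mod_vars d"
| "mod_vars (Cond x y c d) = mod_vars c \<union> mod_vars d"
| "mod_vars (For x y c) = insert x (mod_vars c)"

primrec mod_arrs :: "loop_com \<Rightarrow> nat set" where
  "mod_arrs Nop = {}"
| "mod_arrs (Const x c) = {}"
| "mod_arrs (Move x y) = {}"
| "mod_arrs (Inc x y) = {}"
| "mod_arrs (Sub x y z) = {}"
| "mod_arrs (Quot x y z) = {}"
| "mod_arrs (AddMin x y z) = {}"
| "mod_arrs (Inp x y) = {}"
| "mod_arrs (Get x t i j l) = {}"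
| "mod_arrs (Put t i j l x) = {t}"
| "mod_arrs (c ;; d) = mod_arrs c \<union> mod_arrs d"
| "mod_arrs (Cond x y c d) = mod_arrs c \<union> mod_arrs d"
| "mod_arrs (For x y c) = mod_arrs c"

lemma arr_set_arr_other: "t' \<noteq> t \<Longrightarrow> arr (set_arr t i j l a s) t' = arr s t'"
  by (simp add: set_arr_def)

lemma frame_var: "z \<notin> mod_vars c \<Longrightarrow> vars (sem n inp c s) z = vars s z"
proof (induction c arbitrary: s)
  case (For x y c)
  have "vars (fold (\<lambda>i s. sem n inp c (tick (set_var x i s))) [0..<vars s y] (tick s)) z = vars s z"
    by (rule fold_inv[of "\<lambda>_ s'. vars s' z = vars s z"]) (use For in auto)
  then show ?case by simp
qed auto

lemma frame_arr: "t \<notin> mod_arrs c \<Longrightarrow> arr (sem n inp c s) t = arr s t"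
proof (induction c arbitrary: s)
  case (For x y c)
  have "arr (fold (\<lambda>i s. sem n inp c (tick (set_var x i s))) [0..<vars s y] (tick s)) t = arr s t"
    by (rule fold_inv[of "\<lambda>_ s'. arr s' t = arr s t"]) (use For in auto)
  then show ?case by simp
qed (auto simp: arr_set_arr_other)

text \<open>Loops stay folded: simplification runs straight-line code and stops at a loop, which is
  then treated by \<open>For_rule\<close>.\<close>

declare sem.simps(13) [simp del]

text \<open>The step may assume that everything the body does not assign still has its value from
  before the loop, so invariants mention only what changes. Costs may depend on the iteration, as
  the geometric sum over the peeling phases requires.\<close>

lemma For_rule:
  assumes init: "I 0 (tick s)"
    and step: "\<And>i s'. i < vars s y \<Longrightarrow> I i s' \<Longrightarrow>
      (\<And>z. z \<notin> insert x (mod_vars c) \<Longrightarrow> vars s' z = vars s z) \<Longrightarrow>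
      (\<And>t. t \<notin> mod_arrs c \<Longrightarrow> arr s' t = arr s t) \<Longrightarrow>
      I (Suc i) (sem n inp c (tick (set_var x i s'))) \<and>
      ticks (sem n inp c (tick (set_var x i s'))) \<le> ticks s' + \<tau> i"
  shows "I (vars s y) (sem n inp (For x y c) s) \<and>
    ticks (sem n inp (For x y c) s) \<le> ticks s + 1 + (\<Sum>i<vars s y. \<tau> i)"
proof -
  let ?J = "\<lambda>i s'. I i s' \<and> ticks s' \<le> ticks s + 1 + (\<Sum>i<i. \<tau> i) \<and>
    (\<forall>z. z \<notin> insert x (mod_vars c) \<longrightarrow> vars s' z = vars s z) \<and> (\<forall>t. t \<notin> mod_arrs c \<longrightarrow> arr s' t = arr s t)"
  have "?J (vars s y) (fold (\<lambda>i s. sem n inp c (tick (set_var x i s))) [0..<vars s y] (tick s))"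
  proof (rule fold_inv[of ?J], goal_cases)
    case 1
    then show ?case using init by simp
  next
    case (2 i s')
    then have J: "I i s'" "\<And>z. z \<notin> insert x (mod_vars c) \<Longrightarrow> vars s' z = vars s z"
      "\<And>t. t \<notin> mod_arrs c \<Longrightarrow> arr s' t = arr s t" "ticks s' \<le> ticks s + 1 + (\<Sum>i<i. \<tau> i)" by blast+
    show ?case using step[OF 2(1) J(1-3)] J(2-4) by (auto simp: frame_var frame_arr)
  qed
  then show ?thesis by (simp add: sem.simps)
qed

section \<open>Building the hubs\<close>

definition seq :: "(nat \<Rightarrow> 'b) \<Rightarrow> nat \<Rightarrow> 'b list" where
  "seq f m = map f [0..<m]"

lemma seq_0 [simp]: "seq f 0 = []" by (simp add: seq_def)

lemma length_seq [simp]: "length (seq f m) = m" by (simp add: seq_def)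

lemma nth_seq [simp]: "i < m \<Longrightarrow> seq f m ! i = f i" by (simp add: seq_def)

text \<open>As a congruence rule it hands \<open>i < m\<close> to the simplifier, which then
  discards writes at position \<open>m\<close> from the list of the first \<open>m\<close>
  entries.\<close>

lemma seq_cong [cong]: "m = m' \<Longrightarrow> (\<And>i. i < m' \<Longrightarrow> f i = g i) \<Longrightarrow> seq f m = seq g m'"
  by (simp add: seq_def)

lemma seq_Suc [simp]: "seq f (Suc m) = seq f m @ [f m]"
  by (simp add: seq_def)

lemma set_seq: "set (seq f m) = f ` {..<m}" by (auto simp: seq_def)

text \<open>Names of variables. \<open>vZ\<close> is never assigned: it supplies the constant 0 and
  fills the array indices that a table does not need.\<close>

abbreviation (input) "vN \<equiv> 0 :: nat"
abbreviation (input) "vM \<equiv> 1 :: nat"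
abbreviation (input) "vK \<equiv> 2 :: nat"
abbreviation (input) "vZ \<equiv> 3 :: nat"
abbreviation (input) "vOne \<equiv> 4 :: nat"
abbreviation (input) "vTwo \<equiv> 5 :: nat"
abbreviation (input) "vK1 \<equiv> 6 :: nat"
abbreviation (input) "vP \<equiv> 7 :: nat"
abbreviation (input) "vX \<equiv> 8 :: nat"
abbreviation (input) "vY \<equiv> 9 :: nat"
abbreviation (input) "vA \<equiv> 10 :: nat"
abbreviation (input) "vB \<equiv> 11 :: nat"
abbreviation (input) "vC \<equiv> 12 :: nat"
abbreviation (input) "vG \<equiv> 13 :: nat"
abbreviation (input) "vEC \<equiv> 14 :: nat"
abbreviation (input) "vG1 \<equiv> 15 :: nat"
abbreviation (input) "vE2 \<equiv> 16 :: nat"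
abbreviation (input) "vNN \<equiv> 17 :: nat"
abbreviation (input) "vQ \<equiv> 18 :: nat"
abbreviation (input) "vI \<equiv> 19 :: nat"
abbreviation (input) "vJ \<equiv> 20 :: nat"
abbreviation (input) "vV \<equiv> 21 :: nat"
abbreviation (input) "vHC \<equiv> 22 :: nat"
abbreviation (input) "vPH \<equiv> 23 :: nat"
abbreviation (input) "vL \<equiv> 24 :: nat"
abbreviation (input) "vL1 \<equiv> 25 :: nat"
abbreviation (input) "vSC \<equiv> 26 :: nat"
abbreviation (input) "vLC \<equiv> 27 :: nat"
abbreviation (input) "vRC \<equiv> 28 :: nat"
abbreviation (input) "vLO \<equiv> 29 :: nat"
abbreviation (input) "vNC \<equiv> 30 :: nat"
abbreviation (input) "vE \<equiv> 31 :: nat"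
abbreviation (input) "vE1 \<equiv> 32 :: nat"
abbreviation (input) "vPos \<equiv> 33 :: nat"
abbreviation (input) "vNeg \<equiv> 34 :: nat"
abbreviation (input) "vRes \<equiv> 35 :: nat"

text \<open>Names of tables: \<open>tD\<close> slacks; \<open>tAdj\<close> edge marks;
  \<open>tHc\<close>, \<open>tH\<close> number and list of hubs; \<open>tEX\<close>,
  \<open>tEY\<close>, \<open>tDeg\<close> edge ends and degrees of a phase; \<open>tSc\<close>,
  \<open>tS\<close> labels of each level; \<open>tRc\<close>, \<open>tR\<close> sorted labels;
  \<open>tL\<close> trie nodes of the keys of a vertex; \<open>tCh\<close>, \<open>tCnt\<close>
  children and counters of nodes; \<open>tL2\<close>, \<open>tSg\<close> nodes and signs of a
  query.\<close>

abbreviation (input) "tD \<equiv> 0 :: nat"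
abbreviation (input) "tAdj \<equiv> 1 :: nat"
abbreviation (input) "tHc \<equiv> 2 :: nat"
abbreviation (input) "tH \<equiv> 3 :: nat"
abbreviation (input) "tEX \<equiv> 4 :: nat"
abbreviation (input) "tEY \<equiv> 5 :: nat"
abbreviation (input) "tDeg \<equiv> 6 :: nat"
abbreviation (input) "tSc \<equiv> 7 :: nat"
abbreviation (input) "tS \<equiv> 8 :: nat"
abbreviation (input) "tRc \<equiv> 9 :: nat"
abbreviation (input) "tR \<equiv> 10 :: nat"
abbreviation (input) "tL \<equiv> 11 :: nat"
abbreviation (input) "tCh \<equiv> 12 :: nat"
abbreviation (input) "tCnt \<equiv> 13 :: nat"
abbreviation (input) "tL2 \<equiv> 14 :: nat"
abbreviation (input) "tSg \<equiv> 15 :: nat"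

text \<open>
  The entry for \<open>x\<close>, \<open>y\<close> is \<open>k + 1 - i\<close> if a walk of length \<open>i \<le> k\<close> from \<open>x\<close> to \<open>y\<close> is known, and 0
  otherwise, so that cells that were never written mean an infinite distance.
\<close>

definition slack :: "loop_state \<Rightarrow> nat \<Rightarrow> nat \<Rightarrow> nat" where
  "slack s x y = arr s tD x y 0"

definition marked :: "loop_state \<Rightarrow> nat rel" where
  "marked s = {(x, y). 0 < arr s tAdj x y 0}"

definition hubs :: "loop_state \<Rightarrow> nat \<Rightarrow> nat list" where
  "hubs s v = seq (\<lambda>i. arr s tH v i 0) (arr s tHc v 0 0)"

text \<open>
  Every phase of the orientation writes its edges and degrees to a new row \<open>g\<close>, where all cells are
  still 0; nothing is ever cleared.
\<close>

definition pairs_at :: "loop_state \<Rightarrow> nat \<Rightarrow> nat \<Rightarrow> (nat \<times> nat) list" where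
  "pairs_at s g m = seq (\<lambda>i. (arr s tEX g i 0, arr s tEY g i 0)) m"

abbreviation edges :: "loop_state \<Rightarrow> (nat \<times> nat) list" where
  "edges s \<equiv> pairs_at s (vars s vG) (vars s vEC)"

text \<open>For slacks k + 1 - i and k + 1 - j the two subtractions give k + 1 - (i + j). Truncation
  at 0 turns an unknown part, or a walk longer than k, into an unknown distance.\<close>

definition relax :: "nat \<Rightarrow> nat \<Rightarrow> nat \<Rightarrow> loop_com" where
  "relax x v y = Get vA tD x v vZ ;; Get vB tD v y vZ ;; Sub vC vK1 vB ;; Sub vA vA vC ;;
    Get vB tD x y vZ ;; Cond vB vA (Put tD x y vZ vA) Nop"

definition add_edge :: "nat \<Rightarrow> nat \<Rightarrow> loop_com" where
  "add_edge x y = Get vA tAdj x y vZ ;; Cond vZ vA Nop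
    (Put tAdj x y vZ vOne ;; Put tEX vG vEC vZ x ;; Put tEY vG vEC vZ y ;; Inc vEC vEC)"

lemma mod_relax [simp]: "mod_vars (relax x v y) = {vA, vB, vC}" "mod_arrs (relax x v y) = {tD}"
  by (auto simp: relax_def)

lemma mod_add_edge [simp]: "mod_vars (add_edge x y) = {vA, vEC}" "mod_arrs (add_edge x y) = {tAdj, tEX, tEY}"
  by (auto simp: add_edge_def)

lemma relax:
  assumes "vars s vZ = 0" "x \<notin> {vA, vB, vC}" "v \<notin> {vA, vB, vC}" "y \<notin> {vA, vB, vC}"
  shows "slack (sem n inp (relax x v y) s) =
      (\<lambda>a b. if a = vars s x \<and> b = vars s y
        then max (slack s a b) (slack s a (vars s v) - (vars s vK1 - slack s (vars s v) b)) else slack s a b)"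
    and "ticks (sem n inp (relax x v y) s) \<le> ticks s + 7"
  unfolding relax_def slack_def using assms by (auto simp: fun_eq_iff)

lemma add_edge:
  assumes "vars s vZ = 0" "vars s vOne = 1" "x \<notin> {vA, vEC}" "y \<notin> {vA, vEC}"
  shows "marked (sem n inp (add_edge x y) s) = insert (vars s x, vars s y) (marked s)"
    and "edges (sem n inp (add_edge x y) s) =
      (if (vars s x, vars s y) \<in> marked s then edges s else edges s @ [(vars s x, vars s y)])"
    and "ticks (sem n inp (add_edge x y) s) \<le> ticks s + 6"
  unfolding add_edge_def marked_def pairs_at_def using assms
  by auto

section \<open>Orientation by peeling vertices of low degree\<close>

definition count_tails :: loop_com where
  "count_tails = Const vNN 0 ;; For vI vEC (Get vX tEX vG vI vZ ;; Get vA tDeg vG vX vZ ;;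
    Cond vZ vA Nop (Inc vNN vNN) ;; Inc vA vA ;; Put tDeg vG vX vZ vA)"

text \<open>A vertex of low degree is peeled: all its remaining neighbours become its hubs. An arc
  from a high tail to a low head is dropped, since the opposite arc already makes the tail a hub of
  the head. Arcs between high vertices go to the next row.\<close>

definition split_edges :: loop_com where
  "split_edges = Quot vQ vEC vNN ;; Const vE2 0 ;; Inc vG1 vG ;;
    For vI vEC (Get vX tEX vG vI vZ ;; Get vY tEY vG vI vZ ;;
      Get vA tDeg vG vX vZ ;; Quot vA vA vTwo ;; Get vB tDeg vG vY vZ ;; Quot vB vB vTwo ;;
      Cond vQ vA
        (Cond vQ vB (Put tEX vG1 vE2 vZ vX ;; Put tEY vG1 vE2 vZ vY ;; Inc vE2 vE2) Nop)
        (Get vC tHc vX vZ vZ ;; Put tH vX vC vZ vY ;; Inc vC vC ;; Put tHc vX vZ vZ vC))"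

definition peel_phase :: loop_com where
  "peel_phase = count_tails ;; split_edges ;; Move vEC vE2 ;; Move vG vG1"

text \<open>Each phase at least halves the number of tails, so about log n phases would do; n is a
  bound at hand, and a phase without edges costs only a constant.\<close>

definition orient :: loop_com where
  "orient = For vPH vN peel_phase"

lemma mod_count_tails [simp]: "mod_vars count_tails = {vNN, vI, vX, vA}" "mod_arrs count_tails = {tDeg}"
  by (auto simp: count_tails_def)

lemma mod_split_edges [simp]: "mod_vars split_edges = {vQ, vE2, vG1, vI, vX, vY, vA, vB, vC}"
  "mod_arrs split_edges = {tEX, tEY, tH, tHc}"
  by (auto simp: split_edges_def)

lemma mod_peel_phase [simp]: "mod_vars peel_phase = {vNN, vQ, vE2, vG1, vI, vX, vY, vA, vB, vC, vEC, vG}"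
  "mod_arrs peel_phase = {tDeg, tEX, tEY, tH, tHc}"
  by (auto simp: peel_phase_def)

lemma mod_orient [simp]: "mod_vars orient = {vPH, vNN, vQ, vE2, vG1, vI, vX, vY, vA, vB, vC, vEC, vG}"
  "mod_arrs orient = {tDeg, tEX, tEY, tH, tHc}"
  by (auto simp: orient_def)

lemma count_tails:
  fixes n :: nat and inp :: "nat \<Rightarrow> nat" and s :: loop_state
  assumes Z: "vars s vZ = 0" and fresh: "\<And>g x. vars s vG \<le> g \<Longrightarrow> arr s tDeg g x 0 = 0"
  defines "s' \<equiv> sem n inp count_tails s"
  shows "arr s' tDeg (vars s vG) x 0 = count_list (map fst (edges s)) x"
    and "vars s vG < g \<Longrightarrow> arr s' tDeg g x 0 = 0"
    and "vars s' vNN = card (fst ` set (edges s))"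
    and "ticks s' \<le> ticks s + 2 + 7 * vars s vEC"
proof -
  let ?E = "edges s" and ?g = "vars s vG"
  define I where "I i t \<longleftrightarrow> (\<forall>x. arr t tDeg ?g x 0 = count_list (map fst (take i ?E)) x) \<and>
    (\<forall>g x. ?g < g \<longrightarrow> arr t tDeg g x 0 = 0) \<and> vars t vNN = card (fst ` set (take i ?E))" for i and t :: loop_state
  let ?s0 = "tick (set_var vNN 0 s)"
  let ?c = "Get vX tEX vG vI vZ ;; Get vA tDeg vG vX vZ ;;
    Cond vZ vA Nop (Inc vNN vNN) ;; Inc vA vA ;; Put tDeg vG vX vZ vA"
  have "I (vars ?s0 vEC) (sem n inp (For vI vEC ?c) ?s0) \<and>
    ticks (sem n inp (For vI vEC ?c) ?s0) \<le> ticks ?s0 + 1 + (\<Sum>i<vars ?s0 vEC. 7)"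
  proof (rule For_rule, goal_cases)
    case 1
    then show ?case using fresh by (simp add: I_def)
  next
    case (2 i t)
    have i: "i < length ?E" using 2(1) by (simp add: pairs_at_def)
    have v: "vars t vZ = 0" "vars t vG = ?g" using 2(3) Z by auto
    have a: "arr t tEX = arr s tEX" using 2(4) by auto
    let ?x = "fst (?E ! i)"
    have x: "arr s tEX ?g i 0 = ?x" using 2(1) by (simp add: pairs_at_def)
    have tk: "take (Suc i) ?E = take i ?E @ [?E ! i]" using i by (simp add: take_Suc_conv_app_nth)
    have cl: "count_list (map fst (take i ?E)) ?x = 0 \<longleftrightarrow> ?x \<notin> fst ` set (take i ?E)"
      by (simp add: count_list_0_iff)
    show ?case using 2(2) v a x cl unfolding I_def tk
      by (auto simp: card_insert_if)
  qed
  then show "arr s' tDeg (vars s vG) x 0 = count_list (map fst (edges s)) x"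
    "vars s vG < g \<Longrightarrow> arr s' tDeg g x 0 = 0"
    "vars s' vNN = card (fst ` set (edges s))"
    "ticks s' \<le> ticks s + 2 + 7 * vars s vEC"
    unfolding s'_def count_tails_def I_def by (auto simp: pairs_at_def)
qed

lemma split_edges:
  fixes n :: nat and inp :: "nat \<Rightarrow> nat" and s :: loop_state
  assumes Z: "vars s vZ = 0" "vars s vTwo = 2"
  defines "s' \<equiv> sem n inp split_edges s"
    and "high \<equiv> \<lambda>x. vars s vEC div vars s vNN < arr s tDeg (vars s vG) x 0 div 2"
  shows "pairs_at s' (Suc (vars s vG)) (vars s' vE2) = filter (\<lambda>e. high (fst e) \<and> high (snd e)) (edges s)"
    and "hubs s' v = hubs s v @ map snd (filter (\<lambda>e. fst e = v \<and> \<not> high v) (edges s))"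
    and "vars s' vG1 = Suc (vars s vG)"
    and "ticks s' \<le> ticks s + 4 + 13 * vars s vEC"
proof -
  let ?E = "edges s" and ?g = "vars s vG"
  define I where "I i t \<longleftrightarrow>
    pairs_at t (Suc ?g) (vars t vE2) = filter (\<lambda>e. high (fst e) \<and> high (snd e)) (take i ?E) \<and>
    (\<forall>v. hubs t v = hubs s v @ map snd (filter (\<lambda>e. fst e = v \<and> \<not> high v) (take i ?E))) \<and>
    arr t tEX ?g = arr s tEX ?g \<and> arr t tEY ?g = arr s tEY ?g" for i and t :: loop_state
  let ?q = "vars s vEC div vars s vNN"
  let ?s0 = "sem n inp (Quot vQ vEC vNN ;; Const vE2 0 ;; Inc vG1 vG) s"
  let ?c = "Get vX tEX vG vI vZ ;; Get vY tEY vG vI vZ ;;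
      Get vA tDeg vG vX vZ ;; Quot vA vA vTwo ;; Get vB tDeg vG vY vZ ;; Quot vB vB vTwo ;;
      Cond vQ vA
        (Cond vQ vB (Put tEX vG1 vE2 vZ vX ;; Put tEY vG1 vE2 vZ vY ;; Inc vE2 vE2) Nop)
        (Get vC tHc vX vZ vZ ;; Put tH vX vC vZ vY ;; Inc vC vC ;; Put tHc vX vZ vZ vC)"
  have s0: "vars ?s0 vEC = vars s vEC" "vars ?s0 vQ = ?q" "vars ?s0 vG1 = Suc ?g" "vars ?s0 vG = ?g"
    "vars ?s0 vZ = 0" "vars ?s0 vTwo = 2" "ticks ?s0 = ticks s + 3" "arr ?s0 = arr s" "vars ?s0 vE2 = 0"
    using Z by auto
  have "I (vars ?s0 vEC) (sem n inp (For vI vEC ?c) ?s0) \<and>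
    ticks (sem n inp (For vI vEC ?c) ?s0) \<le> ticks ?s0 + 1 + (\<Sum>i<vars ?s0 vEC. 13)"
  proof (rule For_rule, goal_cases)
    case 1
    then show ?case by (simp add: I_def hubs_def pairs_at_def)
  next
    case (2 i t)
    have v: "vars t vZ = 0" "vars t vTwo = 2" "vars t vG = ?g" "vars t vG1 = Suc ?g" "vars t vQ = ?q"
      using 2(3) s0 by auto
    have i: "i < length ?E" "i < vars s vEC" using 2(1) s0 by (simp_all add: pairs_at_def)
    have "arr t tDeg = arr s tDeg" using 2(4)[of tDeg] s0(8) by simp
    moreover have "arr t tEX ?g = arr s tEX ?g" "arr t tEY ?g = arr s tEY ?g" using 2(2) unfolding I_def by auto
    ultimately have a: "arr t tDeg = arr s tDeg" "arr t tEX ?g = arr s tEX ?g" "arr t tEY ?g = arr s tEY ?g" by auto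
    obtain x y where xy: "?E ! i = (x, y)" by (cases "?E ! i")
    have x: "arr s tEX ?g i 0 = x" "arr s tEY ?g i 0 = y" using i(2) xy by (simp_all add: pairs_at_def)
    have tk: "take (Suc i) ?E = take i ?E @ [(x, y)]" using i xy by (simp add: take_Suc_conv_app_nth)
    have J: "pairs_at t (Suc ?g) (vars t vE2) = filter (\<lambda>e. high (fst e) \<and> high (snd e)) (take i ?E)"
      "\<And>v. hubs t v = hubs s v @ map snd (filter (\<lambda>e. fst e = v \<and> \<not> high v) (take i ?E))"
      using 2(2) unfolding I_def by auto
    define t' where "t' = sem n inp ?c (tick (set_var vI i t))"
    have h: "high z \<longleftrightarrow> ?q < arr s tDeg ?g z 0 div 2" for z by (simp add: high_def)
    have tick_le: "ticks t' \<le> ticks t + 13" unfolding t'_def using v a x by simp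
    have keep: "arr t' tEX ?g = arr s tEX ?g" "arr t' tEY ?g = arr s tEY ?g"
      unfolding t'_def using v a x by (auto simp: fun_eq_iff)
    have hubs_t: "hubs t' z = hubs t z @ (if z = x \<and> \<not> high x then [y] else [])" for z
    proof -
      have "arr t' tHc z 0 0 = (if z = x \<and> \<not> high x then Suc (arr t tHc x 0 0) else arr t tHc z 0 0)"
        "arr t' tH z i 0 = (if z = x \<and> \<not> high x \<and> i = arr t tHc x 0 0 then y else arr t tH z i 0)" for i
        unfolding t'_def using v a x h by simp_all
      then show ?thesis unfolding hubs_def by (cases "z = x"; cases "high x") simp_all
    qed
    have pairs_t: "pairs_at t' (Suc ?g) (vars t' vE2) =
        pairs_at t (Suc ?g) (vars t vE2) @ (if high x \<and> high y then [(x, y)] else [])"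
    proof -
      let ?m = "vars t vE2"
      have "vars t' vE2 = (if high x \<and> high y then Suc ?m else ?m)"
        "arr t' tEX (Suc ?g) i 0 = (if high x \<and> high y \<and> i = ?m then x else arr t tEX (Suc ?g) i 0)"
        "arr t' tEY (Suc ?g) i 0 = (if high x \<and> high y \<and> i = ?m then y else arr t tEY (Suc ?g) i 0)" for i
        unfolding t'_def using v a x h by simp_all
      then show ?thesis unfolding pairs_at_def by (cases "high x"; cases "high y") simp_all
    qed
    show ?case unfolding t'_def[symmetric]
    proof
      show "ticks t' \<le> ticks t + 13" by (rule tick_le)
      show "I (Suc i) t'" unfolding I_def tk using J hubs_t pairs_t keep by auto
    qed
  qed
  moreover have s': "s' = sem n inp (For vI vEC ?c) ?s0" by (simp add: s'_def split_edges_def)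
  moreover have "vars s' vG1 = Suc ?g"
    unfolding s' by (subst frame_var) auto
  ultimately show "pairs_at s' (Suc (vars s vG)) (vars s' vE2) = filter (\<lambda>e. high (fst e) \<and> high (snd e)) (edges s)"
    "hubs s' v = hubs s v @ map snd (filter (\<lambda>e. fst e = v \<and> \<not> high v) (edges s))"
    "vars s' vG1 = Suc (vars s vG)"
    "ticks s' \<le> ticks s + 4 + 13 * vars s vEC"
    unfolding I_def using s0 by (auto simp: pairs_at_def)
qed


lemma length_edges: "length (edges s) = vars s vEC"
  by (simp add: pairs_at_def)

text \<open>Although both quotients are rounded down, a high tail has more than twice the average
  degree.\<close>

definition high_tail :: "(nat \<times> nat) list \<Rightarrow> nat \<Rightarrow> bool" where
  "high_tail E x \<longleftrightarrow> length E div card (fst ` set E) < count_list (map fst E) x div 2"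

lemma peel_phase:
  fixes n :: nat and inp :: "nat \<Rightarrow> nat" and s :: loop_state
  assumes Z: "vars s vZ = 0" "vars s vTwo = 2" and fresh: "\<And>g x. vars s vG \<le> g \<Longrightarrow> arr s tDeg g x 0 = 0"
  defines "s' \<equiv> sem n inp peel_phase s" and "E \<equiv> edges s"
  shows "edges s' = filter (\<lambda>e. high_tail E (fst e) \<and> high_tail E (snd e)) E"
    and "hubs s' v = hubs s v @ map snd (filter (\<lambda>e. fst e = v \<and> \<not> high_tail E v) E)"
    and "vars s' vG \<le> g \<Longrightarrow> arr s' tDeg g x 0 = 0"
    and "ticks s' \<le> ticks s + 8 + 20 * length E"
proof -
  let ?s1 = "sem n inp count_tails s"
  let ?s2 = "sem n inp split_edges ?s1"
  note c = count_tails[OF Z(1) fresh, where n = n and inp = inp]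
  have s1: "vars ?s1 vZ = 0" "vars ?s1 vTwo = 2" "vars ?s1 vG = vars s vG" "vars ?s1 vEC = vars s vEC"
    "hubs ?s1 = hubs s" "pairs_at ?s1 = pairs_at s"
    using Z by (auto simp: frame_var frame_arr hubs_def pairs_at_def fun_eq_iff)
  have h: "vars ?s1 vEC div vars ?s1 vNN < arr ?s1 tDeg (vars ?s1 vG) x 0 div 2 \<longleftrightarrow> high_tail E x" for x
    using c(1)[of x] c(3) s1(3,4) by (simp add: high_tail_def E_def length_edges)
  note sp = split_edges[OF s1(1,2), where n = n and inp = inp, unfolded h, unfolded s1, folded E_def]
  have s': "s' = tick (set_var vG (vars ?s2 vG1) (tick (set_var vEC (vars ?s2 vE2) ?s2)))"
    unfolding s'_def peel_phase_def by simp
  show "edges s' = filter (\<lambda>e. high_tail E (fst e) \<and> high_tail E (snd e)) E"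
    unfolding s' using sp(1,3) by (simp add: pairs_at_def)
  show "hubs s' v = hubs s v @ map snd (filter (\<lambda>e. fst e = v \<and> \<not> high_tail E v) E)"
    unfolding s' using sp(2) by (simp add: hubs_def)
  show "arr s' tDeg g x 0 = 0" if "vars s' vG \<le> g"
    using that c(2)[of g x] sp(3) unfolding s' by (simp add: frame_arr)
  show "ticks s' \<le> ticks s + 8 + 20 * length E"
    unfolding s' using sp(4) c(4) by (simp add: E_def length_edges)
qed

text \<open>Markov's inequality: with \<open>q\<close> the rounded average, a high tail has at least
  2 * (q + 1) arcs, but there are fewer than q + 1 arcs per tail.\<close>

lemma card_high_tails: "2 * card {x \<in> fst ` set E. high_tail E x} \<le> card (fst ` set E)"
proof (cases "E = []")
  case False
  let ?T = "fst ` set E" and ?H = "{x \<in> fst ` set E. high_tail E x}"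
  let ?q = "length E div card ?T"
  have T: "0 < card ?T" using False by (simp add: card_gt_0_iff)
  have "card ?H * (2 * (?q + 1)) = (\<Sum>x\<in>?H. 2 * (?q + 1))" by simp
  also have "\<dots> \<le> (\<Sum>x\<in>?H. count_list (map fst E) x)"
    by (rule sum_mono) (auto simp: high_tail_def)
  also have "\<dots> \<le> (\<Sum>x\<in>?T. count_list (map fst E) x)" by (rule sum_mono2) auto
  also have "\<dots> = length E" using sum_count_set[of "map fst E" ?T] by simp
  also have "\<dots> < (?q + 1) * card ?T" using T by (simp add: dividend_less_div_times)
  finally have "(2 * card ?H) * (?q + 1) < card ?T * (?q + 1)" by (simp add: algebra_simps)
  then have "2 * card ?H < card ?T" by (simp only: mult_less_cancel2)
  then show ?thesis by simp
qed simp

text \<open>The summand 1 is the loss from rounding down half the degree.\<close>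

lemma low_tail_count:
  assumes "\<not> high_tail E v" "length E \<le> d * card (fst ` set E)"
  shows "length (filter (\<lambda>e. fst e = v) E) \<le> 2 * d + 1"
proof -
  have "length (filter (\<lambda>e. fst e = v) E) = count_list (map fst E) v"
    by (simp add: count_list_eq_length_filter filter_map o_def eq_commute)
  moreover have "length E div card (fst ` set E) \<le> d"
    using assms(2) by (cases "card (fst ` set E) = 0") (auto simp: div_le_mono intro: less_mult_imp_div_less order_trans[OF div_le_mono[OF assms(2)]])
  ultimately show ?thesis using assms(1) unfolding high_tail_def by linarith
qed

lemma sum_halves: "(\<Sum>i<b. m div 2 ^ i) \<le> 2 * (m::nat)"
proof -
  have "(\<Sum>i<b. m div 2 ^ i) + 2 * (m div 2 ^ b) \<le> 2 * m"
  proof (induction b)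
    case (Suc b)
    have "m div 2 ^ Suc b = m div 2 ^ b div 2" by (simp add: div_mult2_eq[symmetric] mult.commute)
    then show ?case using Suc by simp
  qed simp
  then show ?thesis by simp
qed

definition fresh_degrees :: "loop_state \<Rightarrow> bool" where
  "fresh_degrees s \<longleftrightarrow> (\<forall>g\<ge>vars s vG. \<forall>x. arr s tDeg g x 0 = 0)"

text \<open>A vertex receives all its new hubs in the single phase that peels it, so their number is
  bounded through the density of one remaining subgraph. As that density is at most \<open>d\<close>
  in every phase, the bound on the edges halves together with the tails, and the total work is
  linear.\<close>

lemma orient:
  fixes n :: nat and inp :: "nat \<Rightarrow> nat" and s :: loop_state
  assumes Z: "vars s vZ = 0" "vars s vTwo = 2" "vars s vN = n" and fresh: "fresh_degrees s"
    and E: "distinct (edges s)" "sym (set (edges s))" "set (edges s) \<subseteq> {..<n} \<times> {..<n}"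
    and sparse: "\<And>F X. F \<subseteq> set (edges s) \<Longrightarrow> X \<subseteq> {..<n} \<Longrightarrow> F \<subseteq> X \<times> X \<Longrightarrow> card F \<le> d * card X"
  defines "s' \<equiv> sem n inp orient s"
  obtains Out where "\<And>v. hubs s' v = hubs s v @ Out v"
    "\<And>v h. h \<in> set (Out v) \<Longrightarrow> (v, h) \<in> set (edges s)"
    "\<And>v. length (Out v) \<le> 2 * d + 1"
    "\<And>x y. (x, y) \<in> set (edges s) \<Longrightarrow> y \<in> set (Out x) \<or> x \<in> set (Out y)"
    "edges s' = []" "fresh_degrees s'"
    "ticks s' \<le> ticks s + 1 + (10 + 40 * d) * n"
proof -
  let ?E = "edges s"
  define good where "good i E Out \<longleftrightarrow> distinct E \<and> set E \<subseteq> set ?E \<and> sym (set E) \<and> card (fst ` set E) * 2 ^ i \<le> n \<and>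
    (\<forall>v h. h \<in> set (Out v) \<longrightarrow> (v, h) \<in> set ?E) \<and>
    (\<forall>v. length (Out v) \<le> 2 * d + 1 \<and> (Out v \<noteq> [] \<longrightarrow> v \<notin> fst ` set E)) \<and>
    (\<forall>x y. (x, y) \<in> set ?E \<longrightarrow> (x, y) \<in> set E \<or> y \<in> set (Out x) \<or> x \<in> set (Out y))"
    for i E and Out :: "nat \<Rightarrow> nat list"
  define I where "I i t \<longleftrightarrow> fresh_degrees t \<and> (\<exists>Out. (\<forall>v. hubs t v = hubs s v @ Out v) \<and> good i (edges t) Out)"
    for i and t :: loop_state
  have sym_fst_snd: "snd ` set E = fst ` set E" if "sym (set E)" for E :: "(nat \<times> nat) list"
    using that unfolding sym_def by force
  \<comment> \<open>By symmetry heads are tails as well, so sparsity applies with the set of tails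
    as \<open>X\<close>.\<close>
  have lenE: "length E \<le> d * card (fst ` set E)" if "good i E Out" for i E Out
  proof -
    have "length E = card (set E)" using that by (simp add: good_def distinct_card)
    also have "\<dots> \<le> d * card (fst ` set E)"
    proof (rule sparse)
      show "set E \<subseteq> set ?E" using that by (simp add: good_def)
      then show "fst ` set E \<subseteq> {..<n}" using E(3) by fastforce
      have "snd ` set E = fst ` set E" using that by (simp add: good_def sym_fst_snd)
      then show "set E \<subseteq> fst ` set E \<times> fst ` set E" by force
    qed
    finally show ?thesis .
  qed
  have lenE2: "length E \<le> d * (n div 2 ^ i)" if "good i E Out" for i E Out
  proof -
    have "card (fst ` set E) * 2 ^ i \<le> n" using that by (simp add: good_def)
    then have "card (fst ` set E) \<le> n div 2 ^ i" by (simp add: less_eq_div_iff_mult_less_eq)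
    then show ?thesis using lenE[OF that] by (meson le_trans mult_le_mono2)
  qed
  have step: "good (Suc i) (filter (\<lambda>e. high_tail E (fst e) \<and> high_tail E (snd e)) E)
      (\<lambda>v. Out v @ map snd (filter (\<lambda>e. fst e = v \<and> \<not> high_tail E v) E))" if g: "good i E Out" for i E Out
  proof -
    let ?E' = "filter (\<lambda>e. high_tail E (fst e) \<and> high_tail E (snd e)) E"
    let ?O = "\<lambda>v. map snd (filter (\<lambda>e. fst e = v \<and> \<not> high_tail E v) E)"
    have g1: "distinct E" "set E \<subseteq> set ?E" "sym (set E)" "card (fst ` set E) * 2 ^ i \<le> n"
      "\<And>v h. h \<in> set (Out v) \<Longrightarrow> (v, h) \<in> set ?E" "\<And>v. length (Out v) \<le> 2 * d + 1"
      "\<And>v. Out v \<noteq> [] \<Longrightarrow> v \<notin> fst ` set E"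
      "\<And>x y. (x, y) \<in> set ?E \<Longrightarrow> (x, y) \<in> set E \<or> y \<in> set (Out x) \<or> x \<in> set (Out y)"
      using g unfolding good_def by blast+
    have "card (fst ` set ?E') \<le> card {x \<in> fst ` set E. high_tail E x}" by (rule card_mono) auto
    then have "card (fst ` set ?E') * 2 \<le> card (fst ` set E)" using card_high_tails[of E] by linarith
    then have "card (fst ` set ?E') * 2 * 2 ^ i \<le> n" using g1(4) by (meson le_trans mult_le_mono1)
    then have c: "card (fst ` set ?E') * 2 ^ Suc i \<le> n" by (simp add: mult.assoc)
    have len: "length (Out v @ ?O v) \<le> 2 * d + 1" for v
    proof (cases "high_tail E v \<or> v \<notin> fst ` set E")
      case True
      then have "?O v = []" by (force simp: filter_empty_conv)
      then show ?thesis using g1(6) by simp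
    next
      case False
      then have "Out v = []" using g1(7) by blast
      then show ?thesis using low_tail_count[OF _ lenE[OF g], of v] False by simp
    qed
    have fin: "v \<notin> fst ` set ?E'" if "Out v @ ?O v \<noteq> []" for v
    proof (cases "Out v = []")
      case True
      then have "\<not> high_tail E v" using that by (auto simp: filter_empty_conv)
      then show ?thesis by auto
    next
      case False
      then show ?thesis using g1(7)[of v] by auto
    qed
    \<comment> \<open>An edge with a low end leaves the list; one of its two arcs starts at that end
      and makes the other end a hub of it.\<close>
    have cov: "(x, y) \<in> set ?E' \<or> y \<in> set (Out x @ ?O x) \<or> x \<in> set (Out y @ ?O y)" if xy: "(x, y) \<in> set ?E" for x y
    proof (cases "(x, y) \<in> set E")
      case True
      then have yx: "(y, x) \<in> set E" using g1(3) by (auto dest: symD)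
      show ?thesis using True yx by force
    next
      case False
      then show ?thesis using g1(8)[OF xy] by auto
    qed
    have o: "(v, h) \<in> set ?E" if "h \<in> set (Out v @ ?O v)" for v h using that g1(2,5) by auto
    have sy: "sym (set ?E')" using g1(3) unfolding sym_def by auto
    show ?thesis unfolding good_def using g1(1,2) c len fin cov o sy by (intro conjI allI impI) auto
  qed
  have "I (vars s vN) (sem n inp (For vPH vN peel_phase) s) \<and>
    ticks (sem n inp (For vPH vN peel_phase) s) \<le> ticks s + 1 + (\<Sum>i<vars s vN. 10 + 20 * (d * (n div 2 ^ i)))"
  proof (rule For_rule, goal_cases)
    case 1
    have "fst ` set ?E \<subseteq> {..<n}" using E(3) by force
    then have "card (fst ` set ?E) \<le> n" using card_mono[of "{..<n}" "fst ` set ?E"] by simp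
    then have "good 0 ?E (\<lambda>_. [])" unfolding good_def using E by simp
    then show ?case unfolding I_def fresh_degrees_def using fresh[unfolded fresh_degrees_def]
      by (intro conjI exI[of _ "\<lambda>_. []"]) (simp_all add: hubs_def pairs_at_def)
  next
    case (2 i t)
    let ?t = "tick (set_var vPH i t)"
    obtain Out where t: "fresh_degrees t" "\<And>v. hubs t v = hubs s v @ Out v" "good i (edges t) Out"
      using 2(2) unfolding I_def by blast
    have eq: "edges ?t = edges t" "hubs ?t = hubs t" by (simp_all add: pairs_at_def hubs_def fun_eq_iff)
    have v: "vars ?t vZ = 0" "vars ?t vTwo = 2" "\<And>g x. vars ?t vG \<le> g \<Longrightarrow> arr ?t tDeg g x 0 = 0"
      using 2(3) Z t(1) by (auto simp: fresh_degrees_def)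
    note p = peel_phase[OF v, where n = n and inp = inp, unfolded eq]
    let ?O = "\<lambda>v. Out v @ map snd (filter (\<lambda>e. fst e = v \<and> \<not> high_tail (edges t) v) (edges t))"
    have "I (Suc i) (sem n inp peel_phase ?t)"
      unfolding I_def
    proof (intro conjI exI[of _ ?O] allI)
      show "fresh_degrees (sem n inp peel_phase ?t)" unfolding fresh_degrees_def using p(3) by blast
      show "good (Suc i) (edges (sem n inp peel_phase ?t)) ?O"
        using step[OF t(3)] p(1) by simp
      show "hubs (sem n inp peel_phase ?t) v = hubs s v @ ?O v" for v
        using p(2)[of v] t(2)[of v] by simp
    qed
    moreover have "ticks (sem n inp peel_phase ?t) \<le> ticks t + (10 + 20 * (d * (n div 2 ^ i)))"
      using p(4) lenE2[OF t(3)] by simp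
    ultimately show ?case by blast
  qed
  then have fin: "I n s'" "ticks s' \<le> ticks s + 1 + (\<Sum>i<n. 10 + 20 * (d * (n div 2 ^ i)))"
    unfolding s'_def orient_def Z(3) by blast+
  have "(\<Sum>i<n. 10 + 20 * (d * (n div 2 ^ i))) = 10 * n + 20 * (d * (\<Sum>i<n. n div 2 ^ i))"
    by (simp add: sum.distrib sum_distrib_left)
  also have "\<dots> \<le> 10 * n + 20 * (d * (2 * n))"
    by (intro add_left_mono mult_le_mono2 sum_halves)
  finally have tk: "ticks s' \<le> ticks s + 1 + (10 + 40 * d) * n" using fin(2) by (simp add: algebra_simps)
  obtain Out where o: "fresh_degrees s'" "\<And>v. hubs s' v = hubs s v @ Out v" "good n (edges s') Out"
    using fin(1) unfolding I_def by blast
  \<comment> \<open>\<open>n div 2 ^ n\<close> is 0: nothing is left after n phases.\<close>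
  have "length (edges s') \<le> d * (n div 2 ^ n)" by (rule lenE2[OF o(3)])
  then have nil: "edges s' = []" by simp
  show thesis
    by (rule that[of Out]) (use o nil tk in \<open>auto simp: good_def\<close>)
qed

lemma observe_tick [simp]:
  "slack (s\<lparr>ticks := a\<rparr>) = slack s" "marked (s\<lparr>ticks := a\<rparr>) = marked s"
  "hubs (s\<lparr>ticks := a\<rparr>) = hubs s" "pairs_at (s\<lparr>ticks := a\<rparr>) = pairs_at s"
  "fresh_degrees (s\<lparr>ticks := a\<rparr>) = fresh_degrees s"
  by (auto simp: slack_def marked_def hubs_def pairs_at_def fresh_degrees_def fun_eq_iff)

lemma observe_vars [simp]:
  "slack (s\<lparr>vars := a\<rparr>) = slack s" "marked (s\<lparr>vars := a\<rparr>) = marked s"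
  "hubs (s\<lparr>vars := a\<rparr>) = hubs s" "pairs_at (s\<lparr>vars := a\<rparr>) = pairs_at s"
  by (auto simp: slack_def marked_def hubs_def pairs_at_def fun_eq_iff)

lemma observe_frame:
  "tD \<notin> mod_arrs c \<Longrightarrow> slack (sem n inp c s) = slack s"
  "tAdj \<notin> mod_arrs c \<Longrightarrow> marked (sem n inp c s) = marked s"
  "tHc \<notin> mod_arrs c \<Longrightarrow> tH \<notin> mod_arrs c \<Longrightarrow> hubs (sem n inp c s) = hubs s"
  "tEX \<notin> mod_arrs c \<Longrightarrow> tEY \<notin> mod_arrs c \<Longrightarrow> pairs_at (sem n inp c s) = pairs_at s"
  by (auto simp: slack_def marked_def hubs_def pairs_at_def frame_arr fun_eq_iff)

lemma fresh_degrees_frame: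
  assumes "fresh_degrees s" "tDeg \<notin> mod_arrs c" "vG \<notin> mod_vars c"
  shows "fresh_degrees (sem n inp c s)"
  using assms by (simp add: fresh_degrees_def frame_arr frame_var)

text \<open>For loops whose iterations are separate tasks: the invariant speaks of the set of tasks
  done. Nested loops compose, because an inner loop just adds its whole set of tasks to the same
  invariant.\<close>

lemma For_collect:
  assumes init: "J Q (tick s)"
    and step: "\<And>i s' Q'. i < vars s y \<Longrightarrow> J Q' s' \<Longrightarrow>
      (\<And>z. z \<notin> insert x (mod_vars c) \<Longrightarrow> vars s' z = vars s z) \<Longrightarrow>
      (\<And>t. t \<notin> mod_arrs c \<Longrightarrow> arr s' t = arr s t) \<Longrightarrow>
      J (Q' \<union> F i) (sem n inp c (tick (set_var x i s'))) \<and>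
      ticks (sem n inp c (tick (set_var x i s'))) \<le> ticks s' + \<tau>"
  shows "J (Q \<union> (\<Union>i<vars s y. F i)) (sem n inp (For x y c) s) \<and>
    ticks (sem n inp (For x y c) s) \<le> ticks s + 1 + vars s y * \<tau>"
proof -
  have "(\<lambda>i. J (Q \<union> (\<Union>j<i. F j))) (vars s y) (sem n inp (For x y c) s) \<and>
    ticks (sem n inp (For x y c) s) \<le> ticks s + 1 + (\<Sum>i<vars s y. \<tau>)"
  proof (rule For_rule, goal_cases)
    case (2 i s')
    have "Q \<union> (\<Union>j<Suc i. F j) = (Q \<union> (\<Union>j<i. F j)) \<union> F i" by (auto simp: lessThan_Suc)
    then show ?case using step[OF 2] by simp
  qed (use init in simp)
  then show ?thesis by simp
qed

text \<open>Entries are only upper bounds on directed distances. That they are good enough is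
  asserted separately, along the walks that matter.\<close>

definition sound_slack :: "nat \<Rightarrow> 'a rel \<Rightarrow> ('a \<Rightarrow> 'a \<Rightarrow> nat) \<Rightarrow> bool" where
  "sound_slack k R D \<longleftrightarrow> (\<forall>x y. 0 < D x y \<longrightarrow> (\<exists>i. (x, y) \<in> R ^^ i \<and> i + D x y \<le> Suc k))"

lemma sound_slack_le: "sound_slack k R D \<Longrightarrow> D x y \<le> Suc k"
  unfolding sound_slack_def by (metis add_leD2 gr0I le0)

lemma relax_sound:
  assumes s: "sound_slack k R (slack s)" and K: "vars s vK1 = Suc k"
    and Z: "vars s vZ = 0" "x \<notin> {vA, vB, vC}" "v \<notin> {vA, vB, vC}" "y \<notin> {vA, vB, vC}"
  shows "sound_slack k R (slack (sem n inp (relax x v y) s))"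
    and "slack s a b \<le> slack (sem n inp (relax x v y) s) a b"
    and "slack s (vars s x) (vars s v) - (Suc k - slack s (vars s v) (vars s y))
      \<le> slack (sem n inp (relax x v y) s) (vars s x) (vars s y)"
proof -
  note r = relax(1)[OF Z, of n inp, unfolded K]
  let ?x = "vars s x" and ?v = "vars s v" and ?y = "vars s y"
  show "slack s a b \<le> slack (sem n inp (relax x v y) s) a b" unfolding r by simp
  show "slack s ?x ?v - (Suc k - slack s ?v ?y) \<le> slack (sem n inp (relax x v y) s) ?x ?y" unfolding r by simp
  have "\<exists>i. (?x, ?y) \<in> R ^^ i \<and> i + (slack s ?x ?v - (Suc k - slack s ?v ?y)) \<le> Suc k"
    if pos: "0 < slack s ?x ?v - (Suc k - slack s ?v ?y)"
  proof -
    have b: "slack s ?x ?v \<le> Suc k" "slack s ?v ?y \<le> Suc k" using sound_slack_le[OF s] by auto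
    then have "0 < slack s ?x ?v" "0 < slack s ?v ?y" using pos by linarith+
    then obtain i j where i: "(?x, ?v) \<in> R ^^ i" "i + slack s ?x ?v \<le> Suc k"
      and j: "(?v, ?y) \<in> R ^^ j" "j + slack s ?v ?y \<le> Suc k" using s unfolding sound_slack_def by blast
    have "(?x, ?y) \<in> R ^^ (i + j)" using i(1) j(1) by (auto simp: relpow_add)
    moreover have "i + j + (slack s ?x ?v - (Suc k - slack s ?v ?y)) \<le> Suc k"
      using i(2) j(2) pos by linarith
    ultimately show ?thesis by blast
  qed
  then show "sound_slack k R (slack (sem n inp (relax x v y) s))"
    using s unfolding r sound_slack_def by (simp add: max_def)
qed

text \<open>An arc gives a distance in its own direction only, but an edge in both, since hubs are
  built in the underlying graph.\<close>

definition init_input :: loop_com where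
  "init_input = Const vOne 1 ;; Const vTwo 2 ;; Inc vK1 vK ;; For vV vN (Put tD vV vV vZ vK1) ;;
    For vI vM (Inp vX vP ;; Inc vP vP ;; Inp vY vP ;; Inc vP vP ;; Put tD vX vY vZ vK ;;
      add_edge vX vY ;; add_edge vY vX)"

lemma mod_init_input [simp]:
  "mod_vars init_input = {vOne, vTwo, vK1, vV, vI, vX, vY, vP, vA, vEC}"
  "mod_arrs init_input = {tD, tAdj, tEX, tEY}"
  by (auto simp: init_input_def)

lemma init_input:
  fixes n k :: nat and inp :: "nat \<Rightarrow> nat" and s :: loop_state
  assumes s: "vars s = (\<lambda>_. 0)(vN := n, vM := length es, vK := k)" "arr s = (\<lambda>_ _ _ _. 0)"
    and inp: "\<forall>i<length es. inp (2 * i) = fst (es ! i) \<and> inp (Suc (2 * i)) = snd (es ! i)"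
    and es: "set es \<subseteq> {..<n} \<times> {..<n}" "irrefl (set es)"
  defines "s' \<equiv> sem n inp init_input s"
  shows "slack s' x y = (if (x, y) \<in> set es then k else if x = y \<and> x < n then Suc k else 0)"
    and "marked s' = set es \<union> (set es)\<inverse>" "distinct (edges s')" "set (edges s') = set es \<union> (set es)\<inverse>"
    and "hubs s' = (\<lambda>_. [])" "fresh_degrees s'" "vars s' vOne = 1" "vars s' vTwo = 2" "vars s' vK1 = Suc k"
    and "ticks s' \<le> ticks s + 5 + 2 * n + 18 * length es"
proof -
  let ?s1 = "sem n inp (Const vOne 1 ;; Const vTwo 2 ;; Inc vK1 vK) s"
  let ?s2 = "sem n inp (For vV vN (Put tD vV vV vZ vK1)) ?s1"
  let ?c = "Inp vX vP ;; Inc vP vP ;; Inp vY vP ;; Inc vP vP ;; Put tD vX vY vZ vK ;;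
      add_edge vX vY ;; add_edge vY vX"
  have s1: "vars ?s1 vN = n" "vars ?s1 vK1 = Suc k" "vars ?s1 vZ = 0" "vars ?s1 vOne = 1" "vars ?s1 vTwo = 2"
    "vars ?s1 vK = k" "vars ?s1 vP = 0" "vars ?s1 vM = length es" "vars ?s1 vEC = 0" "vars ?s1 vG = 0"
    "slack ?s1 = (\<lambda>_ _. 0)" "ticks ?s1 = ticks s + 3"
    using s by (simp_all add: slack_def fun_eq_iff)
  have "(\<lambda>i t. slack t = (\<lambda>x y. if x = y \<and> x < i then Suc k else 0)) (vars ?s1 vN) ?s2 \<and>
      ticks ?s2 \<le> ticks ?s1 + 1 + (\<Sum>i<vars ?s1 vN. 2)"
  proof (rule For_rule, goal_cases)
    case 1
    then show ?case using s1 by simp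
  next
    case (2 i t)
    have "vars t vZ = 0" "vars t vK1 = Suc k" using 2(3) s1(2,3) by simp_all
    then show ?case using 2(2) by (auto simp: slack_def fun_eq_iff)
  qed
  then have s2: "slack ?s2 = (\<lambda>x y. if x = y \<and> x < n then Suc k else 0)" "ticks ?s2 \<le> ticks s + 4 + 2 * n"
    unfolding s1(1,12) by simp_all
  have s2v: "vars ?s2 vZ = 0" "vars ?s2 vOne = 1" "vars ?s2 vTwo = 2" "vars ?s2 vK1 = Suc k" "vars ?s2 vG = 0"
    "vars ?s2 vK = k" "vars ?s2 vP = 0" "vars ?s2 vM = length es" "vars ?s2 vEC = 0"
    using s1 by (simp_all add: frame_var)
  have s2a: "marked ?s2 = {}" "hubs ?s2 = (\<lambda>_. [])" "arr ?s2 tDeg = (\<lambda>_ _ _. 0)"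
    using s by (simp_all add: observe_frame frame_arr) (auto simp: marked_def hubs_def)
  define I where "I i t \<longleftrightarrow> vars t vP = 2 * i \<and>
    slack t = (\<lambda>x y. if (x, y) \<in> set (take i es) then k else if x = y \<and> x < n then Suc k else 0) \<and>
    marked t = set (take i es) \<union> (set (take i es))\<inverse> \<and> distinct (edges t) \<and> set (edges t) = marked t"
    for i and t :: loop_state
  have "I (vars ?s2 vM) (sem n inp (For vI vM ?c) ?s2) \<and>
      ticks (sem n inp (For vI vM ?c) ?s2) \<le> ticks ?s2 + 1 + (\<Sum>i<vars ?s2 vM. 18)"
  proof (rule For_rule, goal_cases)
    case 1
    then show ?case using s2v s2 s2a by (simp add: I_def pairs_at_def)
  next
    case (2 i t)
    have i: "i < length es" using 2(1) s2v by simp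
    obtain u w where uw: "es ! i = (u, w)" by (cases "es ! i")
    have "(u, w) \<in> set es" using i uw by (metis nth_mem)
    then have ne: "u \<noteq> w" using es(2) by (auto simp: irrefl_def)
    have v: "vars t vZ = 0" "vars t vOne = 1" "vars t vK = k" using 2(3) s2v by simp_all
    have J: "vars t vP = 2 * i"
      "slack t = (\<lambda>x y. if (x, y) \<in> set (take i es) then k else if x = y \<and> x < n then Suc k else 0)"
      "marked t = set (take i es) \<union> (set (take i es))\<inverse>" "distinct (edges t)" "set (edges t) = marked t"
      using 2(2) unfolding I_def by blast+
    define t1 where "t1 = sem n inp (Inp vX vP ;; Inc vP vP ;; Inp vY vP ;; Inc vP vP ;; Put tD vX vY vZ vK)
      (tick (set_var vI i t))"
    have p: "inp (2 * i) = u" "inp (Suc (2 * i)) = w" using inp i uw by simp_all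
    have t1: "vars t1 vP = 2 * Suc i" "vars t1 vX = u" "vars t1 vY = w" "vars t1 vZ = 0" "vars t1 vOne = 1"
      "slack t1 = (\<lambda>x y. if (x, y) = (u, w) then k else slack t x y)" "marked t1 = marked t"
      "edges t1 = edges t" "ticks t1 = ticks t + 6"
      unfolding t1_def using v J(1) p by (auto simp: slack_def marked_def pairs_at_def fun_eq_iff)
    define t2 where "t2 = sem n inp (add_edge vX vY) t1"
    have t2: "vars t2 vP = 2 * Suc i" "vars t2 vX = u" "vars t2 vY = w" "vars t2 vZ = 0" "vars t2 vOne = 1"
      "slack t2 = slack t1" using t1 by (simp_all add: t2_def frame_var observe_frame)
    note a1 = add_edge[OF t1(4,5), of vX vY n inp, folded t2_def, unfolded t1]
    note a2 = add_edge[OF t2(4,5), of vY vX n inp, unfolded t2]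
    define t3 where "t3 = sem n inp (add_edge vY vX) t2"
    have t3: "vars t3 vP = 2 * Suc i" "slack t3 = slack t1"
      using t2 by (simp_all add: t3_def frame_var observe_frame)
    have eq: "sem n inp ?c (tick (set_var vI i t)) = t3" by (simp add: t3_def t2_def t1_def)
    have tk: "take (Suc i) es = take i es @ [(u, w)]" using i uw by (simp add: take_Suc_conv_app_nth)
    have "marked t2 = insert (u, w) (marked t)" using a1(1) by simp
    moreover have e2: "distinct (edges t2)" "set (edges t2) = marked t2"
      using a1 J(4,5) by (auto split: if_splits)
    moreover have "marked t3 = insert (w, u) (marked t2)" using a2(1) by (simp add: t3_def)
    moreover have "distinct (edges t3)" "set (edges t3) = marked t3"
      using a2 e2 by (auto simp: t3_def split: if_splits)
    moreover have "slack t3 = (\<lambda>x y. if (x, y) \<in> set (take (Suc i) es) then k else if x = y \<and> x < n then Suc k else 0)"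
      unfolding t3 t1(6) J(2) tk by (auto simp: fun_eq_iff)
    ultimately have "I (Suc i) t3" unfolding I_def using t3(1) J(3) unfolding tk by auto
    moreover have "ticks t3 \<le> ticks t + 18"
      using a1(3) a2(3) t1(9) by (simp add: t3_def)
    ultimately show ?case unfolding eq by blast
  qed
  moreover have s': "s' = sem n inp (For vI vM ?c) ?s2" by (simp add: s'_def init_input_def)
  ultimately have I: "I (length es) s'" "ticks s' \<le> ticks s + 5 + 2 * n + 18 * length es"
    using s2(2) unfolding s2v by simp_all
  then show "slack s' x y = (if (x, y) \<in> set es then k else if x = y \<and> x < n then Suc k else 0)"
    "marked s' = set es \<union> (set es)\<inverse>" "distinct (edges s')" "set (edges s') = set es \<union> (set es)\<inverse>"
    unfolding I_def by simp_all
  show "ticks s' \<le> ticks s + 5 + 2 * n + 18 * length es" by (rule I(2))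
  show "hubs s' = (\<lambda>_. [])" "fresh_degrees s'" "vars s' vOne = 1" "vars s' vTwo = 2" "vars s' vK1 = Suc k"
    unfolding s' using s2a s2v by (simp_all add: observe_frame frame_var fresh_degrees_def frame_arr)
qed

section \<open>Joining hubs of a common vertex\<close>

definition fraternal_pair :: loop_com where
  "fraternal_pair = relax vX vV vY ;; Cond vX vY (add_edge vX vY) (Cond vY vX (add_edge vX vY) Nop)"

definition fraternal_edges :: loop_com where
  "fraternal_edges = For vV vN (Get vHC tHc vV vZ vZ ;; For vI vHC (Get vX tH vV vI vZ ;;
    For vJ vHC (Get vY tH vV vJ vZ ;; fraternal_pair)))"

lemma mod_fraternal_pair [simp]: "mod_vars fraternal_pair = {vA, vB, vC, vEC}"
  "mod_arrs fraternal_pair = {tD, tAdj, tEX, tEY}"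
  by (auto simp: fraternal_pair_def)

lemma mod_fraternal_edges [simp]: "mod_vars fraternal_edges = {vA, vB, vC, vEC, vV, vHC, vI, vX, vJ, vY}"
  "mod_arrs fraternal_edges = {tD, tAdj, tEX, tEY}"
  by (auto simp: fraternal_edges_def)

text \<open>\<open>Q\<close> is the set of triples treated so far, a vertex with two of its hubs.
  The required values refer to the slacks of the start state \<open>s\<close>, which suffices
  because relaxation never decreases an entry.\<close>

definition fraternal_inv :: "nat \<Rightarrow> nat rel \<Rightarrow> loop_state \<Rightarrow> (nat \<times> nat \<times> nat) set \<Rightarrow> loop_state \<Rightarrow> bool" where
  "fraternal_inv k R s Q t \<longleftrightarrow> sound_slack k R (slack t) \<and> (\<forall>x y. slack s x y \<le> slack t x y) \<and>
    (\<forall>(c, x, y)\<in>Q. slack s x c - (Suc k - slack s c y) \<le> slack t x y) \<and>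
    marked t = marked s \<union> {(x, y). x \<noteq> y \<and> (\<exists>c. (c, x, y) \<in> Q)} \<and> distinct (edges t) \<and>
    set (edges t) = {(x, y). x \<noteq> y \<and> (\<exists>c. (c, x, y) \<in> Q)} - marked s"

lemma fraternal_inv_cong:
  "slack t' = slack t \<Longrightarrow> marked t' = marked t \<Longrightarrow> edges t' = edges t \<Longrightarrow>
    fraternal_inv k R s Q t \<Longrightarrow> fraternal_inv k R s Q t'"
  by (simp add: fraternal_inv_def)

lemma fraternal_pair:
  assumes I: "fraternal_inv k R s Q t" and K: "vars t vK1 = Suc k" and Z: "vars t vZ = 0" "vars t vOne = 1"
  shows "fraternal_inv k R s (insert (vars t vV, vars t vX, vars t vY) Q) (sem n inp fraternal_pair t)"
    and "ticks (sem n inp fraternal_pair t) \<le> ticks t + 15"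
proof -
  let ?c = "vars t vV" and ?x = "vars t vX" and ?y = "vars t vY"
  define t1 where "t1 = sem n inp (relax vX vV vY) t"
  have J: "sound_slack k R (slack t)" "\<And>x y. slack s x y \<le> slack t x y"
    "\<And>c x y. (c, x, y) \<in> Q \<Longrightarrow> slack s x c - (Suc k - slack s c y) \<le> slack t x y"
    "marked t = marked s \<union> {(x, y). x \<noteq> y \<and> (\<exists>c. (c, x, y) \<in> Q)}" "distinct (edges t)"
    "set (edges t) = {(x, y). x \<noteq> y \<and> (\<exists>c. (c, x, y) \<in> Q)} - marked s"
    using I unfolding fraternal_inv_def by blast+
  note r = relax_sound[OF J(1) K Z(1), where x = vX and v = vV and y = vY and n = n and inp = inp, folded t1_def, simplified]
  have t1: "vars t1 vX = ?x" "vars t1 vY = ?y" "vars t1 vZ = 0" "vars t1 vOne = 1" "marked t1 = marked t"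
    "edges t1 = edges t" "ticks t1 \<le> ticks t + 7"
    using Z relax(2)[of t vX vV vY n inp] by (simp_all add: t1_def frame_var observe_frame)
  define t2 where "t2 = sem n inp (Cond vX vY (add_edge vX vY) (Cond vY vX (add_edge vX vY) Nop)) t1"
  have sl: "slack t2 = slack t1" unfolding t2_def by (rule observe_frame) simp
  have mk: "marked t2 = (if ?x = ?y then marked t else insert (?x, ?y) (marked t))"
    and ed: "edges t2 = (if ?x = ?y \<or> (?x, ?y) \<in> marked t then edges t else edges t @ [(?x, ?y)])"
    and tk: "ticks t2 \<le> ticks t + 15"
    using t1 add_edge[of "tick t1" vX vY n inp] add_edge[of "tick (tick t1)" vX vY n inp]
    unfolding t2_def by (auto split: if_splits simp del: One_nat_def)
  have eq: "sem n inp fraternal_pair t = t2" by (simp add: t2_def t1_def fraternal_pair_def)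
  show "ticks (sem n inp fraternal_pair t) \<le> ticks t + 15" unfolding eq by (rule tk)
  have 1: "sound_slack k R (slack t2)" unfolding sl using r(1) by simp
  have 2: "slack s x y \<le> slack t2 x y" for x y
    unfolding sl using J(2)[of x y] r(2)[of x y] by simp
  have new: "slack s ?x ?c - (Suc k - slack s ?c ?y) \<le> slack t2 ?x ?y"
    using r(3) J(2)[of ?x ?c] J(2)[of ?c ?y] unfolding sl by simp
  have 3: "slack s x c - (Suc k - slack s c y) \<le> slack t2 x y" if "(c, x, y) \<in> insert (?c, ?x, ?y) Q" for c x y
  proof (cases "(c, x, y) \<in> Q")
    case True
    then show ?thesis using J(3)[OF True] r(2)[of x y] unfolding sl by simp
  next
    case False
    then show ?thesis using that new by auto
  qed
  have P: "{(x, y). x \<noteq> y \<and> (\<exists>c. (c, x, y) \<in> insert (?c, ?x, ?y) Q)} =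
    {(x, y). x \<noteq> y \<and> (\<exists>c. (c, x, y) \<in> Q)} \<union> (if ?x = ?y then {} else {(?x, ?y)})" by auto
  show "fraternal_inv k R s (insert (?c, ?x, ?y) Q) (sem n inp fraternal_pair t)"
    unfolding fraternal_inv_def eq P
  proof (intro conjI)
    show "marked t2 = marked s \<union> ({(x, y). x \<noteq> y \<and> (\<exists>c. (c, x, y) \<in> Q)} \<union> (if ?x = ?y then {} else {(?x, ?y)}))"
      unfolding mk J(4) by auto
    show "distinct (edges t2)" unfolding ed using J(4-6) by auto
    show "set (edges t2) = {(x, y). x \<noteq> y \<and> (\<exists>c. (c, x, y) \<in> Q)} \<union> (if ?x = ?y then {} else {(?x, ?y)}) - marked s"
      unfolding ed using J(4-6) by (auto simp: J(6))
  qed (use 1 2 3 in auto)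
qed

lemma fraternal_edges:
  fixes n k :: nat and inp :: "nat \<Rightarrow> nat" and s :: loop_state
  assumes Z: "vars s vZ = 0" "vars s vOne = 1" "vars s vK1 = Suc k" "vars s vN = n"
    and snd: "sound_slack k R (slack s)" and E: "edges s = []"
    and \<Delta>: "\<And>v. length (hubs s v) \<le> \<Delta>"
  defines "s' \<equiv> sem n inp fraternal_edges s"
  shows "fraternal_inv k R s {(c, x, y). c < n \<and> x \<in> set (hubs s c) \<and> y \<in> set (hubs s c)} s'"
    and "ticks s' \<le> ticks s + 1 + n * (3 + \<Delta> * (3 + \<Delta> * 17))"
proof -
  let ?J = "fraternal_inv k R s"
  let ?h = "\<lambda>c. arr s tHc c 0 0"
  let ?F = "\<lambda>c. {(c, x, y) | x y. x \<in> set (hubs s c) \<and> y \<in> set (hubs s c)}"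
  have hubs_arr: "set (hubs t c) = (\<lambda>i. arr t tH c i 0) ` {..<arr t tHc c 0 0}" "length (hubs t c) = arr t tHc c 0 0"
    for t c by (simp_all add: hubs_def set_seq)
  have "?J ({} \<union> (\<Union>c<vars s vN. ?F c)) (sem n inp fraternal_edges s) \<and>
    ticks (sem n inp fraternal_edges s) \<le> ticks s + 1 + vars s vN * (3 + \<Delta> * (3 + \<Delta> * 17))"
    unfolding fraternal_edges_def
  proof (rule For_collect, goal_cases)
    case 1
    then show ?case using snd E by (simp add: fraternal_inv_def)
  next
    case (2 c t Q)
    define t1 where "t1 = sem n inp (Get vHC tHc vV vZ vZ) (tick (set_var vV c t))"
    have t: "vars t vZ = 0" "vars t vOne = 1" "vars t vK1 = Suc k" "arr t tHc = arr s tHc" "arr t tH = arr s tH"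
      using 2(3,4) Z by auto
    have t1: "vars t1 vZ = 0" "vars t1 vOne = 1" "vars t1 vK1 = Suc k" "arr t1 = arr t" "vars t1 vV = c"
      "vars t1 vHC = ?h c" "ticks t1 = ticks t + 2"
      using t by (simp_all add: t1_def)
    have J1: "?J Q t1" by (rule fraternal_inv_cong[OF _ _ _ 2(2)]) (simp_all add: t1_def)
    have A: "?J (Q \<union> (\<Union>i<vars t1 vHC. {(c, arr s tH c i 0, y) | y. y \<in> set (hubs s c)}))
        (sem n inp (For vI vHC (Get vX tH vV vI vZ ;; For vJ vHC (Get vY tH vV vJ vZ ;; fraternal_pair))) t1) \<and>
      ticks (sem n inp (For vI vHC (Get vX tH vV vI vZ ;; For vJ vHC (Get vY tH vV vJ vZ ;; fraternal_pair))) t1)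
        \<le> ticks t1 + 1 + vars t1 vHC * (3 + \<Delta> * 17)"
    proof (rule For_collect, goal_cases)
      case 1
      then show ?case by (rule fraternal_inv_cong[OF _ _ _ J1]) simp_all
    next
      case (2 i u Q)
      define u1 where "u1 = sem n inp (Get vX tH vV vI vZ) (tick (set_var vI i u))"
      have u: "vars u vZ = 0" "vars u vOne = 1" "vars u vK1 = Suc k" "arr u tHc = arr s tHc" "arr u tH = arr s tH"
        "vars u vV = c" "vars u vHC = ?h c" using 2(3,4) t t1 by auto
      have u1: "vars u1 vZ = 0" "vars u1 vOne = 1" "vars u1 vK1 = Suc k" "arr u1 = arr u" "vars u1 vV = c"
        "vars u1 vHC = ?h c" "vars u1 vX = arr s tH c i 0" "ticks u1 = ticks u + 2"
        using u by (simp_all add: u1_def)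
      have J2: "?J Q u1" by (rule fraternal_inv_cong[OF _ _ _ 2(2)]) (simp_all add: u1_def)
      have "?J (Q \<union> (\<Union>j<vars u1 vHC. {(c, arr s tH c i 0, arr s tH c j 0)}))
          (sem n inp (For vJ vHC (Get vY tH vV vJ vZ ;; fraternal_pair)) u1) \<and>
        ticks (sem n inp (For vJ vHC (Get vY tH vV vJ vZ ;; fraternal_pair)) u1) \<le> ticks u1 + 1 + vars u1 vHC * 17"
      proof (rule For_collect, goal_cases)
        case 1
        then show ?case by (rule fraternal_inv_cong[OF _ _ _ J2]) simp_all
      next
        case (2 j w Q)
        define w1 where "w1 = sem n inp (Get vY tH vV vJ vZ) (tick (set_var vJ j w))"
        have w: "vars w vZ = 0" "vars w vOne = 1" "vars w vK1 = Suc k" "arr w tH = arr s tH"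
          "vars w vV = c" "vars w vX = arr s tH c i 0" using 2(3,4) u u1 by auto
        have w1: "vars w1 vZ = 0" "vars w1 vOne = 1" "vars w1 vK1 = Suc k" "vars w1 vV = c"
          "vars w1 vX = arr s tH c i 0" "vars w1 vY = arr s tH c j 0" "ticks w1 = ticks w + 2"
          using w by (simp_all add: w1_def)
        have J3: "?J Q w1" by (rule fraternal_inv_cong[OF _ _ _ 2(2)]) (simp_all add: w1_def)
        have eq: "sem n inp (Get vY tH vV vJ vZ ;; fraternal_pair) (tick (set_var vJ j w)) = sem n inp fraternal_pair w1"
          by (simp add: w1_def)
        show ?case unfolding eq
          using fraternal_pair[OF J3 w1(3) w1(1,2), of n inp] unfolding w1(4-7) by simp
      qed
      moreover have "sem n inp (Get vX tH vV vI vZ ;; For vJ vHC (Get vY tH vV vJ vZ ;; fraternal_pair)) (tick (set_var vI i u))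
          = sem n inp (For vJ vHC (Get vY tH vV vJ vZ ;; fraternal_pair)) u1" by (simp add: u1_def)
      moreover have "(\<Union>j<vars u1 vHC. {(c, arr s tH c i 0, arr s tH c j 0)}) = {(c, arr s tH c i 0, y) | y. y \<in> set (hubs s c)}"
        unfolding u1 hubs_arr by auto
      moreover have "vars u1 vHC * 17 \<le> \<Delta> * 17" unfolding u1 using \<Delta>[of c] hubs_arr(2)[of s c] by simp
      ultimately show ?case using u1(8) by simp
    qed
    moreover have "sem n inp (Get vHC tHc vV vZ vZ ;; For vI vHC (Get vX tH vV vI vZ ;; For vJ vHC (Get vY tH vV vJ vZ ;; fraternal_pair)))
      (tick (set_var vV c t)) = sem n inp (For vI vHC (Get vX tH vV vI vZ ;; For vJ vHC (Get vY tH vV vJ vZ ;; fraternal_pair))) t1"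
      by (simp add: t1_def)
    moreover have "(\<Union>i<vars t1 vHC. {(c, arr s tH c i 0, y) | y. y \<in> set (hubs s c)}) = ?F c"
      unfolding t1 hubs_arr by auto
    moreover have "vars t1 vHC * (3 + \<Delta> * 17) \<le> \<Delta> * (3 + \<Delta> * 17)"
      unfolding t1 using \<Delta>[of c] hubs_arr(2)[of s c] by (intro mult_le_mono1) simp
    then have "ticks (sem n inp (For vI vHC (Get vX tH vV vI vZ ;; For vJ vHC (Get vY tH vV vJ vZ ;; fraternal_pair))) t1)
        \<le> ticks t + (3 + \<Delta> * (3 + \<Delta> * 17))" using A t1(7) by linarith
    ultimately show ?case using A by simp
  qed
  moreover have "{} \<union> (\<Union>c<vars s vN. ?F c) = {(c, x, y). c < n \<and> x \<in> set (hubs s c) \<and> y \<in> set (hubs s c)}"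
    unfolding Z by auto
  ultimately show "fraternal_inv k R s {(c, x, y). c < n \<and> x \<in> set (hubs s c) \<and> y \<in> set (hubs s c)} s'"
    "ticks s' \<le> ticks s + 1 + n * (3 + \<Delta> * (3 + \<Delta> * 17))"
    unfolding s'_def Z by simp_all
qed

text \<open>Trace length, congestion and number of hubs after i rounds: the first two follow
  \<open>augmentation_fraternal\<close>, the third adds the peeling bound of each orientation. The
  density \<open>d\<close> is queried at the current trace length, and n does not enter.\<close>

primrec hub_bounds :: "(nat \<Rightarrow> nat) \<Rightarrow> nat \<Rightarrow> nat \<times> nat \<times> nat" where
  "hub_bounds d 0 = (1, 0, 2 * link_density 1 0 (d 1) + 1)"
| "hub_bounds d (Suc i) = (case hub_bounds d i of (l, C, \<Delta>) \<Rightarrow>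
    let l' = 2 * l; C' = C + \<Delta> * \<Delta> + 2 * C * \<Delta>
    in (l', C', \<Delta> + (2 * link_density l' C' (d l') + 1)))"

definition hub_bound :: "(nat \<Rightarrow> nat) \<Rightarrow> nat \<Rightarrow> nat" where
  "hub_bound d i = snd (snd (hub_bounds d i))"

text \<open>After i rounds the potential of \<open>short_walk\<close> is down to k - i. Traces run
  in \<open>R \<union> R\<inverse>\<close>, but reachability and slacks refer to \<open>R\<close>.
  The empty edge list and fresh degree rows are what the next round starts from.\<close>

definition round_inv :: "nat \<Rightarrow> nat \<Rightarrow> nat rel \<Rightarrow> (nat \<Rightarrow> nat) \<Rightarrow> nat \<Rightarrow> loop_state \<Rightarrow> bool" where
  "round_inv n k R d i t \<longleftrightarrow>
    augmentation {..<n} (R \<union> R\<inverse>) (fst (hub_bounds d i)) (fst (snd (hub_bounds d i))) (marked t) \<and>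
    (\<forall>v h. h \<in> set (hubs t v) \<longrightarrow> (v, h) \<in> marked t) \<and>
    (\<forall>v. length (hubs t v) \<le> hub_bound d i) \<and>
    (\<forall>x y. (x, y) \<in> marked t \<longrightarrow> y \<in> set (hubs t x) \<or> x \<in> set (hubs t y)) \<and>
    sound_slack k R (slack t) \<and> (\<forall>v<n. slack t v v = Suc k) \<and>
    (\<forall>u<n. \<forall>v<n. (\<exists>j\<le>k. (u, v) \<in> R ^^ j) \<longrightarrow>
      short_walk k (k - i) (marked t) (\<lambda>v. set (hubs t v)) (\<lambda>x y. Suc k - slack t x y) u v) \<and>
    edges t = [] \<and> fresh_degrees t"

text \<open>Only the edges of the current list are oriented. Earlier hubs stay, so the bounds per
  vertex add up and edges oriented before remain covered.\<close>

lemma augmentation_orient: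
  fixes n :: nat and inp :: "nat \<Rightarrow> nat" and s :: loop_state
  assumes Z: "vars s vZ = 0" "vars s vTwo = 2" "vars s vN = n" and fresh: "fresh_degrees s"
    and aug: "augmentation {..<n} R l C (marked s)" and mb: "minor_bound l {..<n} R d"
    and E: "distinct (edges s)" "sym (set (edges s))" "set (edges s) \<subseteq> marked s"
    and hubs: "\<forall>v. \<forall>h\<in>set (hubs s v). (v, h) \<in> marked s" "\<forall>v. length (hubs s v) \<le> \<Delta>"
    and cover: "\<forall>x y. (x, y) \<in> marked s - set (edges s) \<longrightarrow> y \<in> set (hubs s x) \<or> x \<in> set (hubs s y)"
  defines "s' \<equiv> sem n inp orient s" and "d' \<equiv> link_density l C d"
  shows "\<And>v h. h \<in> set (hubs s' v) \<Longrightarrow> (v, h) \<in> marked s'" "\<And>v. length (hubs s' v) \<le> \<Delta> + (2 * d' + 1)"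
    "\<And>x y. (x, y) \<in> marked s' \<Longrightarrow> y \<in> set (hubs s' x) \<or> x \<in> set (hubs s' y)"
    "\<And>v. set (hubs s v) \<subseteq> set (hubs s' v)"
    "edges s' = []" "fresh_degrees s'" "ticks s' \<le> ticks s + 1 + (10 + 40 * d') * n"
proof -
  have m: "marked s' = marked s" unfolding s'_def by (rule observe_frame) simp
  have AV: "marked s \<subseteq> {..<n} \<times> {..<n}" using aug unfolding augmentation_def by blast
  obtain Out where O: "\<And>v. hubs s' v = hubs s v @ Out v"
    "\<And>v h. h \<in> set (Out v) \<Longrightarrow> (v, h) \<in> set (edges s)"
    "\<And>v. length (Out v) \<le> 2 * d' + 1"
    "\<And>x y. (x, y) \<in> set (edges s) \<Longrightarrow> y \<in> set (Out x) \<or> x \<in> set (Out y)"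
    "edges s' = []" "fresh_degrees s'" "ticks s' \<le> ticks s + 1 + (10 + 40 * d') * n"
  proof (rule orient[OF Z fresh E(1,2), of d' inp])
    show "set (edges s) \<subseteq> {..<n} \<times> {..<n}" using E(3) AV by blast
    show "card F \<le> d' * card X" if "F \<subseteq> set (edges s)" "X \<subseteq> {..<n}" "F \<subseteq> X \<times> X" for F X
      unfolding d'_def
      by (rule augmentation_sparse[OF aug mb _ that(2)]) (use that E(3) in auto)
  qed (auto simp: s'_def)
  show "(v, h) \<in> marked s'" if "h \<in> set (hubs s' v)" for v h
    using that O(2) hubs(1) E(3) unfolding O(1) m by auto
  show "length (hubs s' v) \<le> \<Delta> + (2 * d' + 1)" for v
    using O(3)[of v] hubs(2)[rule_format, of v] unfolding O(1) by simp
  show "y \<in> set (hubs s' x) \<or> x \<in> set (hubs s' y)" if "(x, y) \<in> marked s'" for x y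
    using that O(4)[of x y] cover unfolding O(1) m by auto
  show "set (hubs s v) \<subseteq> set (hubs s' v)" for v unfolding O(1) by simp
  show "edges s' = []" "fresh_degrees s'" "ticks s' \<le> ticks s + 1 + (10 + 40 * d') * n" by (fact O)+
qed

lemma short_walk_of_relpow:
  assumes R: "R \<subseteq> A" and w: "\<And>x y. (x, y) \<in> R \<Longrightarrow> w x y \<le> 1" and uv: "(u, v) \<in> R ^^ j" "j \<le> k"
  shows "short_walk k k A H w u v"
proof -
  have "\<exists>p. p \<noteq> [] \<and> hd p = u \<and> last p = v \<and> successively (\<lambda>x y. (x, y) \<in> A) p \<and> walk_weight w p \<le> j \<and> length p = Suc j"
    using uv(1)
  proof (induction j arbitrary: u)
    case 0
    then show ?case by (intro exI[of _ "[u]"]) simp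
  next
    case (Suc j)
    then obtain x where x: "(u, x) \<in> R" "(x, v) \<in> R ^^ j" by (meson relpow_Suc_E2)
    then obtain p where p: "p \<noteq> []" "hd p = x" "last p = v" "successively (\<lambda>x y. (x, y) \<in> A) p"
      "walk_weight w p \<le> j" "length p = Suc j" using Suc.IH by blast
    then obtain q where q: "p = x # q" by (cases p) auto
    show ?case using p R x(1) w[OF x(1)] unfolding q by (intro exI[of _ "u # x # q"]) auto
  qed
  then show ?thesis using uv(2) unfolding short_walk_def by (elim exE) (rule exI, auto)
qed

section \<open>The rounds of augmentation\<close>

definition first_round :: loop_com where
  "first_round = init_input ;; orient"

definition next_round :: loop_com where
  "next_round = fraternal_edges ;; orient"

lemma first_round:
  fixes n k :: nat and inp :: "nat \<Rightarrow> nat" and s :: loop_state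
  assumes s: "vars s = (\<lambda>_. 0)(vN := n, vM := length es, vK := k)" "arr s = (\<lambda>_ _ _ _. 0)"
    and inp: "\<forall>i<length es. inp (2 * i) = fst (es ! i) \<and> inp (Suc (2 * i)) = snd (es ! i)"
    and es: "set es \<subseteq> {..<n} \<times> {..<n}" "irrefl (set es)"
    and mb: "minor_bound 1 {..<n} (set es \<union> (set es)\<inverse>) (d 1)" and k: "1 \<le> k"
  defines "s' \<equiv> sem n inp first_round s"
  shows "round_inv n k (set es) d 0 s'" "vars s' vZ = 0" "vars s' vOne = 1" "vars s' vTwo = 2" "vars s' vK1 = Suc k"
    "vars s' vN = n" "vars s' vK = k"
    "ticks s' \<le> ticks s + 6 + 2 * n + 18 * length es + (10 + 40 * link_density 1 0 (d 1)) * n"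
proof -
  let ?R = "set es"
  define s1 where "s1 = sem n inp init_input s"
  note i = init_input[OF s inp es, folded s1_def]
  have s1: "vars s1 vN = n" "vars s1 vZ = 0" "vars s1 vK = k"
    using s by (simp_all add: s1_def frame_var)
  have symR: "sym (?R \<union> ?R\<inverse>)" by (auto simp: sym_def)
  have irr: "irrefl (?R \<union> ?R\<inverse>)" using es(2) by (auto simp: irrefl_def)
  have aug: "augmentation {..<n} (?R \<union> ?R\<inverse>) 1 0 (marked s1)"
    unfolding i(2) by (rule augmentation_self[OF _ symR irr]) (use es in auto)
  have s': "s' = sem n inp orient s1" by (simp add: s'_def first_round_def s1_def)
  have pre: "sym (set (edges s1))" "set (edges s1) \<subseteq> marked s1" "\<forall>v. \<forall>h\<in>set (hubs s1 v). (v, h) \<in> marked s1"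
    "\<forall>v. length (hubs s1 v) \<le> 0"
    "\<forall>x y. (x, y) \<in> marked s1 - set (edges s1) \<longrightarrow> y \<in> set (hubs s1 x) \<or> x \<in> set (hubs s1 y)"
    unfolding i(2,4,5) using symR by auto
  note o' = augmentation_orient[OF s1(2) i(8) s1(1) i(6) aug mb i(3) pre, where inp = inp, folded s']
  have obs: "marked s' = marked s1" "slack s' = slack s1" unfolding s' by (simp_all add: observe_frame)
  have sl: "slack s' x y = (if (x, y) \<in> set es then k else if x = y \<and> x < n then Suc k else 0)" for x y
    unfolding obs using i(1) .
  have "sound_slack k ?R (slack s')" unfolding sound_slack_def
  proof (intro allI impI)
    fix x y assume "0 < slack s' x y"
    then consider "(x, y) \<in> ?R" | "x = y" "(x, y) \<notin> ?R" "x < n" unfolding sl by (auto split: if_splits)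
    then show "\<exists>i. (x, y) \<in> ?R ^^ i \<and> i + slack s' x y \<le> Suc k"
    proof cases
      case 1
      then show ?thesis unfolding sl by (intro exI[of _ 1]) auto
    next
      case 2
      then show ?thesis unfolding sl by (intro exI[of _ 0]) auto
    qed
  qed
  moreover have "slack s' v v = Suc k" if "v < n" for v
    using that es(2) unfolding sl by (simp add: irrefl_def)
  moreover have "short_walk k k (marked s') (\<lambda>v. set (hubs s' v)) (\<lambda>x y. Suc k - slack s' x y) u v"
    if "(u, v) \<in> ?R ^^ j" "j \<le> k" for u v j
    by (rule short_walk_of_relpow[OF _ _ that]) (auto simp: obs i(1,2))
  ultimately show "round_inv n k ?R d 0 s'"
    unfolding round_inv_def hub_bound_def using o' aug by (auto simp: obs)
  show "vars s' vZ = 0" "vars s' vOne = 1" "vars s' vTwo = 2" "vars s' vK1 = Suc k" "vars s' vN = n" "vars s' vK = k"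
    using s1 i unfolding s' by (simp_all add: frame_var)
  show "ticks s' \<le> ticks s + 6 + 2 * n + 18 * length es + (10 + 40 * link_density 1 0 (d 1)) * n"
    using o'(7) i(10) by simp
qed

definition round_cost :: "(nat \<Rightarrow> nat) \<Rightarrow> nat \<Rightarrow> nat" where
  "round_cost d i = 16 + hub_bound d i * (3 + hub_bound d i * 17) + 20 * hub_bound d (Suc i)"

lemma next_round:
  fixes n k :: nat and inp :: "nat \<Rightarrow> nat" and s :: loop_state
  assumes Z: "vars s vZ = 0" "vars s vOne = 1" "vars s vTwo = 2" "vars s vK1 = Suc k" "vars s vN = n"
    and inv: "round_inv n k R d i s" and i: "i < k"
    and mb: "\<And>r. minor_bound r {..<n} (R \<union> R\<inverse>) (d r)"
  defines "s' \<equiv> sem n inp next_round s"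
  shows "round_inv n k R d (Suc i) s'" "ticks s' \<le> ticks s + 2 + round_cost d i * n"
proof -
  obtain l C \<Delta> where b: "hub_bounds d i = (l, C, \<Delta>)" by (cases "hub_bounds d i")
  then have \<Delta>: "hub_bound d i = \<Delta>" by (simp add: hub_bound_def)
  define l' C' where "l' = 2 * l" and "C' = C + \<Delta> * \<Delta> + 2 * C * \<Delta>"
  have b': "hub_bounds d (Suc i) = (l', C', \<Delta> + (2 * link_density l' C' (d l') + 1))"
    using b by (simp add: l'_def C'_def Let_def)
  have inv': "augmentation {..<n} (R \<union> R\<inverse>) l C (marked s)"
    "\<And>v h. h \<in> set (hubs s v) \<Longrightarrow> (v, h) \<in> marked s" "\<And>v. length (hubs s v) \<le> \<Delta>"
    "\<And>x y. (x, y) \<in> marked s \<Longrightarrow> y \<in> set (hubs s x) \<or> x \<in> set (hubs s y)"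
    "sound_slack k R (slack s)" "\<And>v. v < n \<Longrightarrow> slack s v v = Suc k"
    "\<And>u v j. u < n \<Longrightarrow> v < n \<Longrightarrow> j \<le> k \<Longrightarrow> (u, v) \<in> R ^^ j \<Longrightarrow>
      short_walk k (k - i) (marked s) (\<lambda>v. set (hubs s v)) (\<lambda>x y. Suc k - slack s x y) u v"
    "edges s = []" "fresh_degrees s"
    using inv unfolding round_inv_def b \<Delta> fst_conv snd_conv by blast+
  let ?H = "\<lambda>v. set (hubs s v)"
  have AV: "marked s \<subseteq> {..<n} \<times> {..<n}" and symA: "sym (marked s)" using inv'(1) unfolding augmentation_def by blast+
  have Hn: "c < n" if "x \<in> ?H c" for x c using inv'(2)[OF that] AV by auto
  define s1 where "s1 = sem n inp fraternal_edges s"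
  note f = fraternal_edges[OF Z(1,2,4,5) inv'(5,8,3), of inp, folded s1_def]
  let ?Q = "{(c, x, y). c < n \<and> x \<in> ?H c \<and> y \<in> ?H c}"
  have P: "{(x, y). x \<noteq> y \<and> (\<exists>c. (c, x, y) \<in> ?Q)} = fraternal ?H"
    unfolding fraternal_def using Hn by auto
  have f': "sound_slack k R (slack s1)" "\<And>x y. slack s x y \<le> slack s1 x y"
    "\<And>c x y. x \<in> ?H c \<Longrightarrow> y \<in> ?H c \<Longrightarrow> slack s x c - (Suc k - slack s c y) \<le> slack s1 x y"
    "marked s1 = marked s \<union> fraternal ?H" "distinct (edges s1)" "set (edges s1) = fraternal ?H - marked s"
    using f(1) Hn unfolding fraternal_inv_def P by auto
  have s1: "vars s1 vZ = 0" "vars s1 vTwo = 2" "vars s1 vN = n" "hubs s1 = hubs s" "fresh_degrees s1"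
    using Z inv'(9) by (simp_all add: s1_def frame_var observe_frame fresh_degrees_frame)
  have "card (?H v) \<le> \<Delta>" for v using card_length[of "hubs s v"] inv'(3)[of v] by simp
  then have aug: "augmentation {..<n} (R \<union> R\<inverse>) l' C' (marked s1)"
    unfolding f'(4) l'_def C'_def by (intro augmentation_fraternal[OF inv'(1)] inv'(2)) auto
  have symE: "sym (set (edges s1))" unfolding f'(6) using symA unfolding sym_def fraternal_def by blast
  have s': "s' = sem n inp orient s1" by (simp add: s'_def next_round_def s1_def)
  let ?d = "link_density l' C' (d l')"
  have pre: "set (edges s1) \<subseteq> marked s1" "\<forall>v. \<forall>h\<in>set (hubs s1 v). (v, h) \<in> marked s1"
    "\<forall>v. length (hubs s1 v) \<le> \<Delta>"
    "\<forall>x y. (x, y) \<in> marked s1 - set (edges s1) \<longrightarrow> y \<in> set (hubs s1 x) \<or> x \<in> set (hubs s1 y)"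
    unfolding f'(4,6) s1(4) using inv'(2-4) by blast+
  note o = augmentation_orient[OF s1(1,2,3,5) aug mb f'(5) symE pre, where inp = inp, folded s']
  have obs: "marked s' = marked s1" "slack s' = slack s1" unfolding s' by (simp_all add: observe_frame)
  have diag: "slack s' v v = Suc k" if "v < n" for v
    using f'(2)[of v v] inv'(6)[OF that] sound_slack_le[OF f'(1), of v v] unfolding obs by simp
  have sw: "short_walk k (k - Suc i) (marked s') (\<lambda>v. set (hubs s' v)) (\<lambda>x y. Suc k - slack s' x y) u v"
    if uv: "u < n" "v < n" "j \<le> k" "(u, v) \<in> R ^^ j" for u v j
  proof (rule short_walk_fraternal[where A = "marked s" and H = ?H and w = "\<lambda>x y. Suc k - slack s x y"])
    have "k - i = Suc (k - Suc i)" using i by simp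
    then show "short_walk k (Suc (k - Suc i)) (marked s) ?H (\<lambda>x y. Suc k - slack s x y) u v"
      using inv'(7)[OF uv] by simp
    show "marked s \<union> fraternal ?H \<subseteq> marked s'" unfolding obs f'(4) by simp
    show "?H x \<subseteq> set (hubs s' x)" for x using o(4)[of x] unfolding s1(4) .
    show "Suc k - slack s' x y \<le> Suc k - slack s x y" for x y using f'(2)[of x y] unfolding obs by simp
    \<comment> \<open>Relaxing through c is the triangle inequality for the weights; as slacks never
      exceed k + 1, it can be read off the truncated differences.\<close>
    show "Suc k - slack s' x y \<le> (Suc k - slack s x c) + (Suc k - slack s c y)" if "x \<in> ?H c" "y \<in> ?H c" for x y c
      using f'(3)[OF that] sound_slack_le[OF inv'(5), of x c] sound_slack_le[OF inv'(5), of c y] unfolding obs by linarith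
  qed (use inv'(4) in auto)
  show "round_inv n k R d (Suc i) s'"
    unfolding round_inv_def hub_bound_def b'
    using o aug f'(1) diag sw by (auto simp: obs)
  have "ticks s' \<le> ticks s + 2 + (n * (3 + \<Delta> * (3 + \<Delta> * 17)) + (10 + 40 * ?d) * n)"
    using o(7) f(2) by simp
  also have "n * (3 + \<Delta> * (3 + \<Delta> * 17)) + (10 + 40 * ?d) * n = (13 + \<Delta> * (3 + \<Delta> * 17) + 40 * ?d) * n"
    by (simp add: algebra_simps)
  \<comment> \<open>The new hub bound is \<open>\<Delta> + (2 * ?d + 1)\<close>, so 20 times it
    covers \<open>40 * ?d\<close>.\<close>
  also have "\<dots> \<le> round_cost d i * n"
    unfolding round_cost_def \<Delta> by (intro mult_le_mono1) (simp add: hub_bound_def b' del: hub_bounds.simps)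
  finally show "ticks s' \<le> ticks s + 2 + round_cost d i * n" by simp
qed

lemma mod_next_round [simp]:
  "mod_vars next_round = {vA, vB, vC, vEC, vV, vHC, vI, vX, vJ, vY, vPH, vNN, vQ, vE2, vG1, vG}"
  "mod_arrs next_round = {tD, tAdj, tEX, tEY, tDeg, tH, tHc}"
  by (auto simp: next_round_def)

definition build_hubs :: loop_com where
  "build_hubs = first_round ;; For vL vK next_round"

text \<open>\<open>d 0\<close> bounds the number of arcs per vertex, as contracting nothing gives
  minors of radius 0; so reading the input is linear in n.\<close>

definition hubs_cost :: "(nat \<Rightarrow> nat) \<Rightarrow> nat \<Rightarrow> nat" where
  "hubs_cost d k = 20 + 40 * link_density 1 0 (d 1) + 18 * d 0 + (\<Sum>i<k. 3 + round_cost d i)"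

lemma build_hubs:
  fixes n k :: nat and inp :: "nat \<Rightarrow> nat" and s :: loop_state
  assumes s: "vars s = (\<lambda>_. 0)(vN := n, vM := length es, vK := k)" "arr s = (\<lambda>_ _ _ _. 0)" "ticks s = 0"
    and inp: "\<forall>i<length es. inp (2 * i) = fst (es ! i) \<and> inp (Suc (2 * i)) = snd (es ! i)"
    and es: "set es \<subseteq> {..<n} \<times> {..<n}" "irrefl (set es)" "length es \<le> d 0 * n"
    and mb: "\<And>r. minor_bound r {..<n} (set es \<union> (set es)\<inverse>) (d r)" and k: "1 \<le> k" and n: "1 \<le> n"
  defines "s' \<equiv> sem n inp build_hubs s"
  shows "round_inv n k (set es) d k s'" "vars s' vZ = 0" "vars s' vOne = 1" "vars s' vTwo = 2" "vars s' vK1 = Suc k"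
    "vars s' vN = n" "vars s' vK = k" "ticks s' \<le> hubs_cost d k * n"
proof -
  define s1 where "s1 = sem n inp first_round s"
  note i = first_round[where d = d, OF s(1,2) inp es(1,2) mb[of 1] k, folded s1_def]
  have s': "s' = sem n inp (For vL vK next_round) s1" by (simp add: s'_def build_hubs_def s1_def)
  have "round_inv n k (set es) d (vars s1 vK) s' \<and> ticks s' \<le> ticks s1 + 1 + (\<Sum>i<vars s1 vK. 3 + round_cost d i * n)"
    unfolding s'
  proof (rule For_rule, goal_cases)
    case 1
    then show ?case using i(1) by (simp add: round_inv_def)
  next
    case (2 j t)
    let ?t = "tick (set_var vL j t)"
    have "vars ?t vZ = 0" "vars ?t vOne = 1" "vars ?t vTwo = 2" "vars ?t vK1 = Suc k" "vars ?t vN = n"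
      using 2(3) i by simp_all
    moreover have "round_inv n k (set es) d j ?t" using 2(2) by (simp add: round_inv_def fresh_degrees_def)
    moreover have "j < k" using 2(1) i by simp
    ultimately show ?case using next_round[of ?t k n "set es" d j inp] mb by simp
  qed
  then have r: "round_inv n k (set es) d k s'" "ticks s' \<le> ticks s1 + 1 + (\<Sum>i<k. 3 + round_cost d i * n)"
    unfolding i(7) by blast+
  show "round_inv n k (set es) d k s'" by (rule r)
  show "vars s' vZ = 0" "vars s' vOne = 1" "vars s' vTwo = 2" "vars s' vK1 = Suc k" "vars s' vN = n" "vars s' vK = k"
    unfolding s' using i by (simp_all add: frame_var)
  have "(\<Sum>i<k. 3 + round_cost d i * n) \<le> (\<Sum>i<k. (3 + round_cost d i) * n)"
    by (rule sum_mono) (use n in \<open>simp add: algebra_simps\<close>)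
  also have "\<dots> = (\<Sum>i<k. 3 + round_cost d i) * n" by (rule sum_distrib_right[symmetric])
  finally have c1: "(\<Sum>i<k. 3 + round_cost d i * n) \<le> (\<Sum>i<k. 3 + round_cost d i) * n" .
  have "ticks s' \<le> 7 + 2 * n + 18 * (d 0 * n) + (10 + 40 * link_density 1 0 (d 1)) * n + (\<Sum>i<k. 3 + round_cost d i) * n"
    using r(2) i(8) c1 es(3) s(3) by linarith
  also have "\<dots> \<le> 7 * n + 2 * n + 18 * (d 0 * n) + (10 + 40 * link_density 1 0 (d 1)) * n + (\<Sum>i<k. 3 + round_cost d i) * n"
    using n by simp
  also have "\<dots> \<le> hubs_cost d k * n" unfolding hubs_cost_def by (simp add: algebra_simps)
  finally show "ticks s' \<le> hubs_cost d k * n" .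
qed

section \<open>Hub labels\<close>

definition labels :: "loop_state \<Rightarrow> nat \<Rightarrow> nat \<Rightarrow> nat list" where
  "labels s j v = seq (\<lambda>i. arr s tS j v i) (arr s tSc j v 0)"

lemma labels_tick_vars [simp]:
  "labels (s\<lparr>ticks := a\<rparr>) = labels s" "labels (s\<lparr>vars := b\<rparr>) = labels s"
  by (simp_all add: labels_def fun_eq_iff)

lemma labels_frame: "tS \<notin> mod_arrs c \<Longrightarrow> tSc \<notin> mod_arrs c \<Longrightarrow> labels (sem n inp c s) = labels s"
  by (simp add: labels_def frame_arr fun_eq_iff)

text \<open>Both directions are relaxed: the same label serves a vertex as the start of a pair, with
  the distance to the label, and as its end, with the distance from the label.\<close>

definition label_step :: loop_com where
  "label_step = Get vY tS vL vX vJ ;; relax vV vX vY ;; relax vY vX vV ;;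
    Put tS vL1 vV vSC vY ;; Inc vSC vSC"

definition label_vertex :: loop_com where
  "label_vertex = Put tS vL1 vV vZ vV ;; Const vSC 1 ;; Get vHC tHc vV vZ vZ ;;
    For vI vHC (Get vX tH vV vI vZ ;; Get vLC tSc vL vX vZ ;; For vJ vLC label_step) ;;
    Put tSc vL1 vV vZ vSC"

definition build_labels :: loop_com where
  "build_labels = For vL vK1 (Inc vL1 vL ;; For vV vN label_vertex)"

lemma mod_label_step [simp]: "mod_vars label_step = {vY, vA, vB, vC, vSC}" "mod_arrs label_step = {tD, tS}"
  by (auto simp: label_step_def)

lemma mod_label_vertex [simp]: "mod_vars label_vertex = {vY, vA, vB, vC, vSC, vHC, vI, vX, vLC, vJ}"
  "mod_arrs label_vertex = {tD, tS, tSc}"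
  by (auto simp: label_vertex_def)

lemma mod_build_labels [simp]: "mod_vars build_labels = {vY, vA, vB, vC, vSC, vHC, vI, vX, vLC, vJ, vV, vL, vL1}"
  "mod_arrs build_labels = {tD, tS, tSc}"
  by (auto simp: build_labels_def)

text \<open>\<open>Q\<close> collects triples of a vertex, a hub of it and a label of that hub. As
  entries only grow, it suffices to compare with the slacks of the state \<open>s\<close> in which
  the stage began.\<close>

definition label_inv :: "nat \<Rightarrow> nat rel \<Rightarrow> loop_state \<Rightarrow> (nat \<times> nat \<times> nat) set \<Rightarrow> loop_state \<Rightarrow> bool" where
  "label_inv k R s Q t \<longleftrightarrow> sound_slack k R (slack t) \<and> (\<forall>x y. slack s x y \<le> slack t x y) \<and>
    (\<forall>(v, h, w)\<in>Q. slack s v h - (Suc k - slack s h w) \<le> slack t v w \<and>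
      slack s w h - (Suc k - slack s h v) \<le> slack t w v)"

lemma label_inv_cong: "slack t' = slack t \<Longrightarrow> label_inv k R s Q t \<Longrightarrow> label_inv k R s Q t'"
  by (simp add: label_inv_def)

lemma label_step:
  fixes n :: nat and inp :: "nat \<Rightarrow> nat" and s t :: loop_state
  assumes I: "label_inv k R s Q t" and K: "vars t vK1 = Suc k" and Z: "vars t vZ = 0"
    and ne: "vars t vL \<noteq> vars t vL1"
  defines "t' \<equiv> sem n inp label_step t" and "w \<equiv> arr t tS (vars t vL) (vars t vX) (vars t vJ)"
  shows "label_inv k R s (insert (vars t vV, vars t vX, w) Q) t'"
    "arr t' tS j v i = (if j = vars t vL1 \<and> v = vars t vV \<and> i = vars t vSC then w else arr t tS j v i)"
    "vars t' vSC = Suc (vars t vSC)" "ticks t' \<le> ticks t + 17"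
proof -
  let ?v = "vars t vV" and ?h = "vars t vX"
  define t1 where "t1 = sem n inp (Get vY tS vL vX vJ) t"
  define t2 where "t2 = sem n inp (relax vV vX vY) t1"
  define t3 where "t3 = sem n inp (relax vY vX vV) t2"
  have t1: "vars t1 vV = ?v" "vars t1 vX = ?h" "vars t1 vY = w" "vars t1 vK1 = Suc k" "vars t1 vZ = 0"
    "slack t1 = slack t" "ticks t1 = ticks t + 1" "arr t1 = arr t"
    using K Z by (simp_all add: t1_def w_def)
  have t2: "vars t2 vV = ?v" "vars t2 vX = ?h" "vars t2 vY = w" "vars t2 vK1 = Suc k" "vars t2 vZ = 0"
    "arr t2 tS = arr t tS"
    using t1 by (simp_all add: t2_def frame_var frame_arr)
  have t3: "vars t3 vV = ?v" "vars t3 vY = w" "vars t3 vZ = 0" "arr t3 tS = arr t tS"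
    "vars t3 vSC = vars t vSC" "vars t3 vL1 = vars t vL1"
    using t2 by (simp_all add: t3_def t2_def t1_def frame_var frame_arr)
  have J: "sound_slack k R (slack t1)" "\<And>x y. slack s x y \<le> slack t1 x y"
    "\<And>v h w. (v, h, w) \<in> Q \<Longrightarrow> slack s v h - (Suc k - slack s h w) \<le> slack t1 v w \<and>
      slack s w h - (Suc k - slack s h v) \<le> slack t1 w v"
    using I unfolding label_inv_def t1 by blast+
  note r2 = relax_sound[OF J(1) t1(4,5), where x = vV and v = vX and y = vY and n = n and inp = inp, folded t2_def, simplified]
  note r3 = relax_sound[OF r2(1) t2(4,5), where x = vY and v = vX and y = vV and n = n and inp = inp, folded t3_def, simplified]
  have m: "slack t1 x y \<le> slack t3 x y" for x y using r2(2)[of x y] r3(2)[of x y] by linarith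
  have n1: "slack s ?v ?h - (Suc k - slack s ?h w) \<le> slack t3 ?v w"
    using r2(3) r3(2)[of ?v w] J(2)[of ?v ?h] J(2)[of ?h w] unfolding t1 by linarith
  have n2: "slack s w ?h - (Suc k - slack s ?h ?v) \<le> slack t3 w ?v"
    using r3(3) J(2)[of w ?h] J(2)[of ?h ?v] r2(2)[of w ?h] r2(2)[of ?h ?v] unfolding t2 by linarith
  have eq: "t' = sem n inp (Put tS vL1 vV vSC vY ;; Inc vSC vSC) t3"
    by (simp add: t'_def t3_def t2_def t1_def label_step_def)
  have sl: "slack t' = slack t3" unfolding eq by (rule observe_frame) simp
  have "label_inv k R s (insert (?v, ?h, w) Q) t3" unfolding label_inv_def
  proof (intro conjI)
    show "\<forall>(v, h, w)\<in>insert (?v, ?h, w) Q. slack s v h - (Suc k - slack s h w) \<le> slack t3 v w \<and>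
      slack s w h - (Suc k - slack s h v) \<le> slack t3 w v"
      using n1 n2 J(3) m by (fastforce intro: order_trans)
    show "\<forall>x y. slack s x y \<le> slack t3 x y" using J(2) m by (meson order_trans)
  qed (rule r3(1))
  then show "label_inv k R s (insert (?v, ?h, w) Q) t'" by (rule label_inv_cong[OF sl])
  show "arr t' tS j v i = (if j = vars t vL1 \<and> v = vars t vV \<and> i = vars t vSC then w else arr t tS j v i)"
    unfolding eq using t3 by simp
  show "vars t' vSC = Suc (vars t vSC)" unfolding eq using t3 by simp
  show "ticks t' \<le> ticks t + 17"
    using relax(2)[OF t1(5), where x = vV and v = vX and y = vY and n = n and inp = inp]
      relax(2)[OF t2(5), where x = vY and v = vX and y = vV and n = n and inp = inp] t1(7)
    unfolding eq by (simp add: t2_def[symmetric] t3_def[symmetric])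
qed

lemma label_vertex:
  fixes n k :: nat and inp :: "nat \<Rightarrow> nat" and s t :: loop_state
  assumes I: "label_inv k R s Q t" and K: "vars t vK1 = Suc k" and Z: "vars t vZ = 0"
    and L: "vars t vL = j" "vars t vL1 = Suc j" "vars t vV = v"
    and b: "length (hubs t v) \<le> \<Delta>" "\<forall>h. length (labels t j h) \<le> B"
  defines "t' \<equiv> sem n inp label_vertex t"
  shows "label_inv k R s (Q \<union> {(v, h, w) | h w. h \<in> set (hubs t v) \<and> w \<in> set (labels t j h)}) t'"
    "labels t' (Suc j) v = v # concat (map (labels t j) (hubs t v))"
    "(j', v') \<noteq> (Suc j, v) \<Longrightarrow> labels t' j' v' = labels t j' v'"
    "ticks t' \<le> ticks t + 5 + \<Delta> * (4 + B * 18)"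
proof -
  define t1 where "t1 = sem n inp (Put tS vL1 vV vZ vV ;; Const vSC 1 ;; Get vHC tHc vV vZ vZ) t"
  let ?c2 = "For vJ vLC label_step"
  let ?c1 = "Get vX tH vV vI vZ ;; Get vLC tSc vL vX vZ ;; ?c2"
  define part where "part u = seq (\<lambda>i. arr u tS (Suc j) v i) (vars u vSC)" for u :: loop_state
  \<comment> \<open>Only level j + 1 of v is written, so the lists of level j read by the two loops
    stay as they were.\<close>
  define same where "same u \<longleftrightarrow> (\<forall>j' v'. (j', v') \<noteq> (Suc j, v) \<longrightarrow> arr u tS j' v' = arr t tS j' v')" for u :: loop_state
  let ?h = "\<lambda>i. arr t tH v i 0"
  have hb: "hubs t v = seq ?h (arr t tHc v 0 0)" by (simp add: hubs_def)
  have t1: "vars t1 vK1 = Suc k" "vars t1 vZ = 0" "vars t1 vL = j" "vars t1 vL1 = Suc j" "vars t1 vV = v"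
    "vars t1 vHC = arr t tHc v 0 0" "part t1 = [v]" "same t1" "slack t1 = slack t"
    "arr t1 tH = arr t tH" "arr t1 tSc = arr t tSc" "ticks t1 = ticks t + 3" "vars t1 vSC = 1"
    using K Z L by (auto simp: t1_def part_def same_def slack_def arr_set_arr_other fun_eq_iff)
  define I1 where "I1 i u \<longleftrightarrow> label_inv k R s (Q \<union> {(v, h, w) | h w. h \<in> set (take i (hubs t v)) \<and> w \<in> set (labels t j h)}) u \<and>
    part u = v # concat (map (labels t j) (take i (hubs t v))) \<and> same u" for i and u :: loop_state
  have "I1 (vars t1 vHC) (sem n inp (For vI vHC ?c1) t1) \<and>
    ticks (sem n inp (For vI vHC ?c1) t1) \<le> ticks t1 + 1 + (\<Sum>i<vars t1 vHC. 4 + B * 18)"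
  proof (rule For_rule, goal_cases)
    case 1
    have "label_inv k R s Q (tick t1)" by (rule label_inv_cong[OF _ I]) (simp add: t1)
    then show ?case using t1 unfolding I1_def by (simp add: part_def same_def)
  next
    case (2 i u)
    have i: "i < length (hubs t v)" using 2(1) t1 by (simp add: hubs_def)
    define h where "h = hubs t v ! i"
    have h: "?h i = h" using i by (simp add: h_def hubs_def)
    define u1 where "u1 = sem n inp (Get vX tH vV vI vZ ;; Get vLC tSc vL vX vZ) (tick (set_var vI i u))"
    have u: "vars u vK1 = Suc k" "vars u vZ = 0" "vars u vL = j" "vars u vL1 = Suc j" "vars u vV = v"
      "arr u tH = arr t tH" "arr u tSc = arr t tSc" using 2(3,4) t1 by auto
    have u1: "vars u1 vK1 = Suc k" "vars u1 vZ = 0" "vars u1 vL = j" "vars u1 vL1 = Suc j" "vars u1 vV = v"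
      "vars u1 vX = h" "vars u1 vLC = arr t tSc j h 0" "arr u1 = arr u" "slack u1 = slack u" "ticks u1 = ticks u + 3"
      "vars u1 vSC = vars u vSC"
      using u h by (simp_all add: u1_def)
    let ?lab = "labels t j h"
    have lab: "?lab = seq (\<lambda>l. arr t tS j h l) (arr t tSc j h 0)" by (simp add: labels_def)
    have J: "label_inv k R s (Q \<union> {(v, h, w) | h w. h \<in> set (take i (hubs t v)) \<and> w \<in> set (labels t j h)}) u"
      "part u = v # concat (map (labels t j) (take i (hubs t v)))" "same u"
      using 2(2) unfolding I1_def by blast+
    let ?Q1 = "Q \<union> {(v, h, w) | h w. h \<in> set (take i (hubs t v)) \<and> w \<in> set (labels t j h)}"
    define I2 where "I2 l x \<longleftrightarrow> label_inv k R s (?Q1 \<union> {(v, h, w) | w. w \<in> set (take l ?lab)}) x \<and>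
      part x = part u @ take l ?lab \<and> same x" for l and x :: loop_state
    have "I2 (vars u1 vLC) (sem n inp ?c2 u1) \<and> ticks (sem n inp ?c2 u1) \<le> ticks u1 + 1 + (\<Sum>i<vars u1 vLC. 18)"
    proof (rule For_rule, goal_cases)
      case 1
      have "label_inv k R s ?Q1 (tick u1)" by (rule label_inv_cong[OF _ J(1)]) (simp add: u1)
      then show ?case using u1 J(3) unfolding I2_def by (simp add: part_def same_def)
    next
      case (2 l x)
      let ?x = "tick (set_var vJ l x)"
      have l: "l < length ?lab" using 2(1) u1 by (simp add: labels_def)
      have x: "vars ?x vK1 = Suc k" "vars ?x vZ = 0" "vars ?x vL = j" "vars ?x vL1 = Suc j" "vars ?x vV = v"
        "vars ?x vX = h" "vars ?x vJ = l" "vars ?x vSC = vars x vSC" using 2(3) u1 by auto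
      have I': "label_inv k R s (?Q1 \<union> {(v, h, w) | w. w \<in> set (take l ?lab)}) ?x"
        "part x = part u @ take l ?lab" "same x"
        using 2(2) unfolding I2_def by (auto intro: label_inv_cong[rotated])
      have ne: "vars ?x vL \<noteq> vars ?x vL1" using x by simp
      define y where "y = sem n inp label_step ?x"
      note ls = label_step[OF I'(1) x(1,2) ne, where n = n and inp = inp, folded y_def, unfolded x]
      have w: "arr ?x tS j h l = ?lab ! l" using I'(3) l by (simp add: same_def labels_def)
      have tk: "take (Suc l) ?lab = take l ?lab @ [?lab ! l]" using l by (simp add: take_Suc_conv_app_nth)
      have "part y = part x @ [?lab ! l]" unfolding part_def ls(3) using ls(2) w by simp
      moreover have "same y" using I'(3) ls(2) unfolding same_def by (auto simp: fun_eq_iff)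
      moreover have "insert (v, h, ?lab ! l) (?Q1 \<union> {(v, h, w) | w. w \<in> set (take l ?lab)}) =
          ?Q1 \<union> {(v, h, w) | w. w \<in> set (take (Suc l) ?lab)}" unfolding tk by auto
      ultimately have "I2 (Suc l) y" unfolding I2_def using ls(1) I'(2) w tk by simp
      then show ?case unfolding y_def[symmetric] using ls(4) by simp
    qed
    then have I2: "I2 (length ?lab) (sem n inp ?c2 u1)" "ticks (sem n inp ?c2 u1) \<le> ticks u1 + 1 + length ?lab * 18"
      unfolding u1 by (simp_all add: lab)
    have tk: "take (Suc i) (hubs t v) = take i (hubs t v) @ [h]" using i by (simp add: take_Suc_conv_app_nth h_def)
    have "?Q1 \<union> {(v, h, w) | w. w \<in> set ?lab} = Q \<union> {(v, h, w) | h w. h \<in> set (take (Suc i) (hubs t v)) \<and> w \<in> set (labels t j h)}"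
      unfolding tk by auto
    then have "I1 (Suc i) (sem n inp ?c2 u1)" using I2(1) J(2) unfolding I1_def I2_def tk by simp
    moreover have "ticks (sem n inp ?c2 u1) \<le> ticks u + (4 + B * 18)" using I2(2) u1(10) b(2)[rule_format, of h] by simp
    moreover have "sem n inp ?c1 (tick (set_var vI i u)) = sem n inp ?c2 u1" by (simp add: u1_def)
    ultimately show ?case by simp
  qed
  then have I1: "I1 (length (hubs t v)) (sem n inp (For vI vHC ?c1) t1)"
    "ticks (sem n inp (For vI vHC ?c1) t1) \<le> ticks t1 + 1 + length (hubs t v) * (4 + B * 18)"
    unfolding t1 by (simp_all add: hb)
  define t2 where "t2 = sem n inp (For vI vHC ?c1) t1"
  have t2: "vars t2 vZ = 0" "vars t2 vL1 = Suc j" "vars t2 vV = v" "arr t2 tSc = arr t tSc"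
    using t1 by (simp_all add: t2_def frame_var frame_arr)
  have t': "t' = sem n inp (Put tSc vL1 vV vZ vSC) t2" by (simp add: t'_def t2_def t1_def label_vertex_def)
  have sl: "slack t' = slack t2" unfolding t' by (rule observe_frame) simp
  have i1: "label_inv k R s (Q \<union> {(v, h, w) | h w. h \<in> set (hubs t v) \<and> w \<in> set (labels t j h)}) t2"
    "part t2 = v # concat (map (labels t j) (hubs t v))" "same t2"
    using I1(1) unfolding I1_def t2_def by simp_all
  show "label_inv k R s (Q \<union> {(v, h, w) | h w. h \<in> set (hubs t v) \<and> w \<in> set (labels t j h)}) t'"
    by (rule label_inv_cong[OF sl i1(1)])
  show "labels t' (Suc j) v = v # concat (map (labels t j) (hubs t v))"
    using i1(2) t2 unfolding labels_def part_def t' by simp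
  show "labels t' j' v' = labels t j' v'" if "(j', v') \<noteq> (Suc j, v)"
    using i1(3) t2 that unfolding labels_def same_def t' by auto
  have "length (hubs t v) * (4 + B * 18) \<le> \<Delta> * (4 + B * 18)" using b(1) by (rule mult_le_mono1)
  moreover have "ticks t' = Suc (ticks t2)" unfolding t' by simp
  ultimately show "ticks t' \<le> ticks t + 5 + \<Delta> * (4 + B * 18)"
    using I1(2)[folded t2_def] t1(12) by linarith
qed

text \<open>Ends of the ascending sequences from \<open>v\<close> with at most j vertices, with
  repetitions; climbing k times thus needs index k + 1. Level 0 is empty and so agrees with an array
  that was never written.\<close>

primrec level :: "('a \<Rightarrow> 'a list) \<Rightarrow> nat \<Rightarrow> 'a \<Rightarrow> 'a list" where
  "level H 0 v = []"
| "level H (Suc j) v = v # concat (map (level H j) (H v))"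

lemma length_level: "(\<And>v. length (H v) \<le> \<Delta>) \<Longrightarrow> length (level H j v) \<le> Suc \<Delta> ^ j"
proof (induction j arbitrary: v)
  case (Suc j)
  have "length (level H (Suc j) v) = Suc (\<Sum>h\<leftarrow>H v. length (level H j h))"
    by (simp add: length_concat o_def)
  also have "(\<Sum>h\<leftarrow>H v. length (level H j h)) \<le> (\<Sum>h\<leftarrow>H v. Suc \<Delta> ^ j)"
    by (rule sum_list_mono) (use Suc in auto)
  also have "\<dots> \<le> \<Delta> * Suc \<Delta> ^ j" using Suc.prems[of v] by (simp add: sum_list_triv)
  also have "Suc (\<Delta> * Suc \<Delta> ^ j) \<le> Suc \<Delta> ^ Suc j" by simp
  finally show ?case by simp
qed simp

lemma level_closed:
  assumes "\<And>v h. h \<in> set (H v) \<Longrightarrow> h \<in> V" shows "v \<in> V \<Longrightarrow> set (level H j v) \<subseteq> V"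
  by (induction j arbitrary: v) (use assms in fastforce)+

text \<open>The weights \<open>w\<close> are those of the single steps and stay fixed, while
  \<open>D\<close> improves from stage to stage: after j stages it is composed along every ascending
  sequence of at most j vertices, in both directions.\<close>

definition climbed :: "nat \<Rightarrow> nat \<Rightarrow> (nat \<Rightarrow> nat list) \<Rightarrow> (nat \<Rightarrow> nat \<Rightarrow> nat) \<Rightarrow> nat \<Rightarrow> (nat \<Rightarrow> nat \<Rightarrow> nat) \<Rightarrow> bool" where
  "climbed n K H w j D \<longleftrightarrow> (\<forall>q. q \<noteq> [] \<and> hd q < n \<and> length q \<le> j \<and> successively (\<lambda>x y. y \<in> set (H x)) q \<longrightarrow>
    last q \<in> set (level H j (hd q)) \<and> K - D (hd q) (last q) \<le> walk_weight w q \<and>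
    K - D (last q) (hd q) \<le> walk_weight (\<lambda>x y. w y x) q)"

text \<open>Split off the first vertex v: from its hub h on, the sequence was composed in the
  previous stages, and relaxing through h adds the step between v and h.\<close>

lemma climbed_Suc:
  assumes cl: "climbed n K H w j D" and mono: "\<And>x y. D x y \<le> D' x y" and le: "\<And>x y. D x y \<le> K"
    and new: "\<And>v h x. v < n \<Longrightarrow> h \<in> set (H v) \<Longrightarrow> x \<in> set (level H j h) \<Longrightarrow>
      D v h - (K - D h x) \<le> D' v x \<and> D x h - (K - D h v) \<le> D' x v"
    and w: "\<And>x y. K - D x y \<le> w x y" and diag: "\<And>v. v < n \<Longrightarrow> D v v = K"
    and closed: "\<And>v h. h \<in> set (H v) \<Longrightarrow> h < n"
  shows "climbed n K H w (Suc j) D'"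
  unfolding climbed_def
proof (intro allI impI, elim conjE)
  fix q assume q: "q \<noteq> []" "hd q < n" "length q \<le> Suc j" "successively (\<lambda>x y. y \<in> set (H x)) q"
  then obtain v r where vr: "q = v # r" "v < n" by (cases q) auto
  show "last q \<in> set (level H (Suc j) (hd q)) \<and> K - D' (hd q) (last q) \<le> walk_weight w q \<and>
    K - D' (last q) (hd q) \<le> walk_weight (\<lambda>x y. w y x) q"
  proof (cases r)
    case Nil
    then show ?thesis using vr diag[OF vr(2)] mono[of v v] by simp
  next
    case (Cons h r')
    have h: "h \<in> set (H v)" "successively (\<lambda>x y. y \<in> set (H x)) (h # r')" "length (h # r') \<le> j"
      using q vr Cons by auto
    let ?x = "last (h # r')"
    have ih: "?x \<in> set (level H j h)" "K - D h ?x \<le> walk_weight w (h # r')"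
      "K - D ?x h \<le> walk_weight (\<lambda>x y. w y x) (h # r')"
      using cl[unfolded climbed_def, rule_format, of "h # r'"] h closed[OF h(1)] by auto
    have n: "D v h - (K - D h ?x) \<le> D' v ?x" "D ?x h - (K - D h v) \<le> D' ?x v"
      using new[OF vr(2) h(1) ih(1)] by auto
    have a: "K - D' v ?x \<le> w v h + walk_weight w (h # r')"
      using n(1) ih(2) w[of v h] le[of v h] le[of h ?x] by linarith
    have b: "K - D' ?x v \<le> w h v + walk_weight (\<lambda>x y. w y x) (h # r')"
      using n(2) ih(3) w[of h v] le[of h v] le[of ?x h] by linarith
    have e: "last q = ?x" "hd q = v" using vr Cons by auto
    show ?thesis unfolding e using a b ih(1) h(1) vr Cons by auto
  qed
qed

lemma build_labels:
  fixes n k :: nat and inp :: "nat \<Rightarrow> nat" and s :: loop_state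
  assumes Z: "vars s vZ = 0" "vars s vK1 = Suc k" "vars s vN = n"
    and snd: "sound_slack k R (slack s)" and diag: "\<forall>v<n. slack s v v = Suc k"
    and closed: "\<forall>v. \<forall>h\<in>set (hubs s v). h < n" and \<Delta>: "\<forall>v. length (hubs s v) \<le> \<Delta>"
    and nil: "labels s = (\<lambda>_ _. [])"
  defines "s' \<equiv> sem n inp build_labels s" and "H \<equiv> hubs s"
  shows "sound_slack k R (slack s')"
    and "climbed n (Suc k) H (\<lambda>x y. Suc k - slack s x y) (Suc k) (slack s')"
    and "v < n \<Longrightarrow> labels s' (Suc k) v = level H (Suc k) v"
    and "ticks s' \<le> ticks s + 1 + Suc k * (3 + n * (6 + \<Delta> * (4 + Suc \<Delta> ^ Suc k * 18)))"
proof -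
  let ?w = "\<lambda>x y. Suc k - slack s x y"
  let ?B = "Suc \<Delta> ^ Suc k" and ?c = "For vV vN label_vertex"
  let ?cost = "6 + \<Delta> * (4 + ?B * 18)"
  define lab where "lab j t \<longleftrightarrow> (\<forall>j' v. labels t j' v = (if 0 < j' \<and> j' \<le> j \<and> v < n then level H j' v else []))"
    for j and t :: loop_state
  define I where "I j t \<longleftrightarrow> sound_slack k R (slack t) \<and> (\<forall>x y. slack s x y \<le> slack t x y) \<and>
    climbed n (Suc k) H ?w j (slack t) \<and> lab j t" for j and t :: loop_state
  have lev: "length (level H j v) \<le> ?B" if "j \<le> Suc k" for j v
  proof -
    have "length (level H j v) \<le> Suc \<Delta> ^ j" using \<Delta> by (intro length_level) (simp add: H_def)
    also have "\<dots> \<le> ?B" using that by (intro power_increasing) auto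
    finally show ?thesis .
  qed
  have "I (vars s vK1) s' \<and> ticks s' \<le> ticks s + 1 + (\<Sum>j<vars s vK1. 3 + n * ?cost)"
    unfolding s'_def build_labels_def
  proof (rule For_rule, goal_cases)
    case 1
    then show ?case using snd nil by (simp add: I_def lab_def climbed_def)
  next
    case (2 j t)
    define t1 where "t1 = sem n inp (Inc vL1 vL) (tick (set_var vL j t))"
    have j: "j < Suc k" using 2(1) Z by simp
    have J: "sound_slack k R (slack t)" "\<And>x y. slack s x y \<le> slack t x y"
      "climbed n (Suc k) H ?w j (slack t)" "lab j t" using 2(2) unfolding I_def by blast+
    have t1: "vars t1 vZ = 0" "vars t1 vK1 = Suc k" "vars t1 vN = n" "vars t1 vL = j" "vars t1 vL1 = Suc j"
      "slack t1 = slack t" "hubs t1 = H" "labels t1 = labels t" "ticks t1 = ticks t + 2"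
      using 2(3,4) Z by (auto simp: t1_def H_def hubs_def fun_eq_iff)
    let ?F = "\<lambda>v. {(v, h, w) | h w. h \<in> set (H v) \<and> w \<in> set (level H j h)}"
    define I2 where "I2 i u \<longleftrightarrow> label_inv k R t (\<Union>v<i. ?F v) u \<and>
      (\<forall>j' v. labels u j' v = (if j' = Suc j \<and> v < i then level H j' v else labels t j' v))" for i and u :: loop_state
    have "I2 (vars t1 vN) (sem n inp ?c t1) \<and> ticks (sem n inp ?c t1) \<le> ticks t1 + 1 + (\<Sum>i<vars t1 vN. ?cost)"
    proof (rule For_rule, goal_cases)
      case 1
      then show ?case using J(1) t1 by (simp add: I2_def label_inv_def)
    next
      case (2 v u)
      let ?u = "tick (set_var vV v u)"
      have u: "vars ?u vK1 = Suc k" "vars ?u vZ = 0" "vars ?u vL = j" "vars ?u vL1 = Suc j" "vars ?u vV = v"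
        "hubs ?u = H" "v < n"
        using 2(1,3,4) t1 by (auto simp: hubs_def fun_eq_iff)
      have K: "label_inv k R t (\<Union>v<v. ?F v) ?u"
        "\<And>j' v'. labels u j' v' = (if j' = Suc j \<and> v' < v then level H j' v' else labels t j' v')"
        using 2(2) unfolding I2_def by (auto intro: label_inv_cong[rotated])
      \<comment> \<open>For j = 0 the unwritten row reads as empty lists, which is what
        \<open>level\<close> prescribes.\<close>
      have lj: "labels u j h = (if h < n then level H j h else [])" for h
        using K(2)[of j h] J(4) by (cases j) (auto simp: lab_def)
      have b: "length (hubs ?u v) \<le> \<Delta>" "\<forall>h. length (labels ?u j h) \<le> ?B"
        using \<Delta> lev j u(6) by (simp_all add: lj H_def)
      note lv = label_vertex[OF K(1) u(1-5) b, where n = n and inp = inp, unfolded u(6)]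
      have mp: "map (labels ?u j) (H v) = map (level H j) (H v)"
        using closed by (simp add: lj H_def)
      have "?F v = {(v, h, w) | h w. h \<in> set (H v) \<and> w \<in> set (labels ?u j h)}"
        using closed by (auto simp: lj H_def)
      then have "(\<Union>v<Suc v. ?F v) = (\<Union>v<v. ?F v) \<union> {(v, h, w) | h w. h \<in> set (H v) \<and> w \<in> set (labels ?u j h)}"
        by (auto simp: lessThan_Suc)
      then have "label_inv k R t (\<Union>v<Suc v. ?F v) (sem n inp label_vertex ?u)" using lv(1) by simp
      moreover have "labels (sem n inp label_vertex ?u) j' v' =
          (if j' = Suc j \<and> v' < Suc v then level H j' v' else labels t j' v')" for j' v'
      proof (cases "(j', v') = (Suc j, v)")
        case True
        then show ?thesis using lv(2)[unfolded mp] by simp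
      next
        case False
        then show ?thesis using lv(3)[OF False] K(2)[of j' v'] by auto
      qed
      moreover have "ticks (sem n inp label_vertex ?u) \<le> ticks u + ?cost" using lv(4) by simp
      ultimately show ?case unfolding I2_def by blast
    qed
    then have I2: "I2 n (sem n inp ?c t1)" "ticks (sem n inp ?c t1) \<le> ticks t + (3 + n * ?cost)"
      unfolding t1 by simp_all
    define t2 where "t2 = sem n inp ?c t1"
    have L: "sound_slack k R (slack t2)" "\<And>x y. slack t x y \<le> slack t2 x y"
      "\<And>v h x. v < n \<Longrightarrow> h \<in> set (H v) \<Longrightarrow> x \<in> set (level H j h) \<Longrightarrow>
        slack t v h - (Suc k - slack t h x) \<le> slack t2 v x \<and> slack t x h - (Suc k - slack t h v) \<le> slack t2 x v"
      "\<And>j' v. labels t2 j' v = (if j' = Suc j \<and> v < n then level H j' v else labels t j' v)"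
      using I2(1) unfolding I2_def label_inv_def t2_def by (blast, blast, fastforce, blast)
    have "climbed n (Suc k) H ?w (Suc j) (slack t2)"
    proof (rule climbed_Suc[OF J(3) L(2) sound_slack_le[OF J(1)] L(3)])
      show "slack t v v = Suc k" if "v < n" for v
        using diag that J(2)[of v v] sound_slack_le[OF J(1), of v v] by (simp add: order_antisym)
      show "h < n" if "h \<in> set (H v)" for v h using closed that by (auto simp: H_def)
      show "Suc k - slack t x y \<le> Suc k - slack s x y" for x y using J(2)[of x y] by simp
    qed
    moreover have "lab (Suc j) t2" using J(4) L(4) unfolding lab_def by auto
    moreover have "slack s x y \<le> slack t2 x y" for x y using J(2)[of x y] L(2)[of x y] by simp
    ultimately have "I (Suc j) t2" using L(1) unfolding I_def by blast
    moreover have "sem n inp (Inc vL1 vL ;; ?c) (tick (set_var vL j t)) = t2" by (simp add: t1_def t2_def)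
    ultimately show ?case using I2(2) unfolding t2_def by simp
  qed
  then have fin: "I (Suc k) s'" "ticks s' \<le> ticks s + 1 + Suc k * (3 + n * ?cost)"
    unfolding Z(2) by simp_all
  then show "sound_slack k R (slack s')" "climbed n (Suc k) H ?w (Suc k) (slack s')"
    "ticks s' \<le> ticks s + 1 + Suc k * (3 + n * ?cost)" unfolding I_def by blast+
  show "v < n \<Longrightarrow> labels s' (Suc k) v = level H (Suc k) v" using fin(1) unfolding I_def lab_def by simp
qed


section \<open>Sorting the labels of a vertex\<close>

definition ranked :: "loop_state \<Rightarrow> nat \<Rightarrow> nat list" where
  "ranked s v = seq (\<lambda>i. arr s tR v i 0) (arr s tRc v 0 0)"

text \<open>n serves as a sentinel, all labels being smaller.\<close>

definition find_next :: loop_com where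
  "find_next = Move vA vN ;; For vJ vSC (Get vB tS vK1 vV vJ ;;
    Cond vB vLO Nop (Cond vB vA (Move vA vB) Nop))"

text \<open>Selecting the next larger label both sorts and removes repetitions, so that a set of
  labels is listed by keys in one canonical order only. Quadratic cost is harmless, as the lists
  have bounded length.\<close>

definition sort_vertex :: loop_com where
  "sort_vertex = Get vSC tSc vK1 vV vZ ;; Const vRC 0 ;; Const vLO 0 ;;
    For vI vSC (find_next ;; Cond vA vN (Put tR vV vRC vZ vA ;; Inc vRC vRC ;; Inc vLO vA) Nop) ;;
    Put tRc vV vZ vZ vRC"

definition sort_labels :: loop_com where
  "sort_labels = For vV vN sort_vertex"

lemma mod_find_next [simp]: "mod_vars find_next = {vA, vJ, vB}" "mod_arrs find_next = {}"
  by (auto simp: find_next_def)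

lemma mod_sort_vertex [simp]: "mod_vars sort_vertex = {vSC, vRC, vLO, vI, vA, vJ, vB}" "mod_arrs sort_vertex = {tR, tRc}"
  by (auto simp: sort_vertex_def)

lemma mod_sort_labels [simp]: "mod_vars sort_labels = {vV, vSC, vRC, vLO, vI, vA, vJ, vB}" "mod_arrs sort_labels = {tR, tRc}"
  by (auto simp: sort_labels_def)

lemma find_next:
  fixes n :: nat and inp :: "nat \<Rightarrow> nat" and s :: loop_state
  assumes "vars s vSC = arr s tSc (vars s vK1) (vars s vV) 0"
  defines "s' \<equiv> sem n inp find_next s"
  shows "vars s' vA = Min (insert (vars s vN) {w \<in> set (labels s (vars s vK1) (vars s vV)). vars s vLO \<le> w})"
    and "ticks s' \<le> ticks s + 2 + 5 * vars s vSC"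
proof -
  let ?l = "labels s (vars s vK1) (vars s vV)"
  let ?s1 = "sem n inp (Move vA vN) s"
  let ?c = "Get vB tS vK1 vV vJ ;; Cond vB vLO Nop (Cond vB vA (Move vA vB) Nop)"
  have "(\<lambda>i t. vars t vA = Min (insert (vars s vN) {w \<in> set (take i ?l). vars s vLO \<le> w}))
      (vars ?s1 vSC) (sem n inp (For vJ vSC ?c) ?s1) \<and>
    ticks (sem n inp (For vJ vSC ?c) ?s1) \<le> ticks ?s1 + 1 + (\<Sum>i<vars ?s1 vSC. 5)"
  proof (rule For_rule, goal_cases)
    case (2 i t)
    have i: "i < length ?l" using 2(1) assms(1) by (simp add: labels_def)
    have v: "vars t vLO = vars s vLO" "vars t vK1 = vars s vK1" "vars t vV = vars s vV" "arr t tS = arr s tS"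
      using 2(3,4) by auto
    have e: "arr s tS (vars s vK1) (vars s vV) i = ?l ! i" using i by (simp add: labels_def)
    have tk: "take (Suc i) ?l = take i ?l @ [?l ! i]" using i by (simp add: take_Suc_conv_app_nth)
    have "{w \<in> set (take (Suc i) ?l). vars s vLO \<le> w} =
      {w \<in> set (take i ?l). vars s vLO \<le> w} \<union> (if vars s vLO \<le> ?l ! i then {?l ! i} else {})"
      unfolding tk by auto
    then have "Min (insert (vars s vN) {w \<in> set (take (Suc i) ?l). vars s vLO \<le> w}) =
      (if vars s vLO \<le> ?l ! i then min (?l ! i) (vars t vA) else vars t vA)"
    proof -
      let ?A = "insert (vars s vN) {w \<in> set (take i ?l). vars s vLO \<le> w}"
      assume e: "{w \<in> set (take (Suc i) ?l). vars s vLO \<le> w} =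
        {w \<in> set (take i ?l). vars s vLO \<le> w} \<union> (if vars s vLO \<le> ?l ! i then {?l ! i} else {})"
      have "insert (vars s vN) {w \<in> set (take (Suc i) ?l). vars s vLO \<le> w} =
        (if vars s vLO \<le> ?l ! i then insert (?l ! i) ?A else ?A)" unfolding e by auto
      moreover have "Min (insert (?l ! i) ?A) = min (?l ! i) (Min ?A)" by (rule Min_insert) auto
      ultimately show ?thesis using 2(2) by simp
    qed
    then show ?case using v e by (auto simp: min_def)
  qed simp
  then show "vars s' vA = Min (insert (vars s vN) {w \<in> set ?l. vars s vLO \<le> w})"
    "ticks s' \<le> ticks s + 2 + 5 * vars s vSC"
    unfolding s'_def find_next_def using assms(1) by (simp_all add: labels_def)
qed

lemma sort_vertex:
  fixes n :: nat and inp :: "nat \<Rightarrow> nat" and s :: loop_state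
  assumes Z: "vars s vZ = 0" "vars s vN = n" and l: "set (labels s (vars s vK1) (vars s vV)) \<subseteq> {..<n}"
    and len: "length (labels s (vars s vK1) (vars s vV)) \<le> B"
  defines "s' \<equiv> sem n inp sort_vertex s"
  shows "ranked s' (vars s vV) = sorted_list_of_set (set (labels s (vars s vK1) (vars s vV)))"
    and "v' \<noteq> vars s vV \<Longrightarrow> ranked s' v' = ranked s v'"
    and "ticks s' \<le> ticks s + 5 + B * (7 + 5 * B)"
proof -
  let ?v = "vars s vV"
  let ?l = "labels s (vars s vK1) ?v"
  let ?xs = "sorted_list_of_set (set ?l)"
  define s1 where "s1 = sem n inp (Get vSC tSc vK1 vV vZ ;; Const vRC 0 ;; Const vLO 0) s"
  let ?c = "find_next ;; Cond vA vN (Put tR vV vRC vZ vA ;; Inc vRC vRC ;; Inc vLO vA) Nop"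
  have s1: "vars s1 vZ = 0" "vars s1 vN = n" "vars s1 vV = ?v" "vars s1 vSC = length ?l" "vars s1 vRC = 0" "vars s1 vLO = 0"
    "arr s1 = arr s" "ticks s1 = ticks s + 3" "vars s1 vK1 = vars s vK1"
    using Z by (auto simp: s1_def labels_def)
  define I where "I i t \<longleftrightarrow> seq (\<lambda>i. arr t tR ?v i 0) (vars t vRC) = take i ?xs \<and>
    {w \<in> set ?l. vars t vLO \<le> w} = set (drop i ?xs) \<and> (\<forall>v'. v' \<noteq> ?v \<longrightarrow> arr t tR v' = arr s tR v')"
    for i and t :: loop_state
  have "I (vars s1 vSC) (sem n inp (For vI vSC ?c) s1) \<and>
    ticks (sem n inp (For vI vSC ?c) s1) \<le> ticks s1 + 1 + (\<Sum>i<vars s1 vSC. 7 + 5 * B)"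
  proof (rule For_rule, goal_cases)
    case 1
    then show ?case using s1 by (simp add: I_def)
  next
    case (2 i t)
    let ?t = "tick (set_var vI i t)"
    define u where "u = sem n inp find_next ?t"
    have t: "vars ?t vZ = 0" "vars ?t vN = n" "vars ?t vV = ?v" "vars ?t vSC = length ?l" "vars ?t vK1 = vars s vK1"
      "labels ?t = labels s"
      using 2(3,4) s1 by (auto simp: labels_def fun_eq_iff)
    have J: "seq (\<lambda>i. arr t tR ?v i 0) (vars t vRC) = take i ?xs" "{w \<in> set ?l. vars t vLO \<le> w} = set (drop i ?xs)"
      "\<And>v'. v' \<noteq> ?v \<Longrightarrow> arr t tR v' = arr s tR v'" using 2(2) unfolding I_def by blast+
    have sc: "vars ?t vSC = arr ?t tSc (vars ?t vK1) (vars ?t vV) 0"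
    proof -
      have "arr t tSc = arr s tSc" using 2(4)[of tSc] s1 by simp
      then show ?thesis using t by (simp add: labels_def)
    qed
    have A: "vars u vA = Min (insert n (set (drop i ?xs)))"
      using find_next(1)[OF sc, of n inp] J(2) unfolding u_def t by simp
    have tu: "ticks u \<le> ticks t + 3 + 5 * B" using find_next(2)[OF sc, of n inp] len unfolding u_def t by simp
    have u: "vars u vN = n" "vars u vV = ?v" "vars u vZ = 0" "vars u vRC = vars t vRC" "vars u vLO = vars t vLO"
      "arr u = arr t" using t by (simp_all add: u_def frame_var frame_arr fun_eq_iff)
    have eq: "sem n inp ?c ?t = sem n inp (Cond vA vN (Put tR vV vRC vZ vA ;; Inc vRC vRC ;; Inc vLO vA) Nop) u"
      by (simp add: u_def)
    show ?case
    proof (cases "i < length ?xs")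
      case False
      \<comment> \<open>All labels are used up: the search returns the sentinel and nothing is
        stored.\<close>
      then have "vars u vA = n" using A by simp
      then have "sem n inp ?c ?t = tick (tick u)" unfolding eq using u by simp
      then show ?thesis unfolding I_def using J False tu u by simp
    next
      case True
      let ?y = "?xs ! i"
      have dr: "drop i ?xs = ?y # drop (Suc i) ?xs" using True by (simp add: Cons_nth_drop_Suc)
      have "sorted_wrt (<) ?xs" by (rule strict_sorted_list_of_set)
      then have "sorted_wrt (<) (drop i ?xs)" by (rule sorted_wrt_drop)
      then have lt: "\<forall>z\<in>set (drop (Suc i) ?xs). ?y < z" unfolding dr by simp
      have "?y \<in> set ?l" using True nth_mem[of i ?xs] by simp
      then have yn: "?y < n" using l by auto
      have "Min (insert n (set (drop i ?xs))) = ?y"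
        by (rule Min_eqI) (use lt yn dr in \<open>auto simp del: drop_eq_Nil intro: less_imp_le\<close>)
      then have Ay: "vars u vA = ?y" using A by simp
      define r where "r = sem n inp ?c ?t"
      have r: "vars r vRC = Suc (vars t vRC)" "vars r vLO = Suc ?y" "ticks r = ticks u + 4"
        "arr r tR = (arr t tR)(?v := (arr t tR ?v)(vars t vRC := (arr t tR ?v (vars t vRC))(0 := ?y)))"
        unfolding r_def eq using Ay yn u by (simp_all add: set_arr_def)
      have "seq (\<lambda>i. arr r tR ?v i 0) (vars r vRC) = take (Suc i) ?xs"
        using J(1) True unfolding r(1,4) by (simp add: take_Suc_conv_app_nth)
      moreover have "{w \<in> set ?l. vars r vLO \<le> w} = set (drop (Suc i) ?xs)"
      proof -
        have "{w \<in> set ?l. Suc ?y \<le> w} = {w \<in> {w \<in> set ?l. vars t vLO \<le> w}. Suc ?y \<le> w}"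
        proof -
          have "?y \<in> {w \<in> set ?l. vars t vLO \<le> w}" unfolding J(2) dr by simp
          then show ?thesis by auto
        qed
        also have "\<dots> = set (drop (Suc i) ?xs)" unfolding J(2) dr using lt by (auto simp: Suc_le_eq)
        finally show ?thesis unfolding r .
      qed
      ultimately have "I (Suc i) r" using J(3) unfolding I_def r(4) by simp
      then show ?thesis unfolding r_def[symmetric] using r(3) tu by simp
    qed
  qed
  then have fin: "I (length ?l) (sem n inp (For vI vSC ?c) s1)"
    "ticks (sem n inp (For vI vSC ?c) s1) \<le> ticks s1 + 1 + length ?l * (7 + 5 * B)" unfolding s1 by simp_all
  define s2 where "s2 = sem n inp (For vI vSC ?c) s1"
  have s2: "vars s2 vV = ?v" "vars s2 vZ = 0" "arr s2 tRc = arr s tRc" using s1 by (simp_all add: s2_def frame_var frame_arr)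
  have s': "s' = sem n inp (Put tRc vV vZ vZ vRC) s2" by (simp add: s'_def s2_def s1_def sort_vertex_def)
  have "length ?xs \<le> length ?l" by (simp add: card_length)
  then have i1: "seq (\<lambda>i. arr s2 tR ?v i 0) (vars s2 vRC) = ?xs" "\<And>v'. v' \<noteq> ?v \<Longrightarrow> arr s2 tR v' = arr s tR v'"
    using fin(1) unfolding I_def s2_def by simp_all
  show "ranked s' ?v = ?xs" using i1(1) s2 unfolding ranked_def s' by simp
  show "v' \<noteq> ?v \<Longrightarrow> ranked s' v' = ranked s v'" using i1(2)[of v'] s2 unfolding ranked_def s' by simp
  have "length ?l * (7 + 5 * B) \<le> B * (7 + 5 * B)" using len by (rule mult_le_mono1)
  moreover have "ticks s' = Suc (ticks s2)" unfolding s' by simp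
  ultimately show "ticks s' \<le> ticks s + 5 + B * (7 + 5 * B)"
    using fin(2)[folded s2_def] s1(8) by linarith
qed

lemma sort_labels:
  fixes n :: nat and inp :: "nat \<Rightarrow> nat" and s :: loop_state
  assumes Z: "vars s vZ = 0" "vars s vN = n" and l: "\<forall>v<n. set (labels s (vars s vK1) v) \<subseteq> {..<n}"
    and len: "\<forall>v<n. length (labels s (vars s vK1) v) \<le> B"
  defines "s' \<equiv> sem n inp sort_labels s"
  shows "v < n \<Longrightarrow> ranked s' v = sorted_list_of_set (set (labels s (vars s vK1) v))"
    and "ticks s' \<le> ticks s + 1 + n * (6 + B * (7 + 5 * B))"
proof -
  have "(\<lambda>i t. \<forall>v<i. ranked t v = sorted_list_of_set (set (labels s (vars s vK1) v))) (vars s vN) s' \<and>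
    ticks s' \<le> ticks s + 1 + (\<Sum>i<vars s vN. 6 + B * (7 + 5 * B))"
    unfolding s'_def sort_labels_def
  proof (rule For_rule, goal_cases)
    case (2 v t)
    let ?t = "tick (set_var vV v t)"
    have t: "vars ?t vZ = 0" "vars ?t vN = n" "vars ?t vV = v" "vars ?t vK1 = vars s vK1" "v < n" "labels ?t = labels s"
      using 2(1,3,4) Z by (auto simp: labels_def fun_eq_iff)
    have a: "set (labels ?t (vars ?t vK1) (vars ?t vV)) \<subseteq> {..<n}" "length (labels ?t (vars ?t vK1) (vars ?t vV)) \<le> B"
      unfolding t(3,4,6) using l len t(5) by blast+
    note sv = sort_vertex[OF t(1,2) a, where inp = inp, unfolded t(3,4,6)]
    have r: "ranked ?t = ranked t" by (simp add: ranked_def fun_eq_iff)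
    show ?case using sv 2(2) unfolding r by (auto simp: less_Suc_eq)
  qed simp
  then show "v < n \<Longrightarrow> ranked s' v = sorted_list_of_set (set (labels s (vars s vK1) v))"
    "ticks s' \<le> ticks s + 1 + n * (6 + B * (7 + 5 * B))"
    unfolding Z by simp_all
qed

section \<open>Counting the pairs without a common hub\<close>

type_synonym key = "(nat \<times> nat) list"

section \<open>Tries of keys and their growth\<close>

text \<open>
  A key lists chosen labels \<open>w\<close> in increasing order, each with a value of \<^const>\<open>slack\<close>. Keys are
  interned as nodes of a trie with root 1; node 0 stands for a missing key.
\<close>

definition path :: "(nat \<Rightarrow> nat \<Rightarrow> nat \<Rightarrow> nat) \<Rightarrow> key \<Rightarrow> nat" where
  "path ch ks = foldl (\<lambda>x (w, e). ch x w e) 1 ks"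

lemma path_Nil [simp]: "path ch [] = 1" by (simp add: path_def)

lemma path_snoc [simp]: "path ch (ks @ [(w, e)]) = ch (path ch ks) w e" by (simp add: path_def)

text \<open>The nodes are 1 to \<open>m\<close>. Distinct slots have distinct children and the root
  is no child, so existing keys have distinct nodes; node 0 has no children, so a missing key stays
  missing when it is extended.\<close>

definition trie :: "(nat \<Rightarrow> nat \<Rightarrow> nat \<Rightarrow> nat) \<Rightarrow> nat \<Rightarrow> bool" where
  "trie ch m \<longleftrightarrow> 1 \<le> m \<and> (\<forall>x w e. ch x w e \<le> m \<and> ch x w e \<noteq> 1 \<and> (x = 0 \<or> m < x \<longrightarrow> ch x w e = 0)) \<and>
    (\<forall>x w e x' w' e'. ch x w e \<noteq> 0 \<longrightarrow> ch x w e = ch x' w' e' \<longrightarrow> x = x' \<and> w = w' \<and> e = e')"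

lemma trie_dead:
  assumes "trie ch m" "x = 0 \<or> m < x" shows "ch x w e = 0"
proof -
  have "\<forall>x w e. ch x w e \<le> m \<and> ch x w e \<noteq> 1 \<and> (x = 0 \<or> m < x \<longrightarrow> ch x w e = 0)"
    using assms(1) unfolding trie_def by (elim conjE)
  then show ?thesis using assms(2) by metis
qed

lemma trie_le:
  assumes "trie ch m" shows "ch x w e \<le> m" "ch x w e \<noteq> 1" "1 \<le> m"
proof -
  have "\<forall>x w e. ch x w e \<le> m \<and> ch x w e \<noteq> 1 \<and> (x = 0 \<or> m < x \<longrightarrow> ch x w e = 0)"
    using assms(1) unfolding trie_def by (elim conjE)
  then show "ch x w e \<le> m" "ch x w e \<noteq> 1" by metis+
  show "1 \<le> m" using assms(1) unfolding trie_def by (elim conjE)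
qed

lemma trie_inj:
  assumes "trie ch m" "ch x w e \<noteq> 0" "ch x w e = ch x' w' e'" shows "x = x'" "w = w'" "e = e'"
proof -
  have "\<forall>x w e x' w' e'. ch x w e \<noteq> 0 \<longrightarrow> ch x w e = ch x' w' e' \<longrightarrow> x = x' \<and> w = w' \<and> e = e'"
    using assms(1) unfolding trie_def by (elim conjE)
  from this[rule_format, OF assms(2,3)] show "x = x'" "w = w'" "e = e'" by blast+
qed

text \<open>New children get numbers beyond the old \<open>m\<close>. Hence a new node is one whose
  counter was never touched.\<close>

definition trie_ext :: "(nat \<Rightarrow> nat \<Rightarrow> nat \<Rightarrow> nat) \<Rightarrow> nat \<Rightarrow> (nat \<Rightarrow> nat \<Rightarrow> nat \<Rightarrow> nat) \<Rightarrow> nat \<Rightarrow> bool" where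
  "trie_ext ch m ch' m' \<longleftrightarrow> m \<le> m' \<and> (\<forall>x w e. ch x w e \<noteq> 0 \<longrightarrow> ch' x w e = ch x w e) \<and>
    (\<forall>x w e. ch x w e = 0 \<longrightarrow> ch' x w e = 0 \<or> m < ch' x w e)"

lemma path_inj:
  assumes t: "trie ch m"
  shows "path ch ks \<noteq> 0 \<Longrightarrow> path ch ks = path ch ks' \<Longrightarrow> ks = ks'"
proof (induction ks arbitrary: ks' rule: rev_induct)
  case Nil
  show ?case
  proof (cases ks' rule: rev_cases)
    case (snoc l a)
    obtain w e where "a = (w, e)" by (cases a)
    then have "ch (path ch l) w e = 1" using Nil snoc by simp
    then show ?thesis using trie_le(2)[OF t] by blast
  qed simp
next
  case (snoc a l)
  obtain w e where a: "a = (w, e)" by (cases a)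
  have nz: "ch (path ch l) w e \<noteq> 0" using snoc.prems(1) a by simp
  show ?case
  proof (cases ks' rule: rev_cases)
    case Nil
    then have "ch (path ch l) w e = 1" using snoc.prems a by simp
    then show ?thesis using trie_le(2)[OF t] by blast
  next
    case (snoc l' b)
    obtain w' e' where b: "b = (w', e')" by (cases b)
    have "ch (path ch l) w e = ch (path ch l') w' e'" using snoc snoc.prems a b \<open>path ch (l @ [a]) = path ch ks'\<close> by simp
    then have p: "path ch l = path ch l'" "w = w'" "e = e'" using trie_inj[OF t nz] by blast+
    have "path ch l \<noteq> 0" using nz trie_dead[OF t] by metis
    then have "l = l'" using snoc.IH p(1) \<open>\<And>ks'. path ch l \<noteq> 0 \<Longrightarrow> path ch l = path ch ks' \<Longrightarrow> l = ks'\<close> by blast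
    then show ?thesis using snoc a b p by simp
  qed
qed

lemma trie_ext_refl: "trie_ext ch m ch m"
  by (simp add: trie_ext_def)

lemma trie_ext_trans:
  assumes "trie_ext ch m ch' m'" "trie_ext ch' m' ch'' m''"
  shows "trie_ext ch m ch'' m''"
  unfolding trie_ext_def
proof (intro conjI allI impI)
  show "m \<le> m''" using assms unfolding trie_ext_def by linarith
  show "ch'' x w e = ch x w e" if "ch x w e \<noteq> 0" for x w e
    using assms that unfolding trie_ext_def by metis
  show "ch'' x w e = 0 \<or> m < ch'' x w e" if "ch x w e = 0" for x w e
    using assms that unfolding trie_ext_def by (metis le_less_trans)
qed

text \<open>A key that had no node can get one only through a new child somewhere on its path, and
  whatever hangs below a new node is new as well.\<close>

lemma path_ext:
  assumes e: "trie_ext ch m ch' m'" and t: "trie ch m"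
  shows "path ch ks \<noteq> 0 \<Longrightarrow> path ch' ks = path ch ks"
    and "path ch ks = 0 \<Longrightarrow> path ch' ks = 0 \<or> m < path ch' ks"
proof -
  have "(path ch ks \<noteq> 0 \<longrightarrow> path ch' ks = path ch ks) \<and> (path ch ks = 0 \<longrightarrow> path ch' ks = 0 \<or> m < path ch' ks)"
  proof (induction ks rule: rev_induct)
    case (snoc a l)
    obtain w e' where a: "a = (w, e')" by (cases a)
    have z: "ch 0 w e' = 0" "\<And>x. m < x \<Longrightarrow> ch x w e' = 0" by (rule trie_dead[OF t], simp)+
    show ?case
    proof (cases "path ch l = 0")
      case True
      then have "ch (path ch' l) w e' = 0" using snoc z by metis
      then show ?thesis using e True a z unfolding trie_ext_def by simp
    next
      case False
      then show ?thesis using snoc e a unfolding trie_ext_def by simp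
    qed
  qed simp
  then show "path ch ks \<noteq> 0 \<Longrightarrow> path ch' ks = path ch ks"
    "path ch ks = 0 \<Longrightarrow> path ch' ks = 0 \<or> m < path ch' ks" by blast+
qed

lemma trie_insert:
  assumes t: "trie ch m" and x: "0 < x" "x \<le> m" and 0: "ch x w e = 0"
  defines "ch' \<equiv> ch(x := (ch x)(w := (ch x w)(e := Suc m)))"
  shows "trie ch' (Suc m)" "trie_ext ch m ch' (Suc m)"
proof -
  have e: "ch' y v f = (if y = x \<and> v = w \<and> f = e then Suc m else ch y v f)" for y v f
    by (simp add: ch'_def)
  have le: "ch y v f \<le> m" "ch y v f \<noteq> 1" for y v f by (rule trie_le[OF t])+
  have z: "y = 0 \<or> m < y \<Longrightarrow> ch y v f = 0" for y v f by (rule trie_dead[OF t])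
  have ne: "ch y v f \<noteq> Suc m" for y v f using le(1)[of y v f] by simp
  have m: "1 \<le> m" by (rule trie_le[OF t])
  show "trie ch' (Suc m)" unfolding trie_def
  proof (intro conjI allI impI)
    fix y v f
    show "ch' y v f \<le> Suc m" using le(1)[of y v f] by (simp add: e)
    show "ch' y v f \<noteq> 1" using le(2)[of y v f] m by (simp add: e)
    show "ch' y v f = 0" if y: "y = 0 \<or> Suc m < y"
    proof -
      have "y \<noteq> x" "y = 0 \<or> m < y" using y x by auto
      then show ?thesis using z[of y v f] unfolding e by metis
    qed
    fix y' v' f'
    assume A: "ch' y v f \<noteq> 0" "ch' y v f = ch' y' v' f'"
    have "y = y' \<and> v = v' \<and> f = f'"
    proof (cases "y = x \<and> v = w \<and> f = e")
      case True
      then have "ch' y' v' f' = Suc m" using A(2) unfolding e by simp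
      then show ?thesis using True ne[of y' v' f'] unfolding e by metis
    next
      case False
      then have c: "ch' y v f = ch y v f" unfolding e by (simp only: if_False)
      then have c': "ch' y' v' f' = ch y' v' f'" using A(2) ne[of y v f] unfolding e by metis
      have "ch y v f \<noteq> 0" using A(1) unfolding c .
      moreover have "ch y v f = ch y' v' f'" using A(2) unfolding c c' .
      ultimately show ?thesis using trie_inj[OF t] by blast
    qed
    then show "y = y'" "v = v'" "f = f'" by blast+
  qed (use m in simp)
  show "trie_ext ch m ch' (Suc m)" unfolding trie_ext_def
  proof (intro conjI allI impI)
    fix y v f
    show "ch' y v f = ch y v f" if nz: "ch y v f \<noteq> 0"
    proof -
      have "\<not> (y = x \<and> v = w \<and> f = e)"
      proof (intro notI, elim conjE)
        assume "y = x" "v = w" "f = e"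
        then show False using 0 nz by (simp only:)
      qed
      then show ?thesis unfolding e by (rule if_not_P)
    qed
    show "ch' y v f = 0 \<or> m < ch' y v f" if "ch y v f = 0" using that unfolding e by (metis lessI)
  qed simp
qed

text \<open>A key stored for v guesses the slack \<open>Suc e\<close> = k + 1 - i from the still
  unknown u to the label w. With \<open>B w\<close> = k + 1 - j from w to v and K = k + 1, the
  filter says \<open>Suc K \<le> Suc e + B w\<close>, that is, i + j \<le> k. The bound m is
  separate from K so that a partly executed loop can be described.\<close>

definition extensions :: "(nat \<Rightarrow> nat) \<Rightarrow> nat \<Rightarrow> nat \<Rightarrow> nat \<Rightarrow> key \<Rightarrow> key list" where
  "extensions B K w m ks = map (\<lambda>e. ks @ [(w, Suc e)]) (filter (\<lambda>e. K - e \<le> B w) [0..<m])"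

definition stored_keys :: "(nat \<Rightarrow> nat) \<Rightarrow> nat \<Rightarrow> nat list \<Rightarrow> key list" where
  "stored_keys B K xs = foldl (\<lambda>L w. L @ concat (map (extensions B K w K) L)) [[]] xs"

lemma stored_keys_Nil [simp]: "stored_keys B K [] = [[]]" by (simp add: stored_keys_def)

lemma stored_keys_snoc [simp]: "stored_keys B K (xs @ [w]) =
    stored_keys B K xs @ concat (map (extensions B K w K) (stored_keys B K xs))"
  by (simp add: stored_keys_def)

text \<open>A label is absent from a key or carries one of at most K values.\<close>

lemma length_stored_keys: "length (stored_keys B K xs) \<le> Suc K ^ length xs"
proof (induction xs rule: rev_induct)
  case (snoc w xs)
  let ?L = "stored_keys B K xs"
  have "length (extensions B K w K ks) \<le> K" for ks
    unfolding extensions_def using length_filter_le[of "\<lambda>e. K - e \<le> B w" "[0..<K]"] by simp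
  then have "(\<Sum>ks\<leftarrow>?L. length (extensions B K w K ks)) \<le> (\<Sum>ks\<leftarrow>?L. K)"
    by (intro sum_list_mono) auto
  then have "length (stored_keys B K (xs @ [w])) \<le> length ?L * Suc K"
    by (simp add: length_concat o_def sum_list_triv)
  also have "\<dots> \<le> Suc K ^ length xs * Suc K" using snoc by (rule mult_le_mono1)
  also have "\<dots> = Suc K ^ length (xs @ [w])" by (simp only: length_append_singleton power_Suc2)
  finally show ?case .
qed simp

lemma set_stored_keys:
  assumes "sorted_wrt (<) xs"
  shows "ks \<in> set (stored_keys B K xs) \<longleftrightarrow> sorted_wrt (<) (map fst ks) \<and>
    (\<forall>(w, e)\<in>set ks. w \<in> set xs \<and> 1 \<le> e \<and> e \<le> K \<and> Suc K \<le> e + B w)"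
  using assms
proof (induction xs arbitrary: ks rule: rev_induct)
  case Nil
  then show ?case by (cases ks) auto
next
  case (snoc y xs)
  have lt: "\<forall>z\<in>set xs. z < y" and sx: "sorted_wrt (<) xs" using snoc.prems by (auto simp: sorted_wrt_append)
  note IH = snoc.IH[OF sx]
  let ?P = "\<lambda>xs ks. sorted_wrt (<) (map fst ks) \<and>
    (\<forall>(w, e)\<in>set ks. w \<in> set xs \<and> 1 \<le> e \<and> e \<le> K \<and> Suc K \<le> e + B w)"
  have ext: "ks \<in> set (extensions B K y K l) \<longleftrightarrow> (\<exists>e. ks = l @ [(y, e)] \<and> 1 \<le> e \<and> e \<le> K \<and> Suc K \<le> e + B y)" for l
  proof
    assume "ks \<in> set (extensions B K y K l)"
    then obtain e where "e < K" "K - e \<le> B y" "ks = l @ [(y, Suc e)]" by (auto simp: extensions_def)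
    then show "\<exists>e. ks = l @ [(y, e)] \<and> 1 \<le> e \<and> e \<le> K \<and> Suc K \<le> e + B y"
      by (intro exI[of _ "Suc e"]) auto
  next
    assume "\<exists>e. ks = l @ [(y, e)] \<and> 1 \<le> e \<and> e \<le> K \<and> Suc K \<le> e + B y"
    then obtain e where "ks = l @ [(y, e)]" "1 \<le> e" "e \<le> K" "Suc K \<le> e + B y" by blast
    then show "ks \<in> set (extensions B K y K l)"
      unfolding extensions_def by (auto intro!: image_eqI[of _ _ "e - 1"])
  qed
  have "ks \<in> set (stored_keys B K (xs @ [y])) \<longleftrightarrow>
      ?P xs ks \<or> (\<exists>l e. ?P xs l \<and> ks = l @ [(y, e)] \<and> 1 \<le> e \<and> e \<le> K \<and> Suc K \<le> e + B y)"
    unfolding stored_keys_snoc set_append Un_iff IH using ext by (auto simp: IH)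
  also have "\<dots> \<longleftrightarrow> ?P (xs @ [y]) ks"
  proof
    assume "?P xs ks \<or> (\<exists>l e. ?P xs l \<and> ks = l @ [(y, e)] \<and> 1 \<le> e \<and> e \<le> K \<and> Suc K \<le> e + B y)"
    then show "?P (xs @ [y]) ks"
    proof
      assume "\<exists>l e. ?P xs l \<and> ks = l @ [(y, e)] \<and> 1 \<le> e \<and> e \<le> K \<and> Suc K \<le> e + B y"
      then obtain l e where l: "?P xs l" "ks = l @ [(y, e)]" "1 \<le> e" "e \<le> K" "Suc K \<le> e + B y" by blast
      have "\<forall>z\<in>set (map fst l). z < y" using l(1) lt by fastforce
      then show ?thesis using l by (auto simp: sorted_wrt_append)
    qed auto
  next
    assume P: "?P (xs @ [y]) ks"
    show "?P xs ks \<or> (\<exists>l e. ?P xs l \<and> ks = l @ [(y, e)] \<and> 1 \<le> e \<and> e \<le> K \<and> Suc K \<le> e + B y)"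
    proof (cases ks rule: rev_cases)
      case Nil
      then show ?thesis by simp
    next
      case ks: (snoc l a)
      obtain w e where a: "a = (w, e)" by (cases a)
      have s: "sorted_wrt (<) (map fst l)" "\<forall>z\<in>set l. fst z < w" using P ks a by (auto simp: sorted_wrt_append)
      have wy: "w \<le> y" using P ks a lt by fastforce
      have "\<forall>(w', e')\<in>set l. w' \<in> set xs"
        using P ks s(2) wy by fastforce
      then have Pl: "?P xs l" using P ks s(1) by fastforce
      show ?thesis
      proof (cases "w = y")
        case True
        then show ?thesis using P ks a Pl by auto
      next
        case False
        then have "w \<in> set xs" using P ks a by auto
        then have "?P xs ks" using Pl P ks a by auto
        then show ?thesis by blast
      qed
    qed
  qed
  finally show ?case .
qed

text \<open>Counters are incremented once per list entry, so a repeated key would count its vertex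
  twice.\<close>

lemma distinct_stored_keys: "sorted_wrt (<) xs \<Longrightarrow> distinct (stored_keys B K xs)"
proof (induction xs rule: rev_induct)
  case (snoc y xs)
  let ?L = "stored_keys B K xs"
  have sx: "sorted_wrt (<) xs" and lt: "\<forall>z\<in>set xs. z < y" using snoc.prems by (auto simp: sorted_wrt_append)
  have d: "distinct ?L" using snoc sx by blast
  have de: "distinct (extensions B K y K ks)" for ks
    unfolding extensions_def by (simp add: distinct_map inj_on_def)
  have "distinct (concat (map (extensions B K y K) ?L))"
    using d
  proof (induction ?L)
    case Nil
    then show ?case by simp
  next
    case (Cons a L)
    have "distinct M \<Longrightarrow> distinct (concat (map (extensions B K y K) M))" for M
      by (induction M) (use de in \<open>auto simp: extensions_def\<close>)
    then show ?case using Cons.prems by simp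
  qed
  moreover have "set ?L \<inter> set (concat (map (extensions B K y K) ?L)) = {}"
  proof -
    have "y \<notin> fst ` set ks" if "ks \<in> set ?L" for ks
      using that lt unfolding set_stored_keys[OF sx] by fastforce
    then show ?thesis unfolding extensions_def by fastforce
  qed
  ultimately show ?case using d by simp
qed simp

text \<open>On the side of u the slacks are known, so a chosen label carries one value only; labels
  of unknown distance cannot be suitable and are skipped.\<close>

definition query_keys :: "(nat \<Rightarrow> nat) \<Rightarrow> nat list \<Rightarrow> key list" where
  "query_keys D xs = foldl (\<lambda>L w. if 0 < D w then L @ map (\<lambda>ks. ks @ [(w, D w)]) L else L) [[]] xs"

lemma query_keys_Nil [simp]: "query_keys D [] = [[]]" by (simp add: query_keys_def)

lemma query_keys_snoc [simp]: "query_keys D (xs @ [w]) =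
    (if 0 < D w then query_keys D xs @ map (\<lambda>ks. ks @ [(w, D w)]) (query_keys D xs) else query_keys D xs)"
  by (simp add: query_keys_def)

lemma length_query_keys: "length (query_keys D xs) \<le> 2 ^ length xs"
  by (induction xs rule: rev_induct) auto

lemma query_keys_fst: "ks \<in> set (query_keys D xs) \<Longrightarrow> fst ` set ks \<subseteq> set xs"
  by (induction xs arbitrary: ks rule: rev_induct) (fastforce split: if_splits)+

text \<open>Expanding the product of \<open>1 - [w is a common hub]\<close> over the labels of \<open>u\<close>.\<close>

lemma query_keys_sum:
  assumes xs: "sorted_wrt (<) xs" and ys: "sorted_wrt (<) ys" and D: "\<And>w. D w \<le> K"
  shows "(\<Sum>ks\<leftarrow>query_keys D xs. (-1) ^ length ks * of_bool (ks \<in> set (stored_keys B K ys))) =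
    (of_bool (\<forall>w\<in>set xs. \<not> (w \<in> set ys \<and> 0 < D w \<and> Suc K \<le> D w + B w)) :: int)"
  using xs
proof (induction xs rule: rev_induct)
  case Nil
  then show ?case using set_stored_keys[OF ys, of "[]" B K] by simp
next
  case (snoc w xs)
  have sx: "sorted_wrt (<) xs" and lt: "\<forall>z\<in>set xs. z < w" using snoc.prems by (auto simp: sorted_wrt_append)
  let ?f = "\<lambda>ks. (-1) ^ length ks * of_bool (ks \<in> set (stored_keys B K ys)) :: int"
  let ?g = "w \<in> set ys \<and> 0 < D w \<and> Suc K \<le> D w + B w"
  have step: "?f (ks @ [(w, D w)]) = - (of_bool ?g * ?f ks)" if ks: "ks \<in> set (query_keys D xs)" "0 < D w" for ks
  proof -
    have "\<forall>z\<in>set (map fst ks). z < w" using query_keys_fst[OF ks(1)] lt by auto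
    then have "ks @ [(w, D w)] \<in> set (stored_keys B K ys) \<longleftrightarrow> ks \<in> set (stored_keys B K ys) \<and> ?g"
      unfolding set_stored_keys[OF ys] using ks(2) D[of w] by (auto simp: sorted_wrt_append)
    then show ?thesis by (cases ?g) simp_all
  qed
  have IH: "(\<Sum>ks\<leftarrow>query_keys D xs. ?f ks) = of_bool (\<forall>w\<in>set xs. \<not> (w \<in> set ys \<and> 0 < D w \<and> Suc K \<le> D w + B w))"
    using snoc.IH[OF sx] .
  show ?case
  proof (cases "0 < D w")
    case False
    then show ?thesis using IH by simp
  next
    case True
    have "(\<Sum>ks\<leftarrow>query_keys D xs. ?f (ks @ [(w, D w)])) = (\<Sum>ks\<leftarrow>query_keys D xs. - of_bool ?g * ?f ks)"
      by (rule arg_cong[of _ _ sum_list], rule map_cong) (use step True in auto)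
    also have "\<dots> = - of_bool ?g * (\<Sum>ks\<leftarrow>query_keys D xs. ?f ks)" by (rule sum_list_const_mult)
    finally have "(\<Sum>ks\<leftarrow>query_keys D (xs @ [w]). ?f ks) = (1 - of_bool ?g) * (\<Sum>ks\<leftarrow>query_keys D xs. ?f ks)"
      using True by (simp add: o_def algebra_simps)
    then show ?thesis unfolding IH by auto
  qed
qed

section \<open>Storing and counting the keys of all vertices\<close>

definition child :: "loop_state \<Rightarrow> nat \<Rightarrow> nat \<Rightarrow> nat \<Rightarrow> nat" where
  "child s = arr s tCh"

definition store_key :: loop_com where
  "store_key = Inc vE1 vE ;; Sub vC vK1 vE ;; Cond vB vC Nop
    (Get vA tCh vX vY vE1 ;; Cond vZ vA Nop (Inc vNC vNC ;; Move vA vNC ;; Put tCh vX vY vE1 vA) ;;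
     Put tL vV vLC vZ vA ;; Inc vLC vLC)"

definition store_keys :: loop_com where
  "store_keys = Get vX tL vV vJ vZ ;; For vE vK1 store_key"

text \<open>The bound \<open>vLC\<close> is read at loop entry, so keys appended meanwhile, which
  already contain this label, are not extended by it again. Slacks are taken from the label to
  \<open>vV\<close> here, but from \<open>vV\<close> to the label in a query.\<close>

definition store_label :: loop_com where
  "store_label = Get vY tR vV vI vZ ;; Get vB tD vY vV vZ ;; For vJ vLC store_keys"

definition count_keys :: loop_com where
  "count_keys = For vJ vLC (Get vX tL vV vJ vZ ;; Get vA tCnt vX vZ vZ ;; Inc vA vA ;; Put tCnt vX vZ vZ vA)"

definition store_vertex :: loop_com where
  "store_vertex = Put tL vV vZ vZ vOne ;; Const vLC 1 ;; Get vRC tRc vV vZ vZ ;; For vI vRC store_label ;; count_keys"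

definition build_trie :: loop_com where
  "build_trie = Const vNC 1 ;; For vV vN store_vertex"

lemma mod_store_key [simp]: "mod_vars store_key = {vE1, vC, vA, vNC, vLC}" "mod_arrs store_key = {tCh, tL}"
  by (auto simp: store_key_def)

lemma mod_store_keys [simp]: "mod_vars store_keys = {vE1, vC, vA, vNC, vLC, vX, vE}" "mod_arrs store_keys = {tCh, tL}"
  by (auto simp: store_keys_def)

lemma mod_store_label [simp]: "mod_vars store_label = {vE1, vC, vA, vNC, vLC, vX, vE, vY, vB, vJ}" "mod_arrs store_label = {tCh, tL}"
  by (auto simp: store_label_def)

lemma mod_count_keys [simp]: "mod_vars count_keys = {vA, vX, vJ}" "mod_arrs count_keys = {tCnt}"
  by (auto simp: count_keys_def)

lemma mod_store_vertex [simp]: "mod_vars store_vertex = {vE1, vC, vA, vNC, vLC, vX, vE, vY, vB, vJ, vRC, vI}"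
  "mod_arrs store_vertex = {tCh, tL, tCnt}"
  by (auto simp: store_vertex_def)

lemma mod_build_trie [simp]: "mod_vars build_trie = {vE1, vC, vA, vNC, vLC, vX, vE, vY, vB, vJ, vRC, vI, vV}"
  "mod_arrs build_trie = {tCh, tL, tCnt}"
  by (auto simp: build_trie_def)

definition node_list :: "loop_state \<Rightarrow> nat \<Rightarrow> nat list" where
  "node_list s v = seq (\<lambda>i. arr s tL v i 0) (vars s vLC)"

text \<open>\<open>s\<close> is the state before vertex \<open>v\<close> is processed.\<close>

definition trie_inv :: "loop_state \<Rightarrow> nat \<Rightarrow> key list \<Rightarrow> loop_state \<Rightarrow> bool" where
  "trie_inv s v Ks t \<longleftrightarrow> trie (child t) (vars t vNC) \<and> trie_ext (child s) (vars s vNC) (child t) (vars t vNC) \<and>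
    node_list t v = map (path (child t)) Ks \<and> (\<forall>ks\<in>set Ks. path (child t) ks \<noteq> 0)"

lemma trie_inv_cong:
  "child t' = child t \<Longrightarrow> vars t' vNC = vars t vNC \<Longrightarrow> node_list t' v = node_list t v \<Longrightarrow>
    trie_inv s v Ks t \<Longrightarrow> trie_inv s v Ks t'"
  by (simp add: trie_inv_def)

lemma length_node_list: "trie_inv s v Ks t \<Longrightarrow> vars t vLC = length Ks"
  unfolding trie_inv_def by (metis length_map length_seq node_list_def)

lemma child_tick_vars [simp]: "child (s\<lparr>ticks := a\<rparr>) = child s" "child (s\<lparr>vars := b\<rparr>) = child s"
  "node_list (s\<lparr>ticks := a\<rparr>) v = node_list s v"
  by (simp_all add: child_def node_list_def)

lemma store_key:
  fixes n :: nat and inp :: "nat \<Rightarrow> nat" and s t :: loop_state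
  assumes I: "trie_inv s v Ks t" and ks: "ks \<in> set Ks" "vars t vX = path (child t) ks"
    and Z: "vars t vZ = 0" "vars t vV = v" "vars t vK1 = K" "vars t vE = e" "vars t vY = w"
  defines "t' \<equiv> sem n inp store_key t"
  shows "trie_inv s v (Ks @ (if K - e \<le> vars t vB then [ks @ [(w, Suc e)]] else [])) t'"
    and "path (child t') ks = vars t vX"
    and "ticks t' \<le> ticks t + 10"
proof -
  let ?x = "vars t vX" and ?m = "vars t vNC" and ?ch = "child t"
  have J: "trie ?ch ?m" "trie_ext (child s) (vars s vNC) ?ch ?m" "node_list t v = map (path ?ch) Ks"
    "\<And>ks. ks \<in> set Ks \<Longrightarrow> path ?ch ks \<noteq> 0" using I unfolding trie_inv_def by blast+
  have x0: "?x \<noteq> 0" using ks J(4) by simp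
  show "ticks t' \<le> ticks t + 10" using Z by (simp add: t'_def store_key_def)
  have goal: "trie_inv s v (Ks @ (if K - e \<le> vars t vB then [ks @ [(w, Suc e)]] else [])) t' \<and> path (child t') ks = ?x"
  proof (cases "K - e \<le> vars t vB")
    case False
    then have "child t' = ?ch" "vars t' vNC = ?m" "node_list t' v = node_list t v"
      using Z by (simp_all add: t'_def store_key_def child_def node_list_def)
    then show ?thesis using False I ks by (auto intro: trie_inv_cong)
  next
    case True
    let ?c = "?ch ?x w (Suc e)"
    define ch' m' where "ch' = (if ?c = 0 then ?ch(?x := (?ch ?x)(w := (?ch ?x w)(Suc e := Suc ?m))) else ?ch)"
      and "m' = (if ?c = 0 then Suc ?m else ?m)"
    have xm: "?x \<le> ?m"
    proof (cases ks rule: rev_cases)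
      case Nil
      then show ?thesis using ks trie_le(3)[OF J(1)] by simp
    next
      case (snoc l a)
      then show ?thesis using ks trie_le(1)[OF J(1)] by (cases a) simp
    qed
    have new: "trie ch' m'" "trie_ext ?ch ?m ch' m'" "ch' ?x w (Suc e) \<noteq> 0"
      using trie_insert[OF J(1) _ xm, of w "Suc e"] x0 J(1) trie_ext_refl unfolding ch'_def m'_def
      by (simp_all add: fun_upd_def)
    have ct: "child t' = ch'" "vars t' vNC = m'" "vars t' vLC = Suc (vars t vLC)"
      "arr t' tL v i 0 = (if i = vars t vLC then ch' ?x w (Suc e) else arr t tL v i 0)" for i
      using Z True by (auto simp: t'_def store_key_def child_def ch'_def m'_def set_arr_def)
    have px: "path ch' l = path ?ch l" if "l \<in> set Ks" for l
      using path_ext(1)[OF new(2) J(1) J(4)[OF that]] .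
    have "node_list t' v = node_list t v @ [ch' ?x w (Suc e)]"
      unfolding node_list_def ct(3) using ct(4) by simp
    moreover have "path ch' ks = ?x" using px[OF ks(1)] ks(2) by simp
    ultimately have "trie_inv s v (Ks @ [ks @ [(w, Suc e)]]) t'"
      unfolding trie_inv_def ct(1,2) using new J px trie_ext_trans[OF J(2) new(2)] by simp
    then show ?thesis using True \<open>path ch' ks = ?x\<close> ct(1) by simp
  qed
  then show "trie_inv s v (Ks @ (if K - e \<le> vars t vB then [ks @ [(w, Suc e)]] else [])) t'"
    "path (child t') ks = ?x" by blast+
qed

lemma store_keys:
  fixes n :: nat and inp :: "nat \<Rightarrow> nat" and s t :: loop_state
  assumes I: "trie_inv s v Ks t" and j: "vars t vJ < length Ks"
    and Z: "vars t vZ = 0" "vars t vV = v" "vars t vK1 = K" "vars t vY = w" "vars t vB = B w"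
  defines "t' \<equiv> sem n inp store_keys t"
  shows "trie_inv s v (Ks @ extensions B K w K (Ks ! vars t vJ)) t'"
    and "ticks t' \<le> ticks t + 2 + K * 11"
proof -
  let ?ks = "Ks ! vars t vJ"
  define t1 where "t1 = sem n inp (Get vX tL vV vJ vZ) t"
  have J: "node_list t v = map (path (child t)) Ks" using I unfolding trie_inv_def by blast
  have x: "arr t tL v (vars t vJ) 0 = path (child t) ?ks"
  proof -
    have "arr t tL v (vars t vJ) 0 = node_list t v ! vars t vJ"
      using j length_node_list[OF I] unfolding node_list_def by simp
    then show ?thesis unfolding J using j by simp
  qed
  have t1: "vars t1 vZ = 0" "vars t1 vV = v" "vars t1 vK1 = K" "vars t1 vY = w" "vars t1 vB = B w"
    "vars t1 vX = path (child t) ?ks" "child t1 = child t" "ticks t1 = ticks t + 1"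
    using Z x by (simp_all add: t1_def)
  have I1: "trie_inv s v Ks t1" by (rule trie_inv_cong[OF _ _ _ I]) (simp_all add: t1_def node_list_def)
  define P where "P i u \<longleftrightarrow> trie_inv s v (Ks @ extensions B K w i ?ks) u \<and> path (child u) ?ks = vars t1 vX"
    for i and u :: loop_state
  have "P (vars t1 vK1) (sem n inp (For vE vK1 store_key) t1) \<and>
    ticks (sem n inp (For vE vK1 store_key) t1) \<le> ticks t1 + 1 + (\<Sum>i<vars t1 vK1. 11)"
  proof (rule For_rule, goal_cases)
    case 1
    have "trie_inv s v Ks (tick t1)" by (rule trie_inv_cong[OF _ _ _ I1]) simp_all
    then show ?case using t1 unfolding P_def extensions_def by simp
  next
    case (2 e u)
    let ?u = "tick (set_var vE e u)"
    have u: "vars ?u vZ = 0" "vars ?u vV = v" "vars ?u vK1 = K" "vars ?u vE = e" "vars ?u vY = w" "vars ?u vB = B w"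
      "vars ?u vX = vars t1 vX" using 2(3) t1 by auto
    have p: "path (child u) ?ks = vars t1 vX" using 2(2) unfolding P_def by blast
    have I2: "trie_inv s v (Ks @ extensions B K w e ?ks) ?u"
      using 2(2) unfolding P_def by (elim conjE) (erule trie_inv_cong[rotated 3], simp_all add: node_list_def)
    have ks: "?ks \<in> set (Ks @ extensions B K w e ?ks)" "vars ?u vX = path (child ?u) ?ks"
      using j p u by simp_all
    note sk = store_key[OF I2 ks u(1-5), where n = n and inp = inp]
    have "extensions B K w (Suc e) ?ks = extensions B K w e ?ks @ (if K - e \<le> vars ?u vB then [?ks @ [(w, Suc e)]] else [])"
      unfolding u by (simp add: extensions_def)
    then show ?case using sk(1,3) sk(2)[unfolded u] unfolding P_def by simp
  qed
  then have fin: "P K (sem n inp (For vE vK1 store_key) t1)"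
    "ticks (sem n inp (For vE vK1 store_key) t1) \<le> ticks t + 2 + K * 11" unfolding t1 by simp_all
  have t': "t' = sem n inp (For vE vK1 store_key) t1" by (simp add: t'_def t1_def store_keys_def)
  show "trie_inv s v (Ks @ extensions B K w K ?ks) t'" "ticks t' \<le> ticks t + 2 + K * 11"
    using fin unfolding P_def t' by blast+
qed

lemma store_label:
  fixes n :: nat and inp :: "nat \<Rightarrow> nat" and s t :: loop_state
  assumes I: "trie_inv s v Ks t"
    and Z: "vars t vZ = 0" "vars t vV = v" "vars t vK1 = K"
    and w: "arr t tR v (vars t vI) 0 = w" "slack t w v = B w"
  defines "t' \<equiv> sem n inp store_label t"
  shows "trie_inv s v (Ks @ concat (map (extensions B K w K) Ks)) t'"
    and "ticks t' \<le> ticks t + 3 + length Ks * (3 + K * 11)"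
proof -
  define t1 where "t1 = sem n inp (Get vY tR vV vI vZ ;; Get vB tD vY vV vZ) t"
  have t1: "vars t1 vZ = 0" "vars t1 vV = v" "vars t1 vK1 = K" "vars t1 vY = w" "vars t1 vB = B w"
    "vars t1 vLC = length Ks" "ticks t1 = ticks t + 2"
    using Z w length_node_list[OF I] by (simp_all add: t1_def slack_def)
  have I1: "trie_inv s v Ks t1" by (rule trie_inv_cong[OF _ _ _ I]) (simp_all add: t1_def node_list_def)
  have "(\<lambda>i. trie_inv s v (Ks @ concat (map (extensions B K w K) (take i Ks)))) (vars t1 vLC) (sem n inp (For vJ vLC store_keys) t1) \<and>
    ticks (sem n inp (For vJ vLC store_keys) t1) \<le> ticks t1 + 1 + (\<Sum>i<vars t1 vLC. 3 + K * 11)"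
  proof (rule For_rule, goal_cases)
    case 1
    show ?case using I1 by (auto intro: trie_inv_cong[rotated 3])
  next
    case (2 j u)
    let ?u = "tick (set_var vJ j u)"
    let ?Ks = "Ks @ concat (map (extensions B K w K) (take j Ks))"
    have j: "j < length Ks" using 2(1) t1 by simp
    have u: "vars ?u vZ = 0" "vars ?u vV = v" "vars ?u vK1 = K" "vars ?u vY = w" "vars ?u vB = B w" "vars ?u vJ = j"
      using 2(3) t1 by auto
    have I2: "trie_inv s v ?Ks ?u"
      by (rule trie_inv_cong[OF _ _ _ 2(2)]) (simp_all add: node_list_def)
    have j': "vars ?u vJ < length ?Ks" using j u by simp
    have nth: "?Ks ! j = Ks ! j" using j by (simp add: nth_append)
    have tk: "take (Suc j) Ks = take j Ks @ [Ks ! j]" using j by (simp add: take_Suc_conv_app_nth)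
    show ?case using store_keys[where B = B, OF I2 j' u(1-5), where n = n and inp = inp] unfolding u(6) nth tk by simp
  qed
  moreover have "t' = sem n inp (For vJ vLC store_keys) t1" by (simp add: t'_def t1_def store_label_def)
  ultimately show "trie_inv s v (Ks @ concat (map (extensions B K w K) Ks)) t'"
    "ticks t' \<le> ticks t + 3 + length Ks * (3 + K * 11)"
    unfolding t1 by simp_all
qed

lemma count_keys:
  fixes n :: nat and inp :: "nat \<Rightarrow> nat" and s :: loop_state
  assumes Z: "vars s vZ = 0"
  defines "s' \<equiv> sem n inp count_keys s"
  shows "arr s' tCnt x 0 0 = arr s tCnt x 0 0 + count_list (node_list s (vars s vV)) x"
    and "ticks s' \<le> ticks s + 1 + vars s vLC * 5"
proof -
  let ?l = "node_list s (vars s vV)"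
  have "(\<lambda>i t. \<forall>x. arr t tCnt x 0 0 = arr s tCnt x 0 0 + count_list (take i ?l) x) (vars s vLC) s' \<and>
    ticks s' \<le> ticks s + 1 + (\<Sum>i<vars s vLC. 5)"
    unfolding s'_def count_keys_def
  proof (rule For_rule, goal_cases)
    case (2 i t)
    have i: "i < length ?l" using 2(1) by (simp add: node_list_def)
    have v: "vars t vZ = 0" "vars t vV = vars s vV" "arr t tL = arr s tL" using 2(3,4) Z by auto
    have e: "arr s tL (vars s vV) i 0 = ?l ! i" using i by (simp add: node_list_def)
    have tk: "take (Suc i) ?l = take i ?l @ [?l ! i]" using i by (simp add: take_Suc_conv_app_nth)
    show ?case using 2(2) v e unfolding tk by simp
  qed simp
  then show "arr s' tCnt x 0 0 = arr s tCnt x 0 0 + count_list ?l x" "ticks s' \<le> ticks s + 1 + vars s vLC * 5"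
    by (simp_all add: node_list_def)
qed

definition counted :: "(nat \<Rightarrow> key set) \<Rightarrow> nat \<Rightarrow> loop_state \<Rightarrow> bool" where
  "counted KS i t \<longleftrightarrow> trie (child t) (vars t vNC) \<and> (\<forall>x>vars t vNC. arr t tCnt x 0 0 = 0) \<and> arr t tCnt 0 0 0 = 0 \<and>
    (\<forall>v<i. \<forall>ks\<in>KS v. path (child t) ks \<noteq> 0) \<and>
    (\<forall>ks. path (child t) ks \<noteq> 0 \<longrightarrow> arr t tCnt (path (child t) ks) 0 0 = card {v. v < i \<and> ks \<in> KS v})"

lemma count_list_map_inj:
  assumes "distinct Ks" "\<And>ks ks'. ks \<in> set Ks \<Longrightarrow> f ks = f ks' \<Longrightarrow> ks = ks'"
  shows "count_list (map f Ks) (f ks) = of_bool (ks \<in> set Ks)"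
  using assms
proof (induction Ks)
  case (Cons a Ks)
  have "f a = f ks \<longleftrightarrow> a = ks" using Cons.prems(2)[of a ks] by auto
  moreover have "count_list (map f Ks) (f ks) = of_bool (ks \<in> set Ks)"
    by (rule Cons.IH) (use Cons.prems in auto)
  ultimately show ?case using Cons.prems(1) by auto
qed simp

lemma store_vertex:
  fixes n :: nat and inp :: "nat \<Rightarrow> nat" and s :: loop_state
  assumes C: "counted KS v s" and Z: "vars s vZ = 0" "vars s vOne = 1" "vars s vV = v" "vars s vK1 = K"
    and KS: "KS v = set (stored_keys (\<lambda>w. slack s w v) K (ranked s v))"
    and sorted: "sorted_wrt (<) (ranked s v)" and len: "length (ranked s v) \<le> B"
  defines "s' \<equiv> sem n inp store_vertex s"
  shows "counted KS (Suc v) s'"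
    and "ticks s' \<le> ticks s + 5 + B * (4 + Suc K ^ B * (3 + K * 11)) + Suc K ^ B * 5"
proof -
  let ?D = "\<lambda>w. slack s w v" and ?xs = "ranked s v"
  let ?Kl = "stored_keys ?D K"
  define s1 where "s1 = sem n inp (Put tL vV vZ vZ vOne ;; Const vLC 1 ;; Get vRC tRc vV vZ vZ) s"
  have T: "trie (child s) (vars s vNC)" using C unfolding counted_def by blast
  have s1: "vars s1 vZ = 0" "vars s1 vV = v" "vars s1 vK1 = K" "vars s1 vRC = length ?xs" "vars s1 vNC = vars s vNC"
    "child s1 = child s" "slack s1 = slack s" "ranked s1 = ranked s" "node_list s1 v = [1]" "ticks s1 = ticks s + 3"
    "arr s1 tCnt = arr s tCnt"
    using Z by (auto simp: s1_def child_def slack_def ranked_def node_list_def arr_set_arr_other fun_eq_iff)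
  have "(\<lambda>i. trie_inv s v (?Kl (take i ?xs))) (vars s1 vRC) (sem n inp (For vI vRC store_label) s1) \<and>
    ticks (sem n inp (For vI vRC store_label) s1) \<le> ticks s1 + 1 + (\<Sum>i<vars s1 vRC. 4 + Suc K ^ B * (3 + K * 11))"
  proof (rule For_rule, goal_cases)
    case 1
    show ?case using s1 T trie_ext_refl by (simp add: trie_inv_def)
  next
    case (2 i t)
    let ?t = "tick (set_var vI i t)"
    have i: "i < length ?xs" using 2(1) s1 by simp
    have t: "vars ?t vZ = 0" "vars ?t vV = v" "vars ?t vK1 = K" using 2(3) s1 by auto
    have "arr t tR = arr s1 tR" "arr t tD = arr s1 tD" using 2(4) by auto
    then have w: "arr ?t tR v (vars ?t vI) 0 = ?xs ! i" "slack ?t (?xs ! i) v = ?D (?xs ! i)"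
      using i s1(7,8) by (simp_all add: slack_def ranked_def s1_def arr_set_arr_other)
    have I: "trie_inv s v (?Kl (take i ?xs)) ?t"
      by (rule trie_inv_cong[OF _ _ _ 2(2)]) (simp_all add: node_list_def)
    have tk: "take (Suc i) ?xs = take i ?xs @ [?xs ! i]" using i by (simp add: take_Suc_conv_app_nth)
    have "length (?Kl (take i ?xs)) \<le> Suc K ^ length (take i ?xs)" by (rule length_stored_keys)
    also have "\<dots> \<le> Suc K ^ B" using len by (intro power_increasing) auto
    finally have le: "length (?Kl (take i ?xs)) * (3 + K * 11) \<le> Suc K ^ B * (3 + K * 11)" by (rule mult_le_mono1)
    note sl = store_label[where B = ?D, OF I t w, where n = n and inp = inp]
    have "ticks ?t = Suc (ticks t)" by simp
    then have "ticks (sem n inp store_label ?t) \<le> ticks t + (4 + Suc K ^ B * (3 + K * 11))"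
      using sl(2) le by linarith
    then show ?case using sl(1) unfolding tk stored_keys_snoc by blast
  qed
  moreover define s2 where "s2 = sem n inp (For vI vRC store_label) s1"
  ultimately have s2: "trie_inv s v (?Kl ?xs) s2"
    "ticks s2 \<le> ticks s + 4 + length ?xs * (4 + Suc K ^ B * (3 + K * 11))" unfolding s1 by simp_all
  have v2: "vars s2 vZ = 0" "vars s2 vV = v" "arr s2 tCnt = arr s tCnt"
    using s1 by (simp_all add: s2_def frame_var frame_arr)
  have s': "s' = sem n inp count_keys s2" by (simp add: s'_def s2_def s1_def store_vertex_def)
  note ck = count_keys[OF v2(1), where n = n and inp = inp, folded s', unfolded v2]
  let ?ch = "child s2" and ?m = "vars s2 vNC"
  have ch': "child s' = ?ch" "vars s' vNC = ?m" unfolding s' by (simp_all add: child_def frame_arr frame_var)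
  have J: "trie ?ch ?m" "trie_ext (child s) (vars s vNC) ?ch ?m" "node_list s2 v = map (path ?ch) (?Kl ?xs)"
    "\<And>ks. ks \<in> set (?Kl ?xs) \<Longrightarrow> path ?ch ks \<noteq> 0" using s2(1) unfolding trie_inv_def by blast+
  have C': "\<And>x. vars s vNC < x \<Longrightarrow> arr s tCnt x 0 0 = 0" "arr s tCnt 0 0 0 = 0"
    "\<And>u ks. u < v \<Longrightarrow> ks \<in> KS u \<Longrightarrow> path (child s) ks \<noteq> 0"
    "\<And>ks. path (child s) ks \<noteq> 0 \<Longrightarrow> arr s tCnt (path (child s) ks) 0 0 = card {u. u < v \<and> ks \<in> KS u}"
    using C unfolding counted_def by blast+
  have mm: "vars s vNC \<le> ?m" using J(2) unfolding trie_ext_def by blast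
  have cnt: "arr s' tCnt x 0 0 = arr s tCnt x 0 0 + count_list (map (path ?ch) (?Kl ?xs)) x" for x
    using ck(1)[of x] unfolding J(3) .
  have le: "path ?ch ks \<le> ?m" for ks
  proof (cases ks rule: rev_cases)
    case Nil
    then show ?thesis using trie_le(3)[OF J(1)] by simp
  next
    case (snoc l a)
    then show ?thesis using trie_le(1)[OF J(1)] by (cases a) simp
  qed
  show "counted KS (Suc v) s'" unfolding counted_def ch'
  proof (intro conjI allI impI ballI)
    show "trie ?ch ?m" by (rule J)
    show "arr s' tCnt x 0 0 = 0" if "?m < x" for x
    proof -
      have "x \<notin> set (map (path ?ch) (?Kl ?xs))" using le that by (auto simp: not_less[symmetric])
      then show ?thesis unfolding cnt using C'(1)[of x] that mm by (simp add: count_list_0_iff)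
    qed
    have "0 \<notin> set (map (path ?ch) (?Kl ?xs))" unfolding set_map image_iff using J(4) by metis
    then show "arr s' tCnt 0 0 0 = 0" unfolding cnt using C'(2) by (simp add: count_list_0_iff)
    show "path ?ch ks \<noteq> 0" if "u < Suc v" "ks \<in> KS u" for u ks
    proof (cases "u = v")
      case True
      then show ?thesis using that KS J(4) by simp
    next
      case False
      then have "path (child s) ks \<noteq> 0" using C'(3)[of u ks] that by simp
      then show ?thesis using path_ext(1)[OF J(2) T] by metis
    qed
    show "arr s' tCnt (path ?ch ks) 0 0 = card {u. u < Suc v \<and> ks \<in> KS u}" if nz: "path ?ch ks \<noteq> 0" for ks
    proof -
      have "arr s tCnt (path ?ch ks) 0 0 = card {u. u < v \<and> ks \<in> KS u}"
      proof (cases "path (child s) ks = 0")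
        case True
        \<comment> \<open>The node was created for \<open>v\<close>: its counter was still 0, and no
          earlier vertex had the key.\<close>
        then have "vars s vNC < path ?ch ks" using path_ext(2)[OF J(2) T True] nz by blast
        moreover have "{u. u < v \<and> ks \<in> KS u} = {}" using C'(3) True by blast
        ultimately show ?thesis using C'(1) by simp
      next
        case False
        then show ?thesis using path_ext(1)[OF J(2) T False] C'(4)[OF False] by simp
      qed
      moreover have "count_list (map (path ?ch) (?Kl ?xs)) (path ?ch ks) = of_bool (ks \<in> set (?Kl ?xs))"
      proof (rule count_list_map_inj)
        show "distinct (?Kl ?xs)" by (rule distinct_stored_keys[OF sorted])
        show "l = l'" if "l \<in> set (?Kl ?xs)" "path ?ch l = path ?ch l'" for l l'
          using path_inj[OF J(1) J(4)[OF that(1)] that(2)] .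
      qed
      moreover have "card {u. u < Suc v \<and> ks \<in> KS u} = card {u. u < v \<and> ks \<in> KS u} + of_bool (ks \<in> KS v)"
      proof -
        have "{u. u < Suc v \<and> ks \<in> KS u} = {u. u < v \<and> ks \<in> KS u} \<union> (if ks \<in> KS v then {v} else {})"
          by (auto simp: less_Suc_eq)
        then show ?thesis by (simp add: card_insert_if)
      qed
      ultimately show ?thesis unfolding cnt KS by simp
    qed
  qed
  have lc: "vars s2 vLC \<le> Suc K ^ B"
  proof -
    have "vars s2 vLC \<le> Suc K ^ length ?xs" using length_node_list[OF s2(1)] length_stored_keys by metis
    also have "\<dots> \<le> Suc K ^ B" using len by (intro power_increasing) auto
    finally show ?thesis .
  qed
  have "length ?xs * (4 + Suc K ^ B * (3 + K * 11)) \<le> B * (4 + Suc K ^ B * (3 + K * 11))"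
    using len by (rule mult_le_mono1)
  then show "ticks s' \<le> ticks s + 5 + B * (4 + Suc K ^ B * (3 + K * 11)) + Suc K ^ B * 5"
    using ck(2) s2(2) lc by linarith
qed

lemma build_trie:
  fixes n :: nat and inp :: "nat \<Rightarrow> nat" and s :: loop_state
  assumes Z: "vars s vZ = 0" "vars s vOne = 1" "vars s vN = n" "vars s vK1 = K"
    and empty: "child s = (\<lambda>_ _ _. 0)" "arr s tCnt = (\<lambda>_ _ _. 0)"
    and sorted: "\<forall>v<n. sorted_wrt (<) (ranked s v) \<and> length (ranked s v) \<le> B"
  defines "s' \<equiv> sem n inp build_trie s" and "KS \<equiv> \<lambda>v. set (stored_keys (\<lambda>w. slack s w v) K (ranked s v))"
  shows "counted KS n s'"
    and "ticks s' \<le> ticks s + 2 + n * (6 + B * (4 + Suc K ^ B * (3 + K * 11)) + Suc K ^ B * 5)"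
proof -
  define s1 where "s1 = sem n inp (Const vNC 1) s"
  have s1: "vars s1 vZ = 0" "vars s1 vOne = 1" "vars s1 vN = n" "vars s1 vK1 = K" "slack s1 = slack s"
    "ranked s1 = ranked s" "ticks s1 = ticks s + 1" "vars s1 vNC = 1" "child s1 = (\<lambda>_ _ _. 0)" "arr s1 tCnt = (\<lambda>_ _ _. 0)"
    using Z empty by (simp_all add: s1_def ranked_def fun_eq_iff)
  have p: "path (\<lambda>_ _ _. 0) ks = (if ks = [] then 1 else 0)" for ks
    by (cases ks rule: rev_cases) auto
  have "counted KS (vars s1 vN) (sem n inp (For vV vN store_vertex) s1) \<and>
    ticks (sem n inp (For vV vN store_vertex) s1) \<le> ticks s1 + 1 +
      (\<Sum>i<vars s1 vN. 6 + B * (4 + Suc K ^ B * (3 + K * 11)) + Suc K ^ B * 5)"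
  proof (rule For_rule, goal_cases)
    case 1
    have "trie (\<lambda>_ _ _. 0) 1" by (simp add: trie_def)
    then show ?case using s1 unfolding counted_def by (simp add: p)
  next
    case (2 v t)
    let ?t = "tick (set_var vV v t)"
    have t: "vars ?t vZ = 0" "vars ?t vOne = 1" "vars ?t vV = v" "vars ?t vK1 = K" "slack ?t = slack s"
      "ranked ?t = ranked s" "v < n"
      using 2(1,3,4) s1 by (auto simp: slack_def ranked_def s1_def fun_eq_iff)
    have C: "counted KS v ?t" using 2(2) by (simp add: counted_def child_def)
    have KS: "KS v = set (stored_keys (\<lambda>w. slack ?t w v) K (ranked ?t v))" by (simp only: KS_def t)
    have so: "sorted_wrt (<) (ranked ?t v)" "length (ranked ?t v) \<le> B" unfolding t using sorted t(7) by blast+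
    show ?case using store_vertex[OF C t(1-4) KS so, where n = n and inp = inp] by simp
  qed
  moreover have "s' = sem n inp (For vV vN store_vertex) s1" by (simp add: s'_def s1_def build_trie_def)
  ultimately show "counted KS n s'"
    "ticks s' \<le> ticks s + 2 + n * (6 + B * (4 + Suc K ^ B * (3 + K * 11)) + Suc K ^ B * 5)"
    unfolding s1 by simp_all
qed

section \<open>Evaluating the alternating sums\<close>

definition query_key :: loop_com where
  "query_key = Get vX tL2 vV vJ vZ ;; Get vA tCh vX vY vB ;; Put tL2 vV vLC vZ vA ;;
    Get vA tSg vV vJ vZ ;; Sub vA vOne vA ;; Put tSg vV vLC vZ vA ;; Inc vLC vLC"

definition query_label :: loop_com where
  "query_label = Get vY tR vV vI vZ ;; Get vB tD vV vY vZ ;; Cond vZ vB (For vJ vLC query_key) Nop"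

text \<open>Values are natural numbers, so positive and negative terms are accumulated apart. A
  counter counts vertices, so the truncation by \<open>AddMin\<close> at n changes nothing.\<close>

definition sum_keys :: loop_com where
  "sum_keys = For vJ vLC (Get vX tL2 vV vJ vZ ;; Get vA tCnt vX vZ vZ ;; Get vB tSg vV vJ vZ ;;
    Cond vZ vB (AddMin vNeg vNeg vA) (AddMin vPos vPos vA))"

definition query_vertex :: loop_com where
  "query_vertex = Put tL2 vV vZ vZ vOne ;; Put tSg vV vZ vZ vZ ;; Const vLC 1 ;; Get vRC tRc vV vZ vZ ;;
    For vI vRC query_label ;; sum_keys"

text \<open>The grand total is the number of pairs without a suitable hub. It is never negative, so
  one comparison of its two parts decides whether it is 0.\<close>

definition query_trie :: loop_com where
  "query_trie = For vV vN query_vertex ;; Cond vNeg vPos (Const vRes 0) (Const vRes 1)"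

lemma mod_query_key [simp]: "mod_vars query_key = {vX, vA, vLC}" "mod_arrs query_key = {tL2, tSg}"
  by (auto simp: query_key_def)

lemma mod_query_label [simp]: "mod_vars query_label = {vX, vA, vLC, vY, vB, vJ}" "mod_arrs query_label = {tL2, tSg}"
  by (auto simp: query_label_def)

lemma mod_sum_keys [simp]: "mod_vars sum_keys = {vJ, vX, vA, vB, vNeg, vPos}" "mod_arrs sum_keys = {}"
  by (auto simp: sum_keys_def)

lemma mod_query_vertex [simp]: "mod_vars query_vertex = {vX, vA, vLC, vY, vB, vJ, vRC, vI, vNeg, vPos}"
  "mod_arrs query_vertex = {tL2, tSg}"
  by (auto simp: query_vertex_def)

definition query_list :: "loop_state \<Rightarrow> nat \<Rightarrow> (nat \<times> nat) list" where
  "query_list s v = seq (\<lambda>i. (arr s tL2 v i 0, arr s tSg v i 0)) (vars s vLC)"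

definition query_inv :: "(nat \<Rightarrow> nat \<Rightarrow> nat \<Rightarrow> nat) \<Rightarrow> nat \<Rightarrow> key list \<Rightarrow> loop_state \<Rightarrow> bool" where
  "query_inv ch v Ks t \<longleftrightarrow> query_list t v = map (\<lambda>ks. (path ch ks, length ks mod 2)) Ks"

lemma length_query_inv: "query_inv ch v Ks t \<Longrightarrow> vars t vLC = length Ks"
  unfolding query_inv_def query_list_def by (drule arg_cong[where f = length]) simp

lemma query_inv_cong: "query_list t' v = query_list t v \<Longrightarrow> query_inv ch v Ks t \<Longrightarrow> query_inv ch v Ks t'"
  by (simp add: query_inv_def)

text \<open>A query creates no nodes: a missing key leads to node 0, stays there and contributes 0.
  Of the length only the parity is kept, for the sign.\<close>

lemma query_key:
  fixes n :: nat and inp :: "nat \<Rightarrow> nat" and t :: loop_state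
  assumes I: "query_inv ch v Ks t" and j: "vars t vJ < length Ks" and c: "child t = ch"
    and Z: "vars t vZ = 0" "vars t vOne = 1" "vars t vV = v" "vars t vY = w" "vars t vB = e"
  shows "query_inv ch v (Ks @ [Ks ! vars t vJ @ [(w, e)]]) (sem n inp query_key t)"
    and "ticks (sem n inp query_key t) = ticks t + 7"
proof -
  define t' where "t' = sem n inp query_key t"
  let ?ks = "Ks ! vars t vJ"
  have "(arr t tL2 v (vars t vJ) 0, arr t tSg v (vars t vJ) 0) = query_list t v ! vars t vJ"
    using j length_query_inv[OF I] unfolding query_list_def by simp
  also have "\<dots> = (path ch ?ks, length ?ks mod 2)" using I j unfolding query_inv_def by simp
  finally have x': "arr t tL2 v (vars t vJ) 0 = path ch ?ks" "arr t tSg v (vars t vJ) 0 = length ?ks mod 2" by simp_all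
  define a b where "a = path ch ?ks" and "b = length ?ks mod 2"
  have x: "arr t tL2 v (vars t vJ) 0 = a" "arr t tSg v (vars t vJ) 0 = b" unfolding a_def b_def by (rule x')+
  have ne: "vars t vJ \<noteq> vars t vLC" using j length_query_inv[OF I] by simp
  have c': "arr t tCh = ch" using c by (simp add: child_def)
  have t': "vars t' vLC = Suc (vars t vLC)"
    "arr t' tL2 v i 0 = (if i = vars t vLC then ch a w e else arr t tL2 v i 0)"
    "arr t' tSg v i 0 = (if i = vars t vLC then 1 - b else arr t tSg v i 0)" for i
    unfolding t'_def query_key_def using Z x ne c' by simp_all
  have "1 - b = Suc (length ?ks) mod 2" unfolding b_def by presburger
  then have "query_list t' v = query_list t v @ [(path ch (?ks @ [(w, e)]), length (?ks @ [(w, e)]) mod 2)]"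
    unfolding query_list_def t'(1) using t'(2,3) by (simp add: a_def)
  then show "query_inv ch v (Ks @ [?ks @ [(w, e)]]) (sem n inp query_key t)"
    using I unfolding query_inv_def t'_def by simp
  show "ticks (sem n inp query_key t) = ticks t + 7" by (simp add: query_key_def)
qed

lemma query_label:
  fixes n :: nat and inp :: "nat \<Rightarrow> nat" and t :: loop_state
  assumes I: "query_inv ch v (query_keys D xs) t" and c: "child t = ch"
    and Z: "vars t vZ = 0" "vars t vOne = 1" "vars t vV = v"
    and w: "arr t tR v (vars t vI) 0 = w" "slack t v w = D w"
  shows "query_inv ch v (query_keys D (xs @ [w])) (sem n inp query_label t)"
    and "ticks (sem n inp query_label t) \<le> ticks t + 4 + length (query_keys D xs) * 8"
proof -
  let ?Ks = "query_keys D xs"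
  define t1 where "t1 = sem n inp (Get vY tR vV vI vZ ;; Get vB tD vV vY vZ) t"
  have t1: "vars t1 vZ = 0" "vars t1 vOne = 1" "vars t1 vV = v" "vars t1 vY = w" "vars t1 vB = D w"
    "vars t1 vLC = length ?Ks" "ticks t1 = ticks t + 2" "child t1 = ch"
    using Z w c length_query_inv[OF I] by (simp_all add: t1_def slack_def)
  have I1: "query_inv ch v ?Ks t1" by (rule query_inv_cong[OF _ I]) (simp add: t1_def query_list_def)
  have eq: "sem n inp query_label t = sem n inp (Cond vZ vB (For vJ vLC query_key) Nop) t1"
    by (simp add: t1_def query_label_def)
  have "query_inv ch v (query_keys D (xs @ [w])) (sem n inp query_label t) \<and>
    ticks (sem n inp query_label t) \<le> ticks t + 4 + length ?Ks * 8"
  proof (cases "0 < D w")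
    case False
    then have "sem n inp query_label t = tick (tick t1)" unfolding eq using t1 by simp
    moreover have "query_inv ch v ?Ks (tick (tick t1))"
      by (rule query_inv_cong[OF _ I1]) (simp add: query_list_def)
    ultimately show ?thesis using False t1 by simp
  next
    case True
    let ?t = "tick t1"
    have "(\<lambda>i. query_inv ch v (?Ks @ map (\<lambda>ks. ks @ [(w, D w)]) (take i ?Ks))) (vars ?t vLC) (sem n inp (For vJ vLC query_key) ?t) \<and>
      ticks (sem n inp (For vJ vLC query_key) ?t) \<le> ticks ?t + 1 + (\<Sum>i<vars ?t vLC. 8)"
    proof (rule For_rule, goal_cases)
      case 1
      have "query_inv ch v ?Ks (tick ?t)" by (rule query_inv_cong[OF _ I1]) (simp add: query_list_def)
      then show ?case by simp
    next
      case (2 j u)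
      let ?u = "tick (set_var vJ j u)"
      let ?L = "?Ks @ map (\<lambda>ks. ks @ [(w, D w)]) (take j ?Ks)"
      have j: "j < length ?Ks" using 2(1) t1 by simp
      have u: "vars ?u vZ = 0" "vars ?u vOne = 1" "vars ?u vV = v" "vars ?u vY = w" "vars ?u vB = D w" "vars ?u vJ = j"
        "child ?u = ch"
        using 2(3,4) t1 by (auto simp: child_def)
      have I2: "query_inv ch v ?L ?u" by (rule query_inv_cong[OF _ 2(2)]) (simp add: query_list_def)
      have j': "vars ?u vJ < length ?L" unfolding u(6) length_append using j by (rule trans_less_add1)
      have nth: "?L ! j = ?Ks ! j" using j by (simp add: nth_append)
      have tk: "take (Suc j) ?Ks = take j ?Ks @ [?Ks ! j]" using j by (simp add: take_Suc_conv_app_nth)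
      show ?case using query_key[OF I2 j' u(7) u(1-5), of n inp] unfolding u(6) nth tk by simp
    qed
    then show ?thesis unfolding eq using t1 True by simp
  qed
  then show "query_inv ch v (query_keys D (xs @ [w])) (sem n inp query_label t)"
    "ticks (sem n inp query_label t) \<le> ticks t + 4 + length ?Ks * 8" by blast+
qed

lemma sum_keys:
  fixes n :: nat and inp :: "nat \<Rightarrow> nat" and s :: loop_state
  assumes Z: "vars s vZ = 0"
  defines "s' \<equiv> sem n inp sum_keys s"
  shows "int (vars s' vPos) - int (vars s' vNeg) = int (vars s vPos) - int (vars s vNeg) +
      (\<Sum>(x, b)\<leftarrow>query_list s (vars s vV). (if 0 < b then - 1 else 1) * int (min (arr s tCnt x 0 0) n))"
    and "ticks s' \<le> ticks s + 1 + vars s vLC * 6"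
proof -
  let ?l = "query_list s (vars s vV)"
  let ?f = "\<lambda>(x, b). (if 0 < b then - 1 else 1) * int (min (arr s tCnt x 0 0) n)"
  have "(\<lambda>i t. int (vars t vPos) - int (vars t vNeg) = int (vars s vPos) - int (vars s vNeg) + (\<Sum>p\<leftarrow>take i ?l. ?f p))
      (vars s vLC) s' \<and> ticks s' \<le> ticks s + 1 + (\<Sum>i<vars s vLC. 6)"
    unfolding s'_def sum_keys_def
  proof (rule For_rule, goal_cases)
    case (2 i t)
    have i: "i < length ?l" using 2(1) by (simp add: query_list_def)
    have v: "vars t vZ = 0" "vars t vV = vars s vV" "arr t = arr s" using 2(3,4) Z by (auto simp: fun_eq_iff)
    have e: "?l ! i = (arr s tL2 (vars s vV) i 0, arr s tSg (vars s vV) i 0)" using i by (simp add: query_list_def)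
    have tk: "take (Suc i) ?l = take i ?l @ [?l ! i]" using i by (simp add: take_Suc_conv_app_nth)
    show ?case using 2(2) v unfolding tk e by simp
  qed simp
  then show "int (vars s' vPos) - int (vars s' vNeg) = int (vars s vPos) - int (vars s vNeg) +
      (\<Sum>(x, b)\<leftarrow>?l. (if 0 < b then - 1 else 1) * int (min (arr s tCnt x 0 0) n))"
    "ticks s' \<le> ticks s + 1 + vars s vLC * 6"
    by (simp_all add: query_list_def)
qed

lemma sum_list_sum_swap:
  fixes f :: "'a \<Rightarrow> 'b \<Rightarrow> 'c :: comm_monoid_add"
  shows "(\<Sum>x\<leftarrow>xs. \<Sum>i\<in>A. f x i) = (\<Sum>i\<in>A. \<Sum>x\<leftarrow>xs. f x i)"
  by (induction xs) (simp_all add: sum.distrib)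

lemma query_vertex:
  fixes n :: nat and inp :: "nat \<Rightarrow> nat" and s :: loop_state
  assumes C: "counted (\<lambda>v. set (stored_keys (\<lambda>w. slack s w v) K (ranked s v))) n s"
    and Z: "vars s vZ = 0" "vars s vOne = 1" "vars s vV = u" and u: "u < n"
    and K: "\<forall>x y. slack s x y \<le> K"
    and R: "\<forall>v<n. sorted_wrt (<) (ranked s v) \<and> length (ranked s v) \<le> B"
  defines "s' \<equiv> sem n inp query_vertex s"
  shows "int (vars s' vPos) - int (vars s' vNeg) = int (vars s vPos) - int (vars s vNeg) +
      (\<Sum>v<n. of_bool (\<forall>w\<in>set (ranked s u). \<not> (w \<in> set (ranked s v) \<and> 0 < slack s u w \<and> Suc K \<le> slack s u w + slack s w v)))"
    and "ticks s' \<le> ticks s + 6 + B * (5 + 2 ^ B * 8) + 2 ^ B * 6"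
proof -
  let ?D = "slack s u" and ?xs = "ranked s u" and ?ch = "child s"
  let ?KS = "\<lambda>v. set (stored_keys (\<lambda>w. slack s w v) K (ranked s v))"
  have sx: "sorted_wrt (<) ?xs" "length ?xs \<le> B" using R u by blast+
  define s1 where "s1 = sem n inp (Put tL2 vV vZ vZ vOne ;; Put tSg vV vZ vZ vZ ;; Const vLC 1 ;; Get vRC tRc vV vZ vZ) s"
  have s1: "vars s1 vZ = 0" "vars s1 vOne = 1" "vars s1 vV = u" "vars s1 vRC = length ?xs"
    "child s1 = ?ch" "slack s1 = slack s" "ranked s1 = ranked s" "query_list s1 u = [(1, 0)]" "ticks s1 = ticks s + 4"
    "arr s1 tCnt = arr s tCnt" "vars s1 vPos = vars s vPos" "vars s1 vNeg = vars s vNeg"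
    using Z by (auto simp: s1_def child_def slack_def ranked_def query_list_def arr_set_arr_other fun_eq_iff)
  have len: "length (query_keys ?D (take i ?xs)) \<le> 2 ^ B" for i
  proof -
    have "length (query_keys ?D (take i ?xs)) \<le> 2 ^ length (take i ?xs)" by (rule length_query_keys)
    also have "\<dots> \<le> 2 ^ B" using sx(2) by (intro power_increasing) auto
    finally show ?thesis .
  qed
  have "(\<lambda>i. query_inv ?ch u (query_keys ?D (take i ?xs))) (vars s1 vRC) (sem n inp (For vI vRC query_label) s1) \<and>
    ticks (sem n inp (For vI vRC query_label) s1) \<le> ticks s1 + 1 + (\<Sum>i<vars s1 vRC. 5 + 2 ^ B * 8)"
  proof (rule For_rule, goal_cases)
    case 1
    show ?case using s1 by (simp add: query_inv_def query_list_def)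
  next
    case (2 i t)
    let ?t = "tick (set_var vI i t)"
    have i: "i < length ?xs" using 2(1) s1 by simp
    have t: "vars ?t vZ = 0" "vars ?t vOne = 1" "vars ?t vV = u" using 2(3) s1 by auto
    have "arr t tR = arr s1 tR" "arr t tD = arr s1 tD" "arr t tCh = arr s1 tCh" using 2(4) by auto
    then have w: "arr ?t tR u (vars ?t vI) 0 = ?xs ! i" "slack ?t u (?xs ! i) = ?D (?xs ! i)" "child ?t = ?ch"
      using i s1(5,6,7) by (simp_all add: slack_def ranked_def child_def s1_def arr_set_arr_other)
    have I: "query_inv ?ch u (query_keys ?D (take i ?xs)) ?t"
      by (rule query_inv_cong[OF _ 2(2)]) (simp add: query_list_def)
    have tk: "take (Suc i) ?xs = take i ?xs @ [?xs ! i]" using i by (simp add: take_Suc_conv_app_nth)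
    note ql = query_label[where D = ?D, OF I w(3) t w(1,2), of n inp]
    have "ticks ?t = Suc (ticks t)" by simp
    then have "ticks (sem n inp query_label ?t) \<le> ticks t + (5 + 2 ^ B * 8)"
      using ql(2) len[of i] by linarith
    then show ?case using ql(1) unfolding tk by blast
  qed
  moreover define s2 where "s2 = sem n inp (For vI vRC query_label) s1"
  ultimately have s2: "query_inv ?ch u (query_keys ?D ?xs) s2"
    "ticks s2 \<le> ticks s + 5 + length ?xs * (5 + 2 ^ B * 8)" unfolding s1 by simp_all
  have v2: "vars s2 vZ = 0" "vars s2 vV = u" "arr s2 tCnt = arr s tCnt" "vars s2 vPos = vars s vPos" "vars s2 vNeg = vars s vNeg"
    using s1 by (simp_all add: s2_def frame_var frame_arr)
  have s': "s' = sem n inp sum_keys s2" by (simp add: s'_def s2_def s1_def query_vertex_def)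
  note sk = sum_keys[OF v2(1), where n = n and inp = inp, folded s', unfolded v2]
  \<comment> \<open>The counts are at most n, so the minimum is harmless, and a key without a node
    is stored for no vertex.\<close>
  have cnt: "min (arr s tCnt (path ?ch ks) 0 0) n = card {v. v < n \<and> ks \<in> ?KS v}" for ks
  proof -
    have le: "card {v. v < n \<and> ks \<in> ?KS v} \<le> n"
      using card_mono[of "{..<n}" "{v. v < n \<and> ks \<in> ?KS v}"] by auto
    show ?thesis
    proof (cases "path ?ch ks = 0")
      case True
      have "arr s tCnt 0 0 0 = 0" "\<forall>v<n. \<forall>ks\<in>?KS v. path ?ch ks \<noteq> 0" using C unfolding counted_def by blast+
      then have "arr s tCnt 0 0 0 = 0" "ks \<notin> ?KS v" if "v < n" for v using True that by metis+
      then have "{v. v < n \<and> ks \<in> ?KS v} = {}" by blast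
      moreover have "arr s tCnt 0 0 0 = 0" by fact
      ultimately have "arr s tCnt 0 0 0 = 0" "{v. v < n \<and> ks \<in> ?KS v} = {}" by blast+
      then show ?thesis using True by simp
    next
      case False
      have "\<forall>ks. path ?ch ks \<noteq> 0 \<longrightarrow> arr s tCnt (path ?ch ks) 0 0 = card {v. v < n \<and> ks \<in> ?KS v}"
        using C unfolding counted_def by (elim conjE)
      from this[rule_format, OF False]
      have "arr s tCnt (path ?ch ks) 0 0 = card {v. v < n \<and> ks \<in> ?KS v}" .
      then show ?thesis using le by simp
    qed
  qed
  have sg: "(if 0 < length ks mod 2 then - 1 else 1) = (- 1 :: int) ^ length ks" for ks :: key
    by (cases "even (length ks)") (auto simp: odd_iff_mod_2_eq_one)
  have "(\<Sum>(x, b)\<leftarrow>query_list s2 u. (if 0 < b then - 1 else 1) * int (min (arr s tCnt x 0 0) n)) =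
    (\<Sum>ks\<leftarrow>query_keys ?D ?xs. (- 1) ^ length ks * int (card {v. v < n \<and> ks \<in> ?KS v}))"
    using s2(1) unfolding query_inv_def by (simp only: map_map o_def case_prod_conv cnt sg)
  also have "\<dots> = (\<Sum>ks\<leftarrow>query_keys ?D ?xs. \<Sum>v<n. (- 1) ^ length ks * of_bool (ks \<in> ?KS v))"
  proof (rule arg_cong[of _ _ sum_list], rule map_cong[OF refl])
    fix ks
    have "int (card {v. v < n \<and> ks \<in> ?KS v}) = (\<Sum>v<n. of_bool (ks \<in> ?KS v))"
    proof -
      have "{v. v < n \<and> ks \<in> ?KS v} = {..<n} \<inter> {v. ks \<in> ?KS v}" by auto
      then show ?thesis by (simp add: of_bool_def sum.If_cases)
    qed
    then show "(- 1) ^ length ks * int (card {v. v < n \<and> ks \<in> ?KS v}) = (\<Sum>v<n. (- 1) ^ length ks * of_bool (ks \<in> ?KS v))"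
      by (simp add: sum_distrib_left)
  qed
  \<comment> \<open>After the exchange, the inner sum for a fixed v is the expanded product
    evaluated by \<open>query_keys_sum\<close>.\<close>
  also have "\<dots> = (\<Sum>v<n. \<Sum>ks\<leftarrow>query_keys ?D ?xs. (- 1) ^ length ks * of_bool (ks \<in> ?KS v))"
    by (rule sum_list_sum_swap)
  also have "\<dots> = (\<Sum>v<n. of_bool (\<forall>w\<in>set ?xs. \<not> (w \<in> set (ranked s v) \<and> 0 < ?D w \<and> Suc K \<le> ?D w + slack s w v)))"
    by (rule sum.cong[OF refl], rule query_keys_sum[OF sx(1)]) (use R K in auto)
  finally show "int (vars s' vPos) - int (vars s' vNeg) = int (vars s vPos) - int (vars s vNeg) +
      (\<Sum>v<n. of_bool (\<forall>w\<in>set ?xs. \<not> (w \<in> set (ranked s v) \<and> 0 < ?D w \<and> Suc K \<le> ?D w + slack s w v)))"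
    using sk(1) by simp
  have "length ?xs * (5 + 2 ^ B * 8) \<le> B * (5 + 2 ^ B * 8)" using sx(2) by (rule mult_le_mono1)
  moreover have "vars s2 vLC \<le> 2 ^ B" using length_query_inv[OF s2(1)] len[of "length ?xs"] by simp
  ultimately show "ticks s' \<le> ticks s + 6 + B * (5 + 2 ^ B * 8) + 2 ^ B * 6"
    using sk(2) s2(2) by linarith
qed

lemma query_trie:
  fixes n :: nat and inp :: "nat \<Rightarrow> nat" and s :: loop_state
  assumes C: "counted (\<lambda>v. set (stored_keys (\<lambda>w. slack s w v) K (ranked s v))) n s"
    and Z: "vars s vZ = 0" "vars s vOne = 1" "vars s vN = n" "vars s vPos = 0" "vars s vNeg = 0"
    and K: "\<forall>x y. slack s x y \<le> K"
    and R: "\<forall>v<n. sorted_wrt (<) (ranked s v) \<and> length (ranked s v) \<le> B"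
  defines "s' \<equiv> sem n inp query_trie s"
  shows "vars s' vRes = of_bool (\<forall>u<n. \<forall>v<n. \<exists>w. w \<in> set (ranked s u) \<and> w \<in> set (ranked s v) \<and>
      0 < slack s u w \<and> Suc K \<le> slack s u w + slack s w v)"
    and "ticks s' \<le> ticks s + 3 + n * (7 + B * (5 + 2 ^ B * 8) + 2 ^ B * 6)"
proof -
  let ?bad = "\<lambda>u v. \<forall>w\<in>set (ranked s u). \<not> (w \<in> set (ranked s v) \<and> 0 < slack s u w \<and> Suc K \<le> slack s u w + slack s w v)"
  have "(\<lambda>i t. int (vars t vPos) - int (vars t vNeg) = (\<Sum>u<i. \<Sum>v<n. of_bool (?bad u v)))
      (vars s vN) (sem n inp (For vV vN query_vertex) s) \<and>
    ticks (sem n inp (For vV vN query_vertex) s) \<le> ticks s + 1 + (\<Sum>i<vars s vN. 7 + B * (5 + 2 ^ B * 8) + 2 ^ B * 6)"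
  proof (rule For_rule, goal_cases)
    case 1
    then show ?case using Z by simp
  next
    case (2 u t)
    let ?t = "tick (set_var vV u t)"
    have t: "vars ?t vZ = 0" "vars ?t vOne = 1" "vars ?t vV = u" "u < n" "slack ?t = slack s" "ranked ?t = ranked s"
      "child ?t = child s" "vars ?t vNC = vars s vNC" "arr ?t tCnt = arr s tCnt"
      using 2(1,3,4) Z by (auto simp: slack_def ranked_def child_def fun_eq_iff)
    have C': "counted (\<lambda>v. set (stored_keys (\<lambda>w. slack ?t w v) K (ranked ?t v))) n ?t"
      using C unfolding counted_def t(5-9) .
    have K': "\<forall>x y. slack ?t x y \<le> K" and R': "\<forall>v<n. sorted_wrt (<) (ranked ?t v) \<and> length (ranked ?t v) \<le> B"
      unfolding t(5,6) using K R by blast+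
    show ?case using query_vertex[OF C' t(1-4) K' R', of inp] 2(2) unfolding t(5,6) by simp
  qed
  moreover define s1 where "s1 = sem n inp (For vV vN query_vertex) s"
  ultimately have s1: "int (vars s1 vPos) - int (vars s1 vNeg) = (\<Sum>u<n. \<Sum>v<n. of_bool (?bad u v))"
    "ticks s1 \<le> ticks s + 1 + n * (7 + B * (5 + 2 ^ B * 8) + 2 ^ B * 6)" unfolding Z by simp_all
  have s': "s' = sem n inp (Cond vNeg vPos (Const vRes 0) (Const vRes 1)) s1" by (simp add: s'_def s1_def query_trie_def)
  show "ticks s' \<le> ticks s + 3 + n * (7 + B * (5 + 2 ^ B * 8) + 2 ^ B * 6)" using s1(2) unfolding s' by simp
  have "vars s1 vNeg < vars s1 vPos \<longleftrightarrow> 0 < (\<Sum>u<n. \<Sum>v<n. of_bool (?bad u v) :: int)" using s1(1) by linarith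
  also have "\<dots> \<longleftrightarrow> (\<exists>u<n. \<exists>v<n. ?bad u v)"
  proof
    assume p: "0 < (\<Sum>u<n. \<Sum>v<n. of_bool (?bad u v) :: int)"
    show "\<exists>u<n. \<exists>v<n. ?bad u v"
    proof (rule ccontr)
      assume "\<not> ?thesis"
      then have "(\<Sum>u<n. \<Sum>v<n. of_bool (?bad u v) :: int) = 0" by (intro sum.neutral ballI) auto
      then show False using p by simp
    qed
  next
    assume "\<exists>u<n. \<exists>v<n. ?bad u v"
    then obtain u v where uv: "u < n" "v < n" "?bad u v" by blast
    have "0 < (\<Sum>v<n. of_bool (?bad u v) :: int)"
      by (rule sum_pos2[of _ v]) (use uv in auto)
    note uv_pos = this
    show "0 < (\<Sum>u<n. \<Sum>v<n. of_bool (?bad u v) :: int)"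
    proof (rule sum_pos2[of _ u])
      show "0 \<le> (\<Sum>v<n. of_bool (?bad u v) :: int)" for u by (rule sum_nonneg) simp
      show "0 < (\<Sum>v<n. of_bool (?bad u v) :: int)" by (rule uv_pos)
    qed (simp_all add: uv(1))
  qed
  finally have "vars s1 vNeg < vars s1 vPos \<longleftrightarrow> (\<exists>u<n. \<exists>v<n. ?bad u v)" .
  then have "vars s' vRes = of_bool (\<not> (\<exists>u<n. \<exists>v<n. ?bad u v))" unfolding s' by simp
  also have "(\<not> (\<exists>u<n. \<exists>v<n. ?bad u v)) = (\<forall>u<n. \<forall>v<n. \<exists>w. w \<in> set (ranked s u) \<and> w \<in> set (ranked s v) \<and>
      0 < slack s u w \<and> Suc K \<le> slack s u w + slack s w v)" by blast
  finally show "vars s' vRes = of_bool (\<forall>u<n. \<forall>v<n. \<exists>w. w \<in> set (ranked s u) \<and> w \<in> set (ranked s v) \<and>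
      0 < slack s u w \<and> Suc K \<le> slack s u w + slack s w v)" .
qed

section \<open>The whole program and its correctness\<close>

definition diameter_program :: loop_com where
  "diameter_program = build_hubs ;; build_labels ;; sort_labels ;; build_trie ;; query_trie"

definition diameter_cost :: "(nat \<Rightarrow> nat) \<Rightarrow> nat \<Rightarrow> nat" where
  "diameter_cost d k = (let \<Delta> = hub_bound d k; B = Suc \<Delta> ^ Suc k; K = Suc k in
    hubs_cost d k + (1 + K * (3 + (6 + \<Delta> * (4 + B * 18)))) + (1 + (6 + B * (7 + 5 * B))) +
    (2 + (6 + B * (4 + Suc K ^ B * (3 + K * 11)) + Suc K ^ B * 5)) + (3 + (7 + B * (5 + 2 ^ B * 8) + 2 ^ B * 6)))"

lemma diameter_program:
  fixes n k :: nat and inp :: "nat \<Rightarrow> nat" and s :: loop_state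
  assumes s: "vars s = (\<lambda>_. 0)(vN := n, vM := length es, vK := k)" "arr s = (\<lambda>_ _ _ _. 0)" "ticks s = 0"
    and inp: "\<forall>i<length es. inp (2 * i) = fst (es ! i) \<and> inp (Suc (2 * i)) = snd (es ! i)"
    and es: "set es \<subseteq> {..<n} \<times> {..<n}" "irrefl (set es)" "length es \<le> d 0 * n"
    and mb: "\<And>r. minor_bound r {..<n} (set es \<union> (set es)\<inverse>) (d r)" and k: "1 \<le> k" and n: "1 \<le> n"
  defines "s' \<equiv> sem n inp diameter_program s"
  shows "vars s' vRes = of_bool (\<forall>u<n. \<forall>v<n. \<exists>i\<le>k. (u, v) \<in> set es ^^ i)"
    and "ticks s' \<le> diameter_cost d k * n"
proof -
  let ?R = "set es" and ?\<Delta> = "hub_bound d k"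
  let ?B = "Suc ?\<Delta> ^ Suc k" and ?K = "Suc k"
  define s1 where "s1 = sem n inp build_hubs s"
  note h = build_hubs[OF s inp es mb k n, folded s1_def]
  have r: "augmentation {..<n} (?R \<union> ?R\<inverse>) (fst (hub_bounds d k)) (fst (snd (hub_bounds d k))) (marked s1)"
    "\<And>v h. h \<in> set (hubs s1 v) \<Longrightarrow> (v, h) \<in> marked s1" "\<forall>v. length (hubs s1 v) \<le> ?\<Delta>"
    "sound_slack k ?R (slack s1)" "\<forall>v<n. slack s1 v v = Suc k"
    "\<And>u v j. u < n \<Longrightarrow> v < n \<Longrightarrow> j \<le> k \<Longrightarrow> (u, v) \<in> ?R ^^ j \<Longrightarrow>
      short_walk k 0 (marked s1) (\<lambda>v. set (hubs s1 v)) (\<lambda>x y. Suc k - slack s1 x y) u v"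
    using h(1) unfolding round_inv_def diff_self_eq_0 by blast+
  have closed: "\<forall>v. \<forall>h\<in>set (hubs s1 v). h < n"
    using r(1,2) unfolding augmentation_def by blast
  have mods: "mod_arrs build_hubs = {tD, tAdj, tEX, tEY, tDeg, tH, tHc}"
    "vPos \<notin> mod_vars build_hubs" "vNeg \<notin> mod_vars build_hubs"
    by (auto simp: build_hubs_def first_round_def)
  have lab0: "labels s1 = (\<lambda>_ _. [])" using s(2) mods(1) by (simp add: s1_def labels_frame) (simp add: labels_def fun_eq_iff)
  define s2 where "s2 = sem n inp build_labels s1"
  note l = build_labels[OF h(2,5,6) r(4,5) closed r(3) lab0, where inp = inp, folded s2_def]
  let ?w = "\<lambda>x y. Suc k - slack s1 x y"
  have s2: "vars s2 vZ = 0" "vars s2 vOne = 1" "vars s2 vK1 = ?K" "vars s2 vN = n"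
    using h by (simp_all add: s2_def frame_var)
  have lv: "set (level (hubs s1) (Suc k) v) \<subseteq> {..<n}" if "v < n" for v
    by (rule level_closed) (use closed that in auto)
  have ll: "length (level (hubs s1) (Suc k) v) \<le> ?B" for v
    using r(3) by (intro length_level) simp
  define s3 where "s3 = sem n inp sort_labels s2"
  have p3: "\<forall>v<n. set (labels s2 (vars s2 vK1) v) \<subseteq> {..<n}" "\<forall>v<n. length (labels s2 (vars s2 vK1) v) \<le> ?B"
    unfolding s2(3) using l(3) lv ll by simp_all
  note so = sort_labels[OF s2(1,4) p3, where inp = inp, folded s3_def, unfolded s2(3)]
  have s3: "vars s3 vZ = 0" "vars s3 vOne = 1" "vars s3 vK1 = ?K" "vars s3 vN = n" "slack s3 = slack s2"
    using s2 by (simp_all add: s3_def frame_var observe_frame)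
  have rk: "ranked s3 v = sorted_list_of_set (set (level (hubs s1) (Suc k) v))" if "v < n" for v
    using so(1)[OF that] l(3)[OF that] by simp
  have rks: "set (ranked s3 v) = set (level (hubs s1) (Suc k) v)" if "v < n" for v
    unfolding rk[OF that] by (rule set_sorted_list_of_set) (rule List.finite_set)
  have rs: "\<forall>v<n. sorted_wrt (<) (ranked s3 v) \<and> length (ranked s3 v) \<le> ?B"
  proof (intro allI impI conjI)
    fix v assume v: "v < n"
    show "sorted_wrt (<) (ranked s3 v)" unfolding rk[OF v] by (rule strict_sorted_list_of_set)
    show "length (ranked s3 v) \<le> ?B" unfolding rk[OF v] length_sorted_list_of_set
      by (rule order_trans[OF card_length ll])
  qed
  have e3: "child s3 = (\<lambda>_ _ _. 0)" "arr s3 tCnt = (\<lambda>_ _ _. 0)"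
    using s(2) by (simp_all add: s3_def s2_def s1_def child_def frame_arr mods)
  have v3: "vars s3 vPos = 0" "vars s3 vNeg = 0"
    using s(1) by (simp_all add: s3_def s2_def s1_def frame_var mods)
  define s4 where "s4 = sem n inp build_trie s3"
  note bt = build_trie[OF s3(1,2,4,3) e3 rs, where inp = inp, folded s4_def]
  have s4: "vars s4 vZ = 0" "vars s4 vOne = 1" "vars s4 vN = n" "vars s4 vPos = 0" "vars s4 vNeg = 0"
    "slack s4 = slack s3" "ranked s4 = ranked s3"
    using s3 v3 by (simp_all add: s4_def frame_var observe_frame ranked_def frame_arr fun_eq_iff)
  have C: "counted (\<lambda>v. set (stored_keys (\<lambda>w. slack s4 w v) ?K (ranked s4 v))) n s4"
    using bt(1) unfolding s4(6,7) .
  have sl: "\<forall>x y. slack s4 x y \<le> ?K" unfolding s4 s3 using sound_slack_le[OF l(1)] by blast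
  have rs4: "\<forall>v<n. sorted_wrt (<) (ranked s4 v) \<and> length (ranked s4 v) \<le> ?B" unfolding s4 by (rule rs)
  have s': "s' = sem n inp query_trie s4"
    by (simp add: s'_def s4_def s3_def s2_def s1_def diameter_program_def)
  note q = query_trie[OF C s4(1-5) sl rs4, where inp = inp, folded s', unfolded s4(6,7) s3(5)]
  \<comment> \<open>Slacks k + 1 - i and k + 1 - j with i, j at most k add up to at least k + 2
    exactly if i + j \<le> k. Soundness of the slacks gives one direction; in the other, the hub is
    the apex of an \<open>updown\<close> walk, whose two halves are ascending sequences of at most k
    + 1 vertices.\<close>
  have hub: "(\<exists>w. w \<in> set (ranked s3 u) \<and> w \<in> set (ranked s3 v) \<and> 0 < slack s2 u w \<and> Suc ?K \<le> slack s2 u w + slack s2 w v)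
      \<longleftrightarrow> (\<exists>i\<le>k. (u, v) \<in> ?R ^^ i)" if uv: "u < n" "v < n" for u v
  proof
    assume "\<exists>w. w \<in> set (ranked s3 u) \<and> w \<in> set (ranked s3 v) \<and> 0 < slack s2 u w \<and> Suc ?K \<le> slack s2 u w + slack s2 w v"
    then obtain w where w: "0 < slack s2 u w" "Suc ?K \<le> slack s2 u w + slack s2 w v" by blast
    \<comment> \<open>One slack is at most k + 1, so a sum of k + 2 forces the other to be
      positive.\<close>
    then have "0 < slack s2 w v" using sound_slack_le[OF l(1), of u w] by linarith
    then obtain i j where "(u, w) \<in> ?R ^^ i" "i + slack s2 u w \<le> Suc k" "(w, v) \<in> ?R ^^ j" "j + slack s2 w v \<le> Suc k"
      using l(1) w(1) unfolding sound_slack_def by blast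
    then have "(u, v) \<in> ?R ^^ (i + j)" "i + j \<le> k" using w(2) by (auto simp: relpow_add)
    then show "\<exists>i\<le>k. (u, v) \<in> ?R ^^ i" by blast
  next
    assume "\<exists>i\<le>k. (u, v) \<in> ?R ^^ i"
    then obtain j where "j \<le> k" "(u, v) \<in> ?R ^^ j" by blast
    then obtain p q where pq: "p \<noteq> []" "q \<noteq> []" "hd p = u" "hd q = v" "last p = last q"
      "length p \<le> Suc k" "length q \<le> Suc k"
      "successively (\<lambda>x y. y \<in> set (hubs s1 x)) p" "successively (\<lambda>x y. y \<in> set (hubs s1 x)) q"
      "walk_weight ?w p + walk_weight (\<lambda>x y. ?w y x) q \<le> k"
      using short_walk_apex[OF r(6)[OF uv]] by blast
    let ?x = "last p"
    have p: "?x \<in> set (level (hubs s1) (Suc k) u)" "Suc k - slack s2 u ?x \<le> walk_weight ?w p"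
      using l(2)[unfolded climbed_def, rule_format, of p] pq uv by auto
    have q: "?x \<in> set (level (hubs s1) (Suc k) v)" "Suc k - slack s2 ?x v \<le> walk_weight (\<lambda>x y. ?w y x) q"
      using l(2)[unfolded climbed_def, rule_format, of q] pq uv by auto
    have "0 < slack s2 u ?x" "Suc ?K \<le> slack s2 u ?x + slack s2 ?x v"
      using p(2) q(2) pq(10) by linarith+
    then show "\<exists>w. w \<in> set (ranked s3 u) \<and> w \<in> set (ranked s3 v) \<and> 0 < slack s2 u w \<and> Suc ?K \<le> slack s2 u w + slack s2 w v"
      using p(1) q(1) unfolding rks[OF uv(1)] rks[OF uv(2)] by blast
  qed
  show "vars s' vRes = of_bool (\<forall>u<n. \<forall>v<n. \<exists>i\<le>k. (u, v) \<in> ?R ^^ i)"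
    unfolding q(1) using hub by simp
  have mul: "a \<le> a * n" for a :: nat using n by simp
  let ?c1 = "hubs_cost d k" and ?c2 = "6 + ?\<Delta> * (4 + ?B * 18)" and ?c3 = "6 + ?B * (7 + 5 * ?B)"
    and ?c4 = "6 + ?B * (4 + Suc ?K ^ ?B * (3 + ?K * 11)) + Suc ?K ^ ?B * 5"
    and ?c5 = "7 + ?B * (5 + 2 ^ ?B * 8) + 2 ^ ?B * 6"
  have "?K * (3 + n * ?c2) \<le> ?K * (3 + ?c2) * n"
  proof -
    have "3 + n * ?c2 \<le> 3 * n + n * ?c2" using n by simp
    then have "?K * (3 + n * ?c2) \<le> ?K * (3 * n + n * ?c2)" by (rule mult_le_mono2)
    then show ?thesis by (simp only: distrib_left distrib_right mult.assoc mult.commute mult.left_commute)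
  qed
  then have "ticks s' \<le> ?c1 * n + (1 + ?K * (3 + ?c2) * n) + (1 + n * ?c3) + (2 + n * ?c4) + (3 + n * ?c5)"
    using q(2) bt(2) so(2) l(4) h(8) by linarith
  also have "\<dots> \<le> ?c1 * n + (1 * n + ?K * (3 + ?c2) * n) + (1 * n + n * ?c3) + (2 * n + n * ?c4) + (3 * n + n * ?c5)"
    using n by (intro add_mono order_refl) simp_all
  also have "\<dots> = diameter_cost d k * n"
    by (simp only: diameter_cost_def Let_def add_mult_distrib mult.commute[of n])
  finally show "ticks s' \<le> diameter_cost d k * n" .
qed

section \<open>The machine program\<close>

text \<open>\<open>Arith Plus 1 1 1\<close> doubles the number of arcs into the end of the input,
  where the arrays begin.\<close>

definition diameter_machine :: ram_com where
  "diameter_machine = Seq (Copy (vreg vN) 0) (Seq (Copy (vreg vM) 1) (Seq (Copy (vreg vK) 2)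
    (Seq (SetConst 3 1) (Seq (SetConst 4 2) (Seq (Arith Plus 1 1 1)
    (Seq (compile 0 diameter_program) (Copy 0 (vreg vRes))))))))"

text \<open>15 is the largest table number, that of \<open>tSg\<close>.\<close>

lemma consts_diameter_program: "consts_le diameter_program 15"
  by (simp add: diameter_program_def build_hubs_def first_round_def next_round_def init_input_def add_edge_def
    orient_def peel_phase_def count_tails_def split_edges_def fraternal_edges_def fraternal_pair_def relax_def
    build_labels_def label_vertex_def label_step_def sort_labels_def sort_vertex_def find_next_def
    build_trie_def store_vertex_def store_label_def store_keys_def store_key_def count_keys_def
    query_trie_def query_vertex_def query_label_def query_key_def sum_keys_def)

lemma consts_le_mono: "consts_le c W \<Longrightarrow> W \<le> W' \<Longrightarrow> consts_le c W'"
  by (induction c) auto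

lemma diameter_machine:
  assumes es: "set es \<subseteq> {..<n} \<times> {..<n}" "irrefl (set es)" "length es \<le> d 0 * n"
    and mb: "\<And>r. minor_bound r {..<n} (set es \<union> (set es)\<inverse>) (d r)" and k: "1 \<le> k" and n: "1 \<le> n"
  defines "T \<equiv> diameter_cost d k * n"
  defines "V \<equiv> (9 * (15 + n + 2 * length es + k + Suc n * T)) ^ 8"
  obtains t s' where "ram_exec diameter_machine (ram_input n es k) t s'"
    "reg s' 0 = of_bool (\<forall>u<n. \<forall>v<n. \<exists>i\<le>k. (u, v) \<in> set es ^^ i)"
    "t \<le> (50 * T + 8) * bit_len V"
proof -
  let ?W = "15 + n + 2 * length es + k" and ?m = "length es"
  let ?r = "ram_input n es k"
  define inp where "inp = mem ?r"
  define s where "s = \<lparr>vars = (\<lambda>_. 0)(vN := n, vM := ?m, vK := k), arr = (\<lambda>_ _ _ _. 0), ticks = 0\<rparr>"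
  have inp0: "2 * ?m \<le> a \<Longrightarrow> inp a = 0" for a by (simp add: inp_def ram_input_def)
  have inpW: "inp a \<le> ?W" for a
  proof (cases "a < 2 * ?m")
    case True
    then have "es ! (a div 2) \<in> set es" by simp
    then have "fst (es ! (a div 2)) < n" "snd (es ! (a div 2)) < n" using es(1) by (auto simp: mem_Times_iff)
    then show ?thesis by (simp add: inp_def ram_input_def)
  qed (simp add: inp_def ram_input_def)
  have inpE: "\<forall>i<?m. inp (2 * i) = fst (es ! i) \<and> inp (Suc (2 * i)) = snd (es ! i)"
    by (auto simp: inp_def ram_input_def)
  let ?s' = "sem n inp diameter_program s"
  have sv: "vars s = (\<lambda>_. 0)(vN := n, vM := ?m, vK := k)" "arr s = (\<lambda>_ _ _ _. 0)" "ticks s = 0"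
    by (simp_all add: s_def)
  note dp = diameter_program[OF sv inpE es mb k n]
  have WV: "a \<le> V" if "a \<le> ?W" for a
  proof -
    have "a \<le> 9 * (?W + Suc n * T)" using that by simp
    also have "\<dots> \<le> (9 * (?W + Suc n * T)) ^ 8" by (rule self_le_power) auto
    finally show ?thesis by (simp only: V_def)
  qed
  have g: "grown n ?W s" unfolding grown_def vals_le_def by (simp add: s_def)
  define r1 where "r1 = ?r\<lparr>reg := (reg ?r)(vreg vN := n)\<rparr>"
  define r2 where "r2 = r1\<lparr>reg := (reg r1)(vreg vM := ?m)\<rparr>"
  define r3 where "r3 = r2\<lparr>reg := (reg r2)(vreg vK := k)\<rparr>"
  define r4 where "r4 = r3\<lparr>reg := (reg r3)(3 := 1)\<rparr>"
  define r5 where "r5 = r4\<lparr>reg := (reg r4)(4 := 2)\<rparr>"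
  define r6 where "r6 = r5\<lparr>reg := (reg r5)(1 := ?m + ?m)\<rparr>"
  have 1: "runs V (Copy (vreg vN) 0) ?r r1 1"
    using runs_Copy[of ?r 0 V "vreg vN"] WV[of n] by (simp add: r1_def ram_input_def)
  have 2: "runs V (Copy (vreg vM) 1) r1 r2 1"
    using runs_Copy[of r1 1 V "vreg vM"] WV[of ?m] by (simp add: r2_def r1_def ram_input_def)
  have 3: "runs V (Copy (vreg vK) 2) r2 r3 1"
    using runs_Copy[of r2 2 V "vreg vK"] WV[of k] by (simp add: r3_def r2_def r1_def ram_input_def)
  have 4: "runs V (SetConst 3 1) r3 r4 1"
    using runs_SetConst[of 1 V 3 r3] WV[of 1] by (simp add: r4_def)
  have 5: "runs V (SetConst 4 2) r4 r5 1"
    using runs_SetConst[of 2 V 4 r4] WV[of 2] by (simp add: r5_def)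
  have 6: "runs V (Arith Plus 1 1 1) r5 r6 2"
  proof -
    have "reg r5 1 = ?m" by (simp add: r5_def r4_def r3_def r2_def r1_def ram_input_def)
    moreover have "?m \<le> V" by (rule WV) simp
    ultimately show ?thesis using runs_Arith[of r5 1 V 1 Plus 1] by (simp add: r6_def)
  qed
  \<comment> \<open>Memory beyond the input holds 0, so all arrays start out as 0 without any
    initialisation.\<close>
  have im: "implements n (2 * ?m) inp s r6"
    unfolding implements_def
    by (auto simp: s_def r6_def r5_def r4_def r3_def r2_def r1_def ram_input_def inp_def)
  have "consts_le diameter_program ?W" by (rule consts_le_mono[OF consts_diameter_program]) simp
  then have "\<exists>r'. runs V (compile 0 diameter_program) r6 r' (50 * (ticks ?s' - ticks s)) \<and>
      implements n (2 * ?m) inp ?s' r' \<and> same_hidden 0 r6 r'"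
  proof (rule compile_correct[where W = ?W and T = T, rotated 8])
    show "(9 * (?W + Suc n * T)) ^ 8 \<le> V" by (simp only: V_def order_refl)
    show "ticks ?s' \<le> T" using dp(2) by (simp only: T_def)
  qed (use inpW inp0 im g in auto)
  then obtain r7 where r7: "runs V (compile 0 diameter_program) r6 r7 (50 * (ticks ?s' - ticks s))"
    "implements n (2 * ?m) inp ?s' r7" by blast
  have 7: "runs V (compile 0 diameter_program) r6 r7 (50 * T)"
    using r7(1) by (rule runs_mono) (use dp(2) in \<open>simp add: T_def\<close>)
  have res: "reg r7 (vreg vRes) = of_bool (\<forall>u<n. \<forall>v<n. \<exists>i\<le>k. (u, v) \<in> set es ^^ i)"
    using r7(2) unfolding implements_def dp(1)[symmetric] by blast
  define r8 where "r8 = r7\<lparr>reg := (reg r7)(0 := reg r7 (vreg vRes))\<rparr>"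
  have 8: "runs V (Copy 0 (vreg vRes)) r7 r8 1"
    unfolding r8_def by (rule runs_Copy) (use res WV[of 1] in \<open>simp add: of_bool_def\<close>)
  have "runs V diameter_machine ?r r8 (1 + (1 + (1 + (1 + (1 + (2 + (50 * T + 1)))))))"
    unfolding diameter_machine_def by (intro runs_Seq) (rule 1 2 3 4 5 6 7 8)+
  then have "runs V diameter_machine ?r r8 (50 * T + 8)" by (rule runs_mono) simp
  then obtain t where "t \<le> (50 * T + 8) * bit_len V" "ram_exec diameter_machine ?r t r8" unfolding runs_def by blast
  moreover have "reg r8 0 = reg r7 (vreg vRes)" by (simp add: r8_def)
  ultimately show thesis using that res by metis
qed

section \<open>Back to graphs, and the time bound\<close>

lemma relpow_image:
  assumes inj: "inj_on f V" and R: "R \<subseteq> V \<times> V"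
  shows "u \<in> V \<Longrightarrow> v \<in> V \<Longrightarrow> (f u, f v) \<in> ((\<lambda>(x, y). (f x, f y)) ` R) ^^ i \<longleftrightarrow> (u, v) \<in> R ^^ i"
proof (induction i arbitrary: v)
  case 0
  then show ?case using inj by (auto simp: inj_on_eq_iff)
next
  case (Suc i)
  let ?S = "(\<lambda>(x, y). (f x, f y)) ` R"
  show ?case
  proof
    assume "(f u, f v) \<in> ?S ^^ Suc i"
    then obtain y where y: "(f u, y) \<in> ?S ^^ i" "(y, f v) \<in> ?S" by (elim relpow_Suc_E)
    from y(2) obtain x v' where x: "y = f x" "f v = f v'" "(x, v') \<in> R" by auto
    then have "x \<in> V" "v' = v" using R inj Suc.prems by (auto simp: inj_on_eq_iff)
    then show "(u, v) \<in> R ^^ Suc i" using Suc.IH[OF Suc.prems(1), of x] y(1) x by (meson relpow_Suc_I)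
  next
    assume "(u, v) \<in> R ^^ Suc i"
    then obtain x where x: "(u, x) \<in> R ^^ i" "(x, v) \<in> R" by (elim relpow_Suc_E)
    then have "x \<in> V" using R by auto
    then have "(f u, f x) \<in> ?S ^^ i" "(f x, f v) \<in> ?S" using Suc.IH[OF Suc.prems(1)] x by force+
    then show "(f u, f v) \<in> ?S ^^ Suc i" by (meson relpow_Suc_I)
  qed
qed

text \<open>Take singletons as branch sets. This bounds the length of the input linearly in
  n.\<close>

lemma minor_bound_card:
  assumes "minor_bound 0 V R d" "M \<subseteq> R" "M \<subseteq> V \<times> V" "irrefl M"
  shows "card M \<le> d * card V"
proof (rule assms(1)[unfolded minor_bound_def, rule_format, where B = "\<lambda>z. {z}"], intro conjI ballI impI)
  show "\<exists>i\<le>0. (z, v) \<in> (R \<inter> {z} \<times> {z}) ^^ i" if "v \<in> {z}" for z v using that by (intro exI[of _ 0]) auto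
  show "case e of (x, y) \<Rightarrow> x \<noteq> y \<and> (\<exists>a\<in>{x}. \<exists>b\<in>{y}. (a, b) \<in> R)" if "e \<in> M" for e
    using that assms(2,4) by (auto simp: irrefl_def)
qed (use assms(3) in auto)

lemma bit_len_le_log: "1 \<le> x \<Longrightarrow> real (bit_len x) \<le> 1 + log 2 (real x)"
proof -
  assume x: "1 \<le> x"
  have "0 \<le> log 2 (real x)" using x by simp
  then have "real (floorlog 2 x) \<le> 1 + log 2 (real x)" unfolding floorlog_def using x by simp
  then show ?thesis using \<open>0 \<le> log 2 (real x)\<close> unfolding bit_len_def by simp
qed

text \<open>With c ticks and d arcs per vertex, the first factor bounds the values handled per
  vertex. The second bounds the bit length of \<open>V\<close>, which is at most (9 * a * n ^ 2) ^ 8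
  for a = 16 + 2 * d + k + 2 * c: its binary logarithm is at most 8 * log 2 (9 * a) + 16 * log 2 n,
  and passing to the natural logarithm of n divides by ln 2.\<close>

definition time_factor :: "nat \<Rightarrow> nat \<Rightarrow> nat \<Rightarrow> real" where
  "time_factor c d k = real (50 * c + 8) * (1 + 8 * log 2 (real (9 * (16 + 2 * d + k + 2 * c))) + 16 / ln 2)"

lemma machine_time_le:
  assumes n: "1 \<le> n" and m: "m \<le> d * n"
  shows "real ((50 * (c * n) + 8) * bit_len ((9 * (15 + n + 2 * m + k + Suc n * (c * n))) ^ 8))
    \<le> time_factor c d k * (real n * (1 + ln (real n)))"
proof -
  let ?a = "16 + 2 * d + k + 2 * c"
  let ?V = "(9 * (15 + n + 2 * m + k + Suc n * (c * n))) ^ 8"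
  have nn: "n \<le> n * n" "1 \<le> n * n" using n by simp_all
  have "Suc n * (c * n) \<le> (2 * n) * (c * n)" using n by (intro mult_le_mono1) simp
  then have 1: "Suc n * (c * n) \<le> 2 * c * (n * n)" by (simp add: mult_ac)
  have 2: "2 * m \<le> 2 * d * (n * n)"
  proof -
    have "d * n \<le> d * (n * n)" by (rule mult_le_mono2[OF nn(1)])
    then have "m \<le> d * (n * n)" by (rule order_trans[OF m])
    then show ?thesis by linarith
  qed
  have 3: "15 + k \<le> (15 + k) * (n * n)" using nn(2) by simp
  have "15 + n + 2 * m + k + Suc n * (c * n) \<le> (15 + k) * (n * n) + n * n + 2 * d * (n * n) + 2 * c * (n * n)"
    using 1 2 3 nn(1) by linarith
  also have "\<dots> = ?a * (n * n)" by (simp add: algebra_simps)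
  finally have "?V \<le> (9 * (?a * (n * n))) ^ 8" by (intro power_mono mult_le_mono2) auto
  then have "bit_len ?V \<le> bit_len ((9 * (?a * (n * n))) ^ 8)" by (rule bit_len_mono)
  then have "real (bit_len ?V) \<le> real (bit_len ((9 * (?a * (n * n))) ^ 8))" by simp
  also have "\<dots> \<le> 1 + log 2 (real ((9 * (?a * (n * n))) ^ 8))"
  proof (rule bit_len_le_log)
    have "1 \<le> 9 * (?a * (n * n))" using n by simp
    then show "1 \<le> (9 * (?a * (n * n))) ^ 8" by (rule one_le_power)
  qed
  also have "\<dots> = 1 + 8 * (log 2 (real (9 * ?a)) + 2 * log 2 (real n))"
  proof -
    have "real ((9 * (?a * (n * n))) ^ 8) = (real (9 * ?a) * real n ^ 2) ^ 8"
      by (simp only: of_nat_power of_nat_mult power2_eq_square mult.assoc)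
    then have "log 2 (real ((9 * (?a * (n * n))) ^ 8)) = 8 * log 2 (real (9 * ?a) * real n ^ 2)"
      using n by (simp only: log_nat_power zero_less_mult_iff) (subst log_nat_power, auto)
    also have "log 2 (real (9 * ?a) * real n ^ 2) = log 2 (real (9 * ?a)) + 2 * log 2 (real n)"
      using n by (subst log_mult) (auto simp: log_nat_power)
    finally show ?thesis by simp
  qed
  also have "\<dots> = (1 + 8 * log 2 (real (9 * ?a))) + 16 / ln 2 * ln (real n)"
    by (simp add: log_def)
  also have "\<dots> \<le> (1 + 8 * log 2 (real (9 * ?a)) + 16 / ln 2) * (1 + ln (real n))"
  proof -
    have "0 \<le> ln (real n)" "0 \<le> log 2 (real (9 * ?a))" using n by simp_all
    then show ?thesis by (simp add: distrib_left distrib_right)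
  qed
  finally have b: "real (bit_len ?V) \<le> (1 + 8 * log 2 (real (9 * ?a)) + 16 / ln 2) * (1 + ln (real n))" .
  have "real (50 * (c * n) + 8) \<le> real (50 * c + 8) * real n"
    unfolding of_nat_mult[symmetric] of_nat_le_iff using n by (simp add: algebra_simps)
  then have "real (50 * (c * n) + 8) * real (bit_len ?V) \<le>
      (real (50 * c + 8) * real n) * ((1 + 8 * log 2 (real (9 * ?a)) + 16 / ln 2) * (1 + ln (real n)))"
    using b by (intro mult_mono) auto
  also have "\<dots> = time_factor c d k * (real n * (1 + ln (real n)))"
    unfolding time_factor_def by (simp only: mult_ac)
  finally show ?thesis by (simp only: of_nat_mult)
qed

text \<open>The exponent is chosen so as to absorb the factor 1 + ln n exactly. For n = 1 the
  quotient is a division by zero with value 0, and both sides are 1.\<close>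

lemma powr_log_factor:
  assumes "1 \<le> n" shows "real n powr (1 + ln (1 + ln (real n)) / ln (real n)) = real n * (1 + ln (real n))"
proof (cases "n = 1")
  case False
  then have n: "1 < real n" using assms by simp
  then have l: "0 < ln (real n)" by simp
  then have "(1 + ln (1 + ln (real n)) / ln (real n)) * ln (real n) = ln (real n) + ln (1 + ln (real n))"
    by (simp add: field_simps)
  moreover have "exp (ln (real n) + ln (1 + ln (real n))) = real n * (1 + ln (real n))"
  proof -
    have "0 < 1 + ln (real n)" using l by linarith
    then show ?thesis using n by (simp add: exp_add)
  qed
  ultimately show ?thesis using n by (simp add: powr_def)
qed simp

lemma diameter_machine_decides:
  assumes G: "pair_digraph G" "strongly_connected (with_proj G)" and enc: "encodes_input s G k" and k: "1 \<le> k"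
    and d: "\<And>r H. shallow_minor r H (mk_symmetric (with_proj G)) \<Longrightarrow> edge_density H \<le> d r"
  defines "d' \<equiv> \<lambda>r. nat \<lceil>2 * d r\<rceil>" and "n \<equiv> card (pverts G)"
  shows "decides_in_time diameter_machine s (diameter G \<le> ereal (real k))
    (time_factor (diameter_cost d' k) (d' 0) k * real n powr (1 + ln (1 + ln (real n)) / ln (real n)))"
proof -
  interpret pair_digraph G by fact
  obtain num es where num: "bij_betw num (pverts G) {..<n}" and es: "distinct es"
    "set es = (\<lambda>(u, v). (num u, num v)) ` parcs G" "s = ram_input n es k"
    using enc unfolding encodes_input_def n_def by blast
  let ?R = "set es"
  have inj: "inj_on num (pverts G)" and im: "num ` pverts G = {..<n}" using num by (auto simp: bij_betw_def)
  have PV: "parcs G \<subseteq> pverts G \<times> pverts G" using in_arcsD1 in_arcsD2 by auto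
  have R: "?R \<subseteq> {..<n} \<times> {..<n}" unfolding es(2) using PV im by auto
  have irr: "irrefl ?R" unfolding irrefl_def
  proof (intro allI notI)
    fix a assume "(a, a) \<in> ?R"
    then obtain u v where uv: "(u, v) \<in> parcs G" "num u = num v" unfolding es(2) by auto
    then have "u = v" using inj PV by (auto simp: inj_on_eq_iff)
    then show False using uv(1) no_loops' by blast
  qed
  \<comment> \<open>Strong connectivity excludes the empty graph.\<close>
  have ne: "pverts G \<noteq> {}" using G(2) unfolding strongly_connected_def by simp
  then have n: "1 \<le> n" unfolding n_def using pair_finite_verts by (simp add: Suc_le_eq card_gt_0_iff)
  have sym: "(\<lambda>(u, v). (num u, num v)) ` parcs (mk_symmetric (with_proj G)) = ?R \<union> ?R\<inverse>"
    unfolding es(2) mk_symmetric_def by force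
  have mb: "minor_bound r {..<n} (?R \<union> ?R\<inverse>) (d' r)" for r
  proof -
    have V: "pverts (mk_symmetric (with_proj G)) = pverts G" by (simp add: mk_symmetric_def)
    have "minor_bound r (num ` pverts (mk_symmetric (with_proj G)))
      ((\<lambda>(u, v). (num u, num v)) ` parcs (mk_symmetric (with_proj G))) (d' r)"
      unfolding d'_def
      by (rule minor_bound_of_shallow_minors[OF pair_graph_mk_symmetric[OF G(1)]]) (use inj V d in auto)
    then show ?thesis unfolding sym V im .
  qed
  have len: "length es \<le> d' 0 * n"
    using minor_bound_card[OF mb[of 0] _ R irr] es(1) by (simp add: distinct_card)
  obtain t s' where t: "ram_exec diameter_machine s t s'"
    "reg s' 0 = of_bool (\<forall>u<n. \<forall>v<n. \<exists>i\<le>k. (u, v) \<in> ?R ^^ i)"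
    "t \<le> (50 * (diameter_cost d' k * n) + 8) * bit_len ((9 * (15 + n + 2 * length es + k + Suc n * (diameter_cost d' k * n))) ^ 8)"
    using diameter_machine[OF R irr len mb k n] unfolding es(3) by blast
  have "diameter G \<le> ereal (real k) \<longleftrightarrow> (\<forall>u\<in>pverts G. \<forall>v\<in>pverts G. \<exists>i\<le>k. (u, v) \<in> parcs G ^^ i)"
    by (rule diameter_le_iff) (rule pair_wf_digraph)
  also have "\<dots> \<longleftrightarrow> (\<forall>u\<in>pverts G. \<forall>v\<in>pverts G. \<exists>i\<le>k. (num u, num v) \<in> ?R ^^ i)"
    unfolding es(2) using relpow_image[OF inj PV] by simp
  also have "\<dots> \<longleftrightarrow> (\<forall>u\<in>{..<n}. \<forall>v\<in>{..<n}. \<exists>i\<le>k. (u, v) \<in> ?R ^^ i)" unfolding im[symmetric] by simp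
  finally have "reg s' 0 = of_bool (diameter G \<le> ereal (real k))" using t(2) by (simp add: Ball_def)
  moreover have "real t \<le> time_factor (diameter_cost d' k) (d' 0) k * (real n * (1 + ln (real n)))"
    by (rule order_trans[OF _ machine_time_le[OF n len]]) (use t(3) in \<open>simp only: of_nat_le_iff\<close>)
  ultimately show ?thesis unfolding decides_in_time_def powr_log_factor[OF n] using t(1) by blast
qed

theorem theorem3:
  fixes \<G> :: "'a pair_pre_digraph set"
  assumes "\<And>G. G \<in> \<G> \<Longrightarrow> pair_digraph G"
    and "\<And>G. G \<in> \<G> \<Longrightarrow> strongly_connected (with_proj G)"
    and "bounded_expansion \<G>"
  shows "\<exists>f :: nat \<Rightarrow> real. \<exists>(p :: ram_com) (C :: real) (\<epsilon> :: nat \<Rightarrow> real).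
    \<epsilon> \<longlonglongrightarrow> 0 \<and>
    (\<forall>G\<in>\<G>. \<forall>k::nat. k \<ge> 1 \<longrightarrow> (\<forall>s. encodes_input s G k \<longrightarrow>
      (let n = card (pverts G) in
        decides_in_time p s (diameter G \<le> ereal (real k))
          (C * (f k * real n powr (1 + \<epsilon> n))))))"
proof -
  obtain d :: "nat \<Rightarrow> real" where d: "\<And>r G H. G \<in> \<G> \<Longrightarrow>
      shallow_minor r H (mk_symmetric (with_proj G)) \<Longrightarrow> edge_density H \<le> d r"
    using assms(3) unfolding bounded_expansion_def by metis
  \<comment> \<open>The machine and the exponent are the same for all classes; only the factor f
    depends on \<G>, through \<open>?d\<close>.\<close>
  let ?d = "\<lambda>r. nat \<lceil>2 * d r\<rceil>"
  have "(\<lambda>n. ln (1 + ln (real n)) / ln (real n)) \<longlonglongrightarrow> 0" by real_asymp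
  moreover have "decides_in_time diameter_machine s (diameter G \<le> ereal (real k))
      (1 * (time_factor (diameter_cost ?d k) (?d 0) k *
        real (card (pverts G)) powr (1 + ln (1 + ln (real (card (pverts G)))) / ln (real (card (pverts G))))))"
    if "G \<in> \<G>" "1 \<le> k" "encodes_input s G k" for G k s
    unfolding mult_1 by (rule diameter_machine_decides) (use that assms d in auto)
  ultimately show ?thesis unfolding Let_def
    by (intro exI[of _ "\<lambda>k. time_factor (diameter_cost ?d k) (?d 0) k"] exI[of _ diameter_machine] exI[of _ "1 :: real"]
        exI[of _ "\<lambda>n. ln (1 + ln (real n)) / ln (real n)"]) blast
qed

end
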